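(* There is a deterministic algorithm that, given $n$ integers in $\{1,\dots,s\}$, computes the prime factorization of all of them in total time $\widetilde{O}(n+\sqrt{s})$.
   Context: $\widetilde{O}(T)$ denotes $O(T\log^c T)$ for some constant $c$. *)

theory Defs
  imports Complex_Main "HOL-Library.Landau_Symbols" "HOL-Computational_Algebra.Primes"
begin

text \<open>
  The soft-O class of \<open>T\<close>, for functions of arbitrarily many parameters: the asymptotics are taken as
  the value of \<open>T\<close> itself tends to infinity.
\<close>

definition soft_bigo :: "('a \<Rightarrow> real) \<Rightarrow> ('a \<Rightarrow> real) set" where
  "soft_bigo T = {f. \<exists>c::nat. f \<in> O[filtercomap T at_top](\<lambda>x. T x * ln (T x) ^ c)}"

text \<open>
  Algorithms are programs for the word RAM. All values, including addresses, are \<open>w\<close>-bit words,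
  represented as natural numbers below \<open>2 ^ w\<close>. A program refers to finitely many registers and
  has random access to a memory of words. Programs do not depend on \<open>w\<close>. Control flow is
  structured, which differs from jumps by constant factors only.
\<close>

datatype operand = Const nat | Reg nat

datatype binop = Add | Sub | Mul | Div | Mod | BitAnd | BitOr | BitXor | ShiftL | ShiftR

datatype cmp = Eq operand operand | Lt operand operand

datatype com =
    Skip
  | Op nat binop operand operand
  | Load nat operand
  | Store operand operand
  | Seq com com
  | IfElse cmp com com
  | Loop cmp com

record state =
  regs :: "nat \<Rightarrow> nat"
  mem :: "nat \<Rightarrow> nat"

fun operand_val :: "nat \<Rightarrow> state \<Rightarrow> operand \<Rightarrow> nat" where
  "operand_val w \<sigma> (Const c) = c mod 2 ^ w"
| "operand_val w \<sigma> (Reg r) = regs \<sigma> r"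

text \<open>Arithmetic is modulo \<open>2 ^ w\<close>. Division by zero follows the conventions of type \<open>nat\<close>.\<close>

fun binop_val :: "nat \<Rightarrow> binop \<Rightarrow> nat \<Rightarrow> nat \<Rightarrow> nat" where
  "binop_val w Add a b = (a + b) mod 2 ^ w"
| "binop_val w Sub a b = nat ((int a - int b) mod 2 ^ w)"
| "binop_val w Mul a b = (a * b) mod 2 ^ w"
| "binop_val w Div a b = a div b"
| "binop_val w Mod a b = a mod b"
| "binop_val w BitAnd a b = and a b"
| "binop_val w BitOr a b = or a b"
| "binop_val w BitXor a b = xor a b"
| "binop_val w ShiftL a b = push_bit b a mod 2 ^ w"
| "binop_val w ShiftR a b = drop_bit b a"

fun cmp_val :: "nat \<Rightarrow> state \<Rightarrow> cmp \<Rightarrow> bool" where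
  "cmp_val w \<sigma> (Eq x y) \<longleftrightarrow> operand_val w \<sigma> x = operand_val w \<sigma> y"
| "cmp_val w \<sigma> (Lt x y) \<longleftrightarrow> operand_val w \<sigma> x < operand_val w \<sigma> y"

text \<open>
  \<open>exec w c \<sigma> \<tau> \<sigma>'\<close>: with word size \<open>w\<close>, started in \<open>\<sigma>\<close>, the program \<open>c\<close> halts in \<open>\<sigma>'\<close> after
  exactly \<open>\<tau>\<close> unit-cost steps; each word operation, memory access and test is one step.
\<close>

inductive exec :: "nat \<Rightarrow> com \<Rightarrow> state \<Rightarrow> nat \<Rightarrow> state \<Rightarrow> bool" for w where
  exec_Skip: "exec w Skip \<sigma> 1 \<sigma>"
| exec_Op: "exec w (Op r f x y) \<sigma> 1
    (\<sigma>\<lparr>regs := (regs \<sigma>)(r := binop_val w f (operand_val w \<sigma> x) (operand_val w \<sigma> y))\<rparr>)"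
| exec_Load: "exec w (Load r x) \<sigma> 1 (\<sigma>\<lparr>regs := (regs \<sigma>)(r := mem \<sigma> (operand_val w \<sigma> x))\<rparr>)"
| exec_Store: "exec w (Store x y) \<sigma> 1
    (\<sigma>\<lparr>mem := (mem \<sigma>)(operand_val w \<sigma> x := operand_val w \<sigma> y)\<rparr>)"
| exec_Seq: "exec w c \<sigma> \<tau> \<sigma>' \<Longrightarrow> exec w d \<sigma>' \<tau>' \<sigma>'' \<Longrightarrow> exec w (Seq c d) \<sigma> (\<tau> + \<tau>') \<sigma>''"
| exec_IfTrue: "cmp_val w \<sigma> b \<Longrightarrow> exec w c \<sigma> \<tau> \<sigma>' \<Longrightarrow> exec w (IfElse b c d) \<sigma> (Suc \<tau>) \<sigma>'"
| exec_IfFalse: "\<not> cmp_val w \<sigma> b \<Longrightarrow> exec w d \<sigma> \<tau> \<sigma>' \<Longrightarrow> exec w (IfElse b c d) \<sigma> (Suc \<tau>) \<sigma>'"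
| exec_LoopFalse: "\<not> cmp_val w \<sigma> b \<Longrightarrow> exec w (Loop b c) \<sigma> 1 \<sigma>"
| exec_LoopTrue: "cmp_val w \<sigma> b \<Longrightarrow> exec w c \<sigma> \<tau> \<sigma>' \<Longrightarrow> exec w (Loop b c) \<sigma>' \<tau>' \<sigma>'' \<Longrightarrow>
    exec w (Loop b c) \<sigma> (Suc (\<tau> + \<tau>')) \<sigma>''"

inductive_cases exec_SkipE: "exec w Skip \<sigma> \<tau> \<sigma>'"
inductive_cases exec_OpE: "exec w (Op r f x y) \<sigma> \<tau> \<sigma>'"
inductive_cases exec_LoadE: "exec w (Load r x) \<sigma> \<tau> \<sigma>'"
inductive_cases exec_StoreE: "exec w (Store x y) \<sigma> \<tau> \<sigma>'"
inductive_cases exec_SeqE: "exec w (Seq c d) \<sigma> \<tau> \<sigma>'"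
inductive_cases exec_IfElseE: "exec w (IfElse b c d) \<sigma> \<tau> \<sigma>'"
inductive_cases exec_LoopE: "exec w (Loop b c) \<sigma> \<tau> \<sigma>'"

text \<open>Execution is deterministic, so exhibiting one execution determines all of them.\<close>

lemma exec_deterministic:
  assumes "exec w c \<sigma> \<tau>\<^sub>1 \<sigma>\<^sub>1" and "exec w c \<sigma> \<tau>\<^sub>2 \<sigma>\<^sub>2"
  shows "\<tau>\<^sub>1 = \<tau>\<^sub>2 \<and> \<sigma>\<^sub>1 = \<sigma>\<^sub>2"
  using assms
proof (induction arbitrary: \<tau>\<^sub>2 \<sigma>\<^sub>2 rule: exec.induct)
  case exec_Skip then show ?case by (auto elim: exec_SkipE)
next
  case exec_Op then show ?case by (auto elim: exec_OpE)
next
  case exec_Load then show ?case by (auto elim: exec_LoadE)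
next
  case exec_Store then show ?case by (auto elim: exec_StoreE)
next
  case (exec_Seq c \<sigma> \<tau> \<sigma>' d \<tau>' \<sigma>'')
  from exec_Seq.prems show ?case by (rule exec_SeqE) (use exec_Seq.IH in blast)
next
  case (exec_IfTrue \<sigma> b c \<tau> \<sigma>' d)
  from exec_IfTrue.prems show ?case
    by (rule exec_IfElseE) (use exec_IfTrue.IH exec_IfTrue.hyps in blast)+
next
  case (exec_IfFalse \<sigma> b d \<tau> \<sigma>' c)
  from exec_IfFalse.prems show ?case
    by (rule exec_IfElseE) (use exec_IfFalse.IH exec_IfFalse.hyps in blast)+
next
  case (exec_LoopFalse \<sigma> b c)
  from exec_LoopFalse.prems show ?case
    by (rule exec_LoopE) (use exec_LoopFalse.hyps in simp_all)
next
  case (exec_LoopTrue \<sigma> b c \<tau> \<sigma>' \<tau>' \<sigma>'')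
  from exec_LoopTrue.prems show ?case
    by (rule exec_LoopE) (use exec_LoopTrue.IH exec_LoopTrue.hyps in blast)+
qed

text \<open>
  The input convention: \<open>n\<close> and \<open>s\<close> in registers 0 and 1, the numbers in memory cells
  \<open>0, \<dots>, n - 1\<close>, and zero everywhere else.
\<close>

definition input_state :: "nat \<Rightarrow> nat list \<Rightarrow> state" where
  "input_state s xs =
     \<lparr>regs = (\<lambda>_. 0)(0 := length xs, 1 := s),
      mem = (\<lambda>a. if a < length xs then xs ! a else 0)\<rparr>"

definition mem_holds :: "nat \<Rightarrow> state \<Rightarrow> nat \<Rightarrow> nat list \<Rightarrow> bool" where
  "mem_holds w \<sigma> a ys \<longleftrightarrow>
     a + length ys \<le> 2 ^ w \<and> (\<forall>j<length ys. mem \<sigma> (a + j) = ys ! j)"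

text \<open>
  The output convention: from the address in register 0 on, memory contains, for each input number
  in turn, the number of its prime factors followed by these factors, repeated according to
  multiplicity, in any order.
\<close>

definition outputs_factorizations :: "nat \<Rightarrow> state \<Rightarrow> nat list \<Rightarrow> bool" where
  "outputs_factorizations w \<sigma> xs \<longleftrightarrow>
     (\<exists>pss :: nat list list.
        map mset pss = map prime_factorization xs \<and>
        mem_holds w \<sigma> (regs \<sigma> 0) (concat (map (\<lambda>ps. length ps # ps) pss)))"

end

theory Submission
  imports Defs "HOL-Computational_Algebra.Polynomial" "HOL-Number_Theory.Cong"
begin

text \<open>
  Fix \<open>R\<close> with \<open>s < 2 ^ R\<close> and \<open>K = \<lceil>R / 2\<rceil>\<close>, so that every composite \<open>x \<le> s\<close> has a prime factor at most
  \<open>2 ^ K = O(\<surd>s)\<close>. The smallest \<open>d > 1\<close> that is not coprime to \<open>x\<close> is the smallest prime factor of \<open>x\<close>; it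
  is found by binary search in \<open>{1..2 ^ K}\<close>, where the test at a node is whether \<open>x\<close> is coprime to the
  product of all \<open>d\<close> below its left child. For each of the \<open>K\<close> levels the tests of all inputs are done
  together: inputs at the same node are collected in chunks as long as the node's product, and the product is
  reduced modulo all members of a chunk with a remainder tree. With quasilinear multiplication a level costs
  \<open>n + 2 ^ K\<close> up to logarithmic factors. Each round divides one prime out of every input, so \<open>R\<close> rounds suffice.

  The factors \<open>2\<close> are removed beforehand. All inputs are then odd, and remainders can be replaced by
  Montgomery reductions to the base \<open>2 ^ (R + 2)\<close>: they preserve the greatest common divisor with the modulus and
  need, besides multiplications, only inverses modulo powers of the base, which come from Newton's iteration.
  Long numbers are multiplied through Nussbaumer's negacyclic convolution, which uses ring operations only and
  therefore is exact in arithmetic modulo \<open>2 ^ w\<close>.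
\<close>

section \<open>A layer of expressions and loops over the word RAM\<close>

text \<open>The language has neither recursion nor procedures, so every divide-and-conquer scheme
  runs level by level: a loop over one array treats all nodes of a tree level, or all blocks of a
  convolution level.

  Exactness is the other obstacle. Residues modulo \<open>2 ^ w\<close> have no usable roots of
  unity and no division by \<open>2\<close>. Nussbaumer's scheme uses powers of the variable as
  roots of unity, and each inverse splitting doubles the result. The doublings are collected in one
  factor \<open>2 ^ sc\<close>, which a shift removes at the end, because a word has room for the
  scaled true coefficients.

  The base is \<open>4 * b\<close> with \<open>b = 2 ^ R\<close> bounding all inputs. The factor
  \<open>4\<close> pays for Montgomery reduction, whose results are bounded by
  \<open>2 * b ^ L\<close> instead of the modulus; this bound reproduces itself down the tree.

  The word size condition has exponent \<open>128 = 16 * 8\<close>: arrays are spaced by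
  \<open>S = (n + s + 2) ^ 16\<close>, which exceeds all sizes that occur, and
  \<open>S ^ 8 \<le> 2 ^ w\<close> protects index and digit arithmetic from overflow.\<close>

datatype expr =
    Cst nat
  | Var nat
  | Arr nat expr
  | Chk binop expr expr
  | Wrp binop expr expr
  | Pow2 expr
  | Ite expr expr expr expr

abbreviation add_expr (infixl \<open>[+]\<close> 65) where "a [+] b \<equiv> Chk Add a b"
abbreviation sub_expr (infixl \<open>[-]\<close> 65) where "a [-] b \<equiv> Chk Sub a b"
abbreviation mul_expr (infixl \<open>[*]\<close> 70) where "a [*] b \<equiv> Chk Mul a b"
abbreviation div_expr (infixl \<open>[div]\<close> 70) where "a [div] b \<equiv> Chk Div a b"
abbreviation mod_expr (infixl \<open>[mod]\<close> 70) where "a [mod] b \<equiv> Chk Mod a b"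

text \<open>
  Register \<open>60\<close> holds the array stride \<open>S\<close>: entry \<open>i\<close> of array \<open>a\<close> is the memory cell \<open>a * S + i\<close>.
  Registers below \<open>60\<close> are program variables, those from \<open>61\<close> on are temporaries.
\<close>

fun comp :: "expr \<Rightarrow> nat \<Rightarrow> com" where
  "comp (Cst c) r = Op r BitOr (Const c) (Const 0)"
| "comp (Var v) r = Op r BitOr (Reg v) (Const 0)"
| "comp (Arr a e) r = Seq (comp e r) (Seq (Op (Suc r) Mul (Const a) (Reg 60))
     (Seq (Op r Add (Reg r) (Reg (Suc r))) (Load r (Reg r))))"
| "comp (Chk f e e') r = Seq (comp e r) (Seq (comp e' (Suc r)) (Op r f (Reg r) (Reg (Suc r))))"
| "comp (Wrp f e e') r = Seq (comp e r) (Seq (comp e' (Suc r)) (Op r f (Reg r) (Reg (Suc r))))"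
| "comp (Pow2 e) r = Seq (comp e r) (Op r ShiftL (Const 1) (Reg r))"
| "comp (Ite a b c d) r = Seq (comp a r) (Seq (comp b (Suc r))
     (IfElse (Lt (Reg r) (Reg (Suc r))) (comp c r) (comp d r)))"

fun cost :: "expr \<Rightarrow> nat" where
  "cost (Cst c) = 1"
| "cost (Var v) = 1"
| "cost (Arr a e) = cost e + 3"
| "cost (Chk f e e') = cost e + cost e' + 1"
| "cost (Wrp f e e') = cost e + cost e' + 1"
| "cost (Pow2 e) = cost e + 1"
| "cost (Ite a b c d) = cost a + cost b + cost c + cost d + 1"

text \<open>Writing to an array outside this set does not change the value of the expression
  (\<open>ev_cong\<close>); this is how loops that fill an array are analysed.\<close>

fun arrays :: "expr \<Rightarrow> nat set" where
  "arrays (Cst c) = {}"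
| "arrays (Var v) = {}"
| "arrays (Arr a e) = insert a (arrays e)"
| "arrays (Chk f e e') = arrays e \<union> arrays e'"
| "arrays (Wrp f e e') = arrays e \<union> arrays e'"
| "arrays (Pow2 e) = arrays e"
| "arrays (Ite a b c d) = arrays a \<union> arrays b \<union> arrays c \<union> arrays d"

definition asg :: "nat \<Rightarrow> expr \<Rightarrow> com" where
  "asg v e = Seq (comp e 61) (Op v BitOr (Reg 61) (Const 0))"

definition sto :: "nat \<Rightarrow> expr \<Rightarrow> expr \<Rightarrow> com" where
  "sto a e e' = Seq (comp e 61) (Seq (comp e' 62) (Seq (Op 63 Mul (Const a) (Reg 60))
     (Seq (Op 61 Add (Reg 61) (Reg 63)) (Store (Reg 61) (Reg 62)))))"

definition for_loop :: "nat \<Rightarrow> nat \<Rightarrow> com \<Rightarrow> com" where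
  "for_loop v l c = Seq (asg v (Cst 0)) (Loop (Lt (Reg v) (Reg l)) (Seq c (asg v (Var v [+] Cst 1))))"

definition map_loop :: "nat \<Rightarrow> nat \<Rightarrow> nat \<Rightarrow> expr \<Rightarrow> com" where
  "map_loop a v l e = for_loop v l (sto a (Var v) e)"

text \<open>
  Updating an array through a scratch array, so that the new entries may depend on all old ones.
\<close>

definition upd_loop :: "nat \<Rightarrow> nat \<Rightarrow> nat \<Rightarrow> nat \<Rightarrow> expr \<Rightarrow> com" where
  "upd_loop t a v l e = Seq (map_loop t v l e) (map_loop a v l (Arr t (Var v)))"

text \<open>
  The abstract state carries a clock \<open>tm\<close>, an upper bound for the number of steps made so far.
\<close>

datatype ast = Ast (vr: "nat \<Rightarrow> nat") (ar: "nat \<Rightarrow> nat \<Rightarrow> nat") (tm: nat)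

definition upv :: "nat \<Rightarrow> nat \<Rightarrow> ast \<Rightarrow> ast" where
  "upv v x sg = Ast ((vr sg)(v := x)) (ar sg) (tm sg)"
definition upa :: "nat \<Rightarrow> (nat \<Rightarrow> nat) \<Rightarrow> ast \<Rightarrow> ast" where
  "upa a f sg = Ast (vr sg) ((ar sg)(a := f)) (tm sg)"
definition tick :: "nat \<Rightarrow> ast \<Rightarrow> ast" where
  "tick k sg = Ast (vr sg) (ar sg) (tm sg + k)"

lemma ast_simps [simp]:
  "vr (upv v x sg) = (vr sg)(v := x)" "ar (upv v x sg) = ar sg" "tm (upv v x sg) = tm sg"
  "vr (upa a f sg) = vr sg" "ar (upa a f sg) = (ar sg)(a := f)" "tm (upa a f sg) = tm sg"
  "vr (tick k sg) = vr sg" "ar (tick k sg) = ar sg" "tm (tick k sg) = tm sg + k"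
  by (simp_all add: upv_def upa_def tick_def)

definition frame :: "nat set \<Rightarrow> nat set \<Rightarrow> ast \<Rightarrow> ast \<Rightarrow> bool" where
  "frame X Y sg sg' \<longleftrightarrow> (\<forall>v. v \<notin> X \<longrightarrow> vr sg' v = vr sg v) \<and> (\<forall>a. a \<notin> Y \<longrightarrow> ar sg' a = ar sg a)"

lemma frame_vr: "frame X Y sg sg' \<Longrightarrow> v \<notin> X \<Longrightarrow> vr sg' v = vr sg v"
  by (simp add: frame_def)
lemma frame_ar: "frame X Y sg sg' \<Longrightarrow> a \<notin> Y \<Longrightarrow> ar sg' a = ar sg a"
  by (simp add: frame_def)
lemma frame_refl [simp]: "frame X Y sg sg"
  by (simp add: frame_def)
lemma frame_trans:
  "frame X Y sg sg' \<Longrightarrow> frame X' Y' sg' sg'' \<Longrightarrow> X \<subseteq> X'' \<Longrightarrow> X' \<subseteq> X'' \<Longrightarrow> Y \<subseteq> Y'' \<Longrightarrow> Y' \<subseteq> Y'' \<Longrightarrow>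
   frame X'' Y'' sg sg''"
  unfolding frame_def by (metis subsetD)
lemma frame_mono: "frame X Y sg sg' \<Longrightarrow> X \<subseteq> X' \<Longrightarrow> Y \<subseteq> Y' \<Longrightarrow> frame X' Y' sg sg'"
  unfolding frame_def by blast
lemma frame_upv [simp]: "frame X Y sg (upv v x sg') \<longleftrightarrow> frame X Y sg sg'" if "v \<in> X"
  using that by (auto simp: frame_def)
lemma frame_upa [simp]: "frame X Y sg (upa a f sg') \<longleftrightarrow> frame X Y sg sg'" if "a \<in> Y"
  using that by (auto simp: frame_def)
lemma frame_tick [simp]: "frame X Y sg (tick k sg') \<longleftrightarrow> frame X Y sg sg'"
  by (auto simp: frame_def)

section \<open>Evaluation of expressions without overflow\<close>

fun binop_nat :: "binop \<Rightarrow> nat \<Rightarrow> nat \<Rightarrow> nat" where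
  "binop_nat Add a b = a + b"
| "binop_nat Sub a b = a - b"
| "binop_nat Mul a b = a * b"
| "binop_nat Div a b = a div b"
| "binop_nat Mod a b = a mod b"
| "binop_nat _ a b = 0"

text \<open>
  \<open>mag e\<close> bounds the value of \<open>e\<close> by a power of \<open>S\<close>; it makes the absence of overflow a syntactic
  condition. The value \<open>100\<close> stands for no bound.
\<close>

fun mag :: "expr \<Rightarrow> nat" where
  "mag (Cst c) = 1"
| "mag (Var v) = 1"
| "mag (Arr a e) = 1"
| "mag (Chk f e e') = (case f of Add \<Rightarrow> max (mag e) (mag e') + 1 | Mul \<Rightarrow> mag e + mag e'
     | Sub \<Rightarrow> mag e | Div \<Rightarrow> mag e | Mod \<Rightarrow> mag e | _ \<Rightarrow> 100)"
| "mag (Wrp f e e') = 100"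
| "mag (Pow2 e) = 1"
| "mag (Ite a b c d) = max (mag c) (mag d)"

text \<open>The exponent \<open>8\<close> is one more than the largest magnitude \<open>7\<close>
  that \<open>ok\<close> admits, so checked values stay strictly below \<open>2 ^ w\<close>. The
  bound \<open>256\<close> covers the literals, lets a further factor \<open>S\<close> absorb a sum
  of two terms, and fits the \<open>30\<close> arrays into addresses below
  \<open>S * S\<close>.\<close>

locale ram =
  fixes w S :: nat
  assumes S_ge: "256 \<le> S" and S_pow: "S ^ 8 \<le> 2 ^ w"
begin

text \<open>\<open>Chk\<close> operations are evaluated over the natural numbers and need a proof
  that the word does not overflow; \<open>Wrp\<close> operations are meant modulo
  \<open>2 ^ w\<close> and are used for the coefficients of the convolution.\<close>

fun ev :: "ast \<Rightarrow> expr \<Rightarrow> nat" where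
  "ev sg (Cst c) = c"
| "ev sg (Var v) = vr sg v"
| "ev sg (Arr a e) = ar sg a (ev sg e)"
| "ev sg (Chk f e e') = binop_nat f (ev sg e) (ev sg e')"
| "ev sg (Wrp f e e') = binop_val w f (ev sg e) (ev sg e')"
| "ev sg (Pow2 e) = 2 ^ ev sg e"
| "ev sg (Ite a b c d) = (if ev sg a < ev sg b then ev sg c else ev sg d)"

text \<open>Variables are bounded by \<open>S\<close> in every simulated state, but array entries
  may be arbitrary words. Only an entry that enters checked arithmetic has to be at most
  \<open>S\<close>, and a wrapped value may not enter it at all.\<close>

fun small :: "ast \<Rightarrow> expr \<Rightarrow> bool" where
  "small sg (Arr a e) \<longleftrightarrow> ar sg a (ev sg e) \<le> S"
| "small sg (Wrp f e e') \<longleftrightarrow> False"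
| "small sg (Ite a b c d) \<longleftrightarrow> (if ev sg a < ev sg b then small sg c else small sg d)"
| "small sg _ \<longleftrightarrow> True"

fun ok :: "ast \<Rightarrow> expr \<Rightarrow> bool" where
  "ok sg (Cst c) \<longleftrightarrow> c \<le> 256"
| "ok sg (Var v) \<longleftrightarrow> v < 60"
| "ok sg (Arr a e) \<longleftrightarrow> ok sg e \<and> a < 30 \<and> ev sg e < S"
| "ok sg (Chk f e e') \<longleftrightarrow> ok sg e \<and> ok sg e' \<and> small sg e \<and> small sg e' \<and> mag (Chk f e e') \<le> 7 \<and>
     (f = Sub \<longrightarrow> ev sg e' \<le> ev sg e)"
| "ok sg (Wrp f e e') \<longleftrightarrow> ok sg e \<and> ok sg e'"
| "ok sg (Pow2 e) \<longleftrightarrow> ok sg e \<and> 2 ^ ev sg e \<le> S"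
| "ok sg (Ite a b c d) \<longleftrightarrow> ok sg a \<and> ok sg b \<and> (if ev sg a < ev sg b then ok sg c else ok sg d)"

definition bounded :: "ast \<Rightarrow> bool" where
  "bounded sg \<longleftrightarrow> (\<forall>v<60. vr sg v \<le> S)"

lemma ev_le_mag: "bounded sg \<Longrightarrow> ok sg e \<Longrightarrow> small sg e \<Longrightarrow> ev sg e \<le> S ^ mag e"
proof (induction e)
  case (Chk f e e')
  have IH: "ev sg e \<le> S ^ mag e" "ev sg e' \<le> S ^ mag e'" using Chk by auto
  show ?case
  proof (cases f)
    case Add
    have "S ^ mag e \<le> S ^ max (mag e) (mag e')" "S ^ mag e' \<le> S ^ max (mag e) (mag e')"
      using S_ge by (auto intro!: power_increasing)
    then have "ev sg e + ev sg e' \<le> 2 * S ^ max (mag e) (mag e')" using IH by linarith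
    also have "\<dots> \<le> S * S ^ max (mag e) (mag e')" using S_ge by simp
    finally show ?thesis using Add by simp
  next
    case Mul then show ?thesis using IH by (simp add: power_add mult_mono)
  next
    case Sub then show ?thesis using IH by simp
  next
    case Div then show ?thesis using IH by simp (meson div_le_dividend le_trans)
  next
    case Mod then show ?thesis using IH by simp (meson mod_less_eq_dividend le_trans)
  qed (use Chk in auto)
next
  case (Ite a b c d)
  have "S ^ mag c \<le> S ^ max (mag c) (mag d)" "S ^ mag d \<le> S ^ max (mag c) (mag d)"
    using S_ge by (auto intro!: power_increasing)
  then show ?case using Ite by (auto split: if_splits intro: order_trans)
qed (use S_ge in \<open>auto simp: bounded_def\<close>)

lemma S_pow_less: "k \<le> 7 \<Longrightarrow> S ^ k < 2 ^ w"
proof -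
  assume "k \<le> 7"
  then have "S ^ k < S ^ 8" using S_ge by (intro power_strict_increasing) auto
  then show ?thesis using S_pow by linarith
qed

lemma S_less: "S < 2 ^ w" "S * S < 2 ^ w"
  using S_pow_less[of 1] S_pow_less[of 2] by (simp_all add: power2_eq_square)

definition sim :: "ast \<Rightarrow> state \<Rightarrow> bool" where
  "sim sg \<rho> \<longleftrightarrow> bounded sg \<and> (\<forall>v<60. regs \<rho> v = vr sg v) \<and> regs \<rho> 60 = S \<and>
     (\<forall>a<30. \<forall>i<S. mem \<rho> (a * S + i) = ar sg a i)"

lemma address:
  assumes "a < 30" "i < S"
  shows "a mod 2 ^ w * S mod 2 ^ w = a * S" "(i + a * S) mod 2 ^ w = a * S + i"
    "(a * S + i) mod 2 ^ w = a * S + i"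
proof -
  have "a * S + i < Suc a * S" using assms by simp
  also have "\<dots> \<le> S * S" using assms S_ge by (intro mult_right_mono) auto
  finally have *: "a * S + i < 2 ^ w" using S_less by simp
  have "a < 2 ^ w" using assms S_ge S_less by linarith
  with * show "a mod 2 ^ w * S mod 2 ^ w = a * S" by simp
  from * show "(i + a * S) mod 2 ^ w = a * S + i" "(a * S + i) mod 2 ^ w = a * S + i"
    by (simp_all add: add.commute)
qed

text \<open>The registers from \<open>r\<close> on act as an evaluation stack: the second operand is
  compiled to \<open>Suc r\<close>, and the clause about \<open>q < r\<close> is what protects the
  first one.\<close>

lemma exec_comp:
  assumes "sim sg \<rho>" "ok sg e" "61 \<le> r"
  shows "\<exists>\<tau> \<rho>'. exec w (comp e r) \<rho> \<tau> \<rho>' \<and> \<tau> \<le> cost e \<and> regs \<rho>' r = ev sg e \<and>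
           (\<forall>q<r. regs \<rho>' q = regs \<rho> q) \<and> mem \<rho>' = mem \<rho>"
  using assms
proof (induction e arbitrary: r \<rho>)
  case (Cst c)
  show ?case
    by (rule exI, rule exI, rule conjI, simp only: comp.simps, rule exec_Op)
       (use Cst S_ge S_less in auto)
next
  case (Var v)
  show ?case
    by (rule exI, rule exI, rule conjI, simp only: comp.simps, rule exec_Op)
       (use Var in \<open>auto simp: sim_def\<close>)
next
  case (Arr a e)
  obtain \<tau> \<rho>' where e: "exec w (comp e r) \<rho> \<tau> \<rho>'" "\<tau> \<le> cost e" "regs \<rho>' r = ev sg e"
    "\<forall>q<r. regs \<rho>' q = regs \<rho> q" "mem \<rho>' = mem \<rho>"
    using Arr by (metis ok.simps(3))
  show ?case
    apply (rule exI, rule exI, rule conjI, simp only: comp.simps)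
     apply (rule exec_Seq[OF e(1)], rule exec_Seq[OF exec_Op], rule exec_Seq[OF exec_Op], rule exec_Load)
    using e Arr address[of a "ev sg e"] by (auto simp: sim_def)
next
  case (Chk f e e')
  obtain \<tau> \<rho>' where e: "exec w (comp e r) \<rho> \<tau> \<rho>'" "\<tau> \<le> cost e" "regs \<rho>' r = ev sg e"
    "\<forall>q<r. regs \<rho>' q = regs \<rho> q" "mem \<rho>' = mem \<rho>"
    using Chk.IH(1)[of \<rho> r] Chk.prems by auto
  have "sim sg \<rho>'" using Chk.prems e by (auto simp: sim_def)
  then obtain \<tau>' \<rho>'' where e': "exec w (comp e' (Suc r)) \<rho>' \<tau>' \<rho>''" "\<tau>' \<le> cost e'"
    "regs \<rho>'' (Suc r) = ev sg e'" "\<forall>q<Suc r. regs \<rho>'' q = regs \<rho>' q" "mem \<rho>'' = mem \<rho>'"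
    using Chk.IH(2)[of \<rho>' "Suc r"] Chk.prems by auto
  have "small sg (Chk f e e')" by simp
  then have le: "ev sg (Chk f e e') \<le> S ^ mag (Chk f e e')"
    using Chk.prems by (intro ev_le_mag) (auto simp: sim_def simp del: ev.simps mag.simps)
  have "S ^ mag (Chk f e e') < 2 ^ w" using Chk.prems S_pow_less by (simp del: mag.simps)
  with le have lt: "binop_nat f (ev sg e) (ev sg e') < 2 ^ w" by (simp del: mag.simps)
  have "binop_val w f (ev sg e) (ev sg e') = binop_nat f (ev sg e) (ev sg e')"
  proof (cases f)
    case Sub
    have "int (ev sg e) - int (ev sg e') = int (ev sg e - ev sg e')" using Chk.prems Sub by simp
    moreover have "int (ev sg e - ev sg e') mod 2 ^ w = int (ev sg e - ev sg e')"
      using lt Sub by (metis binop_nat.simps(2) mod_less of_nat_mod of_nat_numeral of_nat_power)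
    ultimately show ?thesis unfolding Sub binop_val.simps binop_nat.simps by (metis nat_int)
  qed (use lt Chk.prems in auto)
  then show ?case
    apply (intro exI conjI)
    apply (simp only: comp.simps)
    apply (rule exec_Seq[OF e(1) exec_Seq[OF e'(1) exec_Op]])
    using e e' by auto
next
  case (Wrp f e e')
  obtain \<tau> \<rho>' where e: "exec w (comp e r) \<rho> \<tau> \<rho>'" "\<tau> \<le> cost e" "regs \<rho>' r = ev sg e"
    "\<forall>q<r. regs \<rho>' q = regs \<rho> q" "mem \<rho>' = mem \<rho>"
    using Wrp.IH(1)[of \<rho> r] Wrp.prems by auto
  have "sim sg \<rho>'" using Wrp.prems e by (auto simp: sim_def)
  then obtain \<tau>' \<rho>'' where e': "exec w (comp e' (Suc r)) \<rho>' \<tau>' \<rho>''" "\<tau>' \<le> cost e'"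
    "regs \<rho>'' (Suc r) = ev sg e'" "\<forall>q<Suc r. regs \<rho>'' q = regs \<rho>' q" "mem \<rho>'' = mem \<rho>'"
    using Wrp.IH(2)[of \<rho>' "Suc r"] Wrp.prems by auto
  show ?case
    apply (intro exI conjI)
    apply (simp only: comp.simps)
    apply (rule exec_Seq[OF e(1) exec_Seq[OF e'(1) exec_Op]])
    using e e' by auto
next
  case (Pow2 e)
  obtain \<tau> \<rho>' where e: "exec w (comp e r) \<rho> \<tau> \<rho>'" "\<tau> \<le> cost e" "regs \<rho>' r = ev sg e"
    "\<forall>q<r. regs \<rho>' q = regs \<rho> q" "mem \<rho>' = mem \<rho>"
    using Pow2.IH(1)[of \<rho> r] Pow2.prems by auto
  have lt: "2 ^ ev sg e < (2::nat) ^ w" using Pow2.prems S_less(1) le_less_trans ok.simps(6) by blast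
  have "1 < (2::nat) ^ w" using S_ge S_less by linarith
  then show ?case
    apply (intro exI conjI)
    apply (simp only: comp.simps)
    apply (rule exec_Seq[OF e(1) exec_Op])
    using e lt by (auto simp: push_bit_eq_mult)
next
  case (Ite a b c d)
  obtain \<tau> \<rho>' where e: "exec w (comp a r) \<rho> \<tau> \<rho>'" "\<tau> \<le> cost a" "regs \<rho>' r = ev sg a"
    "\<forall>q<r. regs \<rho>' q = regs \<rho> q" "mem \<rho>' = mem \<rho>"
    using Ite.IH(1)[of \<rho> r] Ite.prems by auto
  have "sim sg \<rho>'" using Ite.prems e by (auto simp: sim_def)
  then obtain \<tau>' \<rho>'' where e': "exec w (comp b (Suc r)) \<rho>' \<tau>' \<rho>''" "\<tau>' \<le> cost b"
    "regs \<rho>'' (Suc r) = ev sg b" "\<forall>q<Suc r. regs \<rho>'' q = regs \<rho>' q" "mem \<rho>'' = mem \<rho>'"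
    using Ite.IH(2)[of \<rho>' "Suc r"] Ite.prems by auto
  have s: "sim sg \<rho>''" using Ite.prems e e' by (auto simp: sim_def)
  show ?case
  proof (cases "ev sg a < ev sg b")
    case True
    then obtain \<tau>3 \<rho>3 where f: "exec w (comp c r) \<rho>'' \<tau>3 \<rho>3" "\<tau>3 \<le> cost c"
      "regs \<rho>3 r = ev sg c" "\<forall>q<r. regs \<rho>3 q = regs \<rho>'' q" "mem \<rho>3 = mem \<rho>''"
      using Ite.IH(3)[of \<rho>'' r] Ite.prems s by auto
    have "cmp_val w \<rho>'' (Lt (Reg r) (Reg (Suc r)))" using True e e' by simp
    then show ?thesis
      apply (intro exI conjI)
      apply (simp only: comp.simps)
      apply (rule exec_Seq[OF e(1) exec_Seq[OF e'(1) exec_IfTrue[OF _ f(1)]]])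
      using True e e' f by auto
  next
    case False
    then obtain \<tau>3 \<rho>3 where f: "exec w (comp d r) \<rho>'' \<tau>3 \<rho>3" "\<tau>3 \<le> cost d"
      "regs \<rho>3 r = ev sg d" "\<forall>q<r. regs \<rho>3 q = regs \<rho>'' q" "mem \<rho>3 = mem \<rho>''"
      using Ite.IH(4)[of \<rho>'' r] Ite.prems s by auto
    have "\<not> cmp_val w \<rho>'' (Lt (Reg r) (Reg (Suc r)))" using False e e' by simp
    then show ?thesis
      apply (intro exI conjI)
      apply (simp only: comp.simps)
      apply (rule exec_Seq[OF e(1) exec_Seq[OF e'(1) exec_IfFalse[OF _ f(1)]]])
      using False e e' f by auto
  qed
qed

section \<open>Program logic with time bounds\<close>

definition run :: "com \<Rightarrow> ast \<Rightarrow> ast \<Rightarrow> bool" where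
  "run c sg sg' \<longleftrightarrow> (\<forall>\<rho>. sim sg \<rho> \<longrightarrow>
     (\<exists>\<tau> \<rho>'. exec w c \<rho> \<tau> \<rho>' \<and> sim sg' \<rho>' \<and> tm sg + \<tau> \<le> tm sg'))"

lemma run_Seq: "run c sg sg' \<Longrightarrow> run d sg' sg'' \<Longrightarrow> run (Seq c d) sg sg''"
  unfolding run_def
proof (intro allI impI)
  fix \<rho>
  assume 1: "\<forall>\<rho>. sim sg \<rho> \<longrightarrow> (\<exists>\<tau> \<rho>'. exec w c \<rho> \<tau> \<rho>' \<and> sim sg' \<rho>' \<and> tm sg + \<tau> \<le> tm sg')"
    and 2: "\<forall>\<rho>. sim sg' \<rho> \<longrightarrow> (\<exists>\<tau> \<rho>'. exec w d \<rho> \<tau> \<rho>' \<and> sim sg'' \<rho>' \<and> tm sg' + \<tau> \<le> tm sg'')"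
    and "sim sg \<rho>"
  then obtain \<tau> \<rho>' where e: "exec w c \<rho> \<tau> \<rho>'" "sim sg' \<rho>'" "tm sg + \<tau> \<le> tm sg'" by blast
  with 2 obtain \<tau>' \<rho>'' where e': "exec w d \<rho>' \<tau>' \<rho>''" "sim sg'' \<rho>''" "tm sg' + \<tau>' \<le> tm sg''" by blast
  show "\<exists>\<tau> \<rho>'. exec w (Seq c d) \<rho> \<tau> \<rho>' \<and> sim sg'' \<rho>' \<and> tm sg + \<tau> \<le> tm sg''"
    by (rule exI, rule exI, rule conjI, rule exec_Seq[OF e(1) e'(1)]) (use e e' in auto)
qed

lemma run_asg:
  assumes "ok sg e" "v < 60" "ev sg e \<le> S"
  shows "run (asg v e) sg (upv v (ev sg e) (tick (cost e + 1) sg))"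
  unfolding run_def asg_def
proof (intro allI impI)
  fix \<rho> assume s: "sim sg \<rho>"
  obtain \<tau> \<rho>' where e: "exec w (comp e 61) \<rho> \<tau> \<rho>'" "\<tau> \<le> cost e" "regs \<rho>' 61 = ev sg e"
    "\<forall>q<61. regs \<rho>' q = regs \<rho> q" "mem \<rho>' = mem \<rho>"
    using exec_comp[OF s assms(1), of 61] by auto
  show "\<exists>\<tau> \<rho>'. exec w (Seq (comp e 61) (Op v BitOr (Reg 61) (Const 0))) \<rho> \<tau> \<rho>' \<and>
    sim (upv v (ev sg e) (tick (cost e + 1) sg)) \<rho>' \<and> tm sg + \<tau> \<le> tm (upv v (ev sg e) (tick (cost e + 1) sg))"
    apply (intro exI conjI)
    apply (rule exec_Seq[OF e(1) exec_Op])
    using e s assms by (auto simp: sim_def bounded_def)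
qed

lemma asg_ex:
  assumes "ok sg e" "v < 60" "ev sg e = x" "x \<le> S"
  shows "\<exists>sg'. run (asg v e) sg sg' \<and> vr sg' = (vr sg)(v := x) \<and> ar sg' = ar sg \<and> tm sg' = tm sg + cost e + 1"
  by (rule exI, rule conjI, rule run_asg) (use assms in auto)

lemma array_cell_inj:
  assumes "a * S + i = b * S + j" "i < S" "j < S"
  shows "a = b \<and> i = j"
proof -
  have "(a * S + i) div S = a" "(b * S + j) div S = b" using assms(2,3) by simp_all
  then have "a = b" using assms(1) by metis
  then show ?thesis using assms(1) by simp
qed

lemma run_sto:
  assumes "ok sg e" "ok sg e'" "a < 30" "ev sg e < S"
  shows "run (sto a e e') sg (upa a ((ar sg a)(ev sg e := ev sg e')) (tick (cost e + cost e' + 3) sg))"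
  unfolding run_def sto_def
proof (intro allI impI)
  fix \<rho> assume s: "sim sg \<rho>"
  obtain \<tau> \<rho>' where e: "exec w (comp e 61) \<rho> \<tau> \<rho>'" "\<tau> \<le> cost e" "regs \<rho>' 61 = ev sg e"
    "\<forall>q<61. regs \<rho>' q = regs \<rho> q" "mem \<rho>' = mem \<rho>"
    using exec_comp[OF s assms(1), of 61] by auto
  have s': "sim sg \<rho>'" using s e by (auto simp: sim_def)
  obtain \<tau>' \<rho>'' where e': "exec w (comp e' 62) \<rho>' \<tau>' \<rho>''" "\<tau>' \<le> cost e'" "regs \<rho>'' 62 = ev sg e'"
    "\<forall>q<62. regs \<rho>'' q = regs \<rho>' q" "mem \<rho>'' = mem \<rho>'"
    using exec_comp[OF s' assms(2), of 62] by auto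
  have inj: "b * S + j = a * S + ev sg e \<longleftrightarrow> b = a \<and> j = ev sg e" if "j < S" for b j
    using array_cell_inj[of b j a "ev sg e"] that assms by auto
  note ad = address[OF assms(3,4)]
  show "\<exists>\<tau> \<rho>'. exec w (Seq (comp e 61) (Seq (comp e' 62) (Seq (Op 63 Mul (Const a) (Reg 60))
     (Seq (Op 61 Add (Reg 61) (Reg 63)) (Store (Reg 61) (Reg 62)))))) \<rho> \<tau> \<rho>' \<and>
    sim (upa a ((ar sg a)(ev sg e := ev sg e')) (tick (cost e + cost e' + 3) sg)) \<rho>' \<and>
    tm sg + \<tau> \<le> tm (upa a ((ar sg a)(ev sg e := ev sg e')) (tick (cost e + cost e' + 3) sg))"
    apply (intro exI conjI)
    apply (rule exec_Seq[OF e(1) exec_Seq[OF e'(1) exec_Seq[OF exec_Op exec_Seq[OF exec_Op exec_Store]]]])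
    using e e' s ad inj by (auto simp: sim_def bounded_def)
qed

lemma sto_ex:
  assumes "ok sg e" "ok sg e'" "a < 30" "ev sg e = i" "i < S" "ev sg e' = x"
  shows "\<exists>sg'. run (sto a e e') sg sg' \<and> vr sg' = vr sg \<and> ar sg' = (ar sg)(a := (ar sg a)(i := x)) \<and>
     tm sg' = tm sg + cost e + cost e' + 3"
  by (rule exI, rule conjI, rule run_sto) (use assms in auto)

lemma run_Loop:
  assumes "x < 60" "y < 60"
    and "\<And>i. i < N \<Longrightarrow> vr (f i) x < vr (f i) y"
    and "\<not> vr (f N) x < vr (f N) y"
    and "\<And>i. i < N \<Longrightarrow> run c (tick 1 (f i)) (f (Suc i))"
  shows "run (Loop (Lt (Reg x) (Reg y)) c) (f 0) (tick 1 (f N))"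
  unfolding run_def
proof (intro allI impI)
  fix \<rho> assume s: "sim (f 0) \<rho>"
  have "\<exists>\<tau> \<rho>'. exec w (Loop (Lt (Reg x) (Reg y)) c) \<rho> \<tau> \<rho>' \<and> sim (f N) \<rho>' \<and> tm (f i) + \<tau> \<le> tm (f N) + 1"
    if "sim (f i) \<rho>" "i \<le> N" for i \<rho>
    using that
  proof (induction "N - i" arbitrary: i \<rho>)
    case 0
    then have [simp]: "i = N" by simp
    have "\<not> cmp_val w \<rho> (Lt (Reg x) (Reg y))" using 0 assms by (simp add: sim_def)
    then show ?case using 0 exec_LoopFalse by fastforce
  next
    case (Suc d)
    then have i: "i < N" by simp
    have c: "cmp_val w \<rho> (Lt (Reg x) (Reg y))" using Suc assms i by (simp add: sim_def)
    have "sim (tick 1 (f i)) \<rho>" using Suc by (simp add: sim_def bounded_def)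
    then obtain \<tau> \<rho>' where 1: "exec w c \<rho> \<tau> \<rho>'" "sim (f (Suc i)) \<rho>'" "tm (f i) + 1 + \<tau> \<le> tm (f (Suc i))"
      using assms(5)[OF i] unfolding run_def by fastforce
    obtain \<tau>' \<rho>'' where 2: "exec w (Loop (Lt (Reg x) (Reg y)) c) \<rho>' \<tau>' \<rho>''" "sim (f N) \<rho>''"
      "tm (f (Suc i)) + \<tau>' \<le> tm (f N) + 1"
    proof -
      have "d = N - Suc i" using Suc.hyps(2) by simp
      from Suc.hyps(1)[OF this, of \<rho>'] 1 i show ?thesis using that by auto
    qed
    show ?case using exec_LoopTrue[OF c 1(1) 2(1)] 1 2 by (intro exI conjI) auto
  qed
  from this[OF s] obtain \<tau> \<rho>' where "exec w (Loop (Lt (Reg x) (Reg y)) c) \<rho> \<tau> \<rho>'" "sim (f N) \<rho>'"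
    "tm (f 0) + \<tau> \<le> tm (f N) + 1" by auto
  then show "\<exists>\<tau> \<rho>'. exec w (Loop (Lt (Reg x) (Reg y)) c) \<rho> \<tau> \<rho>' \<and> sim (tick 1 (f N)) \<rho>' \<and>
    tm (f 0) + \<tau> \<le> tm (tick 1 (f N))"
    by (intro exI conjI) (auto simp: sim_def bounded_def)
qed

lemma run_Loop_inv:
  assumes "x < 60" "y < 60" "I 0 sg"
    and tick: "\<And>i sg k. I i sg \<Longrightarrow> I i (tick k sg)"
    and guard: "\<And>i sg. i \<le> N \<Longrightarrow> I i sg \<Longrightarrow> vr sg x < vr sg y \<longleftrightarrow> i < N"
    and step: "\<And>i sg. i < N \<Longrightarrow> I i sg \<Longrightarrow> \<exists>sg'. run c sg sg' \<and> tm sg' \<le> tm sg + T \<and> I (Suc i) sg'"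
  shows "\<exists>sg'. run (Loop (Lt (Reg x) (Reg y)) c) sg sg' \<and> tm sg' \<le> tm sg + N * (T + 1) + 1 \<and> I N sg'"
proof -
  \<comment> \<open>The hypothesis on the body only asserts that a successor state exists; a choice
    function turns it into the sequence of states that \<open>run_Loop\<close> works with.\<close>
  define g where "g i sg = (SOME sg'. run c sg sg' \<and> tm sg' \<le> tm sg + T \<and> I (Suc i) sg')" for i sg
  define f where "f = rec_nat sg (\<lambda>i sg. g i (tick 1 sg))"
  have f0: "f 0 = sg" and fS: "\<And>i. f (Suc i) = g i (tick 1 (f i))" by (simp_all add: f_def)
  have g: "run c sg (g i sg) \<and> tm (g i sg) \<le> tm sg + T \<and> I (Suc i) (g i sg)" if "i < N" "I i sg" for i sg
    unfolding g_def by (rule someI_ex[OF step[OF that]])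
  have f: "I i (f i) \<and> tm (f i) \<le> tm sg + i * (T + 1)" if "i \<le> N" for i
    using that
  proof (induction i)
    case 0 then show ?case using assms(3) by (simp add: f0)
  next
    case (Suc i)
    then show ?case using g[of i "tick 1 (f i)"] tick by (auto simp: fS)
  qed
  have "run (Loop (Lt (Reg x) (Reg y)) c) (f 0) (tick 1 (f N))"
  proof (rule run_Loop)
    show "run c (tick 1 (f i)) (f (Suc i))" if "i < N" for i
      using g[of i "tick 1 (f i)"] tick f[of i] that by (simp add: fS)
  qed (use assms(1,2) f guard in \<open>auto dest: less_imp_le\<close>)
  then show ?thesis using f[of N] tick f0 by (intro exI[of _ "tick 1 (f N)"]) auto
qed

text \<open>The invariant is demanded of \<open>upv v (Suc i) sg'\<close> because the counter is
  advanced after the body. A round costs \<open>T + 5\<close>: the body, four steps for the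
  increment and one for the test; the final \<open>3\<close> is the initialisation and the last
  test.\<close>

lemma run_for:
  assumes "v < 60" "l < 60" "v \<noteq> l" "vr sg l = N" "N \<le> S"
    and "I 0 (upv v 0 sg)"
    and tick: "\<And>i sg k. I i sg \<Longrightarrow> I i (tick k sg)"
    and step: "\<And>i sg. i < N \<Longrightarrow> I i sg \<Longrightarrow> vr sg v = i \<Longrightarrow> vr sg l = N \<Longrightarrow>
       \<exists>sg'. run c sg sg' \<and> tm sg' \<le> tm sg + T \<and> vr sg' v = i \<and> vr sg' l = N \<and> I (Suc i) (upv v (Suc i) sg')"
  shows "\<exists>sg'. run (for_loop v l c) sg sg' \<and> tm sg' \<le> tm sg + N * (T + 5) + 3 \<and> I N sg' \<and>
            vr sg' v = N \<and> vr sg' l = N"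
proof -
  have 1: "run (asg v (Cst 0)) sg (upv v 0 (tick 2 sg))"
    using run_asg[of sg "Cst 0" v] assms(1) by (simp add: numeral_2_eq_2)
  have eq: "upv v x (tick k sg) = tick k (upv v x sg)" for v x k sg by (simp add: upv_def tick_def)
  have "\<exists>sg'. run (Loop (Lt (Reg v) (Reg l)) (Seq c (asg v (Var v [+] Cst 1)))) (upv v 0 (tick 2 sg)) sg' \<and>
     tm sg' \<le> tm (upv v 0 (tick 2 sg)) + N * (T + 4 + 1) + 1 \<and> (I N sg' \<and> vr sg' v = N \<and> vr sg' l = N)"
  proof (rule run_Loop_inv[where I = "\<lambda>i sg. I i sg \<and> vr sg v = i \<and> vr sg l = N"])
    show "I 0 (upv v 0 (tick 2 sg)) \<and> vr (upv v 0 (tick 2 sg)) v = 0 \<and> vr (upv v 0 (tick 2 sg)) l = N"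
      using assms by (auto simp: eq)
  next
    fix i sg assume i: "i < N" and "I i sg \<and> vr sg v = i \<and> vr sg l = N"
    with step obtain sg' where s: "run c sg sg'" "tm sg' \<le> tm sg + T" "vr sg' v = i" "vr sg' l = N"
      "I (Suc i) (upv v (Suc i) sg')" by blast
    have "run (asg v (Var v [+] Cst 1)) sg' (upv v (Suc i) (tick 4 sg'))"
      using run_asg[of sg' "Var v [+] Cst 1" v] assms(1,5) s(3) i by (simp add: numeral_eq_Suc)
    from run_Seq[OF s(1) this]
    show "\<exists>sg'. run (Seq c (asg v (Var v [+] Cst 1))) sg sg' \<and> tm sg' \<le> tm sg + (T + 4) \<and>
          I (Suc i) sg' \<and> vr sg' v = Suc i \<and> vr sg' l = N"
      using s tick assms(3) by (intro exI[of _ "upv v (Suc i) (tick 4 sg')"]) (auto simp: eq)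
  qed (use assms in auto)
  then obtain sg' where 2: "run (Loop (Lt (Reg v) (Reg l)) (Seq c (asg v (Var v [+] Cst 1)))) (upv v 0 (tick 2 sg)) sg'"
     "tm sg' \<le> tm (upv v 0 (tick 2 sg)) + N * (T + 4 + 1) + 1" "I N sg' \<and> vr sg' v = N \<and> vr sg' l = N"
    by blast
  show ?thesis unfolding for_loop_def 
    by (rule exI, rule conjI, rule run_Seq[OF 1 2(1)]) (use 2 in \<open>auto simp: algebra_simps\<close>)
qed

lemma ev_cong:
  assumes "\<And>v. vr sg v = vr sg' v" "\<And>a. a \<in> arrays e \<Longrightarrow> ar sg a = ar sg' a"
  shows "ev sg e = ev sg' e" "small sg e = small sg' e" "ok sg e = ok sg' e"
proof -
  have "ev sg e = ev sg' e \<and> small sg e = small sg' e \<and> ok sg e = ok sg' e"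
    using assms by (induction e) auto
  then show "ev sg e = ev sg' e" "small sg e = small sg' e" "ok sg e = ok sg' e" by auto
qed

text \<open>As \<open>a \<notin> arrays e\<close>, earlier stores do not influence later entries, so
  every entry is the value of \<open>e\<close> in the initial state up to the counter. The limit
  \<open>490\<close> leaves room for the loop overhead within \<open>500\<close> steps per
  entry.\<close>

lemma run_map:
  assumes "v < 60" "l < 60" "v \<noteq> l" "vr sg l = N" "N \<le> S" "a < 30" "a \<notin> arrays e" "cost e \<le> 490"
    and "\<And>i. i < N \<Longrightarrow> ok (upv v i sg) e"
  shows "\<exists>sg'. run (map_loop a v l e) sg sg' \<and> tm sg' \<le> tm sg + 500 * (N + 1) \<and>
     vr sg' = (vr sg)(v := N) \<and>
     ar sg' = (ar sg)(a := (\<lambda>i. if i < N then ev (upv v i sg) e else ar sg a i))"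
proof -
  have "\<exists>sg'. run (map_loop a v l e) sg sg' \<and> tm sg' \<le> tm sg + N * (cost e + 4 + 5) + 3 \<and>
     (vr sg' = (vr sg)(v := N) \<and>
     ar sg' = (ar sg)(a := (\<lambda>i. if i < N then ev (upv v i sg) e else ar sg a i))) \<and> vr sg' v = N \<and> vr sg' l = N"
    unfolding map_loop_def
  proof (rule run_for[where I = "\<lambda>k sg'. vr sg' = (vr sg)(v := k) \<and>
     ar sg' = (ar sg)(a := (\<lambda>i. if i < k then ev (upv v i sg) e else ar sg a i))"])
    fix i sg1
    assume i: "i < N" and I: "vr sg1 = (vr sg)(v := i) \<and>
       ar sg1 = (ar sg)(a := (\<lambda>k. if k < i then ev (upv v k sg) e else ar sg a k))"
    have c: "ev sg1 e = ev (upv v i sg) e" "ok sg1 e = ok (upv v i sg) e"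
      using I assms(7) by (auto intro!: ev_cong)
    have r: "run (sto a (Var v) e) sg1 (upa a ((ar sg1 a)(i := ev (upv v i sg) e)) (tick (cost e + 4) sg1))"
      using run_sto[of sg1 "Var v" e a] assms i I c by (auto simp: numeral_eq_Suc)
    have eq: "ar (upa a ((ar sg1 a)(i := ev (upv v i sg) e)) (tick (cost e + 4) sg1)) =
       (ar sg)(a := (\<lambda>k. if k < Suc i then ev (upv v k sg) e else ar sg a k))"
      using I by (auto simp: fun_eq_iff less_Suc_eq)
    show "\<exists>sg'. run (sto a (Var v) e) sg1 sg' \<and> tm sg' \<le> tm sg1 + (cost e + 4) \<and> vr sg' v = i \<and> vr sg' l = N \<and>
        vr (upv v (Suc i) sg') = (vr sg)(v := Suc i) \<and>
        ar (upv v (Suc i) sg') = (ar sg)(a := (\<lambda>k. if k < Suc i then ev (upv v k sg) e else ar sg a k))"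
      by (rule exI, rule conjI, rule r) (use I assms eq in auto)
  qed (use assms in \<open>auto simp: fun_eq_iff\<close>)
  moreover have "N * (cost e + 4 + 5) + 3 \<le> 500 * (N + 1)"
  proof -
    have "N * (cost e + 4 + 5) \<le> N * 500" using assms(8) by (intro mult_left_mono) auto
    then show ?thesis unfolding distrib_left by linarith
  qed
  ultimately show ?thesis by (elim exE, intro exI conjI) auto
qed

lemma run_upd:
  assumes "v < 60" "l < 60" "v \<noteq> l" "vr sg l = N" "N \<le> S" "a < 30" "t < 30" "a \<noteq> t" "t \<notin> arrays e"
    "cost e \<le> 490" "\<And>i. i < N \<Longrightarrow> ok (upv v i sg) e"
  shows "\<exists>sg'. run (upd_loop t a v l e) sg sg' \<and> tm sg' \<le> tm sg + 1000 * (N + 1) \<and>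
     vr sg' = (vr sg)(v := N) \<and> (\<forall>b. b \<noteq> a \<longrightarrow> b \<noteq> t \<longrightarrow> ar sg' b = ar sg b) \<and>
     (\<forall>i. ar sg' a i = (if i < N then ev (upv v i sg) e else ar sg a i))"
proof -
  obtain sg1 where 1: "run (map_loop t v l e) sg sg1" "tm sg1 \<le> tm sg + 500 * (N + 1)"
     "vr sg1 = (vr sg)(v := N)" "ar sg1 = (ar sg)(t := (\<lambda>i. if i < N then ev (upv v i sg) e else ar sg t i))"
    using run_map[OF assms(1-5) assms(7,9,10,11)] by auto
  have "\<exists>sg'. run (map_loop a v l (Arr t (Var v))) sg1 sg' \<and> tm sg' \<le> tm sg1 + 500 * (N + 1) \<and>
     vr sg' = (vr sg1)(v := N) \<and>
     ar sg' = (ar sg1)(a := (\<lambda>i. if i < N then ev (upv v i sg1) (Arr t (Var v)) else ar sg1 a i))"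
    using assms 1 by (intro run_map) auto
  then obtain sg2 where 2: "run (map_loop a v l (Arr t (Var v))) sg1 sg2" "tm sg2 \<le> tm sg1 + 500 * (N + 1)"
     "vr sg2 = (vr sg1)(v := N)"
     "ar sg2 = (ar sg1)(a := (\<lambda>i. if i < N then ev (upv v i sg1) (Arr t (Var v)) else ar sg1 a i))"
    by blast
  show ?thesis unfolding upd_loop_def
    by (intro exI[of _ sg2] conjI run_Seq[OF 1(1) 2(1)]) (use 1 2 assms in auto)
qed

end

section \<open>Nussbaumer's negacyclic convolution\<close>

lemma sum_lessThan_add:
  fixes g :: "nat \<Rightarrow> 'a::comm_monoid_add"
  shows "(\<Sum>j<a+b. g j) = (\<Sum>j<a. g j) + (\<Sum>j<b. g (a + j))"
  by (induction b) (simp_all add: add.assoc)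

lemma sum_lessThan_mult:
  fixes g :: "nat \<Rightarrow> 'a::comm_monoid_add"
  shows "(\<Sum>i<a*b. g i) = (\<Sum>j<a. \<Sum>l<b. g (j * b + l))"
  by (induction a) (simp_all add: add.commute[of b] sum_lessThan_add)

lemma block_div_mod: "l < n \<Longrightarrow> (b * n + l) div n = b" "l < n \<Longrightarrow> (b * n + l) mod n = l" for n :: nat
  by simp_all

definition blk :: "(nat \<Rightarrow> int) \<Rightarrow> nat \<Rightarrow> nat \<Rightarrow> complex \<Rightarrow> complex" where
  "blk f st n x = (\<Sum>l<n. of_int (f (st + l)) * x ^ l)"

text \<open>
  A segment of \<open>h * r\<close> cells read as a polynomial in \<open>X\<close> and \<open>y\<close>. An element of
  \<open>\<int>[X,y] / (y^r + 1, X^h - y^e)\<close> is studied through its values at the complex points with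
  \<open>y^r = -1\<close> and \<open>X^h = y^e\<close>.
\<close>

definition blk2 :: "(nat \<Rightarrow> int) \<Rightarrow> nat \<Rightarrow> nat \<Rightarrow> nat \<Rightarrow> complex \<Rightarrow> complex \<Rightarrow> complex" where
  "blk2 f st h r X y = (\<Sum>j<h. blk f (st + j * r) r y * X ^ j)"

text \<open>The antiperiodic extension of a row of length \<open>r\<close>. Reading it at shifted
  indices multiplies the row by a power of \<open>y\<close> in \<int>[y]/(y^r + 1), which is how
  multiplication by a root of unity becomes a mere permutation with signs.\<close>

definition sgx :: "(nat \<Rightarrow> int) \<Rightarrow> nat \<Rightarrow> nat \<Rightarrow> nat \<Rightarrow> int" where
  "sgx f row r i = (if i mod (2*r) < r then f (row + i mod (2*r)) else - f (row + (i mod (2*r) - r)))"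

lemma sgx_half:
  assumes "0 < r" shows "sgx f row r (i + r) = - sgx f row r i"
proof (cases "i mod (2*r) < r")
  case True
  have "(i + r) mod (2*r) = (i mod (2*r) + r) mod (2*r)" by (simp add: mod_add_left_eq)
  also have "\<dots> = i mod (2*r) + r" using True by simp
  finally show ?thesis using True by (simp add: sgx_def)
next
  case False
  have lt: "i mod (2*r) < 2 * r" using assms by simp
  have "(i + r) mod (2*r) = (i mod (2*r) + r) mod (2*r)" by (simp add: mod_add_left_eq)
  also have "i mod (2*r) + r = i mod (2*r) - r + 2 * r" using False by simp
  also have "(i mod (2*r) - r + 2 * r) mod (2*r) = i mod (2*r) - r"
    using False lt by (subst mod_add_self2) (auto intro: mod_less)
  finally have "(i + r) mod (2*r) = i mod (2*r) - r" .
  moreover have "i mod (2*r) - r < r" using False lt by linarith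
  ultimately show ?thesis using False by (simp add: sgx_def)
qed

text \<open>For a shift by one, the coefficient that leaves at the bottom re-enters at the top with
  the opposite sign, and \<open>y ^ r = -1\<close> accounts for that sign.\<close>

lemma sgx_shift:
  assumes "0 < r" "y ^ r = -1"
  shows "(\<Sum>l<r. of_int (sgx f row r (l + a)) * y ^ l) = y ^ e * (\<Sum>l<r. of_int (sgx f row r (l + (a + e))) * y ^ l :: complex)"
proof (induction e)
  case (Suc e)
  let ?G = "\<lambda>a. (\<Sum>l<r. of_int (sgx f row r (l + a)) * y ^ l :: complex)"
  have "?G a = y * ?G (a + 1)" for a
  proof -
    have "(\<Sum>l<Suc r. of_int (sgx f row r (l + a)) * y ^ l) = of_int (sgx f row r a) + y * ?G (a + 1)"
      by (subst sum.lessThan_Suc_shift) (simp add: sum_distrib_left mult_ac)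
    moreover have "(\<Sum>l<Suc r. of_int (sgx f row r (l + a)) * y ^ l) = ?G a + of_int (sgx f row r a)"
      using sgx_half[OF assms(1), of f row a] assms(2) by (simp add: add.commute)
    ultimately show ?thesis by simp
  qed
  from this[of "a + e"] Suc show ?case by (simp add: mult_ac)
qed simp

text \<open>A full period \<open>2 * r\<close> is added to the index so that subtracting
  \<open>e\<close> stays within the natural numbers.\<close>

lemma sgx_rotate:
  assumes "0 < r" "y ^ r = -1" "e \<le> 2 * r"
  shows "(\<Sum>l<r. of_int (sgx f row r (l + 2 * r - e)) * y ^ l) = y ^ e * blk f row r y"
proof -
  have "(\<Sum>l<r. of_int (sgx f row r (l + 2 * r - e)) * y ^ l) = (\<Sum>l<r. of_int (sgx f row r (l + (2 * r - e))) * y ^ l)"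
    using assms(3) by (intro sum.cong) auto
  also have "\<dots> = y ^ e * (\<Sum>l<r. of_int (sgx f row r (l + (2 * r - e + e))) * y ^ l)"
    by (rule sgx_shift[OF assms(1,2)])
  also have "(\<Sum>l<r. of_int (sgx f row r (l + (2 * r - e + e))) * y ^ l) = blk f row r y"
    unfolding blk_def using assms(3) by (intro sum.cong) (auto simp: sgx_def)
  finally show ?thesis .
qed

text \<open>
  Reduction of each segment of length \<open>2 * H\<close> modulo the two factors \<open>X^h - y^e\<close>, \<open>X^h + y^e\<close>
  of \<open>X^(2h) - y^(2e)\<close>, where \<open>H = h * r\<close>; the exponents of the factors are tabulated in \<open>E\<close>,
  the \<open>G\<close> factors of one block being numbered \<open>G, \<dots>, 2 * G - 1\<close>.
\<close>

definition fwd :: "nat \<Rightarrow> nat \<Rightarrow> nat \<Rightarrow> (nat \<Rightarrow> nat) \<Rightarrow> (nat \<Rightarrow> int) \<Rightarrow> nat \<Rightarrow> int" where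
  "fwd r H G E f i = f (i div (2*H) * (2*H) + i mod H) +
     sgx f (i div (2*H) * (2*H) + H + i mod H div r * r) r (i mod r + 2 * r - E (G + i div H mod G))"

text \<open>The inverse butterfly up to a factor \<open>2\<close>: the sum of the two halves, and
  their difference times y^(-e). The exponent is read off at the first of the two segments, which
  belongs to X^h - y^e; reading \<open>sgx\<close> ahead by \<open>e\<close> is the multiplication
  by y^(-e).\<close>

definition bwd :: "nat \<Rightarrow> nat \<Rightarrow> nat \<Rightarrow> (nat \<Rightarrow> nat) \<Rightarrow> (nat \<Rightarrow> int) \<Rightarrow> nat \<Rightarrow> int" where
  "bwd r H G E c i = (if i mod (2*H) < H then c i + c (i + H)
     else sgx (\<lambda>k. c k - c (k + H)) (i div (2*H) * (2*H) + i mod H div r * r) r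
            (i mod r + E (G + (2 * (i div (2*H))) mod G)))"

lemma row_less:
  fixes r h' :: nat
  assumes "H = h' * r" "j < h'" "l < r"
  shows "j * r + l < H"
proof -
  have "j * r + l < Suc j * r" using assms by simp
  also have "\<dots> \<le> H" using assms by (metis Suc_leI mult_le_mono1)
  finally show ?thesis .
qed

lemma segment_index:
  fixes r h' p c j l :: nat
  assumes "H = h' * r" "j < h'" "l < r" "c < 2"
  defines "i \<equiv> (2 * p + c) * H + j * r + l"
  shows "i div H = 2 * p + c" "i mod H = j * r + l" "i div (2*H) = p" "i mod r = l"
proof -
  have lt: "j * r + l < H" using assms(1-3) by (rule row_less)
  have i: "i = (2 * p + c) * H + (j * r + l)" by (simp add: i_def)
  show 1: "i div H = 2 * p + c" "i mod H = j * r + l" unfolding i using lt by simp_all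
  have "i div (2*H) = i div H div 2" by (simp add: div_mult2_eq mult.commute)
  then show "i div (2*H) = p" using 1 assms(4) by simp
  have "i = ((2 * p + c) * h' + j) * r + l" by (simp add: i_def assms(1) algebra_simps)
  then show "i mod r = l" using assms(3) by simp
qed

text \<open>At the points in question \<open>X ^ (h' + j)\<close> equals y^e X^j, so folding the
  upper half of a segment onto the lower one, rotated by \<open>e\<close>, does not change the
  value.\<close>

lemma blk2_fwd:
  assumes "H = h' * r" "0 < r" "c < 2" "y ^ r = -1" "X ^ h' = y ^ E (G + (2 * p + c) mod G)"
    "E (G + (2 * p + c) mod G) \<le> 2 * r"
  shows "blk2 (fwd r H G E f) ((2 * p + c) * H) h' r X y = blk2 f (2 * p * H) (2 * h') r X y"
proof -
  let ?e = "E (G + (2 * p + c) mod G)"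
  have row: "blk (fwd r H G E f) ((2 * p + c) * H + j * r) r y =
     blk f (2 * p * H + j * r) r y + y ^ ?e * blk f (2 * p * H + (h' + j) * r) r y" if j: "j < h'" for j
  proof -
    have "fwd r H G E f ((2 * p + c) * H + j * r + l) =
       f (2 * p * H + j * r + l) + sgx f (2 * p * H + (h' + j) * r) r (l + 2 * r - ?e)" if "l < r" for l
      unfolding fwd_def segment_index[OF assms(1) j that assms(3)] block_div_mod[OF that]
      by (simp add: assms(1) algebra_simps)
    then have "blk (fwd r H G E f) ((2 * p + c) * H + j * r) r y =
      (\<Sum>l<r. of_int (f (2 * p * H + j * r + l)) * y ^ l) +
      (\<Sum>l<r. of_int (sgx f (2 * p * H + (h' + j) * r) r (l + 2 * r - ?e)) * y ^ l)"
      unfolding blk_def sum.distrib[symmetric] by (intro sum.cong) (auto simp: distrib_right)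
    then show ?thesis using sgx_rotate[OF assms(2,4,6)] by (simp add: blk_def)
  qed
  have "blk2 f (2 * p * H) (2 * h') r X y = (\<Sum>j<h'. blk f (2 * p * H + j * r) r y * X ^ j) +
      (\<Sum>j<h'. blk f (2 * p * H + (h' + j) * r) r y * X ^ (h' + j))"
    unfolding blk2_def mult_2 sum_lessThan_add ..
  also have "\<dots> = (\<Sum>j<h'. (blk f (2 * p * H + j * r) r y + y ^ ?e * blk f (2 * p * H + (h' + j) * r) r y) * X ^ j)"
    unfolding sum.distrib[symmetric] using assms(5) by (intro sum.cong) (auto simp: power_add algebra_simps)
  also have "\<dots> = blk2 (fwd r H G E f) ((2 * p + c) * H) h' r X y"
    unfolding blk2_def using row by (intro sum.cong) auto
  finally show ?thesis ..
qed

lemma blk_diff: "blk (\<lambda>k. c k - c (k + H)) st n y = blk c st n y - blk c (st + H) n y"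
  unfolding blk_def by (simp add: left_diff_distrib sum_subtractf add_ac)

text \<open>With the two halves called c0 and c1, the value at a point with X^h' = s y^e is (c0 +
  c1) + s (c0 - c1): twice c0 for \<open>s = 1\<close> and twice c1 for
  \<open>s = -1\<close>.\<close>

lemma blk2_bwd:
  assumes "H = h' * r" "0 < r" "y ^ r = -1" "X ^ h' = s * y ^ E (G + (2 * p) mod G)" "s = 1 \<or> s = -1"
    "E (G + (2 * p) mod G) \<le> 2 * r"
  shows "blk2 (bwd r H G E c) (2 * p * H) (2 * h') r X y =
     (if s = 1 then 2 * blk2 c (2 * p * H) h' r X y else 2 * blk2 c ((2 * p + 1) * H) h' r X y)"
proof -
  let ?e = "E (G + (2 * p) mod G)"
  have lo: "blk (bwd r H G E c) (2 * p * H + j * r) r y =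
     blk c (2 * p * H + j * r) r y + blk c ((2 * p + 1) * H + j * r) r y" if j: "j < h'" for j
  proof -
    have "bwd r H G E c (2 * p * H + j * r + l) = c (2 * p * H + j * r + l) + c ((2 * p + 1) * H + j * r + l)"
      if l: "l < r" for l
    proof -
      note ix = segment_index[where p = p and c = 0, OF assms(1) j l, simplified] and lt = row_less[OF assms(1) j l]
      have "(2 * p * H + j * r + l) mod (2 * H) = j * r + l"
        using lt by (metis (no_types, lifting) add.assoc mod_less mod_mult_self3 mult.assoc mult.commute mult_2 trans_less_add1)
      then show ?thesis unfolding bwd_def using lt by (simp add: algebra_simps)
    qed
    then show ?thesis unfolding blk_def sum.distrib[symmetric] by (intro sum.cong) (auto simp: distrib_right)
  qed
  have hi: "blk (bwd r H G E c) (2 * p * H + (h' + j) * r) r y * y ^ ?e =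
     blk c (2 * p * H + j * r) r y - blk c ((2 * p + 1) * H + j * r) r y" if j: "j < h'" for j
  proof -
    have "bwd r H G E c (2 * p * H + (h' + j) * r + l) =
      sgx (\<lambda>k. c k - c (k + H)) (2 * p * H + j * r) r (l + 2 * r - (2 * r - ?e))" if l: "l < r" for l
    proof -
      note ix = segment_index[where p = p and c = 1, OF assms(1) j l, simplified] and lt = row_less[OF assms(1) j l]
      have eq: "2 * p * H + (h' + j) * r + l = H + 2 * p * H + j * r + l" by (simp add: assms(1) algebra_simps)
      have "(H + 2 * p * H + j * r + l) mod (2 * H) = (p * (2 * H) + (H + (j * r + l))) mod (2 * H)" by (simp add: algebra_simps)
      also have "\<dots> = H + (j * r + l)" using lt by (subst mod_mult_self3) (auto intro: mod_less)
      finally show ?thesis unfolding bwd_def eq using ix lt block_div_mod[OF l] assms(6) by (simp add: algebra_simps)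
    qed
    then have "blk (bwd r H G E c) (2 * p * H + (h' + j) * r) r y =
      (\<Sum>l<r. of_int (sgx (\<lambda>k. c k - c (k + H)) (2 * p * H + j * r) r (l + 2 * r - (2 * r - ?e))) * y ^ l)"
      unfolding blk_def by (intro sum.cong) auto
    also have "\<dots> = y ^ (2 * r - ?e) * blk (\<lambda>k. c k - c (k + H)) (2 * p * H + j * r) r y"
      by (rule sgx_rotate[OF assms(2,3)]) simp
    finally have "blk (bwd r H G E c) (2 * p * H + (h' + j) * r) r y * y ^ ?e =
       y ^ (2 * r - ?e + ?e) * blk (\<lambda>k. c k - c (k + H)) (2 * p * H + j * r) r y"
      by (simp add: power_add)
    moreover have "y ^ (2 * r - ?e + ?e) = 1"
      using assms(3,6) by (simp add: mult.commute[of 2] power_mult)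
    ultimately show ?thesis by (simp add: blk_diff algebra_simps)
  qed
  have "blk2 (bwd r H G E c) (2 * p * H) (2 * h') r X y =
      (\<Sum>j<h'. blk (bwd r H G E c) (2 * p * H + j * r) r y * X ^ j) +
      (\<Sum>j<h'. blk (bwd r H G E c) (2 * p * H + (h' + j) * r) r y * X ^ (h' + j))"
    unfolding blk2_def mult_2 sum_lessThan_add ..
  also have "\<dots> = (\<Sum>j<h'. (blk c (2 * p * H + j * r) r y + blk c ((2 * p + 1) * H + j * r) r y +
      s * (blk c (2 * p * H + j * r) r y - blk c ((2 * p + 1) * H + j * r) r y)) * X ^ j)"
  proof -
    have "blk (bwd r H G E c) (2 * p * H + (h' + j) * r) r y * X ^ (h' + j) =
      s * (blk c (2 * p * H + j * r) r y - blk c ((2 * p + 1) * H + j * r) r y) * X ^ j" if "j < h'" for j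
    proof -
      have "blk (bwd r H G E c) (2 * p * H + (h' + j) * r) r y * X ^ (h' + j) =
        s * (blk (bwd r H G E c) (2 * p * H + (h' + j) * r) r y * y ^ ?e) * X ^ j"
        unfolding power_add assms(4) by (simp only: mult_ac)
      then show ?thesis unfolding hi[OF that] .
    qed
    then show ?thesis unfolding sum.distrib[symmetric] using lo by (intro sum.cong) (auto simp: distrib_right)
  qed
  also have "\<dots> = (if s = 1 then 2 * blk2 c (2 * p * H) h' r X y else 2 * blk2 c ((2 * p + 1) * H) h' r X y)"
    unfolding blk2_def sum_distrib_left using assms(5) by (auto intro!: sum.cong simp: algebra_simps)
  finally show ?thesis .
qed

text \<open>The factors are numbered like the nodes of a heap, node \<open>v\<close> belonging to
  X^h - y^(tw r v). The children of \<open>v\<close> take the two square roots of its right-hand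
  power: half the exponent, and half the exponent plus \<open>r\<close>, since
  \<open>y ^ r = -1\<close>. The root \<open>1\<close> has exponent \<open>0\<close>.\<close>

function tw :: "nat \<Rightarrow> nat \<Rightarrow> nat" where
  "tw r v = (if v < 2 then 0 else tw r (v div 2) div 2 + v mod 2 * r)"
  by auto
termination by (relation "measure snd") auto

declare tw.simps [simp del]

lemma tw_double: "0 < v \<Longrightarrow> tw r (2 * v) = tw r v div 2" "0 < v \<Longrightarrow> tw r (2 * v + 1) = tw r v div 2 + r"
  by (subst tw.simps, simp)+

lemma tw_le: "tw r v \<le> 2 * r"
proof (induction v rule: less_induct)
  case (less v)
  show ?case
  proof (cases "v < 2")
    case False
    then have "tw r (v div 2) \<le> 2 * r" using less by simp
    then have "tw r (v div 2) div 2 \<le> r" by simp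
    moreover have "v mod 2 * r \<le> r" by (cases "even v") (auto simp: odd_iff_mod_2_eq_one)
    ultimately have "tw r (v div 2) div 2 + v mod 2 * r \<le> 2 * r" by linarith
    then show ?thesis unfolding tw.simps[of r v] by simp
  qed (subst tw.simps, simp)
qed

text \<open>Each level uses up one factor \<open>2\<close> of the exponents, and the added
  \<open>r = 2 ^ u\<close> keeps the rest. So the exponents at depths up to \<open>u\<close> are
  even and the halving in \<open>tw\<close> is exact.\<close>

lemma tw_dvd: "d \<le> u + 1 \<Longrightarrow> 2 ^ d \<le> v \<Longrightarrow> v < 2 ^ (d + 1) \<Longrightarrow> 2 ^ (u + 1 - d) dvd tw (2 ^ u) v"
proof (induction d arbitrary: v)
  case 0 then show ?case by (subst tw.simps) auto
next
  case (Suc d)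
  have "2 ^ (u + 1 - d) dvd tw (2 ^ u) (v div 2)" using Suc by (intro Suc.IH) auto
  then have "2 ^ (u - d) dvd tw (2 ^ u) (v div 2) div 2"
    using Suc.prems(1) by (intro dvd_mult_imp_div) (simp add: Suc_diff_le mult.commute)
  moreover have "2 ^ (u - d) dvd v mod 2 * (2::nat) ^ u" by (simp add: le_imp_power_dvd)
  ultimately show ?case by (subst tw.simps) auto
qed

text \<open>The product relation at the depth where each block has been split into \<open>2 ^ d\<close> segments.\<close>

definition prel2 :: "nat \<Rightarrow> nat \<Rightarrow> nat \<Rightarrow> nat \<Rightarrow> nat \<Rightarrow> (nat \<Rightarrow> int) \<Rightarrow> (nat \<Rightarrow> int) \<Rightarrow> (nat \<Rightarrow> int) \<Rightarrow> bool" where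
  "prel2 P h r d sc c a b \<longleftrightarrow> (\<forall>p<P. \<forall>X y. y ^ r = -1 \<longrightarrow> X ^ h = y ^ tw r (2 ^ d + p mod 2 ^ d) \<longrightarrow>
     blk2 c (p * (h * r)) h r X y = 2 ^ sc * blk2 a (p * (h * r)) h r X y * blk2 b (p * (h * r)) h r X y)"

text \<open>A point of a parent segment satisfies (X^h')^2 = (y^e)^2, so it is a point of exactly
  one kind of child, X^h' = y^e or X^h' = -y^e = y^(e+r). There \<open>fwd\<close> preserves the
  values of the factors, and \<open>bwd\<close> doubles that of the product, whence
  \<open>sc + 1\<close>.\<close>

lemma prel2_step:
  assumes r: "r = 2 ^ u" and d: "d \<le> u" and H: "H = h' * r"
    and p2: "prel2 (2 * P) h' r (d + 1) sc c (fwd r H (2 ^ (d+1)) (tw r) a) (fwd r H (2 ^ (d+1)) (tw r) b)"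
  shows "prel2 P (2 * h') r d (sc + 1) (bwd r H (2 ^ (d+1)) (tw r) c) a b"
  unfolding prel2_def
proof (intro allI impI)
  fix p :: nat and X y :: complex
  assume p: "p < P" and y: "y ^ r = -1" and X: "X ^ (2 * h') = y ^ tw r (2 ^ d + p mod 2 ^ d)"
  define v where "v = 2 ^ d + p mod 2 ^ d"
  have v: "2 ^ d \<le> v" "v < 2 ^ (d + 1)" "0 < v" by (auto simp: v_def)
  have "2 ^ (u + 1 - d) dvd tw r v" unfolding r using d v by (intro tw_dvd) auto
  moreover have "2 dvd (2::nat) ^ (u + 1 - d)" using d by simp
  ultimately have "even (tw r v)" using dvd_trans by blast
  then have tv: "tw r v = 2 * (tw r v div 2)" by simp
  define e where "e = tw r v div 2"
  \<comment> \<open>In the numbering of \<open>tw\<close>, the segments \<open>2 * p\<close> and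
    \<open>2 * p + 1\<close> are the children of node \<open>v\<close>.\<close>
  have v2: "2 ^ (d+1) + (2 * p) mod 2 ^ (d+1) = 2 * v" 
  proof -
    have "(2 * p) mod (2 * 2 ^ d) = 2 * (p mod 2 ^ d)" by (rule mult_mod_right[symmetric])
    then show ?thesis by (simp add: v_def)
  qed
  have ix: "2 ^ (d+1) + (2 * p) mod 2 ^ (d+1) = 2 * v" "2 ^ (d+1) + (2 * p + 1) mod 2 ^ (d+1) = 2 * v + 1"
  proof -
    show "2 ^ (d+1) + (2 * p) mod 2 ^ (d+1) = 2 * v" by (fact v2)
    have "(2 * p + 1) mod 2 ^ (d+1) = 2 * p mod 2 ^ (d+1) + 1"
      using mod_mult2_eq[of "2 * p + 1" 2 "2 ^ d"] mod_mult2_eq[of "2 * p" 2 "2 ^ d"] by simp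
    then show "2 ^ (d+1) + (2 * p + 1) mod 2 ^ (d+1) = 2 * v + 1" using v2 by simp
  qed
  have t: "tw r (2 * v) = e" "tw r (2 * v + 1) = e + r" using tw_double[OF v(3)] by (simp_all add: e_def)
  have r0: "0 < r" by (simp add: r)
  have "(X ^ h')\<^sup>2 = (y ^ e)\<^sup>2" using X tv unfolding v_def[symmetric] e_def[symmetric]
    by (metis mult.commute power_mult)
  then consider (p) "X ^ h' = y ^ e" | (m) "X ^ h' = - (y ^ e)" using power2_eq_iff by blast
  then show "blk2 (bwd r H (2 ^ (d+1)) (tw r) c) (p * (2 * h' * r)) (2 * h') r X y =
      2 ^ (sc + 1) * blk2 a (p * (2 * h' * r)) (2 * h') r X y * blk2 b (p * (2 * h' * r)) (2 * h') r X y"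
  proof cases
    case p
    have F: "blk2 (fwd r H (2 ^ (d+1)) (tw r) g) ((2 * p) * H) h' r X y = blk2 g (2 * p * H) (2 * h') r X y" for g
      using blk2_fwd[OF H r0, of 0 y X "tw r" "2 ^ (d+1)" p g] y p ix t tw_le by simp
    have "blk2 c ((2 * p) * (h' * r)) h' r X y = 2 ^ sc * blk2 (fwd r H (2 ^ (d+1)) (tw r) a) ((2 * p) * (h' * r)) h' r X y *
      blk2 (fwd r H (2 ^ (d+1)) (tw r) b) ((2 * p) * (h' * r)) h' r X y"
      using p2 y p ix t \<open>p < P\<close> unfolding prel2_def by (metis mult_less_cancel1 zero_less_numeral)
    moreover have "blk2 (bwd r H (2 ^ (d+1)) (tw r) c) (2 * p * H) (2 * h') r X y = 2 * blk2 c (2 * p * H) h' r X y"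
      using blk2_bwd[OF H r0 y, of X 1 "tw r" "2 ^ (d+1)" p c] p ix t tw_le by simp
    ultimately show ?thesis using F[of a] F[of b] by (simp add: H mult_ac)
  next
    case m
    have ym: "- (y ^ e) = y ^ (e + r)" using y by (simp add: power_add)
    have F: "blk2 (fwd r H (2 ^ (d+1)) (tw r) g) ((2 * p + 1) * H) h' r X y = blk2 g (2 * p * H) (2 * h') r X y" for g
      using blk2_fwd[OF H r0, of 1 y X "tw r" "2 ^ (d+1)" p g] y m ym ix t tw_le[of r "2 * v + 1"] by simp
    have "blk2 c ((2 * p + 1) * (h' * r)) h' r X y = 2 ^ sc * blk2 (fwd r H (2 ^ (d+1)) (tw r) a) ((2 * p + 1) * (h' * r)) h' r X y *
      blk2 (fwd r H (2 ^ (d+1)) (tw r) b) ((2 * p + 1) * (h' * r)) h' r X y"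
    proof -
      have "2 * p + 1 < 2 * P" using \<open>p < P\<close> by simp
      moreover have "X ^ h' = y ^ tw r (2 ^ (d+1) + (2 * p + 1) mod 2 ^ (d+1))" unfolding ix t using m ym by simp
      ultimately show ?thesis using p2 y unfolding prel2_def by blast
    qed
    moreover have "blk2 (bwd r H (2 ^ (d+1)) (tw r) c) (2 * p * H) (2 * h') r X y = 2 * blk2 c ((2 * p + 1) * H) h' r X y"
      using blk2_bwd[OF H r0 y, of X "-1" "tw r" "2 ^ (d+1)" p c] m ix t tw_le by simp
    ultimately show ?thesis using F[of a] F[of b] by (simp add: H mult_ac)
  qed
qed

section \<open>Interpolation and the substitution y = x^m\<close>

lemma poly_eq_on_roots_of_unity:
  fixes p q :: "complex poly"
  assumes "0 < N" "degree p < N" "degree q < N" "\<And>X. X ^ N = 1 \<Longrightarrow> poly p X = poly q X"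
  shows "p = q"
proof (rule ccontr)
  assume "p \<noteq> q"
  then have nz: "p - q \<noteq> 0" by simp
  have "N = card {X::complex. X ^ N = 1}" using card_nth_roots[of 1 N] assms(1) by simp
  also have "\<dots> \<le> card {X. poly (p - q) X = 0}"
    using assms(4) poly_roots_finite[OF nz] by (intro card_mono) auto
  also have "\<dots> \<le> degree (p - q)" by (rule card_poly_roots_bound[OF nz])
  also have "\<dots> < N" using assms(2,3) by (rule degree_diff_less)
  finally show False by simp
qed

definition cpoly :: "nat \<Rightarrow> (nat \<Rightarrow> complex) \<Rightarrow> complex poly" where
  "cpoly n f = (\<Sum>j<n. monom (f j) j)"

lemma poly_cpoly: "poly (cpoly n f) X = (\<Sum>j<n. f j * X ^ j)"
  by (simp add: cpoly_def poly_sum poly_monom)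

lemma degree_cpoly: "0 < n \<Longrightarrow> degree (cpoly n f) < n"
proof (induction n)
  case (Suc n)
  have "degree (cpoly n f) < Suc n"
    by (cases "n = 0") (use Suc in \<open>auto simp: cpoly_def\<close>)
  moreover have "degree (monom (f n) n) < Suc n" by (meson degree_monom_le le_imp_less_Suc)
  ultimately have "degree (cpoly n f + monom (f n) n) < Suc n" by (rule degree_add_less)
  then show ?case by (simp add: cpoly_def)
qed simp

lemma coeff_cpoly: "coeff (cpoly n f) i = (if i < n then f i else 0)"
  unfolding cpoly_def coeff_sum coeff_monom by (simp add: sum.delta)

text \<open>
  The substitution \<open>y = x^m\<close> turns a block of \<open>m * r\<close> coefficients into a polynomial in \<open>x\<close> of
  degree below \<open>m\<close> over \<open>\<int>[y] / (y^r + 1)\<close>; products of two of these have degree below \<open>2 * m\<close>.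
\<close>

definition pad :: "nat \<Rightarrow> nat \<Rightarrow> (nat \<Rightarrow> int) \<Rightarrow> nat \<Rightarrow> int" where
  "pad m r f i = (if i mod (2*(m*r)) < m * r then f (i div (2*(m*r)) * (m*r) + i mod r * m + i mod (m*r) div r) else 0)"

definition dup :: "nat \<Rightarrow> nat \<Rightarrow> (nat \<Rightarrow> int) \<Rightarrow> nat \<Rightarrow> int" where
  "dup m r f i = f (i div (2*(m*r)) * (m*r) + i mod r * m + i mod (m*r) div r)"

definition comb :: "nat \<Rightarrow> nat \<Rightarrow> (nat \<Rightarrow> int) \<Rightarrow> nat \<Rightarrow> int" where
  "comb m r c i = c (i div (m*r) * (2*(m*r)) + i mod m * r + i mod (m*r) div m) +
     sgx c (i div (m*r) * (2*(m*r)) + (m + i mod m) * r) r (i mod (m*r) div m + 2 * r - 1)"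

text \<open>The first splitting has the factors X^m - 1 and X^m + 1. The padded upper half is zero,
  so both remainders equal the lower half: \<open>dup\<close> performs the padding and this first
  step by copying.\<close>

lemma fwd_pad:
  assumes "0 < m" "0 < r"
  shows "fwd r (m*r) 2 (tw r) (pad m r f) = dup m r f"
proof
  fix i
  let ?n = "m * r" let ?b = "i div (2 * ?n)"
  have n0: "0 < ?n" using assms by simp
  have lt: "i mod ?n < ?n" using n0 by simp
  have 1: "pad m r f (?b * (2 * ?n) + i mod ?n) = dup m r f i"
  proof -
    have d: "(?b * (2 * ?n) + i mod ?n) div (2 * ?n) = ?b" "(?b * (2 * ?n) + i mod ?n) mod (2 * ?n) = i mod ?n"
      by (rule block_div_mod, use lt in simp)+
    have "(?b * (2 * ?n) + i mod ?n) mod r = i mod r"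
      by (metis dvd_triv_right mod_add_cong mod_mod_cancel mod_mult_self3 mult.assoc add_0 mod_mult_self2_is_0)
    moreover have "(?b * (2 * ?n) + i mod ?n) mod ?n = i mod ?n"
      by (metis mod_mod_trivial mod_mult_self3 mult.assoc)
    ultimately show ?thesis unfolding pad_def dup_def d using lt by simp
  qed
  have 2: "sgx (pad m r f) (?b * (2 * ?n) + ?n + i mod ?n div r * r) r k = 0" for k
  proof -
    have z: "pad m r f (?b * (2 * ?n) + ?n + i mod ?n div r * r + l) = 0" if "l < r" for l
    proof -
      have "i mod ?n div r < m" using lt by (simp add: less_mult_imp_div_less)
      then have "(i mod ?n div r + 1) * r \<le> ?n" by (metis Suc_eq_plus1 Suc_leI mult_le_mono1)
      then have *: "i mod ?n div r * r + l < ?n" using that by simp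
      have "(?b * (2 * ?n) + ?n + i mod ?n div r * r + l) mod (2 * ?n) = (?b * (2 * ?n) + (?n + (i mod ?n div r * r + l))) mod (2 * ?n)"
        by (simp add: add_ac)
      also have "\<dots> = ?n + (i mod ?n div r * r + l)" using * by (subst mod_mult_self3) (auto intro: mod_less)
      finally show ?thesis by (simp add: pad_def)
    qed
    have "k mod (2*r) < 2 * r" using assms by simp
    then have "k mod (2*r) - r < r" using assms by linarith
    then show ?thesis unfolding sgx_def using z[of "k mod (2*r)"] z[of "k mod (2*r) - r"] by presburger
  qed
  show "fwd r ?n 2 (tw r) (pad m r f) i = dup m r f i" unfolding fwd_def 1 2 by simp
qed

text \<open>Coefficient number \<open>l * m + j\<close> belongs to x^j y^l with y = x^m; this is the
  transposition that \<open>pad\<close>, \<open>dup\<close> and \<open>comb\<close> carry out on the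
  indices.\<close>

lemma blk_transpose:
  "blk f st (m * r) x = (\<Sum>j<m. (\<Sum>l<r. of_int (f (st + l * m + j)) * (x ^ m) ^ l) * x ^ j)"
proof -
  have "blk f st (m * r) x = (\<Sum>l<r. \<Sum>j<m. of_int (f (st + (l * m + j))) * x ^ (l * m + j))"
    unfolding blk_def by (subst mult.commute) (rule sum_lessThan_mult)
  also have "\<dots> = (\<Sum>j<m. \<Sum>l<r. of_int (f (st + (l * m + j))) * x ^ (l * m + j))" by (rule sum.swap)
  also have "\<dots> = (\<Sum>j<m. (\<Sum>l<r. of_int (f (st + l * m + j)) * (x ^ m) ^ l) * x ^ j)"
  proof -
    have "x ^ (l * m + j) = (x ^ m) ^ l * x ^ j" for l j by (simp add: power_add power_mult[symmetric] mult.commute)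
    then show ?thesis by (simp add: sum_distrib_right add.assoc mult.assoc)
  qed
  finally show ?thesis .
qed

lemma blk2_pad:
  assumes "0 < m" "0 < r"
  shows "blk2 (pad m r f) (b * (2 * m * r)) (2 * m) r X y =
    (\<Sum>j<m. (\<Sum>l<r. of_int (f (b * (m * r) + l * m + j)) * y ^ l) * X ^ j)"
proof -
  have ix: "pad m r f (b * (2 * m * r) + j * r + l) = (if j < m then f (b * (m * r) + l * m + j) else 0)"
    if "j < 2 * m" "l < r" for j l
  proof -
    have jr: "j * r + l < r * j'" if "j < j'" for j'
    proof -
      have "j * r + l < Suc j * r" using \<open>l < r\<close> by simp
      also have "\<dots> \<le> j' * r" using that by (metis Suc_leI mult_le_mono1)
      finally show ?thesis by (simp add: mult.commute)
    qed
    have e: "b * (2 * m * r) + j * r + l = b * (2 * (m * r)) + (j * r + l)" by (simp add: algebra_simps)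
    have 1: "(b * (2 * (m * r)) + (j * r + l)) div (2 * (m * r)) = b" "(b * (2 * (m * r)) + (j * r + l)) mod (2 * (m * r)) = j * r + l"
      by (rule block_div_mod, use jr[OF that(1)] in \<open>simp add: mult_ac\<close>)+
    have 2: "(b * (2 * (m * r)) + (j * r + l)) mod r = l"
    proof -
      have "b * (2 * (m * r)) + (j * r + l) = (b * (2 * m) + j) * r + l" by (simp add: algebra_simps)
      then show ?thesis using that(2) by (simp only: block_div_mod)
    qed
    show ?thesis
    proof (cases "j < m")
      case True
      then have lt: "j * r + l < m * r" using jr by (simp add: mult.commute)
      have "(b * (2 * (m * r)) + (j * r + l)) mod (m * r) = j * r + l"
        using lt by (metis mod_less mod_mult_self3 mult.assoc)
      then show ?thesis unfolding e pad_def 1 2 using lt True that(2) by simp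
    next
      case False
      then have "m * r \<le> j * r + l" by (simp add: trans_le_add1)
      then show ?thesis unfolding e pad_def 1 2 using False by simp
    qed
  qed
  have "blk2 (pad m r f) (b * (2 * m * r)) (2 * m) r X y =
     (\<Sum>j<m. blk (pad m r f) (b * (2 * m * r) + j * r) r y * X ^ j) +
     (\<Sum>j<m. blk (pad m r f) (b * (2 * m * r) + (m + j) * r) r y * X ^ (m + j))"
    unfolding blk2_def mult_2 sum_lessThan_add ..
  also have "(\<Sum>j<m. blk (pad m r f) (b * (2 * m * r) + (m + j) * r) r y * X ^ (m + j)) = 0"
    unfolding blk_def by (intro sum.neutral ballI) (simp add: ix)
  also have "(\<Sum>j<m. blk (pad m r f) (b * (2 * m * r) + j * r) r y * X ^ j) =
     (\<Sum>j<m. (\<Sum>l<r. of_int (f (b * (m * r) + l * m + j)) * y ^ l) * X ^ j)"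
    unfolding blk_def by (intro sum.cong) (auto simp: ix)
  finally show ?thesis by simp
qed

text \<open>Putting X = x and y = x^m turns X^m into y. So row \<open>m + j\<close> is added to row
  \<open>j\<close> after a rotation by one, which is the \<open>- 1\<close> in the index of
  \<open>comb\<close>.\<close>

lemma blk_comb:
  assumes "0 < m" "0 < r" "x ^ (m * r) = -1"
  shows "blk (comb m r c) (b * (m * r)) (m * r) x = blk2 c (b * (2 * m * r)) (2 * m) r x (x ^ m)"
proof -
  let ?st = "b * (2 * (m * r))"
  have ix: "comb m r c (b * (m * r) + l * m + j) = c (?st + j * r + l) + sgx c (?st + (m + j) * r) r (l + 2 * r - 1)"
    if "j < m" "l < r" for j l
  proof -
    have "l * m + j < Suc l * m" using that by simp
    also have "\<dots> \<le> r * m" using that by (metis Suc_leI mult_le_mono1)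
    finally have lt: "l * m + j < m * r" by (simp add: mult.commute)
    have e: "b * (m * r) + l * m + j = b * (m * r) + (l * m + j)" by simp
    have 1: "(b * (m * r) + (l * m + j)) div (m * r) = b" "(b * (m * r) + (l * m + j)) mod (m * r) = l * m + j"
      by (rule block_div_mod[OF lt])+
    have "b * (m * r) + (l * m + j) = (b * r + l) * m + j" by (simp add: algebra_simps)
    then have 2: "(b * (m * r) + (l * m + j)) mod m = j" using that(1) by (simp only: block_div_mod)
    show ?thesis unfolding comb_def e 1 2 using that by simp
  qed
  have y: "(x ^ m) ^ r = -1" using assms(3) by (simp add: power_mult)
  have row: "(\<Sum>l<r. of_int (comb m r c (b * (m * r) + l * m + j)) * (x ^ m) ^ l) =
     blk c (?st + j * r) r (x ^ m) + x ^ m * blk c (?st + (m + j) * r) r (x ^ m)" if "j < m" for j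
  proof -
    have "(\<Sum>l<r. of_int (comb m r c (b * (m * r) + l * m + j)) * (x ^ m) ^ l) =
       (\<Sum>l<r. of_int (c (?st + j * r + l)) * (x ^ m) ^ l) +
       (\<Sum>l<r. of_int (sgx c (?st + (m + j) * r) r (l + 2 * r - 1)) * (x ^ m) ^ l)"
      unfolding sum.distrib[symmetric] using ix[OF that] by (intro sum.cong) (auto simp: distrib_right)
    then show ?thesis using sgx_rotate[OF assms(2) y, of 1] assms(2) by (simp add: blk_def)
  qed
  have "blk (comb m r c) (b * (m * r)) (m * r) x =
     (\<Sum>j<m. (blk c (?st + j * r) r (x ^ m) + x ^ m * blk c (?st + (m + j) * r) r (x ^ m)) * x ^ j)"
    unfolding blk_transpose using row by (intro sum.cong) auto
  also have "\<dots> = blk2 c (b * (2 * m * r)) (2 * m) r x (x ^ m)"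
  proof -
    have st: "b * (2 * m * r) = ?st" by (simp add: mult.assoc)
    show ?thesis unfolding st unfolding blk2_def mult_2[of m] sum_lessThan_add
      by (simp add: sum.distrib distrib_left distrib_right power_add mult_ac)
  qed
  finally show ?thesis .
qed

text \<open>Up to the scaling, \<open>c\<close> is blockwise the negacyclic product of
  \<open>a\<close> and \<open>b\<close>, that is, their product modulo x^n + 1; the \<open>n\<close>
  roots of this polynomial are all distinct, so values at them suffice.\<close>

definition prel :: "nat \<Rightarrow> nat \<Rightarrow> nat \<Rightarrow> (nat \<Rightarrow> int) \<Rightarrow> (nat \<Rightarrow> int) \<Rightarrow> (nat \<Rightarrow> int) \<Rightarrow> bool" where
  "prel P n sc c a b \<longleftrightarrow> (\<forall>p<P. \<forall>x. x ^ n = -1 \<longrightarrow>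
     blk c (p * n) n x = 2 ^ sc * blk a (p * n) n x * blk b (p * n) n x)"

text \<open>The hypothesis only speaks about points with X^(2m) = 1, while the conclusion needs the
  point X = x. For fixed \<open>y\<close>, however, both sides are polynomials in X of degree below
  \<open>2 * m\<close>, the factors having degree below \<open>m\<close>; agreement at the
  \<open>2 * m\<close> roots of unity makes them equal everywhere.\<close>

lemma prel_comb:
  assumes m: "0 < m" and r: "0 < r"
    and p2: "prel2 P (2 * m) r 0 sc c (pad m r a) (pad m r b)"
  shows "prel P (m * r) sc (comb m r c) a b"
  unfolding prel_def
proof (intro allI impI)
  fix p x assume p: "p < P" and x: "(x::complex) ^ (m * r) = -1"
  define y where "y = x ^ m"
  have y: "y ^ r = -1" using x by (simp add: y_def power_mult)
  define A where "A = cpoly m (\<lambda>j. \<Sum>l<r. of_int (a (p * (m * r) + l * m + j)) * y ^ l)"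
  define B where "B = cpoly m (\<lambda>j. \<Sum>l<r. of_int (b (p * (m * r) + l * m + j)) * y ^ l)"
  define C where "C = cpoly (2 * m) (\<lambda>j. blk c (p * (2 * m * r) + j * r) r y)"
  have AB: "poly A X = blk2 (pad m r a) (p * (2 * m * r)) (2 * m) r X y"
    "poly B X = blk2 (pad m r b) (p * (2 * m * r)) (2 * m) r X y"
    "poly C X = blk2 c (p * (2 * m * r)) (2 * m) r X y" for X
    by (simp_all add: A_def B_def poly_cpoly blk2_pad[OF m r]) (simp add: C_def poly_cpoly blk2_def)
  have "C = smult (2 ^ sc) (A * B)"
  proof (rule poly_eq_on_roots_of_unity[of "2 * m"])
    show "0 < 2 * m" using m by simp
    show "degree C < 2 * m" unfolding C_def using m by (intro degree_cpoly) simp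
    have "degree A < m" "degree B < m" unfolding A_def B_def using m by (simp_all add: degree_cpoly)
    then show "degree (smult (2 ^ sc) (A * B)) < 2 * m"
      using degree_mult_le[of A B] degree_smult_le[of "2 ^ sc" "A * B"] by linarith
    fix X :: complex assume "X ^ (2 * m) = 1"
    moreover have "tw r (2 ^ 0 + p mod 2 ^ 0) = 0" by (subst tw.simps) simp
    ultimately have "blk2 c (p * (2 * m * r)) (2 * m) r X y = 2 ^ sc * blk2 (pad m r a) (p * (2 * m * r)) (2 * m) r X y *
       blk2 (pad m r b) (p * (2 * m * r)) (2 * m) r X y"
      using p2 p y unfolding prel2_def by simp
    then show "poly C X = poly (smult (2 ^ sc) (A * B)) X" by (simp add: AB)
  qed
  then have "poly C x = 2 ^ sc * poly A x * poly B x" by simp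
  moreover have "poly A x = blk a (p * (m * r)) (m * r) x" "poly B x = blk b (p * (m * r)) (m * r) x"
    unfolding A_def B_def poly_cpoly blk_transpose y_def by simp_all
  moreover have "poly C x = blk (comb m r c) (p * (m * r)) (m * r) x"
    unfolding AB blk_comb[OF m r x] y_def ..
  ultimately show "blk (comb m r c) (p * (m * r)) (m * r) x =
      2 ^ sc * blk a (p * (m * r)) (m * r) x * blk b (p * (m * r)) (m * r) x" by simp
qed

text \<open>
  The intermediate arrays inside one level, for \<open>m = 2 ^ t\<close> and \<open>r = 2 ^ u\<close>.
\<close>

fun fstg :: "nat \<Rightarrow> nat \<Rightarrow> (nat \<Rightarrow> int) \<Rightarrow> nat \<Rightarrow> nat \<Rightarrow> int" where
  "fstg t u f 0 = dup (2 ^ t) (2 ^ u) f"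
| "fstg t u f (Suc q) = fwd (2 ^ u) (2 ^ (t - Suc q) * 2 ^ u) (2 ^ (q + 2)) (tw (2 ^ u)) (fstg t u f q)"

fun bstg :: "nat \<Rightarrow> nat \<Rightarrow> (nat \<Rightarrow> int) \<Rightarrow> nat \<Rightarrow> nat \<Rightarrow> int" where
  "bstg t u c 0 = c"
| "bstg t u c (Suc q) = bwd (2 ^ u) (2 ^ q * 2 ^ u) (2 ^ (t + 1 - q)) (tw (2 ^ u)) (bstg t u c q)"

text \<open>The product \<open>c\<close> of the fully split arrays is what the recursion supplies.
  The \<open>t\<close> backward stages and the one that undoes the splitting hidden in
  \<open>dup\<close> contribute one factor \<open>2\<close> each; \<open>t \<le> u\<close> provides
  the square roots of powers of \<open>y\<close>.\<close>

lemma prel_stages: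
  assumes "t \<le> u" and c: "prel (P * (2 * 2 ^ t)) (2 ^ u) sc c (fstg t u a t) (fstg t u b t)"
  shows "prel P (2 ^ t * 2 ^ u) (sc + t + 1) (comb (2 ^ t) (2 ^ u) (bstg t u c (Suc t))) a b"
proof -
  let ?r = "2 ^ u :: nat"
  have "prel2 (P * 2 ^ (t + 1 - q)) (2 ^ q) ?r (t + 1 - q) (sc + q) (bstg t u c q) (fstg t u a (t - q)) (fstg t u b (t - q))"
    if "q \<le> t" for q
    using that
  proof (induction q)
    \<comment> \<open>At height one \<open>blk2\<close> is a single row and no longer involves
      \<open>X\<close>, so the relation is the one for negacyclic products of length
      \<open>2 ^ u\<close>.\<close>
    case 0
    show ?case unfolding prel2_def
    proof (intro allI impI)
      fix p and X y :: complex
      assume "p < P * 2 ^ (t + 1 - 0)" "y ^ ?r = -1"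
      with c show "blk2 (bstg t u c 0) (p * (2 ^ 0 * ?r)) (2 ^ 0) ?r X y = 2 ^ (sc + 0) *
        blk2 (fstg t u a (t - 0)) (p * (2 ^ 0 * ?r)) (2 ^ 0) ?r X y * blk2 (fstg t u b (t - 0)) (p * (2 ^ 0 * ?r)) (2 ^ 0) ?r X y"
        by (simp add: prel_def blk2_def)
    qed
  next
    case (Suc q)
    then have q: "q < t" by simp
    have f: "fstg t u g (t - q) = fwd ?r (2 ^ q * ?r) (2 ^ (t - q + 1)) (tw ?r) (fstg t u g (t - Suc q))" for g
    proof -
      have e: "t - q = Suc (t - Suc q)" "t - Suc (t - Suc q) = q" "t - q + 1 = t - Suc q + 2" using q by auto
      show ?thesis unfolding e(1) fstg.simps e(2) using e(3) by (simp add: e(1)[symmetric])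
    qed
    have "prel2 (P * 2 ^ (t - q)) (2 * 2 ^ q) ?r (t - q) (sc + q + 1)
       (bwd ?r (2 ^ q * ?r) (2 ^ (t - q + 1)) (tw ?r) (bstg t u c q)) (fstg t u a (t - Suc q)) (fstg t u b (t - Suc q))"
    proof (rule prel2_step[OF refl _ refl])
      show "t - q \<le> u" using assms by simp
      have "P * 2 ^ (t + 1 - q) = 2 * (P * 2 ^ (t - q))" using q by (simp add: Suc_diff_le)
      then show "prel2 (2 * (P * 2 ^ (t - q))) (2 ^ q) ?r (t - q + 1) (sc + q) (bstg t u c q)
         (fwd ?r (2 ^ q * ?r) (2 ^ (t - q + 1)) (tw ?r) (fstg t u a (t - Suc q)))
         (fwd ?r (2 ^ q * ?r) (2 ^ (t - q + 1)) (tw ?r) (fstg t u b (t - Suc q)))"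
        using Suc q unfolding f by (simp add: Suc_diff_le mult.left_commute)
    qed
    then show ?case using q by (simp add: Suc_diff_le)
  qed
  from this[of t] have 1: "prel2 (P * 2) (2 ^ t) ?r 1 (sc + t) (bstg t u c t) (dup (2 ^ t) ?r a) (dup (2 ^ t) ?r b)"
    by simp
  have d: "dup (2 ^ t) ?r g = fwd ?r (2 ^ t * ?r) (2 ^ (0 + 1)) (tw ?r) (pad (2 ^ t) ?r g)" for g
    using fwd_pad[of "2 ^ t" ?r g] by simp
  have "prel2 P (2 * 2 ^ t) ?r 0 (sc + t + 1) (bwd ?r (2 ^ t * ?r) (2 ^ (0 + 1)) (tw ?r) (bstg t u c t)) (pad (2 ^ t) ?r a) (pad (2 ^ t) ?r b)"
    using 1 unfolding d by (intro prel2_step[OF refl _ refl]) (simp_all add: mult.commute)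
  then show ?thesis by (intro prel_comb) simp_all
qed

section \<open>The recursion of Nussbaumer's convolution\<close>

text \<open>The levels of the recursion; a block of \<open>2 ^ k\<close> coefficients is split into blocks of \<open>2 ^ ((k + 1) div 2)\<close>.\<close>

fun lvk :: "nat \<Rightarrow> nat \<Rightarrow> nat" where
  "lvk k 0 = k"
| "lvk k (Suc i) = (lvk k i + 1) div 2"

definition flev :: "nat \<Rightarrow> (nat \<Rightarrow> int) \<Rightarrow> nat \<Rightarrow> int" where
  "flev k f = fstg (k div 2) ((k + 1) div 2) f (k div 2)"

definition blev :: "nat \<Rightarrow> (nat \<Rightarrow> int) \<Rightarrow> nat \<Rightarrow> int" where
  "blev k c = comb (2 ^ (k div 2)) (2 ^ ((k + 1) div 2)) (bstg (k div 2) ((k + 1) div 2) c (Suc (k div 2)))"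

fun fall :: "nat \<Rightarrow> (nat \<Rightarrow> int) \<Rightarrow> nat \<Rightarrow> nat \<Rightarrow> int" where
  "fall k f 0 = f"
| "fall k f (Suc i) = flev (lvk k i) (fall k f i)"

text \<open>Multiplication modulo x^2 + 1, that is, of Gaussian integers stored as pairs.\<close>

definition base2 :: "(nat \<Rightarrow> int) \<Rightarrow> (nat \<Rightarrow> int) \<Rightarrow> nat \<Rightarrow> int" where
  "base2 a b i = (if i mod 2 = 0 then a i * b i - a (i + 1) * b (i + 1) else a (i - 1) * b i + a i * b (i - 1))"

fun ball :: "nat \<Rightarrow> nat \<Rightarrow> (nat \<Rightarrow> int) \<Rightarrow> nat \<Rightarrow> nat \<Rightarrow> int" where
  "ball k D c 0 = c"
| "ball k D c (Suc j) = blev (lvk k (D - Suc j)) (ball k D c j)"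

fun lvs :: "nat \<Rightarrow> nat \<Rightarrow> nat \<Rightarrow> nat" where
  "lvs k D 0 = 0"
| "lvs k D (Suc j) = lvs k D j + lvk k (D - Suc j) div 2 + 1"

lemma prel_level:
  assumes "prel (P * (2 * 2 ^ (k div 2))) (2 ^ ((k + 1) div 2)) sc c (flev k a) (flev k b)"
  shows "prel P (2 ^ k) (sc + k div 2 + 1) (blev k c) a b"
proof -
  have "(2::nat) ^ k = 2 ^ (k div 2) * 2 ^ ((k + 1) div 2)" by (simp add: power_add[symmetric])
  then show ?thesis
    using assms prel_stages[of "k div 2" "(k + 1) div 2" P sc c a b] by (simp add: flev_def blev_def)
qed

lemma mult_of_square_minus_one:
  fixes a b c d x :: complex
  assumes "x * x = -1"
  shows "a * b - c * d + (a * d + c * b) * x = (a + c * x) * (b + d * x)"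
proof -
  have "(a + c * x) * (b + d * x) = a * b + (a * d + c * b) * x + c * d * (x * x)" by (simp add: algebra_simps)
  then show ?thesis using assms by simp
qed

lemma prel_base2: "prel P 2 0 (base2 a b) a b"
  unfolding prel_def
proof (intro allI impI)
  fix p x assume "(x::complex) ^ 2 = -1"
  then have x: "x * x = -1" by (simp add: power2_eq_square)
  have b: "blk g (p * 2) 2 x = of_int (g (p * 2)) + of_int (g (p * 2 + 1)) * x" for g
    by (simp add: blk_def numeral_2_eq_2)
  have "base2 a b (p * 2) = a (p * 2) * b (p * 2) - a (p * 2 + 1) * b (p * 2 + 1)"
    "base2 a b (p * 2 + 1) = a (p * 2) * b (p * 2 + 1) + a (p * 2 + 1) * b (p * 2)"
    by (simp_all add: base2_def) presburger
  then show "blk (base2 a b) (p * 2) 2 x = 2 ^ 0 * blk a (p * 2) 2 x * blk b (p * 2) 2 x"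
    unfolding b by (simp add: mult_of_square_minus_one[OF x])
qed

fun lvP :: "nat \<Rightarrow> nat \<Rightarrow> nat \<Rightarrow> nat" where
  "lvP k P 0 = P"
| "lvP k P (Suc i) = lvP k P i * (2 * 2 ^ (lvk k i div 2))"

lemma prel_all:
  assumes "lvk k D = 1"
  shows "prel P (2 ^ k) (lvs k D D) (ball k D (base2 (fall k a D) (fall k b D)) D) a b"
proof -
  have "prel (lvP k P (D - j)) (2 ^ lvk k (D - j)) (lvs k D j)
     (ball k D (base2 (fall k a D) (fall k b D)) j) (fall k a (D - j)) (fall k b (D - j))" if "j \<le> D" for j
    using that
  proof (induction j)
    case 0
    then show ?case using prel_base2 assms by simp
  next
    case (Suc j)
    then have e: "D - j = Suc (D - Suc j)" by simp
    have "prel (lvP k P (D - Suc j)) (2 ^ lvk k (D - Suc j)) (lvs k D j + lvk k (D - Suc j) div 2 + 1)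
      (blev (lvk k (D - Suc j)) (ball k D (base2 (fall k a D) (fall k b D)) j)) (fall k a (D - Suc j)) (fall k b (D - Suc j))"
      by (rule prel_level) (use Suc e in simp)
    then show ?case by simp
  qed
  from this[of D] show ?thesis by simp
qed

text \<open>When the upper halves of the factors vanish, their product has degree below
  \<open>n\<close>, so nothing wraps around, and the \<open>n\<close> roots of x^n = -1 determine
  it: the scaled ordinary convolution results.\<close>

lemma prel_coeffs:
  assumes "prel P n sc c a b" "p < P" "n = 2 * h" "0 < h"
    and a: "\<And>i. h \<le> i \<Longrightarrow> i < n \<Longrightarrow> a (p * n + i) = 0" and b: "\<And>i. h \<le> i \<Longrightarrow> i < n \<Longrightarrow> b (p * n + i) = 0"
    and i: "i < n"
  shows "c (p * n + i) = 2 ^ sc * (\<Sum>j\<le>i. a (p * n + j) * b (p * n + (i - j)))"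
proof -
  define ff where "ff g = cpoly n (\<lambda>l. of_int (g (p * n + l)))" for g :: "nat \<Rightarrow> int"
  define ff' where "ff' g = cpoly h (\<lambda>l. of_int (g (p * n + l)))" for g :: "nat \<Rightarrow> int"
  have n0: "0 < n" using assms by simp
  have ff: "poly (ff g) x = blk g (p * n) n x" for g x by (simp add: ff_def poly_cpoly blk_def)
  have eq: "ff g = ff' g" if "\<And>i. h \<le> i \<Longrightarrow> i < n \<Longrightarrow> g (p * n + i) = 0" for g
    by (rule poly_eqI) (use that assms(3) in \<open>auto simp: ff_def ff'_def coeff_cpoly\<close>)
  have ea: "ff a = ff' a" by (rule eq) (rule a)
  have eb: "ff b = ff' b" by (rule eq) (rule b)
  have deg: "degree (ff' g) < h" for g unfolding ff'_def by (rule degree_cpoly[OF assms(4)])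
  have "ff c = smult (2 ^ sc) (ff a * ff b)"
  proof (rule ccontr)
    let ?d = "ff c - smult (2 ^ sc) (ff a * ff b)"
    assume "ff c \<noteq> smult (2 ^ sc) (ff a * ff b)"
    then have nz: "?d \<noteq> 0" by simp
    have "n = card {X::complex. X ^ n = -1}" using card_nth_roots[of "-1" n] n0 by simp
    also have "\<dots> \<le> card {X. poly ?d X = 0}"
      using assms(1,2) poly_roots_finite[OF nz] by (intro card_mono) (auto simp: ff prel_def)
    also have "\<dots> \<le> degree ?d" by (rule card_poly_roots_bound[OF nz])
    also have "\<dots> < n"
    proof (rule degree_diff_less)
      show "degree (ff c) < n" unfolding ff_def by (rule degree_cpoly[OF n0])
      show "degree (smult (2 ^ sc) (ff a * ff b)) < n"
        using deg[of a] deg[of b] degree_mult_le[of "ff a" "ff b"] degree_smult_le[of "2 ^ sc" "ff a * ff b"] assms(3)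
        unfolding ea eb by linarith
    qed
    finally show False by simp
  qed
  then have "coeff (ff c) i = 2 ^ sc * (\<Sum>j\<le>i. coeff (ff a) j * coeff (ff b) (i - j))"
    by (simp add: coeff_mult)
  also have "(\<Sum>j\<le>i. coeff (ff a) j * coeff (ff b) (i - j)) = (\<Sum>j\<le>i. of_int (a (p * n + j) * b (p * n + (i - j))))"
    using i by (intro sum.cong) (auto simp: ff_def coeff_cpoly)
  finally have "(of_int (c (p * n + i)) :: complex) = of_int (2 ^ sc * (\<Sum>j\<le>i. a (p * n + j) * b (p * n + (i - j))))"
    using i by (simp add: ff_def coeff_cpoly)
  then show ?thesis by (simp only: of_int_eq_iff)
qed

text \<open>Repeated halving with rounding up gives the ceiling of k / 2^i, so a depth with
  \<open>k \<le> 2 ^ D\<close> reaches blocks of length two.\<close>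

lemma lvk_ceiling: "lvk k i = (k + 2 ^ i - 1) div 2 ^ i"
proof (induction i)
  case (Suc i)
  have "lvk k (Suc i) = ((k + 2 ^ i - 1) div 2 ^ i + 1) div 2" using Suc by simp
  also have "(k + 2 ^ i - 1) div 2 ^ i + 1 = (k + 2 ^ i - 1 + 2 ^ i) div 2 ^ i" by simp
  also have "k + 2 ^ i - 1 + 2 ^ i = k + 2 ^ Suc i - (1::nat)"
    using one_le_power[of "2::nat" i] by (simp del: one_le_power)
  also have "(k + 2 ^ Suc i - 1) div 2 ^ i div 2 = (k + 2 ^ Suc i - 1) div 2 ^ Suc i"
    by (simp only: div_mult2_eq[symmetric] power_Suc2)
  finally show ?case .
qed simp

lemma lvk_bounds: "lvk k i \<le> k" "1 \<le> k \<Longrightarrow> 1 \<le> lvk k i"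
  by (induction i) auto

lemma lvk_one: "1 \<le> k \<Longrightarrow> k \<le> 2 ^ D \<Longrightarrow> lvk k D = 1"
proof -
  assume k: "1 \<le> k" "k \<le> 2 ^ D"
  have "lvk k D = (k - 1 + 2 ^ D) div 2 ^ D" unfolding lvk_ceiling using k by simp
  also have "\<dots> = (k - 1) div 2 ^ D + 1" by simp
  also have "(k - 1) div 2 ^ D = 0" using k by (simp add: div_eq_0_iff)
  finally show ?thesis by simp
qed

text \<open>The sum telescopes because \<open>x div 2 + (x + 1) div 2 = x\<close>. At full depth it
  says that the total scaling exponent is \<open>k + D - 1\<close>.\<close>

lemma lvs_eq: "j \<le> D \<Longrightarrow> lvs k D j + lvk k D = lvk k (D - j) + j"
proof (induction j)
  case (Suc j)
  then have "D - j = Suc (D - Suc j)" by simp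
  then have "lvk k (D - j) = (lvk k (D - Suc j) + 1) div 2" by simp
  then show ?case using Suc by simp
qed simp

text \<open>The total array length only doubles from level to level, because padding is the only
  expansion. With about log k levels the arrays grow by a factor O(k) altogether.\<close>

lemma lvP_eq: "lvP k P i * 2 ^ lvk k i = P * 2 ^ k * 2 ^ i"
proof (induction i)
  case (Suc i)
  have "(2::nat) ^ lvk k i = 2 ^ (lvk k i div 2) * 2 ^ lvk k (Suc i)" by (simp add: power_add[symmetric])
  then show ?case using Suc by (simp add: algebra_simps)
qed simp

section \<open>The splitting steps as expressions over words\<close>

abbreviation "vI \<equiv> Var 24"

text \<open>In these expressions variables \<open>18\<close> and \<open>19\<close> hold m and r,
  \<open>20\<close> holds the half length H, \<open>21\<close> the number G of factors per block,
  and array \<open>11\<close> the table of \<open>tw\<close>.\<close>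

definition dup_expr :: "nat \<Rightarrow> expr" where
  "dup_expr a = Arr a (vI [div] (Cst 2 [*] (Var 18 [*] Var 19)) [*] (Var 18 [*] Var 19) [+] vI [mod] Var 19 [*] Var 18 [+]
     vI [mod] (Var 18 [*] Var 19) [div] Var 19)"

definition start_expr :: expr where
  "start_expr = vI [div] (Cst 2 [*] Var 20) [*] (Cst 2 [*] Var 20)"

definition row_expr :: expr where
  "row_expr = vI [mod] Var 20 [div] Var 19 [*] Var 19"

definition frot_expr :: expr where
  "frot_expr = (vI [mod] Var 19 [+] Cst 2 [*] Var 19 [-] Arr 11 (Var 21 [+] vI [div] Var 20 [mod] Var 21)) [mod] (Cst 2 [*] Var 19)"

definition fwd_expr :: "nat \<Rightarrow> expr" where
  "fwd_expr a = Ite frot_expr (Var 19)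
     (Wrp Add (Arr a (start_expr [+] vI [mod] Var 20)) (Arr a (start_expr [+] Var 20 [+] row_expr [+] frot_expr)))
     (Wrp Sub (Arr a (start_expr [+] vI [mod] Var 20)) (Arr a (start_expr [+] Var 20 [+] row_expr [+] (frot_expr [-] Var 19))))"

definition brot_expr :: expr where
  "brot_expr = (vI [mod] Var 19 [+] Arr 11 (Var 21 [+] Cst 2 [*] (vI [div] (Cst 2 [*] Var 20)) [mod] Var 21)) [mod] (Cst 2 [*] Var 19)"

definition bwd_expr :: "nat \<Rightarrow> expr" where
  "bwd_expr a = Ite (vI [mod] (Cst 2 [*] Var 20)) (Var 20) (Wrp Add (Arr a vI) (Arr a (vI [+] Var 20)))
     (Ite brot_expr (Var 19)
       (Wrp Sub (Arr a (start_expr [+] row_expr [+] brot_expr)) (Arr a (start_expr [+] row_expr [+] brot_expr [+] Var 20)))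
       (Wrp Sub (Arr a (start_expr [+] row_expr [+] (brot_expr [-] Var 19) [+] Var 20)) (Arr a (start_expr [+] row_expr [+] (brot_expr [-] Var 19)))))"

definition comb_expr :: "nat \<Rightarrow> expr" where
  "comb_expr a = (let n = Var 18 [*] Var 19; st = vI [div] n [*] (Cst 2 [*] n); l = vI [mod] n [div] Var 18; j = vI [mod] Var 18;
     ix = (l [+] Cst 2 [*] Var 19 [-] Cst 1) [mod] (Cst 2 [*] Var 19); row = st [+] (Var 18 [+] j) [*] Var 19 in
     Ite ix (Var 19) (Wrp Add (Arr a (st [+] j [*] Var 19 [+] l)) (Arr a (row [+] ix)))
       (Wrp Sub (Arr a (st [+] j [*] Var 19 [+] l)) (Arr a (row [+] (ix [-] Var 19)))))"

definition base_expr :: expr where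
  "base_expr = Ite (vI [mod] Cst 2) (Cst 1)
     (Wrp Sub (Wrp Mul (Arr 8 vI) (Arr 9 vI)) (Wrp Mul (Arr 8 (vI [+] Cst 1)) (Arr 9 (vI [+] Cst 1))))
     (Wrp Add (Wrp Mul (Arr 8 (vI [-] Cst 1)) (Arr 9 vI)) (Wrp Mul (Arr 8 vI) (Arr 9 (vI [-] Cst 1))))"

context ram
begin

text \<open>Signed coefficients are kept modulo \<open>2 ^ w\<close>. All stages are ring operations
  and respect this, so intermediate values need no bounds; only the final coefficients have to fit
  into a word.\<close>

definition reps :: "nat \<Rightarrow> (nat \<Rightarrow> nat) \<Rightarrow> (nat \<Rightarrow> int) \<Rightarrow> bool" where
  "reps N X f \<longleftrightarrow> (\<forall>i<N. X i = nat (f i mod 2 ^ w))"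

lemma wrap:
  "binop_val w Add (nat (a mod 2 ^ w)) (nat (b mod 2 ^ w)) = nat ((a + b) mod 2 ^ w)"
  "binop_val w Sub (nat (a mod 2 ^ w)) (nat (b mod 2 ^ w)) = nat ((a - b) mod 2 ^ w)"
  "binop_val w Mul (nat (a mod 2 ^ w)) (nat (b mod 2 ^ w)) = nat ((a * b) mod 2 ^ w)"
  by (auto simp: nat_mod_as_int mod_simps nat_add_distrib[symmetric] nat_mult_distrib[symmetric])

lemma wrap_Add:
  "x = nat (a mod 2 ^ w) \<Longrightarrow> y = nat (b mod 2 ^ w) \<Longrightarrow> c = a + b \<Longrightarrow> binop_val w Add x y = nat (c mod 2 ^ w)"
  and wrap_Sub:
  "x = nat (a mod 2 ^ w) \<Longrightarrow> y = nat (b mod 2 ^ w) \<Longrightarrow> c = a - b \<Longrightarrow> binop_val w Sub x y = nat (c mod 2 ^ w)"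
  and wrap_Mul:
  "x = nat (a mod 2 ^ w) \<Longrightarrow> y = nat (b mod 2 ^ w) \<Longrightarrow> c = a * b \<Longrightarrow> binop_val w Mul x y = nat (c mod 2 ^ w)"
  by (simp_all only: wrap)

end

lemma segment_bounds:
  fixes i N H r h' :: nat
  assumes "i < N" "2 * H dvd N" "H = h' * r" "0 < H"
  shows "i div (2*H) * (2*H) + 2 * H \<le> N" "i mod H < H" "i mod H div r * r + r \<le> H"
    "i div (2*H) * (2*H) \<le> i" "i mod (2*H) < H \<Longrightarrow> i + H < N" "i mod r < r" "0 < r"
proof -
  obtain q where q: "N = 2 * H * q" using assms(2) by blast
  have "i div (2*H) < q" using assms(1,4) q by (simp add: less_mult_imp_div_less mult.commute)
  then have "(i div (2*H) + 1) * (2*H) \<le> q * (2*H)" by (intro mult_right_mono) auto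
  then show 1: "i div (2*H) * (2*H) + 2 * H \<le> N" using q by (simp add: mult_ac)
  show "i mod H < H" using assms(4) by simp
  show r: "0 < r" using assms(3,4) by (cases r) auto
  have "i mod H div r < h'" using assms(3,4) \<open>i mod H < H\<close> by (simp add: less_mult_imp_div_less)
  then have "(i mod H div r + 1) * r \<le> h' * r" by (intro mult_right_mono) auto
  then show "i mod H div r * r + r \<le> H" using assms(3) by simp
  show "i div (2*H) * (2*H) \<le> i" by simp
  show "i + H < N" if "i mod (2*H) < H"
  proof -
    have "i = i div (2*H) * (2*H) + i mod (2*H)" by (rule div_mult_mod_eq[symmetric])
    then show ?thesis using that 1 by linarith
  qed
  show "i mod r < r" using r by simp
qed

context ram
begin

lemma dup_expr:
  assumes "vr sg 18 = m" "vr sg 19 = r" "reps N (ar sg a) f" "m * r dvd N" "0 < m" "0 < r" "2 * N \<le> S" "a < 30" "i < 2 * N"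
  shows "ok (upv 24 i sg) (dup_expr a) \<and> ev (upv 24 i sg) (dup_expr a) = nat (dup m r f i mod 2 ^ w)"
proof -
  let ?j = "i div (2*(m*r)) * (m*r) + i mod r * m + i mod (m*r) div r"
  have n0: "0 < m * r" using assms by simp
  have "2 * (m * r) dvd 2 * N" using assms(4) by (metis dvd_refl mult_dvd_mono)
  then have 1: "i div (2*(m*r)) * (2*(m*r)) + 2 * (m*r) \<le> 2 * N"
    using segment_bounds(1)[OF assms(9) _ refl n0] by blast
  have "i mod (m*r) div r < m" using n0 by (simp add: less_mult_imp_div_less)
  moreover have "(i mod r + 1) * m \<le> r * m" using assms(6) by (intro mult_right_mono) (auto simp: Suc_leI)
  ultimately have "i mod r * m + i mod (m*r) div r < m * r" by (simp add: mult.commute[of r])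
  moreover have "i div (2*(m*r)) * (2*(m*r)) = 2 * (i div (2*(m*r)) * (m*r))" by simp
  ultimately have j: "?j < N" using 1 by linarith
  then have "?j < S" using assms by linarith
  then show ?thesis using j assms by (simp add: dup_expr_def reps_def dup_def)
qed

lemma fwd_expr:
  assumes "vr sg 19 = r" "vr sg 20 = H" "vr sg 21 = G" "reps N (ar sg a) f" "2 * H dvd N" "H = h' * r" "0 < H" "0 < G"
    "\<And>v. v < 2 * G \<Longrightarrow> ar sg 11 v = tw r v" "N \<le> S" "2 * G \<le> S" "2 * r \<le> S" "a < 30" "i < N"
  shows "ok (upv 24 i sg) (fwd_expr a) \<and> ev (upv 24 i sg) (fwd_expr a) = nat (fwd r H G (tw r) f i mod 2 ^ w)"
proof -
  note b = segment_bounds[OF assms(14) assms(5-7)]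
  define e where "e = tw r (G + i div H mod G)"
  have g: "G + i div H mod G < 2 * G" using assms(8) by simp
  have gS: "G + i div H mod G < S" using g assms(11) by linarith
  have e: "e \<le> 2 * r" unfolding e_def by (rule tw_le)
  have st: "ev (upv 24 i sg) start_expr = i div (2*H) * (2*H)" "ok (upv 24 i sg) start_expr"
    "small (upv 24 i sg) start_expr" "mag start_expr = 3"
    using assms by (simp_all add: start_expr_def)
  have row: "ev (upv 24 i sg) row_expr = i mod H div r * r" "ok (upv 24 i sg) row_expr"
    "small (upv 24 i sg) row_expr" "mag row_expr = 2"
    using assms by (simp_all add: row_expr_def)
  define l' where "l' = (i mod r + 2 * r - e) mod (2 * r)"
  have rot: "ev (upv 24 i sg) frot_expr = l'" "ok (upv 24 i sg) frot_expr"
    "small (upv 24 i sg) frot_expr" "mag frot_expr = 3"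
    using assms(1-3) assms(9)[OF g] assms(12) gS e by (simp_all add: frot_expr_def l'_def e_def)
  have l': "l' < 2 * r" using b(7) by (simp add: l'_def)
  have lo: "i div (2*H) * (2*H) + i mod H < N" using b by linarith
  have hi: "i div (2*H) * (2*H) + H + i mod H div r * r + l < N" if "l < r" for l
    using b(1,3) that by linarith
  show ?thesis
  proof (cases "l' < r")
    case True
    have "ok (upv 24 i sg) (fwd_expr a)"
      unfolding fwd_expr_def using st row rot True lo hi[OF True] assms(2,10,13) by (simp add: assms(1))
    moreover have "ev (upv 24 i sg) (fwd_expr a) = nat (fwd r H G (tw r) f i mod 2 ^ w)"
      unfolding fwd_expr_def using st row rot True assms(1,2,4) lo hi[OF True]
      by (simp del: binop_val.simps) (rule wrap_Add, auto simp: reps_def fwd_def sgx_def l'_def e_def)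
    ultimately show ?thesis ..
  next
    case False
    then have lr: "l' - r < r" using l' by linarith
    have "ok (upv 24 i sg) (fwd_expr a)"
      unfolding fwd_expr_def using st row rot False lo hi[OF lr] assms(2,10,13) by (simp add: assms(1))
    moreover have "ev (upv 24 i sg) (fwd_expr a) = nat (fwd r H G (tw r) f i mod 2 ^ w)"
      unfolding fwd_expr_def using st row rot False assms(1,2,4) lo hi[OF lr]
      by (simp del: binop_val.simps) (rule wrap_Sub, auto simp: reps_def fwd_def sgx_def l'_def e_def)
    ultimately show ?thesis ..
  qed
qed

lemma bwd_expr:
  assumes "vr sg 19 = r" "vr sg 20 = H" "vr sg 21 = G" "reps N (ar sg a) f" "2 * H dvd N" "H = h' * r" "0 < H" "0 < G"
    "\<And>v. v < 2 * G \<Longrightarrow> ar sg 11 v = tw r v" "N \<le> S" "2 * G \<le> S" "2 * r \<le> S" "a < 30" "i < N"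
  shows "ok (upv 24 i sg) (bwd_expr a) \<and> ev (upv 24 i sg) (bwd_expr a) = nat (bwd r H G (tw r) f i mod 2 ^ w)"
proof (cases "i mod (2 * H) < H")
  case True
  note b = segment_bounds[OF assms(14) assms(5-7)]
  have "i + H < N" using b(5) True by simp
  then show ?thesis
    unfolding bwd_expr_def using True assms(1,2,4,10,13,14)
    by (simp del: binop_val.simps) (rule wrap_Add, auto simp: reps_def bwd_def)
next
  case F: False
  note b = segment_bounds[OF assms(14) assms(5-7)]
  define e where "e = tw r (G + 2 * (i div (2 * H)) mod G)"
  have g: "G + 2 * (i div (2 * H)) mod G < 2 * G" using assms(8) by simp
  have gS: "G + 2 * (i div (2 * H)) mod G < S" using g assms(11) by linarith
  have e: "e \<le> 2 * r" unfolding e_def by (rule tw_le)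
  have st: "ev (upv 24 i sg) start_expr = i div (2*H) * (2*H)" "ok (upv 24 i sg) start_expr"
    "small (upv 24 i sg) start_expr" "mag start_expr = 3"
    using assms by (simp_all add: start_expr_def)
  have row: "ev (upv 24 i sg) row_expr = i mod H div r * r" "ok (upv 24 i sg) row_expr"
    "small (upv 24 i sg) row_expr" "mag row_expr = 2"
    using assms by (simp_all add: row_expr_def)
  define l' where "l' = (i mod r + e) mod (2 * r)"
  have rot: "ev (upv 24 i sg) brot_expr = l'" "ok (upv 24 i sg) brot_expr"
    "small (upv 24 i sg) brot_expr" "mag brot_expr = 2"
    using assms(1-3) assms(9)[OF g] assms(12) gS e by (simp_all add: brot_expr_def l'_def e_def)
  have l': "l' < 2 * r" using b(7) by (simp add: l'_def)
  have hi: "i div (2*H) * (2*H) + i mod H div r * r + l + H < N" if "l < r" for l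
    using b(1,3) that by linarith
  have fw: "bwd r H G (tw r) f i = sgx (\<lambda>k. f k - f (k + H)) (i div (2*H) * (2*H) + i mod H div r * r) r (i mod r + e)"
    using F by (simp add: bwd_def e_def)
  show ?thesis
  proof (cases "l' < r")
    case True
    have "ok (upv 24 i sg) (bwd_expr a)"
      unfolding bwd_expr_def using st row rot F True hi[OF True] assms(2,10,13) by (simp add: assms(1))
    moreover have "ev (upv 24 i sg) (bwd_expr a) = nat (bwd r H G (tw r) f i mod 2 ^ w)"
      unfolding bwd_expr_def using st row rot F True assms(1,2,4) hi[OF True]
      by (simp del: binop_val.simps) (rule wrap_Sub, auto simp: reps_def fw sgx_def l'_def)
    ultimately show ?thesis ..
  next
    case False
    then have lr: "l' - r < r" using l' by linarith
    have "ok (upv 24 i sg) (bwd_expr a)"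
      unfolding bwd_expr_def using st row rot F False hi[OF lr] assms(2,10,13) by (simp add: assms(1))
    moreover have "ev (upv 24 i sg) (bwd_expr a) = nat (bwd r H G (tw r) f i mod 2 ^ w)"
      unfolding bwd_expr_def using st row rot F False assms(1,2,4) hi[OF lr]
      by (simp del: binop_val.simps) (rule wrap_Sub, auto simp: reps_def fw sgx_def l'_def)
    ultimately show ?thesis ..
  qed
qed

lemma comb_expr:
  assumes "vr sg 18 = m" "vr sg 19 = r" "reps (2 * N) (ar sg a) f" "m * r dvd N" "0 < m" "0 < r" "2 * N \<le> S" "2 * r \<le> S" "a < 30" "i < N"
  shows "ok (upv 24 i sg) (comb_expr a) \<and> ev (upv 24 i sg) (comb_expr a) = nat (comb m r f i mod 2 ^ w)"
proof -
  obtain q where q: "N = m * r * q" using assms(4) by blast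
  have n0: "0 < m * r" using assms by simp
  have "i div (m*r) < q" using assms(10) q by (simp add: less_mult_imp_div_less mult.commute)
  then have "(i div (m*r) + 1) * (2 * (m*r)) \<le> q * (2 * (m*r))" by (intro mult_right_mono) auto
  then have 1: "i div (m*r) * (2 * (m*r)) + 2 * (m*r) \<le> 2 * N"
  proof -
    have "2 * N = q * (2 * (m*r))" by (simp add: q)
    then show ?thesis using \<open>(i div (m*r) + 1) * (2 * (m*r)) \<le> q * (2 * (m*r))\<close> by (simp only: distrib_right mult_1)
  qed
  define l where "l = i mod (m*r) div m"
  have l: "l < r" unfolding l_def using n0 by (intro less_mult_imp_div_less) (simp add: mult.commute)
  define j where "j = i mod m"
  have j: "j < m" using assms by (simp add: j_def)
  have jr: "(j + 1) * r \<le> m * r" using j by (intro mult_right_mono) auto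
  have lo: "i div (m*r) * (2 * (m*r)) + j * r + l < 2 * N" using 1 jr l by simp
  have hi: "i div (m*r) * (2 * (m*r)) + (m + j) * r + l' < 2 * N" if "l' < r" for l'
    using 1 jr that by (simp add: distrib_right)
  define l' where "l' = (l + 2 * r - 1) mod (2 * r)"
  have l': "l' < 2 * r" using assms(6) by (simp add: l'_def)
  have cb: "comb m r f i = f (i div (m*r) * (2*(m*r)) + j * r + l) + sgx f (i div (m*r) * (2*(m*r)) + (m + j) * r) r (l + 2 * r - 1)"
    by (simp add: comb_def j_def l_def)
  have ge: "1 \<le> l + 2 * r" using assms(6) by simp
  have l'_eq: "(l + 2 * r - Suc 0) mod (2 * r) = l'" by (simp add: l'_def)
  show ?thesis
  proof (cases "l' < r")
    case True
    show ?thesis unfolding comb_expr_def Let_def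
      using True lo hi[OF True] assms(1,2,3,7,9) ge
      apply (simp del: binop_val.simps add: j_def[symmetric] l_def[symmetric] l'_eq)
      apply (rule wrap_Add) by (auto simp: reps_def cb sgx_def l'_def)
  next
    case False
    then have lr: "l' - r < r" using l' by linarith
    show ?thesis unfolding comb_expr_def Let_def
      using False lo hi[OF lr] assms(1,2,3,7,9) ge
      apply (simp del: binop_val.simps add: j_def[symmetric] l_def[symmetric] l'_eq)
      apply (rule wrap_Sub) by (auto simp: reps_def cb sgx_def l'_def)
  qed
qed

lemma base_expr:
  assumes "reps N (ar sg 8) f" "reps N (ar sg 9) g" "even N" "N < S" "i < N"
  shows "ok (upv 24 i sg) base_expr \<and> ev (upv 24 i sg) base_expr = nat (base2 f g i mod 2 ^ w)"
proof (cases "i mod 2 = 0")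
  case True
  then have "i + 1 < N" using assms(3,5) by (metis Suc_eq_plus1 Suc_lessI even_Suc even_iff_mod_2_eq_zero)
  then show ?thesis unfolding base_expr_def using True assms
    by (simp del: binop_val.simps) (intro wrap_Sub wrap_Mul, auto simp: reps_def base2_def)
next
  case False
  then have "1 \<le> i" by (cases i) auto
  then show ?thesis unfolding base_expr_def using False assms
    by (simp del: binop_val.simps) (intro conjI wrap_Add wrap_Mul, auto simp: reps_def base2_def)
qed

end

section \<open>Programs for the convolution\<close>

abbreviation seq_com (infixr \<open>;;\<close> 60) where "c ;; d \<equiv> Seq c d"

lemma expr_static:
  "cost (dup_expr a) \<le> 490" "10 \<in> arrays (dup_expr a) \<longleftrightarrow> a = 10" "8 \<in> arrays (dup_expr a) \<longleftrightarrow> a = 8"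
  "cost (fwd_expr a) \<le> 490" "10 \<in> arrays (fwd_expr a) \<longleftrightarrow> a = 10" "8 \<in> arrays (fwd_expr a) \<longleftrightarrow> a = 8"
  "cost (bwd_expr a) \<le> 490" "10 \<in> arrays (bwd_expr a) \<longleftrightarrow> a = 10"
  "cost (comb_expr a) \<le> 490" "10 \<in> arrays (comb_expr a) \<longleftrightarrow> a = 10"
  "cost base_expr \<le> 490" "10 \<notin> arrays base_expr"
  by (auto simp: dup_expr_def fwd_expr_def bwd_expr_def comb_expr_def base_expr_def start_expr_def row_expr_def
      frot_expr_def brot_expr_def Let_def)

definition tw_expr :: expr where
  "tw_expr = Ite vI (Cst 2) (Cst 0) (Arr 11 (vI [div] Cst 2) [div] Cst 2 [+] vI [mod] Cst 2 [*] Var 19)"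

definition params_code :: com where
  "params_code = asg 17 (Var 11 [div] Cst 2) ;; asg 18 (Pow2 (Var 17)) ;; asg 19 (Pow2 ((Var 11 [+] Cst 1) [div] Cst 2)) ;;
     asg 23 (Cst 4 [*] Var 18) ;; for_loop 24 23 (sto 11 vI tw_expr)"

definition both_code :: "(nat \<Rightarrow> expr) \<Rightarrow> com" where
  "both_code e = upd_loop 10 8 24 13 (e 8) ;; upd_loop 10 9 24 13 (e 9)"

text \<open>Array \<open>12\<close> records the exponent of each level: halving with rounding up
  cannot be undone, so \<open>bwd_level\<close> looks the exponent up again.\<close>

definition fwd_level :: com where
  "fwd_level = sto 12 (Var 16) (Var 11) ;; params_code ;; asg 13 (Cst 2 [*] Var 13) ;; both_code dup_expr ;;
     asg 20 (Var 18 [*] Var 19) ;; asg 21 (Cst 2) ;;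
     for_loop 22 17 (asg 20 (Var 20 [div] Cst 2) ;; asg 21 (Cst 2 [*] Var 21) ;; both_code fwd_expr) ;;
     asg 11 ((Var 11 [+] Cst 1) [div] Cst 2)"

definition bwd_level :: com where
  "bwd_level = asg 11 (Arr 12 (Var 14 [-] (Var 16 [+] Cst 1))) ;; params_code ;; asg 20 (Var 19) ;; asg 21 (Cst 2 [*] Var 18) ;;
     asg 26 (Var 17 [+] Cst 1) ;;
     for_loop 22 26 (upd_loop 10 8 24 13 (bwd_expr 8) ;; asg 20 (Cst 2 [*] Var 20) ;; asg 21 (Var 21 [div] Cst 2)) ;;
     asg 25 (Var 25 [+] Var 26) ;; asg 13 (Var 13 [div] Cst 2) ;; upd_loop 10 8 24 13 (comb_expr 8)"

text \<open>Finds the least D with k \<le> 2^D. The loop always makes \<open>k\<close> rounds; once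
  the power is large enough they change nothing.\<close>

definition depth_code :: com where
  "depth_code = asg 14 (Cst 0) ;; asg 15 (Cst 1) ;;
     for_loop 16 10 (asg 14 (Ite (Var 15) (Var 10) (Var 14 [+] Cst 1) (Var 14)) ;;
       asg 15 (Ite (Var 15) (Var 10) (Cst 2 [*] Var 15) (Var 15)))"

definition nussbaumer_code :: com where
  "nussbaumer_code = depth_code ;; asg 11 (Var 10) ;; asg 13 (Var 12) ;; for_loop 16 14 fwd_level ;;
     upd_loop 10 8 24 13 base_expr ;; asg 25 (Cst 0) ;; for_loop 16 14 bwd_level"

context ram
begin

text \<open>The table covers the nodes below \<open>4 * 2 ^ (k div 2)\<close> because the last
  splitting has G = 2 * 2^(k div 2) factors per block, with node numbers up to 2G - 1.\<close>

lemma params_run: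
  assumes "vr sg 11 = k" "8 * 2 ^ k \<le> S" "1 \<le> k"
  shows "\<exists>sg'. run params_code sg sg' \<and> frame {17,18,19,23,24} {11} sg sg' \<and> tm sg' \<le> tm sg + 300 * 2 ^ k \<and>
     vr sg' 17 = k div 2 \<and> vr sg' 18 = 2 ^ (k div 2) \<and> vr sg' 19 = 2 ^ ((k + 1) div 2) \<and>
     (\<forall>v<4 * 2 ^ (k div 2). ar sg' 11 v = tw (2 ^ ((k + 1) div 2)) v)"
proof -
  let ?m = "2 ^ (k div 2) :: nat" and ?r = "2 ^ ((k + 1) div 2) :: nat"
  have mr: "?m \<le> 2 ^ k" "?r \<le> 2 ^ k" using assms(3) by (auto intro!: power_increasing)
  have mrS: "8 * ?m \<le> S" "8 * ?r \<le> S" using mr assms(2) by linarith+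
  have kS: "k \<le> S" using less_exp[of k] assms(2) by linarith
  have kS2: "k div 2 \<le> S" using kS by linarith
  obtain sg1 where 1: "run (asg 17 (Var 11 [div] Cst 2)) sg sg1" "vr sg1 = (vr sg)(17 := k div 2)" "ar sg1 = ar sg" "tm sg1 = tm sg + 4"
    using asg_ex[of sg "Var 11 [div] Cst 2" 17 "k div 2"] assms kS2 by auto
  obtain sg2 where 2: "run (asg 18 (Pow2 (Var 17))) sg1 sg2" "vr sg2 = (vr sg1)(18 := ?m)" "ar sg2 = ar sg" "tm sg2 = tm sg + 7"
    using asg_ex[of sg1 "Pow2 (Var 17)" 18 ?m] assms mrS 1 by auto
  obtain sg3 where 3: "run (asg 19 (Pow2 ((Var 11 [+] Cst 1) [div] Cst 2))) sg2 sg3" "vr sg3 = (vr sg2)(19 := ?r)" "ar sg3 = ar sg" "tm sg3 = tm sg + 14"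
    using asg_ex[of sg2 "Pow2 ((Var 11 [+] Cst 1) [div] Cst 2)" 19 ?r] assms mrS 1 2 by auto
  obtain sg4 where 4: "run (asg 23 (Cst 4 [*] Var 18)) sg3 sg4" "vr sg4 = (vr sg3)(23 := 4 * ?m)" "ar sg4 = ar sg" "tm sg4 = tm sg + 18"
    using asg_ex[of sg3 "Cst 4 [*] Var 18" 23 "4 * ?m"] assms mrS 1 2 3 by auto
  have twS: "tw ?r v \<le> S" for v using tw_le[of ?r v] mrS assms(2) by linarith
  have "\<exists>sg'. run (for_loop 24 23 (sto 11 vI tw_expr)) sg4 sg' \<and> tm sg' \<le> tm sg4 + 4 * ?m * (30 + 5) + 3 \<and>
     (frame {24} {11} sg4 sg' \<and> (\<forall>v<4 * ?m. ar sg' 11 v = tw ?r v)) \<and> vr sg' 24 = 4 * ?m \<and> vr sg' 23 = 4 * ?m"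
  proof (rule run_for[where I = "\<lambda>i sg'. frame {24} {11} sg4 sg' \<and> (\<forall>v<i. ar sg' 11 v = tw ?r v)"])
    fix i sg' assume i: "i < 4 * ?m" and I: "frame {24} {11} sg4 sg' \<and> (\<forall>v<i. ar sg' 11 v = tw ?r v)"
      and v: "vr sg' 24 = i" "vr sg' 23 = 4 * ?m"
    have iS: "i < S" using i mrS assms(2) by linarith
    have r: "vr sg' 19 = ?r" using I 1 2 3 4 by (simp add: frame_def)
    have e: "ev sg' tw_expr = tw ?r i"
      unfolding tw_expr_def using v r I by (subst tw.simps) auto
    have o: "ok sg' tw_expr"
      unfolding tw_expr_def using v r I iS twS by auto
    obtain sg'' where s: "run (sto 11 vI tw_expr) sg' sg''" "vr sg'' = vr sg'" "ar sg'' = (ar sg')(11 := (ar sg' 11)(i := tw ?r i))"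
       "tm sg'' = tm sg' + 1 + cost tw_expr + 3"
      using sto_ex[of sg' vI tw_expr 11 i "tw ?r i"] v o e iS by auto
    show "\<exists>sg''. run (sto 11 vI tw_expr) sg' sg'' \<and> tm sg'' \<le> tm sg' + 30 \<and> vr sg'' 24 = i \<and> vr sg'' 23 = 4 * ?m \<and>
       frame {24} {11} sg4 (upv 24 (Suc i) sg'') \<and> (\<forall>v<Suc i. ar (upv 24 (Suc i) sg'') 11 v = tw ?r v)"
      by (rule exI, rule conjI, rule s(1)) (use s I v in \<open>auto simp: frame_def less_Suc_eq tw_expr_def\<close>)
  qed (use 1 2 3 4 mrS in auto)
  then obtain sg5 where 5: "run (for_loop 24 23 (sto 11 vI tw_expr)) sg4 sg5" "tm sg5 \<le> tm sg4 + 4 * ?m * (30 + 5) + 3"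
     "frame {24} {11} sg4 sg5" "\<forall>v<4 * ?m. ar sg5 11 v = tw ?r v" by blast
  have "1 \<le> (2::nat) ^ k" by simp
  moreover have "4 * ?m * (30 + 5) = 140 * ?m" by simp
  ultimately have t: "tm sg5 \<le> tm sg + 300 * 2 ^ k" using 5(2) 4(4) mr by linarith
  show ?thesis unfolding params_code_def
    by (rule exI[of _ sg5], intro conjI run_Seq[OF 1(1)] run_Seq[OF 2(1)] run_Seq[OF 3(1)] run_Seq[OF 4(1)] 5(1))
       (use 1 2 3 4 5 t in \<open>auto simp: frame_def\<close>)
qed

lemma both_run:
  assumes "vr sg 13 = N" "N \<le> S" "\<And>a. cost (e a) \<le> 490" "\<And>a. 10 \<notin> arrays (e a) \<or> a = 10" "8 \<notin> arrays (e 9)"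
    and 8: "\<And>i. i < N \<Longrightarrow> ok (upv 24 i sg) (e 8) \<and> ev (upv 24 i sg) (e 8) = nat (f i mod 2 ^ w)"
    and 9: "\<And>i. i < N \<Longrightarrow> ok (upv 24 i sg) (e 9) \<and> ev (upv 24 i sg) (e 9) = nat (g i mod 2 ^ w)"
  shows "\<exists>sg'. run (both_code e) sg sg' \<and> frame {24} {8,9,10} sg sg' \<and> tm sg' \<le> tm sg + 2000 * (N + 1) \<and>
     reps N (ar sg' 8) f \<and> reps N (ar sg' 9) g"
proof -
  have "\<exists>sg'. run (upd_loop 10 8 24 13 (e 8)) sg sg' \<and> tm sg' \<le> tm sg + 1000 * (N + 1) \<and>
     vr sg' = (vr sg)(24 := N) \<and> (\<forall>b. b \<noteq> 8 \<longrightarrow> b \<noteq> 10 \<longrightarrow> ar sg' b = ar sg b) \<and>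
     (\<forall>i. ar sg' 8 i = (if i < N then ev (upv 24 i sg) (e 8) else ar sg 8 i))"
    by (rule run_upd) (use assms(1-3) assms(4)[of 8] 8 in auto)
  then obtain sg1 where 1: "run (upd_loop 10 8 24 13 (e 8)) sg sg1" "tm sg1 \<le> tm sg + 1000 * (N + 1)"
     "vr sg1 = (vr sg)(24 := N)" "\<forall>b. b \<noteq> 8 \<longrightarrow> b \<noteq> 10 \<longrightarrow> ar sg1 b = ar sg b"
     "\<forall>i. ar sg1 8 i = (if i < N then ev (upv 24 i sg) (e 8) else ar sg 8 i)" by blast
  have "ar sg1 a = ar sg a" if "a \<in> arrays (e 9)" for a
  proof -
    have "a \<noteq> 8" "a \<noteq> 10" using that assms(5) assms(4)[of 9] by auto
    then show ?thesis using 1(4) by simp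
  qed
  then have c: "ev (upv 24 i sg1) (e 9) = ev (upv 24 i sg) (e 9)" "ok (upv 24 i sg1) (e 9) = ok (upv 24 i sg) (e 9)" for i
    using 1(3) ev_cong[of "upv 24 i sg1" "upv 24 i sg" "e 9"] by simp_all
  have "\<exists>sg'. run (upd_loop 10 9 24 13 (e 9)) sg1 sg' \<and> tm sg' \<le> tm sg1 + 1000 * (N + 1) \<and>
     vr sg' = (vr sg1)(24 := N) \<and> (\<forall>b. b \<noteq> 9 \<longrightarrow> b \<noteq> 10 \<longrightarrow> ar sg' b = ar sg1 b) \<and>
     (\<forall>i. ar sg' 9 i = (if i < N then ev (upv 24 i sg1) (e 9) else ar sg1 9 i))"
    by (rule run_upd) (use assms(1-3) assms(4)[of 9] 9 1 c in auto)
  then obtain sg2 where 2: "run (upd_loop 10 9 24 13 (e 9)) sg1 sg2" "tm sg2 \<le> tm sg1 + 1000 * (N + 1)"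
     "vr sg2 = (vr sg1)(24 := N)" "\<forall>b. b \<noteq> 9 \<longrightarrow> b \<noteq> 10 \<longrightarrow> ar sg2 b = ar sg1 b"
     "\<forall>i. ar sg2 9 i = (if i < N then ev (upv 24 i sg1) (e 9) else ar sg1 9 i)" by blast
  show ?thesis unfolding both_code_def
    by (rule exI[of _ sg2], intro conjI run_Seq[OF 1(1) 2(1)]) (use 1 2 8 9 c in \<open>auto simp: frame_def reps_def\<close>)
qed

lemma fwd_level_run:
  assumes "vr sg 11 = k" "8 * 2 ^ k \<le> S" "1 \<le> k" "vr sg 13 = N" "2 ^ k dvd N" "2 * N \<le> S" "vr sg 16 = lv" "lv < S"
    "reps N (ar sg 8) f" "reps N (ar sg 9) g"
  shows "\<exists>sg'. run fwd_level sg sg' \<and> frame {11,13,17,18,19,20,21,22,23,24} {8,9,10,11,12} sg sg' \<and>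
     tm sg' \<le> tm sg + 10000 * (k + 2) * (N + 2 ^ k + 1) \<and>
     vr sg' 11 = (k + 1) div 2 \<and> vr sg' 13 = 2 * N \<and> ar sg' 12 = (ar sg 12)(lv := k) \<and>
     reps (2 * N) (ar sg' 8) (flev k f) \<and> reps (2 * N) (ar sg' 9) (flev k g)"
proof -
  define t where "t = k div 2"
  define u where "u = (k + 1) div 2"
  let ?m = "2 ^ t :: nat" and ?r = "2 ^ u :: nat"
  have tu: "t + u = k" "t \<le> u" by (auto simp: t_def u_def)
  have n: "?m * ?r = 2 ^ k" unfolding tu(1)[symmetric] by (simp add: power_add)
  have mr: "?m \<le> 2 ^ k" "?r \<le> 2 ^ k" using tu by (auto intro!: power_increasing)
  have mrS: "8 * ?m \<le> S" "8 * ?r \<le> S" using mr assms(2) by linarith+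
  have kS: "k \<le> S" using less_exp[of k] assms(2) by linarith
  obtain sg1 where 1: "run (sto 12 (Var 16) (Var 11)) sg sg1" "vr sg1 = vr sg" "ar sg1 = (ar sg)(12 := (ar sg 12)(lv := k))" "tm sg1 = tm sg + 5"
    using sto_ex[of sg "Var 16" "Var 11" 12 lv k] assms by auto
  obtain sg2 where 2: "run params_code sg1 sg2" "frame {17,18,19,23,24} {11} sg1 sg2" "tm sg2 \<le> tm sg1 + 300 * 2 ^ k"
     "vr sg2 17 = t" "vr sg2 18 = ?m" "vr sg2 19 = ?r" "\<forall>v<4 * ?m. ar sg2 11 v = tw ?r v"
    using params_run[of sg1 k] 1 assms(1-3) by (auto simp: t_def u_def)
  note f2 = frame_vr[OF 2(2)] frame_ar[OF 2(2)]
  obtain sg3 where 3: "run (asg 13 (Cst 2 [*] Var 13)) sg2 sg3" "vr sg3 = (vr sg2)(13 := 2 * N)" "ar sg3 = ar sg2" "tm sg3 = tm sg2 + 4"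
    using asg_ex[of sg2 "Cst 2 [*] Var 13" 13 "2 * N"] assms(4,6) f2 1 by auto
  have "\<exists>sg'. run (both_code dup_expr) sg3 sg' \<and> frame {24} {8,9,10} sg3 sg' \<and> tm sg' \<le> tm sg3 + 2000 * (2 * N + 1) \<and>
     reps (2 * N) (ar sg' 8) (dup ?m ?r f) \<and> reps (2 * N) (ar sg' 9) (dup ?m ?r g)"
  proof (rule both_run)
    show "ok (upv 24 i sg3) (dup_expr 8) \<and> ev (upv 24 i sg3) (dup_expr 8) = nat (dup ?m ?r f i mod 2 ^ w)" if "i < 2 * N" for i
      by (rule dup_expr[where N = N]) (use 1 2 3 f2 assms that n in auto)
    show "ok (upv 24 i sg3) (dup_expr 9) \<and> ev (upv 24 i sg3) (dup_expr 9) = nat (dup ?m ?r g i mod 2 ^ w)" if "i < 2 * N" for i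
      by (rule dup_expr[where N = N]) (use 1 2 3 f2 assms that n in auto)
  qed (use 3 assms in \<open>auto simp: expr_static\<close>)
  then obtain sg4 where 4: "run (both_code dup_expr) sg3 sg4" "frame {24} {8,9,10} sg3 sg4" "tm sg4 \<le> tm sg3 + 2000 * (2 * N + 1)"
     "reps (2 * N) (ar sg4 8) (dup ?m ?r f)" "reps (2 * N) (ar sg4 9) (dup ?m ?r g)" by blast
  note f4 = frame_vr[OF 4(2)] frame_ar[OF 4(2)]
  obtain sg5 where 5: "run (asg 20 (Var 18 [*] Var 19)) sg4 sg5" "vr sg5 = (vr sg4)(20 := ?m * ?r)" "ar sg5 = ar sg4" "tm sg5 = tm sg4 + 4"
    using asg_ex[of sg4 "Var 18 [*] Var 19" 20 "?m * ?r"] assms(2) n f4 2 3 by auto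
  obtain sg6 where 6: "run (asg 21 (Cst 2)) sg5 sg6" "vr sg6 = (vr sg5)(21 := 2)" "ar sg6 = ar sg5" "tm sg6 = tm sg5 + 2"
    using asg_ex[of sg5 "Cst 2" 21 2] S_ge by auto
  let ?c = "asg 20 (Var 20 [div] Cst 2) ;; asg 21 (Cst 2 [*] Var 21) ;; both_code fwd_expr"
  let ?I = "\<lambda>q sg'. frame {20,21,22,24} {8,9,10} sg6 sg' \<and> vr sg' 20 = 2 ^ (t - q) * ?r \<and> vr sg' 21 = 2 ^ (q + 1) \<and>
     reps (2 * N) (ar sg' 8) (fstg t u f q) \<and> reps (2 * N) (ar sg' 9) (fstg t u g q)"
  have "\<exists>sg'. run (for_loop 22 17 ?c) sg6 sg' \<and> tm sg' \<le> tm sg6 + t * ((8 + 2000 * (2 * N + 1)) + 5) + 3 \<and> ?I t sg' \<and> vr sg' 22 = t \<and> vr sg' 17 = t"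
  proof (rule run_for[where I = ?I])
    fix q sg' assume q: "q < t" and I: "?I q sg'" and v: "vr sg' 22 = q" "vr sg' 17 = t"
    note fI = frame_vr[OF conjunct1[OF I]] frame_ar[OF conjunct1[OF I]]
    have tq: "(2::nat) ^ (t - q) = 2 * 2 ^ (t - Suc q)" using q by (metis Suc_diff_Suc power_Suc)
    have b1: "(2::nat) ^ (t - q) * ?r \<le> 2 ^ k" unfolding n[symmetric] by (intro mult_right_mono power_increasing) auto
    have b2: "(2::nat) ^ (q + 2) \<le> 2 * ?m"
    proof -
      have "(2::nat) ^ (q + 2) \<le> 2 ^ (t + 1)" using q by (intro power_increasing) auto
      then show ?thesis by simp
    qed
    have b3: "4 * (2::nat) ^ q \<le> S" "8 * (2::nat) ^ q \<le> S" using b2 mrS by (simp_all add: power_add)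
    obtain sga where a: "run (asg 20 (Var 20 [div] Cst 2)) sg' sga" "vr sga = (vr sg')(20 := 2 ^ (t - Suc q) * ?r)" "ar sga = ar sg'" "tm sga = tm sg' + 4"
      using asg_ex[of sg' "Var 20 [div] Cst 2" 20 "2 ^ (t - Suc q) * ?r"] I tq b1 assms(2) by auto
    obtain sgb where b: "run (asg 21 (Cst 2 [*] Var 21)) sga sgb" "vr sgb = (vr sga)(21 := 2 ^ (q + 2))" "ar sgb = ar sg'" "tm sgb = tm sg' + 8"
      using asg_ex[of sga "Cst 2 [*] Var 21" 21 "2 ^ (q + 2)"] I a b3 by auto
    have r: "vr sgb 19 = ?r" "vr sgb 13 = 2 * N" "\<And>v. v < 2 * 2 ^ (q + 2) \<Longrightarrow> ar sgb 11 v = tw ?r v"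
      using a b fI 6 5 f4 3 2 b2 by auto
    have dv: "2 * (2 ^ (t - Suc q) * ?r) dvd 2 * N"
    proof -
      have "2 * (2 ^ (t - Suc q) * ?r) = 2 ^ (t - q) * ?r" using tq by simp
      also have "\<dots> dvd 2 ^ t * ?r" by (intro mult_dvd_mono le_imp_power_dvd) auto
      also have "\<dots> dvd N" using n assms(5) by simp
      finally show ?thesis by (rule dvd_mult)
    qed
    have "\<exists>sg'. run (both_code fwd_expr) sgb sg' \<and> frame {24} {8,9,10} sgb sg' \<and> tm sg' \<le> tm sgb + 2000 * (2 * N + 1) \<and>
       reps (2 * N) (ar sg' 8) (fstg t u f (Suc q)) \<and> reps (2 * N) (ar sg' 9) (fstg t u g (Suc q))"
    proof (rule both_run)
      show "ok (upv 24 i sgb) (fwd_expr 8) \<and> ev (upv 24 i sgb) (fwd_expr 8) = nat (fstg t u f (Suc q) i mod 2 ^ w)" if "i < 2 * N" for i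
        unfolding fstg.simps by (rule fwd_expr[OF r(1) _ _ _ dv refl]) (use r a b I b2 b3 mrS assms that in auto)
      show "ok (upv 24 i sgb) (fwd_expr 9) \<and> ev (upv 24 i sgb) (fwd_expr 9) = nat (fstg t u g (Suc q) i mod 2 ^ w)" if "i < 2 * N" for i
        unfolding fstg.simps by (rule fwd_expr[OF r(1) _ _ _ dv refl]) (use r a b I b2 b3 mrS assms that in auto)
    qed (use r assms in \<open>auto simp: expr_static\<close>)
    then obtain sgc where c: "run (both_code fwd_expr) sgb sgc" "frame {24} {8,9,10} sgb sgc" "tm sgc \<le> tm sgb + 2000 * (2 * N + 1)"
       "reps (2 * N) (ar sgc 8) (fstg t u f (Suc q))" "reps (2 * N) (ar sgc 9) (fstg t u g (Suc q))" by blast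
    note fc = frame_vr[OF c(2)] frame_ar[OF c(2)]
    have fr: "frame {20,21,22,24} {8,9,10} sg6 sgc"
      using fI fc a b by (auto simp: frame_def)
    show "\<exists>sg''. run ?c sg' sg'' \<and> tm sg'' \<le> tm sg' + (8 + 2000 * (2 * N + 1)) \<and> vr sg'' 22 = q \<and> vr sg'' 17 = t \<and> ?I (Suc q) (upv 22 (Suc q) sg'')"
      by (rule exI[of _ sgc], intro conjI run_Seq[OF a(1)] run_Seq[OF b(1)] c(1)) (use a b c fc fr v in auto)
  qed (use 2 3 f4 4 5 6 kS in \<open>auto simp: t_def\<close>)
  then obtain sg7 where 7: "run (for_loop 22 17 ?c) sg6 sg7" "tm sg7 \<le> tm sg6 + t * ((8 + 2000 * (2 * N + 1)) + 5) + 3" "?I t sg7" by blast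
  note f7 = frame_vr[OF conjunct1[OF 7(3)]] frame_ar[OF conjunct1[OF 7(3)]]
  have k7: "vr sg7 11 = k" using f7 6 5 f4 3 f2 1 assms(1) by simp
  have uS: "Suc k div 2 \<le> S" using kS assms(3) by linarith
  obtain sg8 where 8: "run (asg 11 ((Var 11 [+] Cst 1) [div] Cst 2)) sg7 sg8" "vr sg8 = (vr sg7)(11 := u)" "ar sg8 = ar sg7" "tm sg8 = tm sg7 + 6"
    using asg_ex[of sg7 "(Var 11 [+] Cst 1) [div] Cst 2" 11 u] k7 uS by (auto simp: u_def)
  have t: "tm sg8 \<le> tm sg + 10000 * (k + 2) * (N + 2 ^ k + 1)"
  proof -
    have "t * ((8 + 2000 * (2 * N + 1)) + 5) \<le> k * (5000 * (N + 2 ^ k + 1))"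
      by (intro mult_mono) (auto simp: t_def)
    then have "tm sg8 \<le> tm sg + (300 * 2 ^ k + 2000 * (2 * N + 1) + 24 + k * (5000 * (N + 2 ^ k + 1)))"
      using 1 2 3 4 5 6 7 8 by linarith
    moreover have "300 * 2 ^ k + 2000 * (2 * N + 1) + 24 \<le> 5000 * (N + 2 ^ k + 1)" by simp
    ultimately have "tm sg8 \<le> tm sg + (5000 * (N + 2 ^ k + 1) + k * (5000 * (N + 2 ^ k + 1)))" by linarith
    also have "\<dots> \<le> tm sg + 10000 * (k + 2) * (N + 2 ^ k + 1)" by (simp add: algebra_simps)
    finally show ?thesis .
  qed
  have lv: "flev k h = fstg t u h t" for h by (simp add: flev_def t_def u_def)
  show ?thesis unfolding fwd_level_def lv
    by (rule exI[of _ sg8], intro conjI run_Seq[OF 1(1)] run_Seq[OF 2(1)] run_Seq[OF 3(1)] run_Seq[OF 4(1)] run_Seq[OF 5(1)] run_Seq[OF 6(1)] run_Seq[OF 7(1)] 8(1))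
       (use 1 3 5 6 7(3) 8 f2 f4 f7 t in \<open>auto simp: frame_def u_def\<close>)
qed

lemma bwd_level_run:
  assumes "vr sg 16 = j" "vr sg 14 = D" "j < D" "D \<le> S" "ar sg 12 (D - Suc j) = k" "8 * 2 ^ k \<le> S" "1 \<le> k"
    "vr sg 13 = 2 * N" "2 ^ k dvd N" "2 * N \<le> S" "vr sg 25 = sc" "sc + k div 2 + 1 \<le> S" "reps (2 * N) (ar sg 8) c"
  shows "\<exists>sg'. run bwd_level sg sg' \<and> frame {11,13,17,18,19,20,21,22,23,24,25,26} {8,10,11} sg sg' \<and>
     tm sg' \<le> tm sg + 10000 * (k + 2) * (N + 2 ^ k + 1) \<and>
     vr sg' 13 = N \<and> vr sg' 25 = sc + k div 2 + 1 \<and> reps N (ar sg' 8) (blev k c)"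
proof -
  define t where "t = k div 2"
  define u where "u = (k + 1) div 2"
  let ?m = "2 ^ t :: nat" and ?r = "2 ^ u :: nat"
  have tu: "t + u = k" "t \<le> u" by (auto simp: t_def u_def)
  have n: "?m * ?r = 2 ^ k" unfolding tu(1)[symmetric] by (simp add: power_add)
  have mr: "?m \<le> 2 ^ k" "?r \<le> 2 ^ k" using tu by (auto intro!: power_increasing)
  have mrS: "8 * ?m \<le> S" "8 * ?r \<le> S" using mr assms(6) by linarith+
  have kS: "k \<le> S" using less_exp[of k] assms(6) by linarith
  have "D - Suc j < S" using assms(3,4) by linarith
  then obtain sg1 where 1: "run (asg 11 (Arr 12 (Var 14 [-] (Var 16 [+] Cst 1)))) sg sg1" "vr sg1 = (vr sg)(11 := k)" "ar sg1 = ar sg" "tm sg1 = tm sg + 9"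
    using asg_ex[of sg "Arr 12 (Var 14 [-] (Var 16 [+] Cst 1))" 11 k] assms kS by auto
  obtain sg2 where 2: "run params_code sg1 sg2" "frame {17,18,19,23,24} {11} sg1 sg2" "tm sg2 \<le> tm sg1 + 300 * 2 ^ k"
     "vr sg2 17 = t" "vr sg2 18 = ?m" "vr sg2 19 = ?r" "\<forall>v<4 * ?m. ar sg2 11 v = tw ?r v"
    using params_run[of sg1 k] 1 assms(6,7) by (auto simp: t_def u_def)
  note f2 = frame_vr[OF 2(2)] frame_ar[OF 2(2)]
  obtain sg3 where 3: "run (asg 20 (Var 19)) sg2 sg3" "vr sg3 = (vr sg2)(20 := ?r)" "ar sg3 = ar sg2" "tm sg3 = tm sg2 + 2"
    using asg_ex[of sg2 "Var 19" 20 "?r"] assms(6) mr 2 by auto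
  obtain sg4 where 4: "run (asg 21 (Cst 2 [*] Var 18)) sg3 sg4" "vr sg4 = (vr sg3)(21 := 2 * ?m)" "ar sg4 = ar sg2" "tm sg4 = tm sg2 + 6"
    using asg_ex[of sg3 "Cst 2 [*] Var 18" 21 "2 * ?m"] assms(6) mr 2 3 by auto
  obtain sg5 where 5: "run (asg 26 (Var 17 [+] Cst 1)) sg4 sg5" "vr sg5 = (vr sg4)(26 := t + 1)" "ar sg5 = ar sg2" "tm sg5 = tm sg2 + 10"
    using asg_ex[of sg4 "Var 17 [+] Cst 1" 26 "t + 1"] assms(12) mr 2 3 4 by (auto simp: t_def)
  let ?c = "upd_loop 10 8 24 13 (bwd_expr 8) ;; asg 20 (Cst 2 [*] Var 20) ;; asg 21 (Var 21 [div] Cst 2)"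
  let ?I = "\<lambda>q sg'. frame {20,21,22,24} {8,10} sg5 sg' \<and> vr sg' 20 = 2 ^ q * ?r \<and> vr sg' 21 = 2 ^ (t + 1 - q) \<and>
     reps (2 * N) (ar sg' 8) (bstg t u c q)"
  have "\<exists>sg'. run (for_loop 22 26 ?c) sg5 sg' \<and> tm sg' \<le> tm sg5 + (t + 1) * ((8 + 1000 * (2 * N + 1)) + 5) + 3 \<and> ?I (t + 1) sg' \<and>
     vr sg' 22 = t + 1 \<and> vr sg' 26 = t + 1"
  proof (rule run_for[where I = ?I])
    fix q sg' assume q: "q < t + 1" and I: "?I q sg'" and v: "vr sg' 22 = q" "vr sg' 26 = t + 1"
    note fI = frame_vr[OF conjunct1[OF I]] frame_ar[OF conjunct1[OF I]]
    have tq: "(2::nat) ^ (t + 1 - q) = 2 * 2 ^ (t - q)" using q by (simp add: Suc_diff_le)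
    have b1: "(2::nat) ^ q * ?r \<le> 2 ^ k" unfolding n[symmetric] using q by (intro mult_right_mono power_increasing) auto
    have b2: "(2::nat) ^ (t + 1 - q) \<le> 2 * ?m"
    proof -
      have "(2::nat) ^ (t + 1 - q) \<le> 2 ^ (t + 1)" by (intro power_increasing) auto
      then show ?thesis by simp
    qed
    have b3: "2 * (2::nat) ^ (Suc t - q) \<le> S" using b2 mrS by simp
    have r: "vr sg' 19 = ?r" "vr sg' 13 = 2 * N" "\<And>v. v < 2 * 2 ^ (t + 1 - q) \<Longrightarrow> ar sg' 11 v = tw ?r v"
      using fI 5 4 3 2 f2 1 assms(8) b2 by auto
    have dv: "2 * (2 ^ q * ?r) dvd 2 * N"
    proof -
      have "2 ^ q * ?r dvd 2 ^ t * ?r" using q by (intro mult_dvd_mono le_imp_power_dvd) auto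
      also have "\<dots> dvd N" using n assms(9) by simp
      finally show ?thesis by simp
    qed
    have be: "ok (upv 24 i sg') (bwd_expr 8) \<and> ev (upv 24 i sg') (bwd_expr 8) = nat (bstg t u c (Suc q) i mod 2 ^ w)" if "i < 2 * N" for i
      unfolding bstg.simps by (rule bwd_expr[OF r(1) _ _ _ dv refl]) (use r I b2 b3 mrS assms(6,10) that in auto)
    have "\<exists>sg1. run (upd_loop 10 8 24 13 (bwd_expr 8)) sg' sg1 \<and> tm sg1 \<le> tm sg' + 1000 * (2 * N + 1) \<and>
       vr sg1 = (vr sg')(24 := 2 * N) \<and> (\<forall>b. b \<noteq> 8 \<longrightarrow> b \<noteq> 10 \<longrightarrow> ar sg1 b = ar sg' b) \<and>
       (\<forall>i. ar sg1 8 i = (if i < 2 * N then ev (upv 24 i sg') (bwd_expr 8) else ar sg' 8 i))"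
      by (rule run_upd) (use r be assms(10) in \<open>auto simp: expr_static\<close>)
    then obtain sga where a: "run (upd_loop 10 8 24 13 (bwd_expr 8)) sg' sga" "tm sga \<le> tm sg' + 1000 * (2 * N + 1)"
       "vr sga = (vr sg')(24 := 2 * N)" "\<forall>b. b \<noteq> 8 \<longrightarrow> b \<noteq> 10 \<longrightarrow> ar sga b = ar sg' b"
       "\<forall>i. ar sga 8 i = (if i < 2 * N then ev (upv 24 i sg') (bwd_expr 8) else ar sg' 8 i)" by blast
    obtain sgb where b: "run (asg 20 (Cst 2 [*] Var 20)) sga sgb" "vr sgb = (vr sga)(20 := 2 ^ Suc q * ?r)" "ar sgb = ar sga" "tm sgb = tm sga + 4"
      using asg_ex[of sga "Cst 2 [*] Var 20" 20 "2 ^ Suc q * ?r"] I a b1 assms(6) by auto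
    obtain sgc where c: "run (asg 21 (Var 21 [div] Cst 2)) sgb sgc" "vr sgc = (vr sgb)(21 := 2 ^ (t - q))" "ar sgc = ar sga" "tm sgc = tm sga + 8"
      using asg_ex[of sgb "Var 21 [div] Cst 2" 21 "2 ^ (t - q)"] I a b b2 tq mrS assms(6) by auto
    show "\<exists>sg''. run ?c sg' sg'' \<and> tm sg'' \<le> tm sg' + (8 + 1000 * (2 * N + 1)) \<and> vr sg'' 22 = q \<and> vr sg'' 26 = t + 1 \<and> ?I (Suc q) (upv 22 (Suc q) sg'')"
      by (rule exI[of _ sgc], intro conjI run_Seq[OF a(1)] run_Seq[OF b(1)] c(1)) (use a b c fI v be in \<open>auto simp: frame_def reps_def\<close>)
  qed (use 1 2 f2 3 4 5 kS assms in \<open>auto simp: t_def\<close>)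
  then obtain sg6 where 6: "run (for_loop 22 26 ?c) sg5 sg6" "tm sg6 \<le> tm sg5 + (t + 1) * ((8 + 1000 * (2 * N + 1)) + 5) + 3" "?I (t + 1) sg6" by blast
  note f6 = frame_vr[OF conjunct1[OF 6(3)]] frame_ar[OF conjunct1[OF 6(3)]]
  have v6: "vr sg6 25 = sc" "vr sg6 26 = t + 1" "vr sg6 13 = 2 * N" "vr sg6 18 = ?m" "vr sg6 19 = ?r"
    using f6 5 4 3 2 f2 1 assms(8,11) by auto
  obtain sg7 where 7: "run (asg 25 (Var 25 [+] Var 26)) sg6 sg7" "vr sg7 = (vr sg6)(25 := sc + t + 1)" "ar sg7 = ar sg6" "tm sg7 = tm sg6 + 4"
    using asg_ex[of sg6 "Var 25 [+] Var 26" 25 "sc + t + 1"] v6 assms(12) by (auto simp: t_def)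
  obtain sg8 where 8: "run (asg 13 (Var 13 [div] Cst 2)) sg7 sg8" "vr sg8 = (vr sg7)(13 := N)" "ar sg8 = ar sg6" "tm sg8 = tm sg6 + 8"
    using asg_ex[of sg7 "Var 13 [div] Cst 2" 13 N] 7 v6 assms(10) by auto
  have ce: "ok (upv 24 i sg8) (comb_expr 8) \<and> ev (upv 24 i sg8) (comb_expr 8) = nat (blev k c i mod 2 ^ w)" if "i < N" for i
    unfolding blev_def t_def[symmetric] u_def[symmetric] by (rule comb_expr[where N = N]) (use v6 7 8 6(3) n mrS assms that in auto)
  have "\<exists>sg1. run (upd_loop 10 8 24 13 (comb_expr 8)) sg8 sg1 \<and> tm sg1 \<le> tm sg8 + 1000 * (N + 1) \<and>
       vr sg1 = (vr sg8)(24 := N) \<and> (\<forall>b. b \<noteq> 8 \<longrightarrow> b \<noteq> 10 \<longrightarrow> ar sg1 b = ar sg8 b) \<and>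
       (\<forall>i. ar sg1 8 i = (if i < N then ev (upv 24 i sg8) (comb_expr 8) else ar sg8 8 i))"
      by (rule run_upd) (use 8 ce assms(10) in \<open>auto simp: expr_static\<close>)
  then obtain sg9 where 9: "run (upd_loop 10 8 24 13 (comb_expr 8)) sg8 sg9" "tm sg9 \<le> tm sg8 + 1000 * (N + 1)"
       "vr sg9 = (vr sg8)(24 := N)" "\<forall>b. b \<noteq> 8 \<longrightarrow> b \<noteq> 10 \<longrightarrow> ar sg9 b = ar sg8 b"
       "\<forall>i. ar sg9 8 i = (if i < N then ev (upv 24 i sg8) (comb_expr 8) else ar sg8 8 i)" by blast
  have t: "tm sg9 \<le> tm sg + 10000 * (k + 2) * (N + 2 ^ k + 1)"
  proof -
    have "(t + 1) * ((8 + 1000 * (2 * N + 1)) + 5) \<le> (k + 1) * (5000 * (N + 2 ^ k + 1))"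
      by (intro mult_mono) (auto simp: t_def)
    then have "tm sg9 \<le> tm sg + (300 * 2 ^ k + 1000 * (N + 1) + 30 + (k + 1) * (5000 * (N + 2 ^ k + 1)))"
      using 1 2 3 4 5 6 7 8 9(2) by linarith
    moreover have "300 * 2 ^ k + 1000 * (N + 1) + 30 \<le> 5000 * (N + 2 ^ k + 1)" by simp
    ultimately have "tm sg9 \<le> tm sg + (5000 * (N + 2 ^ k + 1) + (k + 1) * (5000 * (N + 2 ^ k + 1)))" by linarith
    also have "\<dots> \<le> tm sg + 10000 * (k + 2) * (N + 2 ^ k + 1)" by (simp add: algebra_simps)
    finally show ?thesis .
  qed
  show ?thesis unfolding bwd_level_def
    by (rule exI[of _ sg9], intro conjI run_Seq[OF 1(1)] run_Seq[OF 2(1)] run_Seq[OF 3(1)] run_Seq[OF 4(1)] run_Seq[OF 5(1)] run_Seq[OF 6(1)] run_Seq[OF 7(1)] run_Seq[OF 8(1)] 9(1))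
       (use 1 3 4 5 7 8 9 f2 f6 t ce in \<open>auto simp: frame_def reps_def t_def\<close>)
qed


lemma depth_run:
  assumes "vr sg 10 = k" "1 \<le> k" "2 * k \<le> S"
  shows "\<exists>sg' D. run depth_code sg sg' \<and> frame {14,15,16} {} sg sg' \<and> tm sg' \<le> tm sg + 50 * k + 10 \<and>
     vr sg' 14 = D \<and> k \<le> 2 ^ D \<and> 2 ^ D < 2 * k"
proof -
  obtain sg1 where 1: "run (asg 14 (Cst 0)) sg sg1" "vr sg1 = (vr sg)(14 := 0)" "ar sg1 = ar sg" "tm sg1 = tm sg + 2"
    using asg_ex[of sg "Cst 0" 14 0] by auto
  obtain sg2 where 2: "run (asg 15 (Cst 1)) sg1 sg2" "vr sg2 = (vr sg1)(15 := 1)" "ar sg2 = ar sg" "tm sg2 = tm sg + 4"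
    using asg_ex[of sg1 "Cst 1" 15 1] 1 S_ge by auto
  let ?c = "asg 14 (Ite (Var 15) (Var 10) (Var 14 [+] Cst 1) (Var 14)) ;; asg 15 (Ite (Var 15) (Var 10) (Cst 2 [*] Var 15) (Var 15))"
  let ?I = "\<lambda>i sg'. frame {14,15,16} {} sg2 sg' \<and> vr sg' 15 = 2 ^ vr sg' 14 \<and> 2 ^ vr sg' 14 < 2 * k \<and> (i \<le> vr sg' 14 \<or> k \<le> 2 ^ vr sg' 14)"
  have "\<exists>sg'. run (for_loop 16 10 ?c) sg2 sg' \<and> tm sg' \<le> tm sg2 + k * (30 + 5) + 3 \<and> ?I k sg' \<and> vr sg' 16 = k \<and> vr sg' 10 = k"
  proof (rule run_for[where I = ?I])
    fix i sg' assume i: "i < k" and I: "?I i sg'" and v: "vr sg' 16 = i" "vr sg' 10 = k"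
    define d where "d = vr sg' 14"
    have d: "2 ^ d < 2 * k" "vr sg' 15 = 2 ^ d" "vr sg' 14 = d" using I by (auto simp: d_def)
    have dS: "d < 2 * k" using d(1) less_exp[of d] by linarith
    define d' where "d' = (if 2 ^ d < k then d + 1 else d)"
    have d': "d' \<le> S" "2 ^ d' < 2 * k" using dS d(1) assms(3) by (auto simp: d'_def)
    obtain sga where a: "run (asg 14 (Ite (Var 15) (Var 10) (Var 14 [+] Cst 1) (Var 14))) sg' sga" "vr sga = (vr sg')(14 := d')" "ar sga = ar sg'" "tm sga = tm sg' + 8"
      using asg_ex[of sg' "Ite (Var 15) (Var 10) (Var 14 [+] Cst 1) (Var 14)" 14 d'] d v d' by (cases "2 ^ d < k") (auto simp: d'_def)
    have e: "2 ^ d' \<le> S" using d' assms(3) by linarith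
    obtain sgb where b: "run (asg 15 (Ite (Var 15) (Var 10) (Cst 2 [*] Var 15) (Var 15))) sga sgb" "vr sgb = (vr sga)(15 := 2 ^ d')" "ar sgb = ar sg'" "tm sgb = tm sg' + 16"
      using asg_ex[of sga "Ite (Var 15) (Var 10) (Cst 2 [*] Var 15) (Var 15)" 15 "2 ^ d'"] d v e a by (cases "2 ^ d < k") (auto simp: d'_def)
    show "\<exists>sg''. run ?c sg' sg'' \<and> tm sg'' \<le> tm sg' + 30 \<and> vr sg'' 16 = i \<and> vr sg'' 10 = k \<and> ?I (Suc i) (upv 16 (Suc i) sg'')"
      by (rule exI[of _ sgb], intro conjI run_Seq[OF a(1) b(1)]) (use a b I v d' d in \<open>auto simp: frame_def d'_def\<close>)
  qed (use 1 2 assms in auto)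
  then obtain sg3 where 3: "run (for_loop 16 10 ?c) sg2 sg3" "tm sg3 \<le> tm sg2 + k * (30 + 5) + 3" "?I k sg3" by blast
  have "k \<le> 2 ^ vr sg3 14"
  proof (cases "k \<le> vr sg3 14")
    case True then show ?thesis using less_exp[of "vr sg3 14"] by linarith
  qed (use 3(3) in auto)
  then show ?thesis unfolding depth_code_def
    by (intro exI[of _ sg3] exI[of _ "vr sg3 14"] conjI run_Seq[OF 1(1)] run_Seq[OF 2(1)] 3(1)) (use 1 2 3 in \<open>auto simp: frame_def\<close>)
qed

text \<open>Since \<open>2 ^ D < 2 * k\<close>, the arrays never exceed \<open>2 * k * N\<close>
  cells, and the scaling 2^(k+D-1) is at most \<open>k * 2 ^ k\<close>. The cubic factor in the time
  is generous: a level takes about k passes over arrays of length at most 2kN, and \<open>D\<close>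
  is simply bounded by \<open>2 * k\<close>.\<close>

lemma nussbaumer_run:
  assumes "vr sg 10 = k" "1 \<le> k" "vr sg 12 = N" "N = P * 2 ^ k" "8 * 2 ^ k \<le> S" "4 * k \<le> S" "2 * k * N < S"
    "reps N (ar sg 8) f" "reps N (ar sg 9) g"
  shows "\<exists>sg' sc c. run nussbaumer_code sg sg' \<and> frame ({11} \<union> {13..26}) {8..12} sg sg' \<and>
     tm sg' \<le> tm sg + 100000 * (k + 2) ^ 3 * (N + 2 ^ k + 1) \<and> vr sg' 25 = sc \<and> 2 ^ sc \<le> k * 2 ^ k \<and>
     prel P (2 ^ k) sc c f g \<and> reps N (ar sg' 8) c"
proof -
  obtain sg1 D where 1: "run depth_code sg sg1" "frame {14,15,16} {} sg sg1" "tm sg1 \<le> tm sg + 50 * k + 10"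
     "vr sg1 14 = D" "k \<le> 2 ^ D" "2 ^ D < 2 * k"
    using depth_run[OF assms(1,2)] assms(6) by auto
  note f1 = frame_vr[OF 1(2)] frame_ar[OF 1(2)]
  have D2: "D < 2 * k" using 1(6) less_exp[of D] by linarith
  have kS: "k \<le> S" using assms(6) by linarith
  have NS: "N \<le> S"
  proof -
    have "1 * N \<le> 2 * k * N" using assms(2) by (intro mult_right_mono) auto
    then show ?thesis using assms(7) by linarith
  qed
  have DN: "2 ^ i * N \<le> 2 * k * N" "2 ^ i * N < S" if "i \<le> D" for i
  proof -
    have "(2::nat) ^ i \<le> 2 ^ D" using that by (intro power_increasing) auto
    then have "2 ^ i \<le> 2 * k" using 1(6) by linarith
    then show "2 ^ i * N \<le> 2 * k * N" by (intro mult_right_mono) auto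
    then show "2 ^ i * N < S" using assms(7) by linarith
  qed
  obtain sg2 where 2: "run (asg 11 (Var 10)) sg1 sg2" "vr sg2 = (vr sg1)(11 := k)" "ar sg2 = ar sg1" "tm sg2 = tm sg1 + 2"
    using asg_ex[of sg1 "Var 10" 11 k] f1 assms(1) kS by auto
  obtain sg3 where 3: "run (asg 13 (Var 12)) sg2 sg3" "vr sg3 = (vr sg2)(13 := N)" "ar sg3 = ar sg1" "tm sg3 = tm sg1 + 4"
    using asg_ex[of sg2 "Var 12" 13 N] f1 2 assms(3) NS by auto
  define T where "T = 10000 * (k + 2) * (2 * k * N + 2 ^ k + 1)"
  have lk: "(2::nat) ^ lvk k i \<le> 2 ^ k" for i using lvk_bounds(1)[of k i] by (intro power_increasing) auto
  have Tl: "10000 * (lvk k i + 2) * (2 ^ i * N + 2 ^ lvk k i + 1) \<le> T" if "i \<le> D" for i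
  proof -
    have h1: "2 ^ i * N + 2 ^ lvk k i + 1 \<le> 2 * k * N + 2 ^ k + 1" using lk[of i] DN(1)[OF that] by linarith
    have h2: "10000 * (lvk k i + 2) \<le> 10000 * (k + 2)" using lvk_bounds(1)[of k i] by simp
    show ?thesis unfolding T_def by (rule mult_le_mono[OF h2 h1])
  qed
  have dv: "2 ^ lvk k i dvd 2 ^ i * N" for i
    using lvP_eq[of k P i] assms(4) by (metis dvd_triv_right mult.commute)
  let ?I = "\<lambda>i sg'. frame {11,13,16,17,18,19,20,21,22,23,24} {8,9,10,11,12} sg3 sg' \<and> vr sg' 11 = lvk k i \<and> vr sg' 13 = 2 ^ i * N \<and>
     (\<forall>j<i. ar sg' 12 j = lvk k j) \<and> reps (2 ^ i * N) (ar sg' 8) (fall k f i) \<and> reps (2 ^ i * N) (ar sg' 9) (fall k g i)"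
  have "\<exists>sg'. run (for_loop 16 14 fwd_level) sg3 sg' \<and> tm sg' \<le> tm sg3 + D * (T + 5) + 3 \<and> ?I D sg' \<and> vr sg' 16 = D \<and> vr sg' 14 = D"
  proof (rule run_for[where I = ?I])
    fix i sg' assume i: "i < D" and I: "?I i sg'" and v: "vr sg' 16 = i" "vr sg' 14 = D"
    note fI = frame_vr[OF conjunct1[OF I]] frame_ar[OF conjunct1[OF I]]
    have "2 * (2 ^ i * N) \<le> S" using DN(2)[of "Suc i"] i by (simp add: mult.assoc)
    moreover have "8 * 2 ^ lvk k i \<le> S" using lk[of i] assms(5) by linarith
    moreover have "i < S" using i D2 assms(6) by linarith
    ultimately obtain sg'' where r: "run fwd_level sg' sg''" "frame {11,13,17,18,19,20,21,22,23,24} {8,9,10,11,12} sg' sg''"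
     "tm sg'' \<le> tm sg' + 10000 * (lvk k i + 2) * (2 ^ i * N + 2 ^ lvk k i + 1)"
     "vr sg'' 11 = (lvk k i + 1) div 2" "vr sg'' 13 = 2 * (2 ^ i * N)" "ar sg'' 12 = (ar sg' 12)(i := lvk k i)"
     "reps (2 * (2 ^ i * N)) (ar sg'' 8) (flev (lvk k i) (fall k f i))" "reps (2 * (2 ^ i * N)) (ar sg'' 9) (flev (lvk k i) (fall k g i))"
      using fwd_level_run[of sg' "lvk k i" "2 ^ i * N" i "fall k f i" "fall k g i"] I v dv lvk_bounds(2)[OF assms(2), of i] by blast
    note fr = frame_vr[OF r(2)] frame_ar[OF r(2)]
    have t: "tm sg'' \<le> tm sg' + T" using r(3) Tl[of i] i by linarith
    have fr2: "frame {11,13,16,17,18,19,20,21,22,23,24} {8,9,10,11,12} sg3 (upv 16 (Suc i) sg'')"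
      using fI fr by (auto simp: frame_def)
    show "\<exists>sg''. run fwd_level sg' sg'' \<and> tm sg'' \<le> tm sg' + T \<and> vr sg'' 16 = i \<and> vr sg'' 14 = D \<and> ?I (Suc i) (upv 16 (Suc i) sg'')"
      by (intro exI[of _ sg''] conjI r(1) t fr2) (use r fr v I in \<open>auto simp: less_Suc_eq mult.assoc\<close>)
  qed (use 1 2 3 f1 assms D2 in auto)
  then obtain sg4 where 4: "run (for_loop 16 14 fwd_level) sg3 sg4" "tm sg4 \<le> tm sg3 + D * (T + 5) + 3" "?I D sg4" "vr sg4 14 = D" by blast
  note f4 = frame_vr[OF conjunct1[OF 4(3)]] frame_ar[OF conjunct1[OF 4(3)]]
  have l1: "lvk k D = 1" using assms(2) 1(5) by (rule lvk_one)
  define c0 where "c0 = base2 (fall k f D) (fall k g D)"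
  have be: "ok (upv 24 i sg4) base_expr \<and> ev (upv 24 i sg4) base_expr = nat (c0 i mod 2 ^ w)" if "i < 2 ^ D * N" for i
    unfolding c0_def by (rule base_expr[where N = "2 ^ D * N"]) (use 4(3) that DN(2)[of D] dv[of D] l1 in auto)
  have "\<exists>sg'. run (upd_loop 10 8 24 13 base_expr) sg4 sg' \<and> tm sg' \<le> tm sg4 + 1000 * (2 ^ D * N + 1) \<and>
       vr sg' = (vr sg4)(24 := 2 ^ D * N) \<and> (\<forall>b. b \<noteq> 8 \<longrightarrow> b \<noteq> 10 \<longrightarrow> ar sg' b = ar sg4 b) \<and>
       (\<forall>i. ar sg' 8 i = (if i < 2 ^ D * N then ev (upv 24 i sg4) base_expr else ar sg4 8 i))"
    by (rule run_upd) (use 4 be DN(2)[of D] in \<open>auto simp: expr_static\<close>)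
  then obtain sg5 where 5: "run (upd_loop 10 8 24 13 base_expr) sg4 sg5" "tm sg5 \<le> tm sg4 + 1000 * (2 ^ D * N + 1)"
       "vr sg5 = (vr sg4)(24 := 2 ^ D * N)" "\<forall>b. b \<noteq> 8 \<longrightarrow> b \<noteq> 10 \<longrightarrow> ar sg5 b = ar sg4 b"
       "\<forall>i. ar sg5 8 i = (if i < 2 ^ D * N then ev (upv 24 i sg4) base_expr else ar sg4 8 i)" by blast
  obtain sg6 where 6: "run (asg 25 (Cst 0)) sg5 sg6" "vr sg6 = (vr sg5)(25 := 0)" "ar sg6 = ar sg5" "tm sg6 = tm sg5 + 2"
    using asg_ex[of sg5 "Cst 0" 25 0] by auto
  have sc_le: "lvs k D j \<le> 3 * k" if "j \<le> D" for j
    using lvs_eq[OF that, of k] lvk_bounds(1)[of k "D - j"] D2 that by linarith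
  let ?J = "\<lambda>j sg'. frame {11,13,16,17,18,19,20,21,22,23,24,25,26} {8,10,11} sg6 sg' \<and> vr sg' 13 = 2 ^ (D - j) * N \<and>
     vr sg' 25 = lvs k D j \<and> reps (2 ^ (D - j) * N) (ar sg' 8) (ball k D c0 j)"
  have "\<exists>sg'. run (for_loop 16 14 bwd_level) sg6 sg' \<and> tm sg' \<le> tm sg6 + D * (T + 5) + 3 \<and> ?J D sg' \<and> vr sg' 16 = D \<and> vr sg' 14 = D"
  proof (rule run_for[where I = ?J])
    fix j sg' assume j: "j < D" and I: "?J j sg'" and v: "vr sg' 16 = j" "vr sg' 14 = D"
    note fI = frame_vr[OF conjunct1[OF I]] frame_ar[OF conjunct1[OF I]]
    let ?i = "D - Suc j"
    have i: "?i < D" "D - j = Suc ?i" using j by auto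
    have tw: "2 ^ (D - j) * N = 2 * (2 ^ ?i * N)" unfolding i(2) by simp
    have a12: "ar sg' 12 ?i = lvk k ?i" using fI 6 5 4(3) i by auto
    have h1: "2 * (2 ^ ?i * N) \<le> S" using DN(2)[of "D - j"] unfolding tw by simp
    have h2: "8 * 2 ^ lvk k ?i \<le> S" using lk[of ?i] assms(5) by linarith
    have h3: "lvs k D j + lvk k ?i div 2 + 1 \<le> S" using sc_le[of "Suc j"] j assms(6) by simp
    have h4: "D \<le> S" using D2 assms(6) by linarith
    obtain sg'' where r: "run bwd_level sg' sg''" "frame {11,13,17,18,19,20,21,22,23,24,25,26} {8,10,11} sg' sg''"
     "tm sg'' \<le> tm sg' + 10000 * (lvk k ?i + 2) * (2 ^ ?i * N + 2 ^ lvk k ?i + 1)"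
     "vr sg'' 13 = 2 ^ ?i * N" "vr sg'' 25 = lvs k D j + lvk k ?i div 2 + 1"
     "reps (2 ^ ?i * N) (ar sg'' 8) (blev (lvk k ?i) (ball k D c0 j))"
      using bwd_level_run[OF v j h4 a12 h2 lvk_bounds(2)[OF assms(2)] _ dv h1 _ h3] I unfolding tw by blast
    note fr = frame_vr[OF r(2)] frame_ar[OF r(2)]
    have t: "tm sg'' \<le> tm sg' + T" using r(3) Tl[of ?i] i by linarith
    have fr2: "frame {11,13,16,17,18,19,20,21,22,23,24,25,26} {8,10,11} sg6 (upv 16 (Suc j) sg'')"
      using fI fr by (auto simp: frame_def)
    show "\<exists>sg''. run bwd_level sg' sg'' \<and> tm sg'' \<le> tm sg' + T \<and> vr sg'' 16 = j \<and> vr sg'' 14 = D \<and> ?J (Suc j) (upv 16 (Suc j) sg'')"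
      by (intro exI[of _ sg''] conjI r(1) t fr2) (use r fr v in auto)
  next
    show "?J 0 (upv 16 0 sg6)" using 6 5 4(3) be by (auto simp: frame_def reps_def)
  qed (use 4 5 6 D2 assms(6) in auto)
  then obtain sg7 where 7: "run (for_loop 16 14 bwd_level) sg6 sg7" "tm sg7 \<le> tm sg6 + D * (T + 5) + 3" "?J D sg7" by blast
  note f7 = frame_vr[OF conjunct1[OF 7(3)]] frame_ar[OF conjunct1[OF 7(3)]]
  have "prel P (2 ^ k) (lvs k D D) (ball k D c0 D) f g" unfolding c0_def by (rule prel_all[OF l1])
  moreover have "2 ^ lvs k D D \<le> k * 2 ^ k"
  proof -
    have "lvs k D D + 1 = k + D" using lvs_eq[of D D k] l1 by simp
    then have "2 * 2 ^ lvs k D D = 2 ^ k * (2::nat) ^ D" by (metis Suc_eq_plus1 power_Suc power_add)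
    also have "\<dots> \<le> 2 ^ k * (2 * k)" using 1(6) by (intro mult_left_mono) auto
    finally show ?thesis by (simp add: mult.commute)
  qed
  moreover have "tm sg7 \<le> tm sg + 100000 * (k + 2) ^ 3 * (N + 2 ^ k + 1)"
  proof -
    let ?X = "N + 2 ^ k + 1"
    have T: "T \<le> 20000 * (k + 2) ^ 2 * ?X"
    proof -
      have "2 * k * N + 2 ^ k + 1 \<le> 2 * (k + 2) * ?X" by (simp add: algebra_simps)
      then have "T \<le> 10000 * (k + 2) * (2 * (k + 2) * ?X)" unfolding T_def by (intro mult_left_mono) auto
      moreover have "10000 * a * (2 * a * x) = 20000 * a ^ 2 * x" for a x :: nat by (simp add: power2_eq_square)
      ultimately show ?thesis by metis
    qed
    have "D * (T + 5) \<le> (2 * k) * (20000 * (k + 2) ^ 2 * ?X + 5)" using D2 T by (intro mult_mono) auto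
    also have "\<dots> \<le> 40000 * k * (k + 2) ^ 2 * ?X + 10 * k" by (simp add: algebra_simps)
    finally have D': "D * (T + 5) \<le> 40000 * k * (k + 2) ^ 2 * ?X + 10 * k" .
    have u: "2 ^ D * N \<le> 2 * k * ?X"
    proof -
      have "2 ^ D * N \<le> 2 * k * N" by (rule DN) simp
      also have "\<dots> \<le> 2 * k * ?X" by (intro mult_left_mono) auto
      finally show ?thesis .
    qed
    have "tm sg7 \<le> tm sg + (50 * k + 10 + 4 + 2 * (40000 * k * (k + 2) ^ 2 * ?X + 10 * k) + 6 + 1000 * (2 * k * ?X + 1) + 2)"
    proof -
      have "t7 \<le> t + (50 * k + 10 + 4 + 2 * (y + 10 * k) + 6 + 1000 * (z + 1) + 2)"
        if "t1 \<le> t + 50 * k + 10" "t3 = t1 + 4" "t4 \<le> t3 + d + 3" "t5 \<le> t4 + 1000 * (u + 1)" "t6 = t5 + 2"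
          "t7 \<le> t6 + d + 3" "d \<le> y + 10 * k" "u \<le> z" for t t1 t3 t4 t5 t6 t7 d u y z :: nat
        using that by simp
      from this[OF 1(3) 3(4) 4(2) 5(2) 6(4) 7(2) D' u] show ?thesis .
    qed
    also have "\<dots> \<le> tm sg + (80000 * k * (k + 2) ^ 2 * ?X + 2200 * (k + 1) * ?X)"
    proof -
      have "k \<le> k * ?X" by simp
      moreover have "1 \<le> ?X" by simp
      moreover have "1000 * (2 * k * ?X + 1) = 2000 * (k * ?X) + 1000" by simp
      moreover have "2200 * (k + 1) * ?X = 2200 * (k * ?X) + 2200 * ?X" by (simp add: algebra_simps)
      moreover have "2 * (40000 * k * (k + 2) ^ 2 * ?X + 10 * k) = 80000 * k * (k + 2) ^ 2 * ?X + 20 * k" by simp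
      moreover have "50 * k + 10 + 4 + (y + 20 * k) + 6 + (2000 * kx + 1000) + 2 \<le> y + (2200 * kx + 2200 * x)"
        if "k \<le> kx" "1 \<le> x" for y kx x :: nat using that by simp
      ultimately show ?thesis by (metis add_left_mono)
    qed
    also have "80000 * k * (k + 2) ^ 2 * ?X + 2200 * (k + 1) * ?X \<le> 100000 * (k + 2) ^ 3 * ?X"
    proof -
      have "80000 * k * (k + 2) ^ 2 + 2200 * (k + 1) \<le> 100000 * (k + 2) ^ 3"
        by (simp add: power2_eq_square power3_eq_cube algebra_simps)
      then have "(80000 * k * (k + 2) ^ 2 + 2200 * (k + 1)) * ?X \<le> (100000 * (k + 2) ^ 3) * ?X" by (intro mult_right_mono) auto
      then show ?thesis by (simp only: distrib_right)
    qed
    finally show ?thesis by simp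
  qed
  moreover have "frame ({11} \<union> {13..26}) {8..12} sg sg7"
  proof -
    have "frame ({11} \<union> {13..26}) {8..12} sg sg3" using f1 2 3 by (auto simp: frame_def)
    moreover have "frame ({11} \<union> {13..26}) {8..12} sg3 sg4" by (rule frame_mono[OF conjunct1[OF 4(3)]]) auto
    moreover have "frame ({11} \<union> {13..26}) {8..12} sg4 sg6" using 5 6 by (auto simp: frame_def)
    moreover have "frame ({11} \<union> {13..26}) {8..12} sg6 sg7" by (rule frame_mono[OF conjunct1[OF 7(3)]]) auto
    ultimately show ?thesis by (meson frame_trans subset_refl)
  qed
  ultimately show ?thesis unfolding nussbaumer_code_def
    using 7(3)
    by (intro exI[of _ sg7] exI[of _ "lvs k D D"] exI[of _ "ball k D c0 D"] conjI run_Seq[OF 1(1)] run_Seq[OF 2(1)] run_Seq[OF 3(1)]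
          run_Seq[OF 4(1)] run_Seq[OF 5(1)] run_Seq[OF 6(1)] 7(1)) auto
qed

end

section \<open>Multiplication of long numbers\<close>

definition nval :: "nat \<Rightarrow> (nat \<Rightarrow> nat) \<Rightarrow> nat \<Rightarrow> nat \<Rightarrow> nat" where
  "nval B f st n = (\<Sum>i<n. f (st + i) * B ^ i)"

lemma nval_cong: "(\<And>i. i < n \<Longrightarrow> f (st + i) = g (st' + i)) \<Longrightarrow> nval B f st n = nval B g st' n"
  by (simp add: nval_def)

lemma nval_add: "nval B f st (a + b) = nval B f st a + B ^ a * nval B f (st + a) b"
  by (simp add: nval_def sum_lessThan_add sum_distrib_left power_add mult_ac add_ac)

lemma nval_less: "(\<And>i. i < n \<Longrightarrow> f (st + i) < B) \<Longrightarrow> nval B f st n < B ^ n"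
proof (induction n)
  case (Suc n)
  have "nval B f st (Suc n) = nval B f st n + f (st + n) * B ^ n" by (simp add: nval_def)
  also have "\<dots> < B ^ n + f (st + n) * B ^ n" using Suc by simp
  also have "\<dots> = (f (st + n) + 1) * B ^ n" by simp
  also have "\<dots> \<le> B * B ^ n" using Suc.prems[of n] by (intro mult_right_mono) auto
  finally show ?case by simp
qed (simp add: nval_def)

text \<open>The carry into position \<open>i\<close>. It is reset at the start of each block of
  \<open>n\<close> digits, so blocks are normalised independently and modulo B^n.\<close>

fun cry :: "nat \<Rightarrow> nat \<Rightarrow> (nat \<Rightarrow> nat) \<Rightarrow> nat \<Rightarrow> nat" where
  "cry B n c 0 = 0"
| "cry B n c (Suc i) = (if Suc i mod n = 0 then 0 else (c i + cry B n c i) div B)"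

definition dig :: "nat \<Rightarrow> nat \<Rightarrow> (nat \<Rightarrow> nat) \<Rightarrow> nat \<Rightarrow> nat" where
  "dig B n c i = (c i + cry B n c i) mod B"

lemma cry_start: "i mod n = 0 \<Longrightarrow> cry B n c i = 0"
  by (cases i) auto

text \<open>The pending carry, placed at the next position, is precisely what the digits written so
  far lack. Dropping it at the end of a block yields the congruence \<open>nval_dig\<close>.\<close>

lemma nval_dig_exact:
  assumes "j < n" "0 < B"
  shows "nval B (dig B n c) (p * n) (Suc j) + (c (p * n + j) + cry B n c (p * n + j)) div B * B ^ Suc j = nval B c (p * n) (Suc j)"
  using assms(1)
proof (induction j)
  case 0
  have "cry B n c (p * n) = 0" by (rule cry_start) simp
  then show ?case by (simp add: nval_def dig_def)
next
  case (Suc j)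
  let ?x = "c (p * n + Suc j) + cry B n c (p * n + Suc j)"
  have "Suc (p * n + j) mod n = Suc j"
    using Suc.prems by (metis add_Suc_right mod_less mod_mult_self3)
  then have cy: "cry B n c (p * n + Suc j) = (c (p * n + j) + cry B n c (p * n + j)) div B" by simp
  have "nval B (dig B n c) (p * n) (Suc (Suc j)) + ?x div B * B ^ Suc (Suc j) =
     nval B (dig B n c) (p * n) (Suc j) + (?x mod B + ?x div B * B) * B ^ Suc j"
  proof -
    have e: "dig B n c (p * n + Suc j) = ?x mod B" by (simp only: dig_def)
    have "nval B (dig B n c) (p * n) (Suc (Suc j)) = nval B (dig B n c) (p * n) (Suc j) + ?x mod B * B ^ Suc j"
      unfolding nval_def sum.lessThan_Suc[of _ "Suc j"] e ..
    moreover have "a + y * b + z * (B * b) = a + (y + z * B) * b" for a y z b :: nat by (simp add: algebra_simps)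
    ultimately show ?thesis unfolding power_Suc[of B "Suc j"] by presburger
  qed
  also have "\<dots> = nval B (dig B n c) (p * n) (Suc j) + ?x * B ^ Suc j" by simp
  also have "\<dots> = (nval B (dig B n c) (p * n) (Suc j) + cry B n c (p * n + Suc j) * B ^ Suc j) + c (p * n + Suc j) * B ^ Suc j"
    by (simp only: distrib_right add_ac)
  also have "\<dots> = nval B c (p * n) (Suc j) + c (p * n + Suc j) * B ^ Suc j"
    unfolding cy using Suc.IH Suc.prems by simp
  also have "\<dots> = nval B c (p * n) (Suc (Suc j))" by (simp add: nval_def)
  finally show ?case .
qed

lemma nval_dig:
  assumes "0 < n" "0 < B"
  shows "[nval B (dig B n c) (p * n) n = nval B c (p * n) n] (mod B ^ n)"
proof -
  obtain j where n: "n = Suc j" using assms(1) by (cases n) auto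
  from nval_dig_exact[of j n B c p] assms show ?thesis
    unfolding cong_def n by (metis lessI mod_mult_self1 mult.commute)
qed

text \<open>Carries never exceed the bound of the entries, because (M + M) / B is at most M for B at
  least \<open>2\<close>.\<close>

lemma cry_le:
  assumes "2 \<le> B" "\<And>l. l < i \<Longrightarrow> c l \<le> M"
  shows "cry B n c i \<le> M"
  using assms(2)
proof (induction i)
  case (Suc i)
  have "c i \<le> M" "cry B n c i \<le> M" using Suc by auto
  then have "(c i + cry B n c i) div B \<le> (2 * M) div 2"
    using assms(1) by (intro order_trans[OF div_le_mono2[of 2 B "c i + cry B n c i"]] div_le_mono) auto
  then show ?case by simp
qed simp

text \<open>Because of the zero upper halves, the square i, j < h and the triangle i + j < 2h
  contain the same nonzero terms, so the double sum may be rearranged by the value of i + j.\<close>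

lemma nval_mult_conv:
  assumes "\<And>i. h \<le> i \<Longrightarrow> i < 2 * h \<Longrightarrow> a (st + i) = 0" "\<And>i. h \<le> i \<Longrightarrow> i < 2 * h \<Longrightarrow> b (st + i) = 0"
  shows "nval B a st (2 * h) * nval B b st (2 * h) = (\<Sum>i<2 * h. (\<Sum>j\<le>i. a (st + j) * b (st + (i - j))) * B ^ i)"
proof -
  let ?g = "\<lambda>i j. a (st + i) * b (st + j) * B ^ (i + j)"
  have z: "nval B f st (2 * h) = (\<Sum>i<h. f (st + i) * B ^ i)" if "\<And>i. h \<le> i \<Longrightarrow> i < 2 * h \<Longrightarrow> f (st + i) = 0" for f
    unfolding nval_def by (rule sum.mono_neutral_right) (use that in auto)
  have za: "nval B a st (2 * h) = (\<Sum>i<h. a (st + i) * B ^ i)" by (rule z) (rule assms(1))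
  have zb: "nval B b st (2 * h) = (\<Sum>i<h. b (st + i) * B ^ i)" by (rule z) (rule assms(2))
  have "nval B a st (2 * h) * nval B b st (2 * h) = (\<Sum>(i,j)\<in>{..<h} \<times> {..<h}. ?g i j)"
    unfolding za zb sum_product sum.cartesian_product by (intro sum.cong) (auto simp: power_add mult_ac)
  also have "\<dots> = (\<Sum>(i,j)\<in>{(i,j). i + j < 2 * h}. ?g i j)"
  proof (rule sum.mono_neutral_left)
    show "finite {(i, j). i + j < 2 * h}"
      by (rule finite_subset[of _ "{..<2 * h} \<times> {..<2 * h}"]) auto
    show "\<forall>x\<in>{(i, j). i + j < 2 * h} - {..<h} \<times> {..<h}. (case x of (i, j) \<Rightarrow> ?g i j) = 0"
    proof
      fix x assume x: "x \<in> {(i, j). i + j < 2 * h} - {..<h} \<times> {..<h}"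
      obtain i j where ij: "x = (i, j)" by (cases x)
      have "i + j < 2 * h" "h \<le> i \<or> h \<le> j" using x ij by auto
      then show "(case x of (i, j) \<Rightarrow> ?g i j) = 0" using assms(1)[of i] assms(2)[of j] ij by auto
    qed
  qed auto
  also have "\<dots> = (\<Sum>k<2 * h. \<Sum>i\<le>k. ?g i (k - i))" by (rule sum.triangle_reindex)
  also have "\<dots> = (\<Sum>i<2 * h. (\<Sum>j\<le>i. a (st + j) * b (st + (i - j))) * B ^ i)"
    by (intro sum.cong) (auto simp: sum_distrib_right intro!: sum.cong)
  finally show ?thesis .
qed

definition carry_code :: "nat \<Rightarrow> com" where
  "carry_code a = asg 27 (Cst 0) ;; for_loop 24 12 (asg 27 (Ite (vI [mod] Var 29) (Cst 1) (Cst 0) (Var 27)) ;;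
     asg 26 (Arr a vI [+] Var 27) ;; sto 13 vI (Var 26 [mod] Var 5) ;; asg 27 (Var 26 [div] Var 5))"

text \<open>The shift divides by the scaling \<open>2 ^ sc\<close>. This is exact since the stored
  words are then no longer residues: the scaled convolution coefficients are natural numbers below
  \<open>2 ^ w\<close>.\<close>

definition mul_code :: com where
  "mul_code = nussbaumer_code ;; upd_loop 10 8 24 12 (Wrp ShiftR (Arr 8 vI) (Var 25)) ;; asg 29 (Pow2 (Var 10)) ;; carry_code 8"

context ram
begin

lemma carry_run:
  assumes "vr sg 12 = N" "vr sg 29 = n" "0 < n" "vr sg 5 = B" "2 \<le> B" "a < 30" "a \<noteq> 13" "N \<le> S" "2 * M \<le> S"
    and c: "\<And>i. i < N \<Longrightarrow> ar sg a i \<le> M"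
  shows "\<exists>sg'. run (carry_code a) sg sg' \<and> frame {24,26,27} {13} sg sg' \<and> tm sg' \<le> tm sg + 50 * (N + 1) \<and>
     (\<forall>i<N. ar sg' 13 i = dig B n (ar sg a) i)"
proof -
  let ?c = "ar sg a"
  obtain sg1 where 1: "run (asg 27 (Cst 0)) sg sg1" "vr sg1 = (vr sg)(27 := 0)" "ar sg1 = ar sg" "tm sg1 = tm sg + 2"
    using asg_ex[of sg "Cst 0" 27 0] by auto
  let ?b = "asg 27 (Ite (vI [mod] Var 29) (Cst 1) (Cst 0) (Var 27)) ;;
     asg 26 (Arr a vI [+] Var 27) ;; sto 13 vI (Var 26 [mod] Var 5) ;; asg 27 (Var 26 [div] Var 5)"
  let ?I = "\<lambda>i sg'. frame {24,26,27} {13} sg1 sg' \<and> (\<forall>l<i. ar sg' 13 l = dig B n ?c l) \<and> (i mod n \<noteq> 0 \<longrightarrow> vr sg' 27 = cry B n ?c i)"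
  have "\<exists>sg'. run (for_loop 24 12 ?b) sg1 sg' \<and> tm sg' \<le> tm sg1 + N * (40 + 5) + 3 \<and> ?I N sg' \<and> vr sg' 24 = N \<and> vr sg' 12 = N"
  proof (rule run_for[where I = ?I])
    fix i sg' assume i: "i < N" and I: "?I i sg'" and v: "vr sg' 24 = i" "vr sg' 12 = N"
    note fI = frame_vr[OF conjunct1[OF I]] frame_ar[OF conjunct1[OF I]]
    have v': "vr sg' 29 = n" "vr sg' 5 = B" "ar sg' a = ?c" using fI 1 assms by auto
    have cy: "cry B n ?c i \<le> M" "cry B n ?c i \<le> S" using cry_le[OF assms(5), of i ?c M n] c i assms(9) by auto
    have s: "?c i \<le> M" "?c i \<le> S" "?c i + cry B n ?c i \<le> S" using c[OF i] cy assms(9) by auto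
    let ?x = "?c i + cry B n ?c i"
    have d: "?x div B \<le> S" using s(3) by (meson div_le_dividend le_trans)
    have iS: "i < S" using i assms by linarith
    obtain sga where a: "run (asg 27 (Ite (vI [mod] Var 29) (Cst 1) (Cst 0) (Var 27))) sg' sga" "vr sga = (vr sg')(27 := cry B n ?c i)" "ar sga = ar sg'" "tm sga = tm sg' + 8"
      using asg_ex[of sg' "Ite (vI [mod] Var 29) (Cst 1) (Cst 0) (Var 27)" 27 "cry B n ?c i"] v v' I cy cry_start[of i n B ?c] by (cases "i mod n = 0") auto
    obtain sgb where b: "run (asg 26 (Arr a vI [+] Var 27)) sga sgb" "vr sgb = (vr sga)(26 := ?x)" "ar sgb = ar sg'" "tm sgb = tm sg' + 15"
      using asg_ex[of sga "Arr a vI [+] Var 27" 26 ?x] v v' a s iS assms(6) by auto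
    obtain sgc where c: "run (sto 13 vI (Var 26 [mod] Var 5)) sgb sgc" "vr sgc = vr sgb" "ar sgc = (ar sg')(13 := (ar sg' 13)(i := dig B n ?c i))" "tm sgc = tm sg' + 22"
      using sto_ex[of sgb vI "Var 26 [mod] Var 5" 13 i "dig B n ?c i"] v v' a b iS by (auto simp: dig_def)
    obtain sgd where d: "run (asg 27 (Var 26 [div] Var 5)) sgc sgd" "vr sgd = (vr sgc)(27 := ?x div B)" "ar sgd = ar sgc" "tm sgd = tm sg' + 26"
      using asg_ex[of sgc "Var 26 [div] Var 5" 27 "?x div B"] v v' a b c d by auto
    show "\<exists>sg''. run ?b sg' sg'' \<and> tm sg'' \<le> tm sg' + 40 \<and> vr sg'' 24 = i \<and> vr sg'' 12 = N \<and> ?I (Suc i) (upv 24 (Suc i) sg'')"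
      by (rule exI[of _ sgd], intro conjI run_Seq[OF a(1)] run_Seq[OF b(1)] run_Seq[OF c(1)] d(1))
         (use a b c d fI v in \<open>auto simp: frame_def less_Suc_eq conjunct1[OF conjunct2[OF I]]\<close>)
  qed (use 1 assms in auto)
  then obtain sg2 where 2: "run (for_loop 24 12 ?b) sg1 sg2" "tm sg2 \<le> tm sg1 + N * (40 + 5) + 3" "?I N sg2" by blast
  show ?thesis unfolding carry_code_def
    by (rule exI[of _ sg2], intro conjI run_Seq[OF 1(1) 2(1)]) (use 1 2 in \<open>auto simp: frame_def\<close>)
qed

lemma mul_run:
  assumes "vr sg 10 = k" "1 \<le> k" "vr sg 12 = N" "N = P * 2 ^ k" "vr sg 5 = B" "2 \<le> B"
    and le: "\<And>i. i < N \<Longrightarrow> ar sg 8 i \<le> 2 * B \<and> ar sg 9 i \<le> 2 * B"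
    and zero: "\<And>i. i < N \<Longrightarrow> 2 ^ (k - 1) \<le> i mod 2 ^ k \<Longrightarrow> ar sg 8 i = 0 \<and> ar sg 9 i = 0"
    and bd: "8 * 2 ^ k * (B * B) \<le> S" "4 * k \<le> S" "2 * k * N < S"
  shows "\<exists>sg'. run mul_code sg sg' \<and> frame ({11} \<union> {13..29}) {8..13} sg sg' \<and>
     tm sg' \<le> tm sg + 200000 * (k + 2) ^ 3 * (N + 2 ^ k + 1) \<and> (\<forall>i<N. ar sg' 13 i < B) \<and>
     (\<forall>p<P. [nval B (ar sg' 13) (p * 2 ^ k) (2 ^ k) =
        nval B (ar sg 8) (p * 2 ^ k) (2 ^ k) * nval B (ar sg 9) (p * 2 ^ k) (2 ^ k)] (mod B ^ 2 ^ k))"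
proof -
  let ?n = "2 ^ k :: nat" and ?a = "ar sg 8" and ?b = "ar sg 9"
  define h where "h = (2::nat) ^ (k - 1)"
  have n: "?n = 2 * h" using assms(2) by (simp add: h_def power_eq_if)
  have h0: "0 < h" by (simp add: h_def)
  have B4: "4 \<le> B * B" using mult_le_mono[OF assms(6,6)] by simp
  have nS: "8 * ?n \<le> S"
  proof -
    have "8 * ?n * 1 \<le> 8 * ?n * (B * B)" using B4 assms(6) by (intro mult_left_mono) auto
    then show ?thesis using bd(1) by linarith
  qed
  have BS: "2 * B \<le> S"
  proof -
    have "1 * B * 2 \<le> 8 * ?n * (B * B)" using assms(6) by (intro order_trans[OF _ mult_le_mono[of 2 "8 * ?n" B "B * B"]]) auto
    then show ?thesis using bd(1) by linarith
  qed
  have NS: "N \<le> S"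
  proof -
    have "1 * N \<le> 2 * k * N" using assms(2) by (intro mult_right_mono) auto
    then show ?thesis using bd(3) by linarith
  qed
  define f where "f i = int (?a i)" for i
  define g where "g i = int (?b i)" for i
  have rp: "reps N ?a f" "reps N ?b g"
  proof -
    have "?a i < 2 ^ w" "?b i < 2 ^ w" if "i < N" for i using le[OF that] BS S_less(1) by linarith+
    then show "reps N ?a f" "reps N ?b g" unfolding reps_def f_def g_def
      by (auto simp: nat_mod_as_int zmod_int[symmetric])
  qed
  obtain sg1 sc c where 1: "run nussbaumer_code sg sg1" "frame ({11} \<union> {13..26}) {8..12} sg sg1"
     "tm sg1 \<le> tm sg + 100000 * (k + 2) ^ 3 * (N + ?n + 1)" "vr sg1 25 = sc" "2 ^ sc \<le> k * ?n"
     "prel P ?n sc c f g" "reps N (ar sg1 8) c"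
    using nussbaumer_run[OF assms(1-4) nS bd(2,3) rp] by blast
  note f1 = frame_vr[OF 1(2)] frame_ar[OF 1(2)]
  define cv where "cv p i = (\<Sum>j\<le>i. ?a (p * ?n + j) * ?b (p * ?n + (i - j)))" for p i
  have blk_lt: "p * ?n + i < N" if "p < P" "i < ?n" for p i
    using that unfolding assms(4) by (metis (no_types, lifting) add_less_cancel_left less_le_trans mult_Suc mult_le_mono1 Suc_leI add.commute)
  have z: "?a (p * ?n + i) = 0 \<and> ?b (p * ?n + i) = 0" if "p < P" "h \<le> i" "i < ?n" for p i
    using zero[OF blk_lt[OF that(1,3)]] that(2,3) by (simp add: h_def)
  have cvle: "cv p i \<le> 4 * ?n * (B * B)" if "p < P" "i < ?n" for p i
  proof -
    have "cv p i \<le> (\<Sum>j\<le>i. (2 * B) * (2 * B))" unfolding cv_def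
    proof (intro sum_mono mult_le_mono)
      fix j assume "j \<in> {..i}"
      then have "j < ?n" "i - j < ?n" using that(2) by auto
      then show "?a (p * ?n + j) \<le> 2 * B" "?b (p * ?n + (i - j)) \<le> 2 * B"
        using le[OF blk_lt[OF that(1)]] by blast+
    qed
    also have "\<dots> = (i + 1) * (4 * (B * B))" by (simp add: algebra_simps)
    also have "\<dots> \<le> ?n * (4 * (B * B))" using that(2) by (intro mult_right_mono) auto
    finally show ?thesis by (simp add: mult_ac)
  qed
  have cw: "ar sg1 8 (p * ?n + i) = 2 ^ sc * cv p i" if "p < P" "i < ?n" for p i
  proof -
    have "c (p * ?n + i) = 2 ^ sc * (\<Sum>j\<le>i. f (p * ?n + j) * g (p * ?n + (i - j)))"
      by (rule prel_coeffs[OF 1(6) that(1) n h0 _ _ that(2)]) (use z that in \<open>auto simp: f_def g_def\<close>)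
    also have "\<dots> = int (2 ^ sc * cv p i)" by (simp add: f_def g_def cv_def)
    finally have ceq: "c (p * ?n + i) = int (2 ^ sc * cv p i)" .
    \<comment> \<open>The scaling is at most \<open>k * 2 ^ k\<close> and the coefficient at most
      \<open>S\<close>; a word holds more than the cube of \<open>S\<close>, so reduction modulo
      \<open>2 ^ w\<close> has no effect.\<close>
    have "2 ^ sc * cv p i \<le> (S * S) * S"
    proof (rule mult_le_mono)
      show "2 ^ sc \<le> S * S" using 1(5) mult_le_mono[of k S ?n S] bd(2) nS by linarith
      show "cv p i \<le> S" using cvle[OF that] bd(1) by linarith
    qed
    also have "\<dots> < 2 ^ w" using S_pow_less[of 3] by (simp add: power3_eq_cube)
    finally have lt: "2 ^ sc * cv p i < 2 ^ w" .
    have "ar sg1 8 (p * ?n + i) = nat (c (p * ?n + i) mod 2 ^ w)" using 1(7) blk_lt[OF that] by (simp add: reps_def)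
    also have "\<dots> = (2 ^ sc * cv p i) mod 2 ^ w" unfolding ceq by (metis nat_int of_nat_mod of_nat_numeral of_nat_power)
    finally show ?thesis using lt by simp
  qed
  have ix: "i div ?n < P" "i mod ?n < ?n" "i div ?n * ?n + i mod ?n = i" if "i < N" for i
    using that unfolding assms(4) by (auto simp: less_mult_imp_div_less simp del: power_Suc) (rule div_mult_mod_eq)
  have "\<exists>sg'. run (upd_loop 10 8 24 12 (Wrp ShiftR (Arr 8 vI) (Var 25))) sg1 sg' \<and> tm sg' \<le> tm sg1 + 1000 * (N + 1) \<and>
       vr sg' = (vr sg1)(24 := N) \<and> (\<forall>b. b \<noteq> 8 \<longrightarrow> b \<noteq> 10 \<longrightarrow> ar sg' b = ar sg1 b) \<and>
       (\<forall>i. ar sg' 8 i = (if i < N then ev (upv 24 i sg1) (Wrp ShiftR (Arr 8 vI) (Var 25)) else ar sg1 8 i))"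
    by (rule run_upd) (use f1 assms(3) NS in auto)
  then obtain sg2 where 2: "run (upd_loop 10 8 24 12 (Wrp ShiftR (Arr 8 vI) (Var 25))) sg1 sg2" "tm sg2 \<le> tm sg1 + 1000 * (N + 1)"
       "vr sg2 = (vr sg1)(24 := N)" "\<forall>b. b \<noteq> 8 \<longrightarrow> b \<noteq> 10 \<longrightarrow> ar sg2 b = ar sg1 b"
       "\<forall>i. ar sg2 8 i = (if i < N then ev (upv 24 i sg1) (Wrp ShiftR (Arr 8 vI) (Var 25)) else ar sg1 8 i)" by blast
  have c2: "ar sg2 8 (p * ?n + i) = cv p i" if "p < P" "i < ?n" for p i
    using 2(5) cw[OF that] blk_lt[OF that] 1(4) by (simp add: drop_bit_eq_div)
  have c2': "ar sg2 8 i \<le> 4 * ?n * (B * B)" if "i < N" for i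
    using c2[OF ix(1,2)[OF that]] cvle[OF ix(1,2)[OF that]] ix(3)[OF that] by simp
  obtain sg3 where 3: "run (asg 29 (Pow2 (Var 10))) sg2 sg3" "vr sg3 = (vr sg2)(29 := ?n)" "ar sg3 = ar sg2" "tm sg3 = tm sg2 + 3"
    using asg_ex[of sg2 "Pow2 (Var 10)" 29 ?n] f1 2 assms(1) nS by auto
  have "\<exists>sg'. run (carry_code 8) sg3 sg' \<and> frame {24,26,27} {13} sg3 sg' \<and> tm sg' \<le> tm sg3 + 50 * (N + 1) \<and>
     (\<forall>i<N. ar sg' 13 i = dig B ?n (ar sg3 8) i)"
    by (rule carry_run[where M = "4 * ?n * (B * B)"]) (use 2 3 f1 assms c2' NS bd(1) in auto)
  then obtain sg4 where 4: "run (carry_code 8) sg3 sg4" "frame {24,26,27} {13} sg3 sg4" "tm sg4 \<le> tm sg3 + 50 * (N + 1)"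
     "\<forall>i<N. ar sg4 13 i = dig B ?n (ar sg2 8) i" using 3 by auto
  note f4 = frame_vr[OF 4(2)] frame_ar[OF 4(2)]
  have val: "[nval B (ar sg4 13) (p * ?n) ?n = nval B ?a (p * ?n) ?n * nval B ?b (p * ?n) ?n] (mod B ^ ?n)" if "p < P" for p
  proof -
    have "nval B (ar sg4 13) (p * ?n) ?n = nval B (dig B ?n (ar sg2 8)) (p * ?n) ?n"
      using 4(4) blk_lt[OF that] by (intro nval_cong) auto
    also have "[\<dots> = nval B (ar sg2 8) (p * ?n) ?n] (mod B ^ ?n)" using assms(6) by (intro nval_dig) auto
    also have "nval B (ar sg2 8) (p * ?n) ?n = nval B ?a (p * ?n) ?n * nval B ?b (p * ?n) ?n"
    proof -
      have "nval B ?a (p * ?n) ?n * nval B ?b (p * ?n) ?n = (\<Sum>i<?n. cv p i * B ^ i)"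
        unfolding cv_def n by (rule nval_mult_conv) (use z[OF that] n in auto)
      then show ?thesis using c2[OF that] by (simp add: nval_def)
    qed
    finally show ?thesis .
  qed
  have t: "tm sg4 \<le> tm sg + 200000 * (k + 2) ^ 3 * (N + ?n + 1)"
  proof -
    define Q where "Q = (k + 2) ^ 3 * (N + ?n + 1)"
    have "1 * (N + ?n + 1) \<le> Q" unfolding Q_def by (intro mult_right_mono one_le_power) auto
    moreover have "tm sg1 \<le> tm sg + 100000 * Q" using 1(3) by (simp only: Q_def mult.assoc)
    ultimately have "tm sg4 \<le> tm sg + 200000 * Q" using 2(2) 3(4) 4(3) by simp
    then show ?thesis by (simp only: Q_def mult.assoc)
  qed
  have fr: "frame ({11} \<union> {13..29}) {8..13} sg sg4"
  proof -
    have "frame ({11} \<union> {13..29}) {8..13} sg sg1" by (rule frame_mono[OF 1(2)]) auto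
    moreover have "frame ({11} \<union> {13..29}) {8..13} sg1 sg3" using 2 3 by (auto simp: frame_def)
    moreover have "frame ({11} \<union> {13..29}) {8..13} sg3 sg4" by (rule frame_mono[OF 4(2)]) auto
    ultimately show ?thesis by (meson frame_trans subset_refl)
  qed
  show ?thesis unfolding mul_code_def
    by (rule exI[of _ sg4], intro conjI run_Seq[OF 1(1)] run_Seq[OF 2(1)] run_Seq[OF 3(1)] 4(1) fr t)
       (use 4(4) assms(6) val in \<open>auto simp: dig_def\<close>)
qed

end

section \<open>Product and remainder trees\<close>

definition smap_loop :: "nat \<Rightarrow> nat \<Rightarrow> nat \<Rightarrow> expr \<Rightarrow> com" where
  "smap_loop a vo l e = for_loop 24 l (sto a (Var vo [+] vI) e)"

text \<open>Zeros in the upper half of each block prevent wrap-around. As \<open>ok\<close> inspects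
  only the branch of \<open>Ite\<close> that is taken, the operands need to be meaningful on the
  lower halves only.\<close>

definition mulx_code :: "expr \<Rightarrow> expr \<Rightarrow> com" where
  "mulx_code eA eB = asg 36 (Pow2 (Var 10 [-] Cst 1)) ;;
     map_loop 8 24 12 (Ite (vI [mod] (Cst 2 [*] Var 36)) (Var 36) eA (Cst 0)) ;;
     map_loop 9 24 12 (Ite (vI [mod] (Cst 2 [*] Var 36)) (Var 36) eB (Cst 0)) ;; mul_code"

context ram
begin

lemma run_smap:
  assumes "vo < 60" "l < 60" "l \<noteq> 24" "vo \<noteq> 24" "vr sg l = N" "vr sg vo = b" "b + N \<le> S" "a < 30" "a \<notin> arrays e" "cost e \<le> 480"
    and "\<And>i. i < N \<Longrightarrow> ok (upv 24 i sg) e"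
  shows "\<exists>sg'. run (smap_loop a vo l e) sg sg' \<and> tm sg' \<le> tm sg + 500 * (N + 1) \<and> vr sg' = (vr sg)(24 := N) \<and>
     ar sg' = (ar sg)(a := (\<lambda>x. if b \<le> x \<and> x < b + N then ev (upv 24 (x - b) sg) e else ar sg a x))"
proof -
  let ?F = "\<lambda>k x. if b \<le> x \<and> x < b + k then ev (upv 24 (x - b) sg) e else ar sg a x"
  have "\<exists>sg'. run (for_loop 24 l (sto a (Var vo [+] vI) e)) sg sg' \<and> tm sg' \<le> tm sg + N * (cost e + 6 + 5) + 3 \<and>
     (vr sg' = (vr sg)(24 := N) \<and> ar sg' = (ar sg)(a := ?F N)) \<and> vr sg' 24 = N \<and> vr sg' l = N"
  proof (rule run_for[where I = "\<lambda>k sg'. vr sg' = (vr sg)(24 := k) \<and> ar sg' = (ar sg)(a := ?F k)"])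
    fix i sg1
    assume i: "i < N" and I: "vr sg1 = (vr sg)(24 := i) \<and> ar sg1 = (ar sg)(a := ?F i)"
    have c: "ev sg1 e = ev (upv 24 i sg) e" "ok sg1 e = ok (upv 24 i sg) e"
      using I assms(9) by (auto intro!: ev_cong)
    have r: "run (sto a (Var vo [+] vI) e) sg1 (upa a ((ar sg1 a)(b + i := ev (upv 24 i sg) e)) (tick (cost e + 6) sg1))"
      using run_sto[of sg1 "Var vo [+] vI" e a] assms i I c by (auto simp: numeral_eq_Suc)
    have eq: "ar (upa a ((ar sg1 a)(b + i := ev (upv 24 i sg) e)) (tick (cost e + 6) sg1)) = (ar sg)(a := ?F (Suc i))"
    proof -
      have "(?F i)(b + i := ev (upv 24 i sg) e) = ?F (Suc i)" by (rule ext) (auto simp: less_Suc_eq)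
      then show ?thesis using I by simp
    qed
    show "\<exists>sg'. run (sto a (Var vo [+] vI) e) sg1 sg' \<and> tm sg' \<le> tm sg1 + (cost e + 6) \<and> vr sg' 24 = i \<and> vr sg' l = N \<and>
        vr (upv 24 (Suc i) sg') = (vr sg)(24 := Suc i) \<and> ar (upv 24 (Suc i) sg') = (ar sg)(a := ?F (Suc i))"
      by (rule exI, rule conjI, rule r) (use I assms eq in auto)
  qed (use assms in \<open>auto simp: fun_eq_iff\<close>)
  then obtain sg' where r: "run (smap_loop a vo l e) sg sg'" "tm sg' \<le> tm sg + N * (cost e + 6 + 5) + 3"
     "vr sg' = (vr sg)(24 := N)" "ar sg' = (ar sg)(a := ?F N)" unfolding smap_loop_def by blast
  have "N * (cost e + 6 + 5) \<le> N * 495" using assms(10) by (intro mult_left_mono) auto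
  moreover have "t' \<le> t + 500 * (N + 1)" if "X \<le> N * 495" "t' \<le> t + X + 3" for t t' X :: nat using that by simp
  ultimately have "tm sg' \<le> tm sg + 500 * (N + 1)" using r(2) by blast
  with r show ?thesis by blast
qed

lemma mulx_run:
  assumes v: "vr sg 10 = k" "1 \<le> k" "vr sg 12 = N" "N = P * 2 ^ k" "vr sg 5 = B" "2 \<le> B"
    and st: "cost eA \<le> 400" "cost eB \<le> 400" "8 \<notin> arrays eA" "8 \<notin> arrays eB" "9 \<notin> arrays eB"
    and A: "\<And>i. i < N \<Longrightarrow> i mod 2 ^ k < 2 ^ (k - 1) \<Longrightarrow> ok (upv 24 i (upv 36 (2 ^ (k - 1)) sg)) eA \<and>
       ev (upv 24 i (upv 36 (2 ^ (k - 1)) sg)) eA = fa i \<and> fa i \<le> 2 * B"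
    and B: "\<And>i. i < N \<Longrightarrow> i mod 2 ^ k < 2 ^ (k - 1) \<Longrightarrow> ok (upv 24 i (upv 36 (2 ^ (k - 1)) sg)) eB \<and>
       ev (upv 24 i (upv 36 (2 ^ (k - 1)) sg)) eB = fb i \<and> fb i \<le> 2 * B"
    and bd: "8 * 2 ^ k * (B * B) \<le> S" "4 * k \<le> S" "2 * k * N < S"
  shows "\<exists>sg'. run (mulx_code eA eB) sg sg' \<and> frame ({11} \<union> {13..29} \<union> {36}) {8..13} sg sg' \<and>
     tm sg' \<le> tm sg + 250000 * ((k + 2) ^ 3 * (N + 2 ^ k + 1)) \<and> (\<forall>i<N. ar sg' 13 i < B) \<and>
     (\<forall>p<P. [nval B (ar sg' 13) (p * 2 ^ k) (2 ^ k) =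
        nval B fa (p * 2 ^ k) (2 ^ (k - 1)) * nval B fb (p * 2 ^ k) (2 ^ (k - 1))] (mod B ^ 2 ^ k))"
proof -
  define h where "h = (2::nat) ^ (k - 1)"
  have n: "2 ^ k = 2 * h" using v(2) by (simp add: h_def power_eq_if)
  have h0: "0 < h" by (simp add: h_def)
  have NS: "N \<le> S"
  proof -
    have "1 * N \<le> 2 * k * N" using v(2) by (intro mult_right_mono) auto
    then show ?thesis using bd(3) by linarith
  qed
  have hS: "h \<le> S"
  proof -
    have "8 * 2 ^ k * 1 \<le> 8 * 2 ^ k * (B * B)" using v(6) by (intro mult_left_mono) auto
    then show ?thesis using bd(1) n by linarith
  qed
  obtain sg1 where 1: "run (asg 36 (Pow2 (Var 10 [-] Cst 1))) sg sg1" "vr sg1 = (vr sg)(36 := h)" "ar sg1 = ar sg" "tm sg1 = tm sg + 5"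
    using asg_ex[of sg "Pow2 (Var 10 [-] Cst 1)" 36 h] v(1,2) hS by (auto simp: h_def)
  let ?A = "Ite (vI [mod] (Cst 2 [*] Var 36)) (Var 36) eA (Cst 0)"
  let ?B = "Ite (vI [mod] (Cst 2 [*] Var 36)) (Var 36) eB (Cst 0)"
  define ga where "ga i = (if i mod 2 ^ k < h then fa i else 0)" for i
  define gb where "gb i = (if i mod 2 ^ k < h then fb i else 0)" for i
  have cA: "ok (upv 24 i sg1) ?A \<and> ev (upv 24 i sg1) ?A = ga i" if "i < N" for i
  proof -
    have "ev (upv 24 i sg1) eA = ev (upv 24 i (upv 36 h sg)) eA" "ok (upv 24 i sg1) eA = ok (upv 24 i (upv 36 h sg)) eA"
      by (rule ev_cong; use 1 in simp)+
    then show ?thesis using A[OF that] 1 n by (simp add: ga_def h_def)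
  qed
  have "\<exists>sg'. run (map_loop 8 24 12 ?A) sg1 sg' \<and> tm sg' \<le> tm sg1 + 500 * (N + 1) \<and> vr sg' = (vr sg1)(24 := N) \<and>
     ar sg' = (ar sg1)(8 := (\<lambda>i. if i < N then ev (upv 24 i sg1) ?A else ar sg1 8 i))"
  proof (rule run_map)
    show "ok (upv 24 i sg1) ?A" if "i < N" for i using cA[OF that] by blast
    show "cost ?A \<le> 490" "8 \<notin> arrays ?A" using st by simp_all
  qed (use 1 v(3) NS in simp_all)
  then obtain sg2 where 2: "run (map_loop 8 24 12 ?A) sg1 sg2" "tm sg2 \<le> tm sg1 + 500 * (N + 1)" "vr sg2 = (vr sg1)(24 := N)"
     "ar sg2 = (ar sg1)(8 := (\<lambda>i. if i < N then ev (upv 24 i sg1) ?A else ar sg1 8 i))" by blast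
  have cB: "ok (upv 24 i sg2) ?B \<and> ev (upv 24 i sg2) ?B = gb i" if "i < N" for i
  proof -
    have "ev (upv 24 i sg2) eB = ev (upv 24 i (upv 36 h sg)) eB" "ok (upv 24 i sg2) eB = ok (upv 24 i (upv 36 h sg)) eB"
      by (rule ev_cong; use 1 2 st(4) in auto)+
    then show ?thesis using B[OF that] 1 2 n by (simp add: gb_def h_def)
  qed
  have "\<exists>sg'. run (map_loop 9 24 12 ?B) sg2 sg' \<and> tm sg' \<le> tm sg2 + 500 * (N + 1) \<and> vr sg' = (vr sg2)(24 := N) \<and>
     ar sg' = (ar sg2)(9 := (\<lambda>i. if i < N then ev (upv 24 i sg2) ?B else ar sg2 9 i))"
  proof (rule run_map)
    show "ok (upv 24 i sg2) ?B" if "i < N" for i using cB[OF that] by blast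
    show "cost ?B \<le> 490" "9 \<notin> arrays ?B" using st by simp_all
  qed (use 1 2(3) v(3) NS in simp_all)
  then obtain sg3 where 3: "run (map_loop 9 24 12 ?B) sg2 sg3" "tm sg3 \<le> tm sg2 + 500 * (N + 1)" "vr sg3 = (vr sg2)(24 := N)"
     "ar sg3 = (ar sg2)(9 := (\<lambda>i. if i < N then ev (upv 24 i sg2) ?B else ar sg2 9 i))" by blast
  have a3: "ar sg3 8 i = ga i" "ar sg3 9 i = gb i" if "i < N" for i
    using 2 3 cA[OF that] cB[OF that] that by (simp_all del: ev.simps)
  have "\<exists>sg'. run mul_code sg3 sg' \<and> frame ({11} \<union> {13..29}) {8..13} sg3 sg' \<and>
     tm sg' \<le> tm sg3 + 200000 * (k + 2) ^ 3 * (N + 2 ^ k + 1) \<and> (\<forall>i<N. ar sg' 13 i < B) \<and>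
     (\<forall>p<P. [nval B (ar sg' 13) (p * 2 ^ k) (2 ^ k) =
        nval B (ar sg3 8) (p * 2 ^ k) (2 ^ k) * nval B (ar sg3 9) (p * 2 ^ k) (2 ^ k)] (mod B ^ 2 ^ k))"
  proof (rule mul_run)
    fix i assume i: "i < N"
    show "ar sg3 8 i \<le> 2 * B \<and> ar sg3 9 i \<le> 2 * B"
      using a3[OF i] A[OF i] B[OF i] by (auto simp: ga_def gb_def h_def)
    show "ar sg3 8 i = 0 \<and> ar sg3 9 i = 0" if "2 ^ (k - 1) \<le> i mod 2 ^ k"
      using a3[OF i] that by (auto simp: ga_def gb_def h_def)
  qed (use 1 2 3 v bd in auto)
  then obtain sg4 where 4: "run mul_code sg3 sg4" "frame ({11} \<union> {13..29}) {8..13} sg3 sg4"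
     "tm sg4 \<le> tm sg3 + 200000 * (k + 2) ^ 3 * (N + 2 ^ k + 1)" "\<forall>i<N. ar sg4 13 i < B"
     "\<forall>p<P. [nval B (ar sg4 13) (p * 2 ^ k) (2 ^ k) =
        nval B (ar sg3 8) (p * 2 ^ k) (2 ^ k) * nval B (ar sg3 9) (p * 2 ^ k) (2 ^ k)] (mod B ^ 2 ^ k)" by blast
  have half: "nval B x (p * 2 ^ k) (2 ^ k) = nval B f (p * 2 ^ k) h"
    if "p < P" "\<And>i. i < N \<Longrightarrow> x i = (if i mod 2 ^ k < h then f i else 0)" for p x f
  proof -
    have ix: "p * 2 ^ k + i < N" "(p * 2 ^ k + i) mod 2 ^ k = i" if "i < 2 ^ k" for i
    proof -
      have "p * 2 ^ k + i < (p + 1) * 2 ^ k" using that by simp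
      also have "\<dots> \<le> N" unfolding v(4) using \<open>p < P\<close> by (intro mult_right_mono) auto
      finally show "p * 2 ^ k + i < N" .
      show "(p * 2 ^ k + i) mod 2 ^ k = i" using that by (rule block_div_mod)
    qed
    have "nval B x (p * 2 ^ k) (2 ^ k) = nval B x (p * 2 ^ k) h + B ^ h * nval B x (p * 2 ^ k + h) h"
      unfolding n mult_2[of h] by (rule nval_add)
    also have "nval B x (p * 2 ^ k + h) h = 0"
    proof -
      have "x (p * 2 ^ k + h + i) = 0" if "i < h" for i
        using that(1) that ix[of "h + i"] n \<open>\<And>i. i < N \<Longrightarrow> x i = (if i mod 2 ^ k < h then f i else 0)\<close> by (simp add: add.assoc)
      then show ?thesis by (simp add: nval_def)
    qed
    also have "nval B x (p * 2 ^ k) h = nval B f (p * 2 ^ k) h"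
      using ix n that(2) by (intro nval_cong) auto
    finally show ?thesis by simp
  qed
  have val: "[nval B (ar sg4 13) (p * 2 ^ k) (2 ^ k) =
        nval B fa (p * 2 ^ k) (2 ^ (k - 1)) * nval B fb (p * 2 ^ k) (2 ^ (k - 1))] (mod B ^ 2 ^ k)" if "p < P" for p
  proof -
    have ha: "nval B (ar sg3 8) (p * 2 ^ k) (2 ^ k) = nval B fa (p * 2 ^ k) h"
      by (rule half[OF that]) (use a3 in \<open>simp add: ga_def\<close>)
    have hb: "nval B (ar sg3 9) (p * 2 ^ k) (2 ^ k) = nval B fb (p * 2 ^ k) h"
      by (rule half[OF that]) (use a3 in \<open>simp add: gb_def\<close>)
    from 4(5) that show ?thesis unfolding h_def[symmetric] ha[symmetric] hb[symmetric] by blast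
  qed
  have t: "tm sg4 \<le> tm sg + 250000 * ((k + 2) ^ 3 * (N + 2 ^ k + 1))"
  proof -
    define Q where "Q = (k + 2) ^ 3 * (N + 2 ^ k + 1)"
    have "1 * (N + 2 ^ k + 1) \<le> Q" unfolding Q_def by (intro mult_right_mono one_le_power) auto
    then have q: "N + 1 \<le> Q" by simp
    have "tm sg4 \<le> tm sg3 + 200000 * Q" using 4(3) by (simp only: Q_def mult.assoc)
    then have "tm sg4 \<le> tm sg + 250000 * Q" using 1(4) 2(2) 3(2) q by simp
    then show ?thesis by (simp only: Q_def)
  qed
  have fr: "frame ({11} \<union> {13..29} \<union> {36}) {8..13} sg sg4"
  proof -
    have "frame ({11} \<union> {13..29} \<union> {36}) {8..13} sg sg3" using 1 2 3 by (auto simp: frame_def)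
    moreover have "frame ({11} \<union> {13..29} \<union> {36}) {8..13} sg3 sg4" by (rule frame_mono[OF 4(2)]) auto
    ultimately show ?thesis by (meson frame_trans subset_refl)
  qed
  show ?thesis unfolding mulx_code_def
    by (rule exI[of _ sg4], intro conjI run_Seq[OF 1(1)] run_Seq[OF 2(1)] run_Seq[OF 3(1)] 4(1) fr t)
       (use 4(4) val in auto)
qed

end

section \<open>Product trees stored level by level\<close>

definition pv :: "(nat \<Rightarrow> nat) \<Rightarrow> nat \<Rightarrow> nat \<Rightarrow> nat" where
  "pv x l c = (\<Prod>j<2 ^ l. x (c * 2 ^ l + j))"

lemma prod_lessThan_add:
  fixes g :: "nat \<Rightarrow> nat"
  shows "(\<Prod>j<a+b. g j) = (\<Prod>j<a. g j) * (\<Prod>j<b. g (a + j))"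
  by (induction b) (simp_all add: mult.assoc)

lemma block_count: "(c + 1) * n \<le> Q * n \<Longrightarrow> 0 < n \<Longrightarrow> c < Q" for n :: nat
  by (metis Suc_eq_plus1 Suc_le_lessD mult_le_cancel2)

lemma pv_0: "pv x 0 c = x c"
  by (simp add: pv_def)

lemma pv_Suc: "pv x (Suc l) c = pv x l (2 * c) * pv x l (2 * c + 1)"
proof -
  have "(2::nat) ^ Suc l = 2 ^ l + 2 ^ l" by simp
  then have "pv x (Suc l) c = (\<Prod>j<2 ^ l. x (c * 2 ^ Suc l + j)) * (\<Prod>j<2 ^ l. x (c * 2 ^ Suc l + (2 ^ l + j)))"
    unfolding pv_def by (simp only: prod_lessThan_add)
  then show ?thesis by (simp add: pv_def algebra_simps)
qed

lemma pv_le: "(\<And>j. j < 2 ^ l \<Longrightarrow> x (c * 2 ^ l + j) \<le> b) \<Longrightarrow> pv x l c \<le> b ^ 2 ^ l"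
  unfolding pv_def by (rule order_trans[OF prod_mono[where g = "\<lambda>_. b"]]) auto

text \<open>Level \<open>l\<close> is the slice of length \<open>Z\<close> from \<open>l * Z\<close>
  on, in which a node takes \<open>2 ^ l\<close> digits. Every level thus has the same total length,
  and one blockwise multiplication leads to the next.\<close>

definition ptree :: "nat \<Rightarrow> nat \<Rightarrow> (nat \<Rightarrow> nat) \<Rightarrow> (nat \<Rightarrow> nat) \<Rightarrow> nat \<Rightarrow> bool" where
  "ptree B Z X x l \<longleftrightarrow> (\<forall>i<Z. X (l * Z + i) < B) \<and>
     (\<forall>c. (c + 1) * 2 ^ l \<le> Z \<longrightarrow> nval B X (l * Z + c * 2 ^ l) (2 ^ l) = pv x l c)"

text \<open>The same layout for the negated inverses of the nodes modulo B^(2^l), the constants of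
  Montgomery reduction; the negative sign lets the reduction add instead of subtract.\<close>

definition ntree :: "nat \<Rightarrow> nat \<Rightarrow> (nat \<Rightarrow> nat) \<Rightarrow> (nat \<Rightarrow> nat) \<Rightarrow> nat \<Rightarrow> bool" where
  "ntree B Z X x l \<longleftrightarrow> (\<forall>i<Z. X (l * Z + i) < B) \<and>
     (\<forall>c. (c + 1) * 2 ^ l \<le> Z \<longrightarrow> B ^ 2 ^ l dvd pv x l c * nval B X (l * Z + c * 2 ^ l) (2 ^ l) + 1)"

text \<open>
  Variables: \<open>30\<close> the level \<open>l\<close> of the children, \<open>31\<close> the number \<open>Z\<close> of leaves, \<open>32\<close> the length \<open>2 ^ l\<close>.
\<close>

definition offs_code :: com where
  "offs_code = asg 37 (Var 30 [*] Var 31) ;; asg 38 (Var 37 [+] Var 31)"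

definition upx_code :: "nat \<Rightarrow> com" where
  "upx_code x = offs_code ;; asg 10 (Var 30 [+] Cst 1) ;; asg 12 (Var 31) ;;
     mulx_code (Arr x (Var 37 [+] vI)) (Arr x (Var 37 [+] vI [+] Var 32)) ;; smap_loop x 38 31 (Arr 13 vI)"

context ram
begin

text \<open>Everything that a tree with \<open>Z\<close> leaves and height \<open>g\<close> demands
  of \<open>S\<close>: multiplications with block exponents up to \<open>g + 2\<close> on arrays of
  length up to \<open>2 * Z\<close>, and the storage of all levels (\<open>roomD\<close>).\<close>

definition room :: "nat \<Rightarrow> nat \<Rightarrow> nat \<Rightarrow> bool" where
  "room g Z B \<longleftrightarrow> 8 * 2 ^ (g + 2) * (B * B) \<le> S \<and> 4 * (g + 2) \<le> S \<and> 4 * (g + 2) * Z < S"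

lemma roomD:
  assumes "room g Z B" "k \<le> g + 2"
  shows "8 * 2 ^ k * (B * B) \<le> S" "4 * k \<le> S" "2 * k * Z < S" "2 * k * (2 * Z) < S" "(g + 2) * Z < S"
proof -
  have "8 * 2 ^ k * (B * B) \<le> 8 * 2 ^ (g + 2) * (B * B)"
    using assms(2) by (intro mult_right_mono mult_left_mono power_increasing) auto
  also have "\<dots> \<le> S" using assms(1) unfolding room_def by blast
  finally show "8 * 2 ^ k * (B * B) \<le> S" .
  show "4 * k \<le> S" using assms by (simp add: room_def)
  have "4 * k * Z \<le> 4 * (g + 2) * Z" using assms(2) by (intro mult_right_mono) auto
  then show "2 * k * (2 * Z) < S" using assms(1) unfolding room_def by linarith
  moreover have "2 * k * Z \<le> 2 * k * (2 * Z)" by simp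
  ultimately show "2 * k * Z < S" by linarith
  have "1 * (g + 2) * Z \<le> 4 * (g + 2) * Z" by (intro mult_right_mono) auto
  then show "(g + 2) * Z < S" using assms(1) unfolding room_def by linarith
qed

lemma offs_run:
  assumes "vr sg 30 = l" "vr sg 31 = Z" "(l + 2) * Z < S"
  shows "\<exists>sg'. run offs_code sg sg' \<and> vr sg' = (vr sg)(37 := l * Z, 38 := Suc l * Z) \<and> ar sg' = ar sg \<and> tm sg' = tm sg + 8"
proof -
  have b: "l * Z \<le> S" "Suc l * Z \<le> S" using assms(3) by (simp_all add: algebra_simps)
  obtain sg1 where 1: "run (asg 37 (Var 30 [*] Var 31)) sg sg1" "vr sg1 = (vr sg)(37 := l * Z)" "ar sg1 = ar sg" "tm sg1 = tm sg + 4"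
    using asg_ex[of sg "Var 30 [*] Var 31" 37 "l * Z"] assms b by auto
  obtain sg2 where 2: "run (asg 38 (Var 37 [+] Var 31)) sg1 sg2" "vr sg2 = (vr sg1)(38 := Suc l * Z)" "ar sg2 = ar sg" "tm sg2 = tm sg + 8"
    using asg_ex[of sg1 "Var 37 [+] Var 31" 38 "Suc l * Z"] assms b 1 by (auto simp: add.commute)
  show ?thesis unfolding offs_code_def by (rule exI, rule conjI, rule run_Seq[OF 1(1) 2(1)]) (use 1 2 in auto)
qed

text \<open>All leaves are at most \<open>b < B\<close>, so the product at a node is below
  B^(2^(l+1)) and the congruence provided by the multiplication is an equality. Cells outside the
  new slice are preserved, which keeps the lower levels. The array is a parameter because the tree
  over the inputs and that over 1, ..., 2^K are built by the same code.\<close>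

lemma upx_run:
  assumes v: "vr sg 30 = l" "vr sg 31 = Z" "vr sg 32 = 2 ^ l" "vr sg 5 = B" and Z: "Z = Q * 2 ^ Suc l"
    and B: "B = 4 * b" "1 \<le> b" and xb: "\<And>i. i < Z \<Longrightarrow> x i \<le> b" and a: "a < 8"
    and rm: "room g Z B" "l < g" and pt: "ptree B Z (ar sg a) x l"
  shows "\<exists>sg'. run (upx_code a) sg sg' \<and> frame ({10..29} \<union> {36,37,38}) ({8..13} \<union> {a}) sg sg' \<and>
     tm sg' \<le> tm sg + 300000 * ((l + 3) ^ 3 * (Z + 2 ^ Suc l + 1)) \<and>
     (\<forall>i. \<not> (Suc l * Z \<le> i \<and> i < Suc l * Z + Z) \<longrightarrow> ar sg' a i = ar sg a i) \<and> ptree B Z (ar sg' a) x (Suc l)"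
proof -
  note rD = roomD[OF rm(1)]
  have SS: "(l + 2) * Z < S"
  proof -
    have "(l + 2) * Z \<le> (g + 2) * Z" using rm(2) by (intro mult_right_mono) auto
    also have "\<dots> < S" by (rule rD(5)[of 0]) simp
    finally show ?thesis .
  qed
  have gS: "g + 2 \<le> S" using rD(2)[of "g+2"] by simp
  have ZS: "Z \<le> S" using SS by simp
  obtain sg1 where 1: "run offs_code sg sg1" "vr sg1 = (vr sg)(37 := l * Z, 38 := Suc l * Z)" "ar sg1 = ar sg" "tm sg1 = tm sg + 8"
    using offs_run[OF v(1,2) SS] by auto
  obtain sg2 where 2: "run (asg 10 (Var 30 [+] Cst 1)) sg1 sg2" "vr sg2 = (vr sg1)(10 := Suc l)" "ar sg2 = ar sg" "tm sg2 = tm sg + 12"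
    using asg_ex[of sg1 "Var 30 [+] Cst 1" 10 "Suc l"] 1 v rm(2) gS by auto
  obtain sg3 where 3: "run (asg 12 (Var 31)) sg2 sg3" "vr sg3 = (vr sg2)(12 := Z)" "ar sg3 = ar sg" "tm sg3 = tm sg + 14"
    using asg_ex[of sg2 "Var 31" 12 Z] 1 2 v ZS by auto
  let ?A = "Arr a (Var 37 [+] vI)" and ?B = "Arr a (Var 37 [+] vI [+] Var 32)"
  have half: "i + 2 ^ l < Z" if "i < Z" "i mod 2 ^ Suc l < 2 ^ l" for i
  proof -
    have "i div 2 ^ Suc l < Q" using that(1) Z by (simp add: less_mult_imp_div_less)
    then have "(i div 2 ^ Suc l + 1) * 2 ^ Suc l \<le> Z" unfolding Z by (intro mult_right_mono) auto
    moreover have "i = i div 2 ^ Suc l * 2 ^ Suc l + i mod 2 ^ Suc l" by (rule div_mult_mod_eq[symmetric])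
    ultimately show ?thesis using that(2) by simp
  qed
  have d: "ar sg a (l * Z + i) \<le> 2 * B" if "i < Z" for i using pt that by (auto simp: ptree_def less_imp_le_nat intro: order_trans)
  have lZ: "l * Z + i < S" if "i < Z" for i using SS that by (simp add: algebra_simps)
  have B2: "2 \<le> B" using B by simp
  have "\<exists>sg'. run (mulx_code ?A ?B) sg3 sg' \<and> frame ({11} \<union> {13..29} \<union> {36}) {8..13} sg3 sg' \<and>
     tm sg' \<le> tm sg3 + 250000 * ((Suc l + 2) ^ 3 * (Z + 2 ^ Suc l + 1)) \<and> (\<forall>i<Z. ar sg' 13 i < B) \<and>
     (\<forall>p<Q. [nval B (ar sg' 13) (p * 2 ^ Suc l) (2 ^ Suc l) =
        nval B (\<lambda>i. ar sg a (l * Z + i)) (p * 2 ^ Suc l) (2 ^ (Suc l - 1)) *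
        nval B (\<lambda>i. ar sg a (l * Z + i + 2 ^ l)) (p * 2 ^ Suc l) (2 ^ (Suc l - 1))] (mod B ^ 2 ^ Suc l))"
  proof (rule mulx_run)
    fix i assume i: "i < Z" "i mod 2 ^ Suc l < 2 ^ (Suc l - 1)"
    then have h: "i + 2 ^ l < Z" using half by simp
    show "ok (upv 24 i (upv 36 (2 ^ (Suc l - 1)) sg3)) ?A \<and> ev (upv 24 i (upv 36 (2 ^ (Suc l - 1)) sg3)) ?A = ar sg a (l * Z + i) \<and>
       ar sg a (l * Z + i) \<le> 2 * B"
      using 1 2 3 v a lZ[OF i(1)] d[OF i(1)] by simp
    show "ok (upv 24 i (upv 36 (2 ^ (Suc l - 1)) sg3)) ?B \<and> ev (upv 24 i (upv 36 (2 ^ (Suc l - 1)) sg3)) ?B = ar sg a (l * Z + i + 2 ^ l) \<and>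
       ar sg a (l * Z + i + 2 ^ l) \<le> 2 * B"
      using 1 2 3 v a lZ[OF h] d[OF h] by (simp add: add.assoc)
  qed (use 1 2 3 v Z B2 a rm(2) rD(1-3)[of "Suc l"] in auto)
  then obtain sg4 where 4: "run (mulx_code ?A ?B) sg3 sg4" "frame ({11} \<union> {13..29} \<union> {36}) {8..13} sg3 sg4"
     "tm sg4 \<le> tm sg3 + 250000 * ((Suc l + 2) ^ 3 * (Z + 2 ^ Suc l + 1))" "\<forall>i<Z. ar sg4 13 i < B"
     "\<forall>p<Q. [nval B (ar sg4 13) (p * 2 ^ Suc l) (2 ^ Suc l) =
        nval B (\<lambda>i. ar sg a (l * Z + i)) (p * 2 ^ Suc l) (2 ^ (Suc l - 1)) *
        nval B (\<lambda>i. ar sg a (l * Z + i + 2 ^ l)) (p * 2 ^ Suc l) (2 ^ (Suc l - 1))] (mod B ^ 2 ^ Suc l)" by blast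
  note f4 = frame_vr[OF 4(2)] frame_ar[OF 4(2)]
  have "\<exists>sg'. run (smap_loop a 38 31 (Arr 13 vI)) sg4 sg' \<and> tm sg' \<le> tm sg4 + 500 * (Z + 1) \<and> vr sg' = (vr sg4)(24 := Z) \<and>
     ar sg' = (ar sg4)(a := (\<lambda>x. if Suc l * Z \<le> x \<and> x < Suc l * Z + Z then ev (upv 24 (x - Suc l * Z) sg4) (Arr 13 vI) else ar sg4 a x))"
    by (rule run_smap) (use f4 1 2 3 v a SS ZS in auto)
  then obtain sg5 where 5: "run (smap_loop a 38 31 (Arr 13 vI)) sg4 sg5" "tm sg5 \<le> tm sg4 + 500 * (Z + 1)" "vr sg5 = (vr sg4)(24 := Z)"
     "ar sg5 = (ar sg4)(a := (\<lambda>x. if Suc l * Z \<le> x \<and> x < Suc l * Z + Z then ev (upv 24 (x - Suc l * Z) sg4) (Arr 13 vI) else ar sg4 a x))" by blast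
  have a5: "ar sg5 a (Suc l * Z + i) = ar sg4 13 i" if "i < Z" for i using 5(4) that by simp
  have pt': "ptree B Z (ar sg5 a) x (Suc l)" unfolding ptree_def
  proof (intro conjI allI impI)
    fix i assume "i < Z" then show "ar sg5 a (Suc l * Z + i) < B" using a5 4(4) by simp
  next
    fix c assume c: "(c + 1) * 2 ^ Suc l \<le> Z"
    then have "(c + 1) * 2 ^ Suc l \<le> Q * 2 ^ Suc l" using Z by simp
    then have cQ: "c < Q" by (rule block_count) simp
    have c1: "(2 * c + 1) * 2 ^ l \<le> Z" "(2 * c + 1 + 1) * 2 ^ l \<le> Z" using c by (simp_all add: algebra_simps)
    have l5: "nval B (ar sg5 a) (Suc l * Z + c * 2 ^ Suc l) (2 ^ Suc l) = nval B (ar sg4 13) (c * 2 ^ Suc l) (2 ^ Suc l)"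
    proof (rule nval_cong)
      fix i assume "i < (2::nat) ^ Suc l"
      then have "c * 2 ^ Suc l + i < Z" using c by simp
      then show "ar sg5 a (Suc l * Z + c * 2 ^ Suc l + i) = ar sg4 13 (c * 2 ^ Suc l + i)" using a5 by (simp add: add.assoc)
    qed
    have n1: "nval B (\<lambda>i. ar sg a (l * Z + i)) (c * 2 ^ Suc l) (2 ^ (Suc l - 1)) = pv x l (2 * c)"
    proof -
      have "nval B (\<lambda>i. ar sg a (l * Z + i)) (c * 2 ^ Suc l) (2 ^ (Suc l - 1)) = nval B (ar sg a) (l * Z + 2 * c * 2 ^ l) (2 ^ l)"
        by (simp add: nval_def algebra_simps)
      then show ?thesis using pt c1(1) by (simp add: ptree_def)
    qed
    have n2: "nval B (\<lambda>i. ar sg a (l * Z + i + 2 ^ l)) (c * 2 ^ Suc l) (2 ^ (Suc l - 1)) = pv x l (2 * c + 1)"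
    proof -
      have "nval B (\<lambda>i. ar sg a (l * Z + i + 2 ^ l)) (c * 2 ^ Suc l) (2 ^ (Suc l - 1)) = nval B (ar sg a) (l * Z + (2 * c + 1) * 2 ^ l) (2 ^ l)"
        by (simp add: nval_def algebra_simps)
      also have "\<dots> = pv x l (2 * c + 1)" using pt c1(2) unfolding ptree_def by blast
      finally show ?thesis .
    qed
    have "[nval B (ar sg4 13) (c * 2 ^ Suc l) (2 ^ Suc l) = pv x (Suc l) c] (mod B ^ 2 ^ Suc l)"
      using 4(5) cQ unfolding pv_Suc n1[symmetric] n2[symmetric] by blast
    moreover have "nval B (ar sg4 13) (c * 2 ^ Suc l) (2 ^ Suc l) < B ^ 2 ^ Suc l"
      using 4(4) c by (intro nval_less) simp
    moreover have "pv x (Suc l) c < B ^ 2 ^ Suc l"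
    proof -
      have "pv x (Suc l) c \<le> b ^ 2 ^ Suc l" using xb c by (intro pv_le) simp
      also have "\<dots> < B ^ 2 ^ Suc l" using B by (intro power_strict_mono) auto
      finally show ?thesis .
    qed
    ultimately show "nval B (ar sg5 a) (Suc l * Z + c * 2 ^ Suc l) (2 ^ Suc l) = pv x (Suc l) c"
      unfolding l5 by (simp add: cong_def)
  qed
  have t: "tm sg5 \<le> tm sg + 300000 * ((l + 3) ^ 3 * (Z + 2 ^ Suc l + 1))"
  proof -
    define Y where "Y = (l + 3) ^ 3 * (Z + 2 ^ Suc l + 1)"
    have "1 * (Z + 2 ^ Suc l + 1) \<le> Y" unfolding Y_def by (intro mult_right_mono one_le_power) auto
    then have q: "Z + 1 \<le> Y" by simp
    have "Suc l + 2 = l + 3" by simp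
    then have "tm sg4 \<le> tm sg3 + 250000 * Y" using 4(3) unfolding Y_def by metis
    then have "tm sg5 \<le> tm sg + 300000 * Y" using 3(4) 5(2) q by simp
    then show ?thesis by (simp only: Y_def)
  qed
  have fr: "frame ({10..29} \<union> {36,37,38}) ({8..13} \<union> {a}) sg sg5"
  proof -
    have "frame ({10..29} \<union> {36,37,38}) ({8..13} \<union> {a}) sg sg3" using 1 2 3 by (auto simp: frame_def)
    moreover have "frame ({10..29} \<union> {36,37,38}) ({8..13} \<union> {a}) sg3 sg4" by (rule frame_mono[OF 4(2)]) auto
    moreover have "frame ({10..29} \<union> {36,37,38}) ({8..13} \<union> {a}) sg4 sg5" using 5 by (auto simp: frame_def)
    ultimately show ?thesis by (meson frame_trans subset_refl)
  qed
  show ?thesis unfolding upx_code_def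
    by (rule exI[of _ sg5], intro conjI run_Seq[OF 1(1)] run_Seq[OF 2(1)] run_Seq[OF 3(1)] run_Seq[OF 4(1)] 5(1) fr t pt')
       (use 5(4) f4(2)[of a] a 3(3) in auto)
qed

end

section \<open>Negated inverses modulo powers of the base\<close>

lemma nval_add_const: "nval B (\<lambda>i. f i + g i) st n = nval B f st n + nval B g st n"
  by (simp add: nval_def distrib_right sum.distrib)

lemma nval_ones: "1 \<le> B \<Longrightarrow> nval B (\<lambda>_. B - 1) st n + 1 = B ^ n"
proof (induction n)
  case (Suc n)
  have "nval B (\<lambda>_. B - 1) st (Suc n) + 1 = (nval B (\<lambda>_. B - 1) st n + 1) + (B - 1) * B ^ n" by (simp add: nval_def)
  also have "\<dots> = (1 + (B - 1)) * B ^ n" unfolding Suc.IH[OF Suc.prems] by (simp only: distrib_right mult_1)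
  also have "1 + (B - 1) = B" using Suc.prems by simp
  finally show ?case by simp
qed (simp add: nval_def)

lemma nval_low: "[nval B f st (a + b) = nval B f st a] (mod B ^ a)"
  unfolding nval_add by (simp add: cong_def)

lemma nval_cut:
  assumes "\<And>i. a \<le> i \<Longrightarrow> i < a + b \<Longrightarrow> f (st + i) = 0"
  shows "nval B f st (a + b) = nval B f st a"
proof -
  have "nval B f (st + a) b = 0" unfolding nval_def using assms by (simp add: add.assoc)
  then show ?thesis by (simp add: nval_add)
qed

text \<open>
  One Newton step for the inverse modulo a power of the base: if \<open>X J \<equiv> 1\<close> modulo \<open>D\<close>, then
  \<open>X J (X J - 2) + 1 = (X J - 1)\<^sup>2 \<equiv> 0\<close> modulo \<open>D\<^sup>2\<close>.
\<close>

lemma newton_step: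
  fixes D xl xr Nl Nr J Y N :: nat
  assumes l: "D dvd xl * Nl + 1" and r: "D dvd xr * Nr + 1" and J: "[J = Nl * Nr] (mod D)"
    and Y: "[Y = xl * xr * J] (mod D * D)" and N: "[N = (Y + (D * D - 2)) * J] (mod D * D)" and D: "2 \<le> D"
  shows "D * D dvd xl * xr * N + 1"
proof -
  define X where "X = int (xl * xr)"
  have DD: "2 \<le> D * D" using mult_le_mono[OF D, of 1 D] D by simp
  have "[int xl * int Nl = -1] (mod int D)" "[int xr * int Nr = -1] (mod int D)"
    using l r by (simp_all add: cong_iff_dvd_diff) (metis int_dvd_int_iff of_nat_Suc of_nat_mult add.commute)+
  then have "[(int xl * int Nl) * (int xr * int Nr) = (-1) * (-1)] (mod int D)" by (rule cong_mult)
  moreover have "[X * int J = X * (int Nl * int Nr)] (mod int D)"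
    using J by (intro cong_scalar_left) (simp add: cong_int_iff flip: of_nat_mult)
  ultimately have "[X * int J = 1] (mod int D)" by (simp add: X_def mult_ac cong_def)
  then have "int D dvd X * int J - 1" by (simp only: cong_iff_dvd_diff)
  then have sq: "int D * int D dvd (X * int J - 1) * (X * int J - 1)" using mult_dvd_mono by blast
  have Y': "[int Y = X * int J] (mod int D * int D)"
    using Y unfolding X_def by (simp add: cong_int_iff flip: of_nat_mult)
  have "[int N = (int Y + (int D * int D - 2)) * int J] (mod int D * int D)"
  proof -
    have "[int N = int ((Y + (D * D - 2)) * J)] (mod int (D * D))" using N by (simp only: cong_int_iff)
    moreover have "int (D * D - 2) = int D * int D - 2" using DD by (simp add: of_nat_diff)
    ultimately show ?thesis by simp
  qed
  also have "[(int Y + (int D * int D - 2)) * int J = (X * int J + (0 - 2)) * int J] (mod int D * int D)"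
    by (intro cong_mult cong_add cong_diff Y' cong_refl) (simp add: cong_def)
  finally have "[X * int N = X * ((X * int J + (0 - 2)) * int J)] (mod int D * int D)" by (rule cong_scalar_left)
  then have "[X * int N + 1 = X * ((X * int J + (0 - 2)) * int J) + 1] (mod int D * int D)" by (rule cong_add[OF _ cong_refl])
  also have "X * ((X * int J + (0 - 2)) * int J) + 1 = (X * int J - 1) * (X * int J - 1)" by (simp add: algebra_simps)
  also have "[(X * int J - 1) * (X * int J - 1) = 0] (mod int D * int D)" using sq by (simp add: cong_iff_dvd_diff)
  finally have "int (D * D) dvd int (xl * xr * N + 1)" by (simp add: cong_iff_dvd_diff X_def add.commute)
  then show ?thesis by (simp only: int_dvd_int_iff)
qed

abbreviation "eL \<equiv> Var 32"
abbreviation "e2L \<equiv> Cst 2 [*] Var 32"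
abbreviation "e4L \<equiv> Cst 4 [*] Var 32"

text \<open>The product J of the children's entries, cut to its low 2^l digits and spread to blocks
  four times as long. More digits would be useless, as J is an inverse only modulo B^(2^l).\<close>

definition jt_expr :: expr where
  "jt_expr = Ite (vI [mod] e4L) eL (Arr 7 (vI [div] e4L [*] e2L [+] vI [mod] e4L)) (Cst 0)"

text \<open>The signs of the children's negated inverses cancel, so J approximates the inverse of
  the product X of the two child nodes, and N = (X J - 2) J is the negated inverse to doubled
  precision. The products X J and (X J - 2) J have factors with twice the digits of a child, hence
  blocks of four times its length.\<close>

definition upn_code :: com where
  "upn_code = offs_code ;; asg 10 (Var 30 [+] Cst 1) ;; asg 12 (Var 31) ;;
     mulx_code (Arr 5 (Var 37 [+] vI)) (Arr 5 (Var 37 [+] vI [+] eL)) ;; map_loop 7 24 31 (Arr 13 vI) ;;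
     asg 10 (Var 30 [+] Cst 2) ;; asg 12 (Cst 2 [*] Var 31) ;;
     mulx_code (Arr 4 (Var 38 [+] vI [div] e4L [*] e2L [+] vI [mod] e4L)) jt_expr ;;
     mulx_code (Ite (vI [mod] e4L) (Cst 1) (Arr 13 vI [+] Var 5 [-] Cst 2) (Arr 13 vI [+] Var 5 [-] Cst 1)) jt_expr ;;
     smap_loop 5 38 31 (Arr 13 (vI [div] e2L [*] e4L [+] vI [mod] e2L))"

lemma half_block:
  fixes n Q i Z :: nat
  assumes "Z = Q * (2 * n)" "i < Z" "i mod (2 * n) < n"
  shows "i + n < Z"
proof -
  have "i div (2 * n) < Q" using assms(1,2) by (simp add: less_mult_imp_div_less)
  then have "(i div (2 * n) + 1) * (2 * n) \<le> Z" unfolding assms(1) by (intro mult_right_mono) auto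
  moreover have "i = i div (2 * n) * (2 * n) + i mod (2 * n)" by (rule div_mult_mod_eq[symmetric])
  ultimately show ?thesis using assms(3) by simp
qed

lemma block_shrink:
  fixes n m Q i :: nat
  assumes "i < Q * n" "i mod n < m"
  shows "i div n * m + i mod n < Q * m"
proof -
  have "i div n < Q" using assms(1) by (simp add: less_mult_imp_div_less)
  then have "(i div n + 1) * m \<le> Q * m" by (intro mult_right_mono) auto
  then show ?thesis using assms(2) by simp
qed

context ram
begin

lemma upn_run:
  assumes v: "vr sg 30 = l" "vr sg 31 = Z" "vr sg 32 = 2 ^ l" "vr sg 5 = B" and Z: "Z = Q * 2 ^ Suc l"
    and B: "4 \<le> B" and rm: "room g Z B" "l < g" and pt: "ptree B Z (ar sg 4) x (Suc l)" and nt: "ntree B Z (ar sg 5) x l"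
  shows "\<exists>sg'. run upn_code sg sg' \<and> frame ({10..29} \<union> {36,37,38}) ({8..13} \<union> {5,7}) sg sg' \<and>
     tm sg' \<le> tm sg + 800000 * ((l + 4) ^ 3 * (2 * Z + 2 ^ (l + 2) + 1)) \<and>
     (\<forall>i. \<not> (Suc l * Z \<le> i \<and> i < Suc l * Z + Z) \<longrightarrow> ar sg' 5 i = ar sg 5 i) \<and> ntree B Z (ar sg' 5) x (Suc l)"
proof -
  define L where "L = (2::nat) ^ l"
  have L: "2 ^ Suc l = 2 * L" "2 ^ (l + 2) = 4 * L" "2 ^ (l + 1) = 2 * L" "0 < L" by (simp_all add: L_def)
  have Z': "Z = Q * (2 * L)" using Z L by simp
  note rD = roomD[OF rm(1)]
  have SS: "(l + 2) * Z < S"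
  proof -
    have "(l + 2) * Z \<le> (g + 2) * Z" using rm(2) by (intro mult_right_mono) auto
    also have "\<dots> < S" by (rule rD(5)[of 0]) simp
    finally show ?thesis .
  qed
  have gS: "g + 2 \<le> S" using rD(2)[of "g+2"] by simp
  have ZS: "Z \<le> S" using SS by simp
  have Z2S: "2 * Z < S" using rD(4)[of 1] rm(2) by simp
  have BB: "8 * (B * B) \<le> S" using rD(1)[of 0] by simp
  have BS: "2 * B \<le> S"
  proof -
    have "2 * B \<le> 8 * (B * B)" using B by simp
    then show ?thesis using BB by linarith
  qed
  obtain sg1 where 1: "run offs_code sg sg1" "vr sg1 = (vr sg)(37 := l * Z, 38 := Suc l * Z)" "ar sg1 = ar sg" "tm sg1 = tm sg + 8"
    using offs_run[OF v(1,2) SS] by auto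
  obtain sg2 where 2: "run (asg 10 (Var 30 [+] Cst 1)) sg1 sg2" "vr sg2 = (vr sg1)(10 := Suc l)" "ar sg2 = ar sg" "tm sg2 = tm sg + 12"
    using asg_ex[of sg1 "Var 30 [+] Cst 1" 10 "Suc l"] 1 v rm(2) gS by auto
  obtain sg3 where 3: "run (asg 12 (Var 31)) sg2 sg3" "vr sg3 = (vr sg2)(12 := Z)" "ar sg3 = ar sg" "tm sg3 = tm sg + 14"
    using asg_ex[of sg2 "Var 31" 12 Z] 1 2 v ZS by auto
  let ?A = "Arr 5 (Var 37 [+] vI)" and ?B = "Arr 5 (Var 37 [+] vI [+] eL)"
  have d: "ar sg 5 (l * Z + i) \<le> 2 * B" if "i < Z" for i using nt that by (auto simp: ntree_def less_imp_le_nat intro: order_trans)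
  have lZ: "l * Z + i < S" "Suc l * Z + i < S" if "i < Z" for i using SS that by (simp_all add: algebra_simps)
  have B2: "2 \<le> B" using B by simp
  have "\<exists>sg'. run (mulx_code ?A ?B) sg3 sg' \<and> frame ({11} \<union> {13..29} \<union> {36}) {8..13} sg3 sg' \<and>
     tm sg' \<le> tm sg3 + 250000 * ((Suc l + 2) ^ 3 * (Z + 2 ^ Suc l + 1)) \<and> (\<forall>i<Z. ar sg' 13 i < B) \<and>
     (\<forall>p<Q. [nval B (ar sg' 13) (p * 2 ^ Suc l) (2 ^ Suc l) =
        nval B (\<lambda>i. ar sg 5 (l * Z + i)) (p * 2 ^ Suc l) (2 ^ (Suc l - 1)) *
        nval B (\<lambda>i. ar sg 5 (l * Z + i + 2 ^ l)) (p * 2 ^ Suc l) (2 ^ (Suc l - 1))] (mod B ^ 2 ^ Suc l))"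
  proof (rule mulx_run)
    fix i assume i: "i < Z" "i mod 2 ^ Suc l < 2 ^ (Suc l - 1)"
    then have h: "i + 2 ^ l < Z" using half_block[OF Z', of i] L by (simp add: L_def)
    show "ok (upv 24 i (upv 36 (2 ^ (Suc l - 1)) sg3)) ?A \<and> ev (upv 24 i (upv 36 (2 ^ (Suc l - 1)) sg3)) ?A = ar sg 5 (l * Z + i) \<and>
       ar sg 5 (l * Z + i) \<le> 2 * B"
      using 1 2 3 v lZ[OF i(1)] d[OF i(1)] by simp
    show "ok (upv 24 i (upv 36 (2 ^ (Suc l - 1)) sg3)) ?B \<and> ev (upv 24 i (upv 36 (2 ^ (Suc l - 1)) sg3)) ?B = ar sg 5 (l * Z + i + 2 ^ l) \<and>
       ar sg 5 (l * Z + i + 2 ^ l) \<le> 2 * B"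
      using 1 2 3 v lZ[OF h] d[OF h] by (simp add: add.assoc)
  qed (use 1 2 3 v Z B2 rm(2) rD(1-3)[of "Suc l"] in auto)
  then obtain sg4 where 4: "run (mulx_code ?A ?B) sg3 sg4" "frame ({11} \<union> {13..29} \<union> {36}) {8..13} sg3 sg4"
     "tm sg4 \<le> tm sg3 + 250000 * ((Suc l + 2) ^ 3 * (Z + 2 ^ Suc l + 1))" "\<forall>i<Z. ar sg4 13 i < B"
     "\<forall>p<Q. [nval B (ar sg4 13) (p * 2 ^ Suc l) (2 ^ Suc l) =
        nval B (\<lambda>i. ar sg 5 (l * Z + i)) (p * 2 ^ Suc l) (2 ^ (Suc l - 1)) *
        nval B (\<lambda>i. ar sg 5 (l * Z + i + 2 ^ l)) (p * 2 ^ Suc l) (2 ^ (Suc l - 1))] (mod B ^ 2 ^ Suc l)" by blast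
  note f4 = frame_vr[OF 4(2)] frame_ar[OF 4(2)]
  have "\<exists>sg'. run (map_loop 7 24 31 (Arr 13 vI)) sg4 sg' \<and> tm sg' \<le> tm sg4 + 500 * (Z + 1) \<and> vr sg' = (vr sg4)(24 := Z) \<and>
     ar sg' = (ar sg4)(7 := (\<lambda>i. if i < Z then ev (upv 24 i sg4) (Arr 13 vI) else ar sg4 7 i))"
    by (rule run_map) (use f4 1 2 3 v ZS in auto)
  then obtain sg5 where 5: "run (map_loop 7 24 31 (Arr 13 vI)) sg4 sg5" "tm sg5 \<le> tm sg4 + 500 * (Z + 1)" "vr sg5 = (vr sg4)(24 := Z)"
     "ar sg5 = (ar sg4)(7 := (\<lambda>i. if i < Z then ev (upv 24 i sg4) (Arr 13 vI) else ar sg4 7 i))" by blast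
  obtain sg6 where 6: "run (asg 10 (Var 30 [+] Cst 2)) sg5 sg6" "vr sg6 = (vr sg5)(10 := l + 2)" "ar sg6 = ar sg5" "tm sg6 = tm sg5 + 4"
    using asg_ex[of sg5 "Var 30 [+] Cst 2" 10 "l + 2"] 1 2 3 f4 5 v rm(2) gS by auto
  obtain sg7 where 7: "run (asg 12 (Cst 2 [*] Var 31)) sg6 sg7" "vr sg7 = (vr sg6)(12 := 2 * Z)" "ar sg7 = ar sg5" "tm sg7 = tm sg5 + 8"
    using asg_ex[of sg6 "Cst 2 [*] Var 31" 12 "2 * Z"] 1 2 3 f4 5 6 v Z2S by auto
  have v7: "vr sg7 30 = l" "vr sg7 31 = Z" "vr sg7 32 = L" "vr sg7 5 = B" "vr sg7 38 = Suc l * Z" "vr sg7 10 = l + 2" "vr sg7 12 = 2 * Z"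
    using 1 2 3 f4 5 6 7 v by (auto simp: L_def)
  have a7: "ar sg7 4 = ar sg 4" "ar sg7 5 = ar sg 5" "\<And>i. i < Z \<Longrightarrow> ar sg7 7 i = ar sg4 13 i" "\<And>i. i < Z \<Longrightarrow> ar sg7 7 i < B"
    using 3 f4 5 7 4(4) by auto
  have Z2: "2 * Z = Q * (4 * L)" using Z' by simp
  define fx where "fx i = ar sg 4 (Suc l * Z + i div (4*L) * (2*L) + i mod (4*L))" for i
  define fj where "fj i = (if i mod (4*L) < L then ar sg4 13 (i div (4*L) * (2*L) + i mod (4*L)) else 0)" for i
  let ?X = "Arr 4 (Var 38 [+] vI [div] e4L [*] e2L [+] vI [mod] e4L)"
  have je: "ok (upv 24 i (upv 36 h sg')) jt_expr \<and> ev (upv 24 i (upv 36 h sg')) jt_expr = fj i \<and> fj i \<le> 2 * B"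
    if "i < 2 * Z" "vr sg' 32 = L" "ar sg' 7 = ar sg7 7" for i h sg'
  proof (cases "i mod (4*L) < L")
    case True
    then have "i div (4*L) * (2*L) + i mod (4*L) < Z" using block_shrink[of i Q "4*L" "2*L"] that(1) Z2 Z' by simp
    then show ?thesis using True that a7(3,4)[of "i div (4*L) * (2*L) + i mod (4*L)"] ZS by (auto simp: jt_expr_def fj_def)
  qed (use that in \<open>auto simp: jt_expr_def fj_def\<close>)
  have "\<exists>sg'. run (mulx_code ?X jt_expr) sg7 sg' \<and> frame ({11} \<union> {13..29} \<union> {36}) {8..13} sg7 sg' \<and>
     tm sg' \<le> tm sg7 + 250000 * ((l + 2 + 2) ^ 3 * (2 * Z + 2 ^ (l + 2) + 1)) \<and> (\<forall>i<2 * Z. ar sg' 13 i < B) \<and>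
     (\<forall>p<Q. [nval B (ar sg' 13) (p * 2 ^ (l + 2)) (2 ^ (l + 2)) =
        nval B fx (p * 2 ^ (l + 2)) (2 ^ (l + 2 - 1)) * nval B fj (p * 2 ^ (l + 2)) (2 ^ (l + 2 - 1))] (mod B ^ 2 ^ (l + 2)))"
  proof (rule mulx_run)
    fix i assume i: "i < 2 * Z" "i mod 2 ^ (l + 2) < 2 ^ (l + 2 - 1)"
    then have "i div (4*L) * (2*L) + i mod (4*L) < Z" using block_shrink[of i Q "4*L" "2*L"] Z2 Z' L by simp
    note k = this lZ(2)[OF this]
    have "fx i < B" using pt k(1) by (auto simp: ptree_def fx_def add.assoc)
    then show "ok (upv 24 i (upv 36 (2 ^ (l + 2 - 1)) sg7)) ?X \<and> ev (upv 24 i (upv 36 (2 ^ (l + 2 - 1)) sg7)) ?X = fx i \<and> fx i \<le> 2 * B"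
      using v7 a7 k(2) by (auto simp: fx_def add.assoc)
    show "ok (upv 24 i (upv 36 (2 ^ (l + 2 - 1)) sg7)) jt_expr \<and> ev (upv 24 i (upv 36 (2 ^ (l + 2 - 1)) sg7)) jt_expr = fj i \<and> fj i \<le> 2 * B"
      by (rule je) (use i v7 in auto)
  qed (use v7 Z2 L B2 rm(2) rD(1,2,4)[of "l + 2"] in \<open>auto simp: jt_expr_def\<close>)
  then obtain sg8 where 8: "run (mulx_code ?X jt_expr) sg7 sg8" "frame ({11} \<union> {13..29} \<union> {36}) {8..13} sg7 sg8"
     "tm sg8 \<le> tm sg7 + 250000 * ((l + 2 + 2) ^ 3 * (2 * Z + 2 ^ (l + 2) + 1))" "\<forall>i<2 * Z. ar sg8 13 i < B"
     "\<forall>p<Q. [nval B (ar sg8 13) (p * 2 ^ (l + 2)) (2 ^ (l + 2)) =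
        nval B fx (p * 2 ^ (l + 2)) (2 ^ (l + 2 - 1)) * nval B fj (p * 2 ^ (l + 2)) (2 ^ (l + 2 - 1))] (mod B ^ 2 ^ (l + 2))" by blast
  note f8 = frame_vr[OF 8(2)] frame_ar[OF 8(2)]
  let ?Y = "Ite (vI [mod] e4L) (Cst 1) (Arr 13 vI [+] Var 5 [-] Cst 2) (Arr 13 vI [+] Var 5 [-] Cst 1)"
  define fy where "fy i = ar sg8 13 i + (if i mod (4*L) = 0 then B - 2 else B - 1)" for i
  have "\<exists>sg'. run (mulx_code ?Y jt_expr) sg8 sg' \<and> frame ({11} \<union> {13..29} \<union> {36}) {8..13} sg8 sg' \<and>
     tm sg' \<le> tm sg8 + 250000 * ((l + 2 + 2) ^ 3 * (2 * Z + 2 ^ (l + 2) + 1)) \<and> (\<forall>i<2 * Z. ar sg' 13 i < B) \<and>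
     (\<forall>p<Q. [nval B (ar sg' 13) (p * 2 ^ (l + 2)) (2 ^ (l + 2)) =
        nval B fy (p * 2 ^ (l + 2)) (2 ^ (l + 2 - 1)) * nval B fj (p * 2 ^ (l + 2)) (2 ^ (l + 2 - 1))] (mod B ^ 2 ^ (l + 2)))"
  proof (rule mulx_run)
    fix i assume i: "i < 2 * Z" "i mod 2 ^ (l + 2) < 2 ^ (l + 2 - 1)"
    have "ar sg8 13 i < B" using 8(4) i by blast
    moreover have "ar sg8 13 i \<le> S" using calculation BS by linarith
    ultimately show "ok (upv 24 i (upv 36 (2 ^ (l + 2 - 1)) sg8)) ?Y \<and> ev (upv 24 i (upv 36 (2 ^ (l + 2 - 1)) sg8)) ?Y = fy i \<and> fy i \<le> 2 * B"
      using v7 f8 i(1) Z2S B by (cases "i mod (4*L) = 0") (auto simp: fy_def)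
    show "ok (upv 24 i (upv 36 (2 ^ (l + 2 - 1)) sg8)) jt_expr \<and> ev (upv 24 i (upv 36 (2 ^ (l + 2 - 1)) sg8)) jt_expr = fj i \<and> fj i \<le> 2 * B"
      by (rule je) (use i v7 f8 in auto)
  qed (use v7 f8 Z2 L B2 rm(2) rD(1,2,4)[of "l + 2"] in \<open>auto simp: jt_expr_def\<close>)
  then obtain sg9 where 9: "run (mulx_code ?Y jt_expr) sg8 sg9" "frame ({11} \<union> {13..29} \<union> {36}) {8..13} sg8 sg9"
     "tm sg9 \<le> tm sg8 + 250000 * ((l + 2 + 2) ^ 3 * (2 * Z + 2 ^ (l + 2) + 1))" "\<forall>i<2 * Z. ar sg9 13 i < B"
     "\<forall>p<Q. [nval B (ar sg9 13) (p * 2 ^ (l + 2)) (2 ^ (l + 2)) =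
        nval B fy (p * 2 ^ (l + 2)) (2 ^ (l + 2 - 1)) * nval B fj (p * 2 ^ (l + 2)) (2 ^ (l + 2 - 1))] (mod B ^ 2 ^ (l + 2))" by blast
  note f9 = frame_vr[OF 9(2)] frame_ar[OF 9(2)]
  let ?E = "Arr 13 (vI [div] e2L [*] e4L [+] vI [mod] e2L)"
  have ixE: "i div (2*L) * (4*L) + i mod (2*L) < 2 * Z" if "i < Z" for i
  proof -
    have "i div (2*L) < Q" using that Z' by (simp add: less_mult_imp_div_less)
    then have "(i div (2*L) + 1) * (4*L) \<le> 2 * Z" unfolding Z2 by (intro mult_right_mono) auto
    moreover have "i mod (2*L) < 2*L" using L(4) by simp
    ultimately show ?thesis by simp
  qed
  have "\<exists>sg'. run (smap_loop 5 38 31 ?E) sg9 sg' \<and> tm sg' \<le> tm sg9 + 500 * (Z + 1) \<and> vr sg' = (vr sg9)(24 := Z) \<and>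
     ar sg' = (ar sg9)(5 := (\<lambda>x. if Suc l * Z \<le> x \<and> x < Suc l * Z + Z then ev (upv 24 (x - Suc l * Z) sg9) ?E else ar sg9 5 x))"
  proof (rule run_smap)
    show "ok (upv 24 i sg9) ?E" if "i < Z" for i using ixE[OF that] Z2S v7 f8 f9 by auto
  qed (use f8 f9 v7 SS ZS in auto)
  then obtain sg10 where 10: "run (smap_loop 5 38 31 ?E) sg9 sg10" "tm sg10 \<le> tm sg9 + 500 * (Z + 1)" "vr sg10 = (vr sg9)(24 := Z)"
     "ar sg10 = (ar sg9)(5 := (\<lambda>x. if Suc l * Z \<le> x \<and> x < Suc l * Z + Z then ev (upv 24 (x - Suc l * Z) sg9) ?E else ar sg9 5 x))" by blast
  have a10: "ar sg10 5 (Suc l * Z + i) = ar sg9 13 (i div (2*L) * (4*L) + i mod (2*L))" if "i < Z" for i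
    using 10(4) that v7 f8 f9 by simp
  have nt': "ntree B Z (ar sg10 5) x (Suc l)" unfolding ntree_def
  proof (intro conjI allI impI)
    fix i assume i: "i < Z" then show "ar sg10 5 (Suc l * Z + i) < B" using a10[OF i] 9(4) ixE[OF i] by simp
  next
    fix c assume c: "(c + 1) * 2 ^ Suc l \<le> Z"
    then have "(c + 1) * 2 ^ Suc l \<le> Q * 2 ^ Suc l" using Z by simp
    then have cQ: "c < Q" by (rule block_count) simp
    have c': "c * (2 * L) + 2 * L \<le> Z" "c * (4 * L) + 4 * L \<le> 2 * Z" using c L by simp_all
    have c1: "(2 * c + 1) * 2 ^ l \<le> Z" "(2 * c + 1 + 1) * 2 ^ l \<le> Z" using c by (simp_all add: algebra_simps)
    define D where "D = B ^ L"
    have DD: "B ^ 2 ^ Suc l = D * D" "B ^ (2 * L) = D * D" unfolding L D_def by (simp_all add: power_add[symmetric] mult_2)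
    have D2: "2 \<le> D"
    proof -
      have "B ^ 1 \<le> B ^ L" using L(4) B2 by (intro power_increasing) auto
      then show ?thesis using B2 by (simp add: D_def)
    qed
    define J where "J = nval B (ar sg4 13) (c * (2*L)) L"
    have in1: "(c * (4*L) + i) div (4*L) = c" "(c * (4*L) + i) mod (4*L) = i" if "i < 2*L" for i
      by (rule block_div_mod, use that in simp)+
    have in2: "(c * (2*L) + i) div (2*L) = c" "(c * (2*L) + i) mod (2*L) = i" if "i < 2*L" for i
      by (rule block_div_mod, use that in simp)+
    have vN: "nval B (ar sg10 5) (Suc l * Z + c * 2 ^ Suc l) (2 ^ Suc l) = nval B (ar sg9 13) (c * (4*L)) (2*L)"
      unfolding L(1) by (rule nval_cong) (use a10 in2 c' in \<open>simp add: add.assoc\<close>)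
    have vX: "nval B fx (c * (4*L)) (2*L) = pv x (Suc l) c"
    proof -
      have "nval B fx (c * (4*L)) (2*L) = nval B (ar sg 4) (Suc l * Z + c * (2*L)) (2*L)"
        by (rule nval_cong) (simp add: fx_def in1 add.assoc)
      then show ?thesis using pt c unfolding ptree_def L(1) by simp
    qed
    have vJ: "nval B fj (c * (4*L)) (2*L) = J"
    proof -
      have "nval B fj (c * (4*L)) (L + L) = nval B fj (c * (4*L)) L"
        by (rule nval_cut) (simp add: fj_def in1)
      also have "\<dots> = J" unfolding J_def by (rule nval_cong) (simp add: fj_def in1)
      finally show ?thesis by (simp add: mult_2)
    qed
    have vY: "nval B fy (c * (4*L)) (2*L) = nval B (ar sg8 13) (c * (4*L)) (2*L) + (D * D - 2)"
    proof -
      \<comment> \<open>These are the digits of \<open>D * D - 2\<close>. Adding them digitwise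
        subtracts \<open>2\<close> modulo \<open>D * D\<close> without borrowing.\<close>
      define u where "u i = (if i mod (4*L) = 0 then B - 2 else B - 1)" for i
      have "nval B u (c * (4*L)) (2*L) + 1 = nval B (\<lambda>_. B - 1) (c * (4*L)) (2*L)"
      proof -
        obtain m where m: "2 * L = Suc m" using L(4) by (cases "2 * L") auto
        have "u (c * (4*L)) = B - 2" by (simp add: u_def)
        moreover have "u (c * (4*L) + Suc i) = B - 1" if "i < m" for i using in1(2)[of "Suc i"] m that by (simp add: u_def)
        ultimately have "nval B u (c * (4*L)) (2*L) = (B - 2) + (\<Sum>i<m. (B - 1) * B ^ Suc i)"
          unfolding nval_def m sum.lessThan_Suc_shift by simp
        moreover have "nval B (\<lambda>_. B - 1) (c * (4*L)) (2*L) = (B - 1) + (\<Sum>i<m. (B - 1) * B ^ Suc i)"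
          unfolding nval_def m sum.lessThan_Suc_shift by simp
        ultimately show ?thesis using B by simp
      qed
      then have "nval B u (c * (4*L)) (2*L) = D * D - 2" using nval_ones[of B "c * (4*L)" "2*L"] B2 DD by simp
      then show ?thesis unfolding fy_def nval_add_const u_def by simp
    qed
    \<comment> \<open>Cutting J to its low \<open>L\<close> digits only changes it by a multiple of
      \<open>D\<close>.\<close>
    have lowJ: "[J = nval B (ar sg 5) (l * Z + 2 * c * 2 ^ l) (2 ^ l) * nval B (ar sg 5) (l * Z + (2 * c + 1) * 2 ^ l) (2 ^ l)] (mod D)"
    proof -
      have "[nval B (ar sg4 13) (c * (2*L)) (2*L) = nval B (\<lambda>i. ar sg 5 (l * Z + i)) (c * (2*L)) L * nval B (\<lambda>i. ar sg 5 (l * Z + i + L)) (c * (2*L)) L] (mod D * D)"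
        using 4(5) cQ unfolding L(1) L_def[symmetric] DD[symmetric] by (simp add: L_def)
      then have "[nval B (ar sg4 13) (c * (2*L)) (2*L) = nval B (\<lambda>i. ar sg 5 (l * Z + i)) (c * (2*L)) L * nval B (\<lambda>i. ar sg 5 (l * Z + i + L)) (c * (2*L)) L] (mod D)"
        by (rule cong_dvd_modulus_nat) simp
      moreover have "[nval B (ar sg4 13) (c * (2*L)) (2*L) = J] (mod D)" unfolding J_def D_def mult_2[of L] by (rule nval_low)
      moreover have "nval B (\<lambda>i. ar sg 5 (l * Z + i)) (c * (2*L)) L = nval B (ar sg 5) (l * Z + 2 * c * 2 ^ l) (2 ^ l)"
        by (simp add: nval_def L_def algebra_simps)
      moreover have "nval B (\<lambda>i. ar sg 5 (l * Z + i + L)) (c * (2*L)) L = nval B (ar sg 5) (l * Z + (2 * c + 1) * 2 ^ l) (2 ^ l)"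
        by (simp add: nval_def L_def algebra_simps)
      ultimately show ?thesis by (simp add: cong_def)
    qed
    \<comment> \<open>The products are computed modulo B^(4L), but only their low
      \<open>2 * L\<close> digits are used further.\<close>
    have low2: "[nval B f (c * (4*L)) (2*L) = a * b] (mod D * D)"
      if "[nval B f (c * 2 ^ (l + 2)) (2 ^ (l + 2)) = a * b] (mod B ^ 2 ^ (l + 2))" for f a b
    proof -
      have "[nval B f (c * (4*L)) (2*L + 2*L) = a * b] (mod B ^ (2*L + 2*L))"
        using that unfolding L by simp
      then have "[nval B f (c * (4*L)) (2*L + 2*L) = a * b] (mod B ^ (2*L))"
        by (rule cong_dvd_modulus_nat) (simp add: le_imp_power_dvd)
      moreover have "[nval B f (c * (4*L)) (2*L + 2*L) = nval B f (c * (4*L)) (2*L)] (mod B ^ (2*L))" by (rule nval_low)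
      ultimately show ?thesis unfolding DD by (simp add: cong_def)
    qed
    have hl: "2 ^ (l + 2 - 1) = 2 * L" by (simp add: L_def)
    have Yc: "[nval B (ar sg8 13) (c * (4*L)) (2*L) = pv x l (2 * c) * pv x l (2 * c + 1) * J] (mod D * D)"
    proof (rule low2)
      have "[nval B (ar sg8 13) (c * 2 ^ (l + 2)) (2 ^ (l + 2)) =
        nval B fx (c * 2 ^ (l + 2)) (2 ^ (l + 2 - 1)) * nval B fj (c * 2 ^ (l + 2)) (2 ^ (l + 2 - 1))] (mod B ^ 2 ^ (l + 2))"
        using 8(5) cQ by blast
      moreover have "nval B fx (c * 2 ^ (l + 2)) (2 ^ (l + 2 - 1)) = pv x l (2 * c) * pv x l (2 * c + 1)"
        unfolding hl unfolding L(2) vX pv_Suc ..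
      moreover have "nval B fj (c * 2 ^ (l + 2)) (2 ^ (l + 2 - 1)) = J" unfolding hl unfolding L(2) vJ ..
      ultimately show "[nval B (ar sg8 13) (c * 2 ^ (l + 2)) (2 ^ (l + 2)) = pv x l (2 * c) * pv x l (2 * c + 1) * J] (mod B ^ 2 ^ (l + 2))"
        by simp
    qed
    have Nc: "[nval B (ar sg9 13) (c * (4*L)) (2*L) = (nval B (ar sg8 13) (c * (4*L)) (2*L) + (D * D - 2)) * J] (mod D * D)"
    proof (rule low2)
      have "[nval B (ar sg9 13) (c * 2 ^ (l + 2)) (2 ^ (l + 2)) =
        nval B fy (c * 2 ^ (l + 2)) (2 ^ (l + 2 - 1)) * nval B fj (c * 2 ^ (l + 2)) (2 ^ (l + 2 - 1))] (mod B ^ 2 ^ (l + 2))"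
        using 9(5) cQ by blast
      moreover have "nval B fy (c * 2 ^ (l + 2)) (2 ^ (l + 2 - 1)) = nval B (ar sg8 13) (c * (4*L)) (2*L) + (D * D - 2)"
        unfolding hl unfolding L(2) vY ..
      moreover have "nval B fj (c * 2 ^ (l + 2)) (2 ^ (l + 2 - 1)) = J" unfolding hl unfolding L(2) vJ ..
      ultimately show "[nval B (ar sg9 13) (c * 2 ^ (l + 2)) (2 ^ (l + 2)) = (nval B (ar sg8 13) (c * (4*L)) (2*L) + (D * D - 2)) * J] (mod B ^ 2 ^ (l + 2))"
        by simp
    qed
    have "D dvd pv x l (2 * c) * nval B (ar sg 5) (l * Z + 2 * c * 2 ^ l) (2 ^ l) + 1"
      using nt c1(1) unfolding ntree_def D_def L_def by blast
    moreover have "D dvd pv x l (2 * c + 1) * nval B (ar sg 5) (l * Z + (2 * c + 1) * 2 ^ l) (2 ^ l) + 1"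
      using nt c1(2) unfolding ntree_def D_def L_def by blast
    ultimately have "D * D dvd pv x l (2 * c) * pv x l (2 * c + 1) * nval B (ar sg9 13) (c * (4*L)) (2*L) + 1"
      using lowJ Yc Nc D2 by (rule newton_step)
    then show "B ^ 2 ^ Suc l dvd pv x (Suc l) c * nval B (ar sg10 5) (Suc l * Z + c * 2 ^ Suc l) (2 ^ Suc l) + 1"
      unfolding DD vN pv_Suc .
  qed
  have t: "tm sg10 \<le> tm sg + 800000 * ((l + 4) ^ 3 * (2 * Z + 2 ^ (l + 2) + 1))"
  proof -
    define Y where "Y = (l + 4) ^ 3 * (2 * Z + 2 ^ (l + 2) + 1)"
    have "1 * (2 * Z + 2 ^ (l + 2) + 1) \<le> Y" unfolding Y_def by (intro mult_right_mono one_le_power) auto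
    then have q: "Z + 1 \<le> Y" by simp
    have "(Suc l + 2) ^ 3 * (Z + 2 ^ Suc l + 1) \<le> Y" unfolding Y_def by (intro mult_le_mono power_mono) auto
    moreover have "l + 2 + 2 = l + 4" by simp
    then have "(l + 2 + 2) ^ 3 * (2 * Z + 2 ^ (l + 2) + 1) = Y" unfolding Y_def by metis
    moreover have "t10 \<le> t + 800000 * Y" if "t3 = t + 14" "t4 \<le> t3 + 250000 * y" "y \<le> Y" "t5 \<le> t4 + 500 * (Z + 1)" "t7 = t5 + 8"
      "t8 \<le> t7 + 250000 * Y" "t9 \<le> t8 + 250000 * Y" "t10 \<le> t9 + 500 * (Z + 1)" for t t3 t4 t5 t7 t8 t9 t10 y :: nat
      using that q by simp
    ultimately have "tm sg10 \<le> tm sg + 800000 * Y" using 3(4) 4(3) 5(2) 7(4) 8(3) 9(3) 10(2) by metis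
    then show ?thesis by (simp only: Y_def)
  qed
  have fr: "frame ({10..29} \<union> {36,37,38}) ({8..13} \<union> {5,7}) sg sg10"
  proof -
    have "frame ({10..29} \<union> {36,37,38}) ({8..13} \<union> {5,7}) sg sg3" using 1 2 3 by (auto simp: frame_def)
    moreover have "frame ({10..29} \<union> {36,37,38}) ({8..13} \<union> {5,7}) sg3 sg4" by (rule frame_mono[OF 4(2)]) auto
    moreover have "frame ({10..29} \<union> {36,37,38}) ({8..13} \<union> {5,7}) sg4 sg7" using 5 6 7 by (auto simp: frame_def)
    moreover have "frame ({10..29} \<union> {36,37,38}) ({8..13} \<union> {5,7}) sg7 sg8" by (rule frame_mono[OF 8(2)]) auto
    moreover have "frame ({10..29} \<union> {36,37,38}) ({8..13} \<union> {5,7}) sg8 sg9" by (rule frame_mono[OF 9(2)]) auto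
    moreover have "frame ({10..29} \<union> {36,37,38}) ({8..13} \<union> {5,7}) sg9 sg10" using 10 by (auto simp: frame_def)
    ultimately show ?thesis by (meson frame_trans subset_refl)
  qed
  show ?thesis unfolding upn_code_def
    by (rule exI[of _ sg10], intro conjI run_Seq[OF 1(1)] run_Seq[OF 2(1)] run_Seq[OF 3(1)] run_Seq[OF 4(1)] run_Seq[OF 5(1)]
        run_Seq[OF 6(1)] run_Seq[OF 7(1)] run_Seq[OF 8(1)] run_Seq[OF 9(1)] 10(1) fr t nt')
       (use 10(4) a7(2) f8(2)[of 5] f9(2)[of 5] in auto)
qed

end

section \<open>The remainder tree\<close>

text \<open>
  Montgomery reduction: adding a multiple of the modulus makes \<open>V\<close> divisible by \<open>D\<close>, a unit modulo \<open>X\<close>.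
\<close>

lemma montgomery_step:
  fixes V q X N b L :: nat
  assumes B: "B = 4 * b" "1 \<le> b" and D: "D = B ^ L" and L: "1 \<le> L"
    and V: "V \<le> 2 * (b ^ L * b ^ L)" and X: "X \<le> b ^ L" and q: "q < D" "[q = V * N] (mod D)" and N: "D dvd X * N + 1"
  shows "D dvd V + q * X" "V + q * X \<le> D * (2 * b ^ L)" "V + q * X < D * D"
proof -
  have D4: "D = 4 ^ L * b ^ L" unfolding D B by (simp add: power_mult_distrib)
  have "[V + q * X = V + V * N * X] (mod D)" using q(2) by (intro cong_add cong_mult cong_refl)
  also have "V + V * N * X = V * (X * N + 1)" by (simp add: algebra_simps)
  also have "[\<dots> = 0] (mod D)" unfolding cong_0_iff using N by (rule dvd_mult)
  finally show "D dvd V + q * X" by (simp add: cong_0_iff)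
  have "(4::nat) ^ 1 \<le> 4 ^ L" using L by (intro power_increasing) auto
  then have four: "(4::nat) \<le> 4 ^ L" by simp
  have bb: "2 * b ^ L \<le> D" unfolding D4 using four by (intro mult_right_mono) auto
  have "V + q * X \<le> 2 * b ^ L * b ^ L + D * b ^ L"
    using V mult_le_mono[OF less_imp_le[OF q(1)] X] by simp
  also have "\<dots> \<le> D * b ^ L + D * b ^ L" using mult_le_mono1[OF bb, of "b ^ L"] by linarith
  finally show le: "V + q * X \<le> D * (2 * b ^ L)" by simp
  have "0 < b ^ L" using B(2) by simp
  then have "2 * b ^ L < D" unfolding D4 using four by (simp add: less_le_trans[of 2 4])
  then have "D * (2 * b ^ L) < D * D" by simp
  with le show "V + q * X < D * D" by linarith
qed

text \<open>Remainders themselves are not preserved, since each reduction divides by a power of the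
  base. What survives is the gcd with every leaf below the node, recorded in \<open>G\<close>,
  together with the size bound \<open>2 * b ^ 2 ^ l\<close>, which each step reproduces for the
  children.\<close>

definition vtree :: "nat \<Rightarrow> nat \<Rightarrow> nat \<Rightarrow> (nat \<Rightarrow> nat) \<Rightarrow> (nat \<Rightarrow> nat) \<Rightarrow> (nat \<Rightarrow> nat) \<Rightarrow> nat \<Rightarrow> bool" where
  "vtree B b Z V x G l \<longleftrightarrow> (\<forall>i<Z. V i < B) \<and>
     (\<forall>c. (c + 1) * 2 ^ l \<le> Z \<longrightarrow> nval B V (c * 2 ^ l) (2 ^ l) \<le> 2 * b ^ 2 ^ l \<and>
        (\<forall>j<2 ^ l. gcd (nval B V (c * 2 ^ l) (2 ^ l)) (x (c * 2 ^ l + j)) = G (c * 2 ^ l + j)))"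

definition pval_expr :: expr where
  "pval_expr = Arr 6 (vI [div] e4L [*] e2L [+] vI [mod] e2L)"

definition child_expr :: "nat \<Rightarrow> expr" where
  "child_expr a = Arr a (Var 37 [+] vI [div] e2L [*] eL [+] vI [mod] e2L)"

text \<open>Every parent value V is handed to both children, hence arrays of length 2Z. For a child
  X with negated inverse N, the low half of V times N gives q, and the upper half of V + q X is the
  exact quotient by D = B^(2^l), the new value.\<close>

definition down_code :: com where
  "down_code = offs_code ;; asg 10 (Var 30 [+] Cst 1) ;; asg 12 (Cst 2 [*] Var 31) ;;
     mulx_code pval_expr (child_expr 5) ;; mulx_code (Arr 13 vI) (child_expr 4) ;;
     map_loop 8 24 12 (Arr 13 vI [+] pval_expr) ;; asg 29 e2L ;; carry_code 8 ;;
     map_loop 6 24 31 (Arr 13 (vI [div] eL [*] e2L [+] eL [+] vI [mod] eL))"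

lemma gcd_mult_coprime: "coprime d x \<Longrightarrow> gcd (d * v) x = gcd v x" for d v x :: nat
  by (rule gcd_mult_left_left_cancel) (simp add: coprime_commute)

context ram
begin

lemma down_run:
  assumes v: "vr sg 30 = l" "vr sg 31 = Z" "vr sg 32 = 2 ^ l" "vr sg 5 = B" and Z: "Z = Q * 2 ^ Suc l"
    and B: "B = 4 * b" "1 \<le> b" and xb: "\<And>i. i < Z \<Longrightarrow> x i \<le> b" and cop: "\<And>i. i < Z \<Longrightarrow> coprime B (x i)"
    and rm: "room g Z B" "l < g" and pt: "ptree B Z (ar sg 4) x l" and nt: "ntree B Z (ar sg 5) x l"
    and vt: "vtree B b Z (ar sg 6) x G (Suc l)"
  shows "\<exists>sg'. run down_code sg sg' \<and> frame ({10..29} \<union> {36,37,38}) ({8..13} \<union> {6}) sg sg' \<and>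
     tm sg' \<le> tm sg + 800000 * ((l + 3) ^ 3 * (2 * Z + 2 ^ Suc l + 1)) \<and> vtree B b Z (ar sg' 6) x G l"
proof -
  define L where "L = (2::nat) ^ l"
  have L: "2 ^ Suc l = 2 * L" "0 < L" by (simp_all add: L_def)
  have Z': "Z = Q * (2 * L)" "2 * Z = Q * (4 * L)" "2 * Z = 2 * Q * (2 * L)" "Z = 2 * Q * L" using Z L by simp_all
  note rD = roomD[OF rm(1)]
  have SS: "(l + 2) * Z < S"
  proof -
    have "(l + 2) * Z \<le> (g + 2) * Z" using rm(2) by (intro mult_right_mono) auto
    also have "\<dots> < S" by (rule rD(5)[of 0]) simp
    finally show ?thesis .
  qed
  have gS: "g + 2 \<le> S" using rD(2)[of "g+2"] by simp
  have ZS: "Z \<le> S" using SS by simp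
  have Z2S: "2 * Z < S" using rD(4)[of 1] rm(2) by simp
  have BB: "8 * (B * B) \<le> S" using rD(1)[of 0] by simp
  have B4: "4 \<le> B" using B by simp
  have B2: "2 \<le> B" using B by simp
  have BS: "4 * B \<le> S"
  proof -
    have "4 * B \<le> 8 * (B * B)" using B4 by simp
    then show ?thesis using BB by linarith
  qed
  have LS: "2 * L \<le> S"
  proof -
    have "8 * 2 ^ Suc l * 1 \<le> 8 * 2 ^ Suc l * (B * B)" using B2 by (intro mult_left_mono) auto
    also have "\<dots> \<le> S" by (rule rD(1)) (use rm(2) in simp)
    finally show ?thesis using L by simp
  qed
  obtain sg1 where 1: "run offs_code sg sg1" "vr sg1 = (vr sg)(37 := l * Z, 38 := Suc l * Z)" "ar sg1 = ar sg" "tm sg1 = tm sg + 8"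
    using offs_run[OF v(1,2) SS] by auto
  obtain sg2 where 2: "run (asg 10 (Var 30 [+] Cst 1)) sg1 sg2" "vr sg2 = (vr sg1)(10 := Suc l)" "ar sg2 = ar sg" "tm sg2 = tm sg + 12"
    using asg_ex[of sg1 "Var 30 [+] Cst 1" 10 "Suc l"] 1 v rm(2) gS by auto
  obtain sg3 where 3: "run (asg 12 (Cst 2 [*] Var 31)) sg2 sg3" "vr sg3 = (vr sg2)(12 := 2 * Z)" "ar sg3 = ar sg" "tm sg3 = tm sg + 16"
    using asg_ex[of sg2 "Cst 2 [*] Var 31" 12 "2 * Z"] 1 2 v Z2S by auto
  have v3: "vr sg3 31 = Z" "vr sg3 32 = L" "vr sg3 5 = B" "vr sg3 37 = l * Z" "vr sg3 10 = Suc l" "vr sg3 12 = 2 * Z"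
    using 1 2 3 v by (auto simp: L_def)
  define fv where "fv i = ar sg 6 (i div (4*L) * (2*L) + i mod (2*L))" for i
  define fc where "fc a i = ar sg a (l * Z + i div (2*L) * L + i mod (2*L))" for a i
  have ixv: "i div (4*L) * (2*L) + i mod (2*L) < Z" if "i < 2 * Z" for i
  proof -
    have "i div (4*L) < Q" using that unfolding Z'(2) by (simp add: less_mult_imp_div_less)
    then have "(i div (4*L) + 1) * (2*L) \<le> Z" unfolding Z'(1) by (intro mult_right_mono) auto
    moreover have "i mod (2*L) < 2*L" using L(2) by simp
    ultimately show ?thesis by simp
  qed
  have ixc: "i div (2*L) * L + i mod (2*L) < Z" if "i < 2 * Z" "i mod (2*L) < L" for i
    using block_shrink[of i "2 * Q" "2*L" L] that Z' by simp
  have lZ: "l * Z + i < S" if "i < Z" for i using SS that by (simp add: algebra_simps)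
  have pe: "ok (upv 24 i sg') pval_expr \<and> ev (upv 24 i sg') pval_expr = fv i \<and> fv i < B \<and> small (upv 24 i sg') pval_expr"
    if "i < 2 * Z" "vr sg' 32 = L" "ar sg' 6 = ar sg 6" for i sg'
  proof -
    have "fv i < B" using vt ixv[OF that(1)] by (simp add: vtree_def fv_def)
    then show ?thesis using that ixv[OF that(1)] ZS BS by (auto simp: pval_expr_def fv_def)
  qed
  have ce: "ok (upv 24 i (upv 36 h sg')) (child_expr a) \<and> ev (upv 24 i (upv 36 h sg')) (child_expr a) = fc a i \<and> fc a i \<le> 2 * B"
    if "i < 2 * Z" "i mod (2*L) < L" "vr sg' 32 = L" "vr sg' 37 = l * Z" "ar sg' a = ar sg a" "a = 4 \<or> a = 5" for i a h sg'
  proof -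
    note k = ixc[OF that(1,2)]
    have "fc a i < B" using pt nt k that(6) by (auto simp: ptree_def ntree_def fc_def add.assoc)
    then show ?thesis using that lZ[OF k] by (auto simp: child_expr_def fc_def add.assoc)
  qed
  have st: "cost pval_expr \<le> 400" "8 \<notin> arrays pval_expr" "cost (child_expr a) \<le> 400" "arrays (child_expr a) = {a}" for a
    by (auto simp: pval_expr_def child_expr_def)
  have "\<exists>sg'. run (mulx_code pval_expr (child_expr 5)) sg3 sg' \<and> frame ({11} \<union> {13..29} \<union> {36}) {8..13} sg3 sg' \<and>
     tm sg' \<le> tm sg3 + 250000 * ((Suc l + 2) ^ 3 * (2 * Z + 2 ^ Suc l + 1)) \<and> (\<forall>i<2 * Z. ar sg' 13 i < B) \<and>
     (\<forall>p<2 * Q. [nval B (ar sg' 13) (p * 2 ^ Suc l) (2 ^ Suc l) =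
        nval B fv (p * 2 ^ Suc l) (2 ^ (Suc l - 1)) * nval B (fc 5) (p * 2 ^ Suc l) (2 ^ (Suc l - 1))] (mod B ^ 2 ^ Suc l))"
  proof (rule mulx_run)
    fix i assume i: "i < 2 * Z" "i mod 2 ^ Suc l < 2 ^ (Suc l - 1)"
    then have i': "i mod (2*L) < L" using L by (simp add: L_def)
    show "ok (upv 24 i (upv 36 (2 ^ (Suc l - 1)) sg3)) pval_expr \<and> ev (upv 24 i (upv 36 (2 ^ (Suc l - 1)) sg3)) pval_expr = fv i \<and> fv i \<le> 2 * B"
      using pe[OF i(1), of "upv 36 (2 ^ (Suc l - 1)) sg3"] v3 3(3) by auto
    show "ok (upv 24 i (upv 36 (2 ^ (Suc l - 1)) sg3)) (child_expr 5) \<and> ev (upv 24 i (upv 36 (2 ^ (Suc l - 1)) sg3)) (child_expr 5) = fc 5 i \<and> fc 5 i \<le> 2 * B"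
      by (rule ce[OF i(1) i']) (use v3 3(3) in auto)
  qed (use v3 Z' L B2 st rm(2) rD(1,2,4)[of "Suc l"] in auto)
  then obtain sg4 where 4: "run (mulx_code pval_expr (child_expr 5)) sg3 sg4" "frame ({11} \<union> {13..29} \<union> {36}) {8..13} sg3 sg4"
     "tm sg4 \<le> tm sg3 + 250000 * ((Suc l + 2) ^ 3 * (2 * Z + 2 ^ Suc l + 1))" "\<forall>i<2 * Z. ar sg4 13 i < B"
     "\<forall>p<2 * Q. [nval B (ar sg4 13) (p * 2 ^ Suc l) (2 ^ Suc l) =
        nval B fv (p * 2 ^ Suc l) (2 ^ (Suc l - 1)) * nval B (fc 5) (p * 2 ^ Suc l) (2 ^ (Suc l - 1))] (mod B ^ 2 ^ Suc l)" by blast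
  note f4 = frame_vr[OF 4(2)] frame_ar[OF 4(2)]
  have "\<exists>sg'. run (mulx_code (Arr 13 vI) (child_expr 4)) sg4 sg' \<and> frame ({11} \<union> {13..29} \<union> {36}) {8..13} sg4 sg' \<and>
     tm sg' \<le> tm sg4 + 250000 * ((Suc l + 2) ^ 3 * (2 * Z + 2 ^ Suc l + 1)) \<and> (\<forall>i<2 * Z. ar sg' 13 i < B) \<and>
     (\<forall>p<2 * Q. [nval B (ar sg' 13) (p * 2 ^ Suc l) (2 ^ Suc l) =
        nval B (ar sg4 13) (p * 2 ^ Suc l) (2 ^ (Suc l - 1)) * nval B (fc 4) (p * 2 ^ Suc l) (2 ^ (Suc l - 1))] (mod B ^ 2 ^ Suc l))"
  proof (rule mulx_run)
    fix i assume i: "i < 2 * Z" "i mod 2 ^ Suc l < 2 ^ (Suc l - 1)"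
    then have i': "i mod (2*L) < L" using L by (simp add: L_def)
    have "ar sg4 13 i < B" using 4(4) i(1) by blast
    then show "ok (upv 24 i (upv 36 (2 ^ (Suc l - 1)) sg4)) (Arr 13 vI) \<and> ev (upv 24 i (upv 36 (2 ^ (Suc l - 1)) sg4)) (Arr 13 vI) = ar sg4 13 i \<and> ar sg4 13 i \<le> 2 * B"
      using i(1) Z2S by auto
    show "ok (upv 24 i (upv 36 (2 ^ (Suc l - 1)) sg4)) (child_expr 4) \<and> ev (upv 24 i (upv 36 (2 ^ (Suc l - 1)) sg4)) (child_expr 4) = fc 4 i \<and> fc 4 i \<le> 2 * B"
      by (rule ce[OF i(1) i']) (use v3 3(3) f4 in auto)
  qed (use v3 f4 Z' L B2 st rm(2) rD(1,2,4)[of "Suc l"] in auto)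
  then obtain sg5 where 5: "run (mulx_code (Arr 13 vI) (child_expr 4)) sg4 sg5" "frame ({11} \<union> {13..29} \<union> {36}) {8..13} sg4 sg5"
     "tm sg5 \<le> tm sg4 + 250000 * ((Suc l + 2) ^ 3 * (2 * Z + 2 ^ Suc l + 1))" "\<forall>i<2 * Z. ar sg5 13 i < B"
     "\<forall>p<2 * Q. [nval B (ar sg5 13) (p * 2 ^ Suc l) (2 ^ Suc l) =
        nval B (ar sg4 13) (p * 2 ^ Suc l) (2 ^ (Suc l - 1)) * nval B (fc 4) (p * 2 ^ Suc l) (2 ^ (Suc l - 1))] (mod B ^ 2 ^ Suc l)" by blast
  note f5 = frame_vr[OF 5(2)] frame_ar[OF 5(2)]
  have v5: "vr sg5 31 = Z" "vr sg5 32 = L" "vr sg5 5 = B" "vr sg5 12 = 2 * Z" "ar sg5 6 = ar sg 6"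
    using v3 f4 f5 3(3) by auto
  let ?C = "Arr 13 vI [+] pval_expr"
  have cC: "ok (upv 24 i sg5) ?C \<and> ev (upv 24 i sg5) ?C = ar sg5 13 i + fv i" if "i < 2 * Z" for i
  proof -
    have "ar sg5 13 i < B" using 5(4) that by blast
    moreover have "ar sg5 13 i \<le> S" using calculation BS by linarith
    moreover have "mag pval_expr = 1" by (simp add: pval_expr_def)
    ultimately show ?thesis using pe[OF that v5(2,5)] that Z2S by auto
  qed
  have "\<exists>sg'. run (map_loop 8 24 12 ?C) sg5 sg' \<and> tm sg' \<le> tm sg5 + 500 * (2 * Z + 1) \<and> vr sg' = (vr sg5)(24 := 2 * Z) \<and>
     ar sg' = (ar sg5)(8 := (\<lambda>i. if i < 2 * Z then ev (upv 24 i sg5) ?C else ar sg5 8 i))"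
  proof (rule run_map)
    show "ok (upv 24 i sg5) ?C" if "i < 2 * Z" for i using cC[OF that] by blast
  qed (use v5 st Z2S in auto)
  then obtain sg6 where 6: "run (map_loop 8 24 12 ?C) sg5 sg6" "tm sg6 \<le> tm sg5 + 500 * (2 * Z + 1)" "vr sg6 = (vr sg5)(24 := 2 * Z)"
     "ar sg6 = (ar sg5)(8 := (\<lambda>i. if i < 2 * Z then ev (upv 24 i sg5) ?C else ar sg5 8 i))" by blast
  have a6: "ar sg6 8 i = ar sg5 13 i + fv i" if "i < 2 * Z" for i using 6(4) cC[OF that] that by (simp del: ev.simps)
  obtain sg7 where 7: "run (asg 29 e2L) sg6 sg7" "vr sg7 = (vr sg6)(29 := 2 * L)" "ar sg7 = ar sg6" "tm sg7 = tm sg6 + 4"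
    using asg_ex[of sg6 e2L 29 "2 * L"] 6 v5 LS by auto
  have le8: "ar sg7 8 i \<le> 2 * B" if "i < 2 * Z" for i
  proof -
    have "ar sg5 13 i < B" using 5(4) that by blast
    then show ?thesis using a6[OF that] pe[OF that v5(2,5)] 7(3) by simp
  qed
  have "\<exists>sg'. run (carry_code 8) sg7 sg' \<and> frame {24,26,27} {13} sg7 sg' \<and> tm sg' \<le> tm sg7 + 50 * (2 * Z + 1) \<and>
     (\<forall>i<2 * Z. ar sg' 13 i = dig B (2 * L) (ar sg7 8) i)"
    by (rule carry_run[where M = "2 * B"]) (use 6 7 v5 le8 Z2S BS B2 L(2) in auto)
  then obtain sg8 where 8: "run (carry_code 8) sg7 sg8" "frame {24,26,27} {13} sg7 sg8" "tm sg8 \<le> tm sg7 + 50 * (2 * Z + 1)"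
     "\<forall>i<2 * Z. ar sg8 13 i = dig B (2 * L) (ar sg7 8) i" by blast
  note f8 = frame_vr[OF 8(2)] frame_ar[OF 8(2)]
  let ?E = "Arr 13 (vI [div] eL [*] e2L [+] eL [+] vI [mod] eL)"
  have ixE: "i div L * (2*L) + L + i mod L < 2 * Z" if "i < Z" for i
  proof -
    have "i div L < 2 * Q" using that Z'(4) by (simp add: less_mult_imp_div_less)
    then have "(i div L + 1) * (2*L) \<le> 2 * Z" unfolding Z'(3) by (intro mult_right_mono) auto
    moreover have "i mod L < L" using L(2) by simp
    ultimately show ?thesis by simp
  qed
  have "\<exists>sg'. run (map_loop 6 24 31 ?E) sg8 sg' \<and> tm sg' \<le> tm sg8 + 500 * (Z + 1) \<and> vr sg' = (vr sg8)(24 := Z) \<and>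
     ar sg' = (ar sg8)(6 := (\<lambda>i. if i < Z then ev (upv 24 i sg8) ?E else ar sg8 6 i))"
  proof (rule run_map)
    show "ok (upv 24 i sg8) ?E" if "i < Z" for i using ixE[OF that] Z2S v5 6 7 f8 by auto
  qed (use v5 6 7 f8 ZS in auto)
  then obtain sg9 where 9: "run (map_loop 6 24 31 ?E) sg8 sg9" "tm sg9 \<le> tm sg8 + 500 * (Z + 1)" "vr sg9 = (vr sg8)(24 := Z)"
     "ar sg9 = (ar sg8)(6 := (\<lambda>i. if i < Z then ev (upv 24 i sg8) ?E else ar sg8 6 i))" by blast
  have a9: "ar sg9 6 i = ar sg8 13 (i div L * (2*L) + L + i mod L)" if "i < Z" for i
    using 9(4) that v5 6 7 f8 by simp
  have d13: "ar sg8 13 i < B" if "i < 2 * Z" for i using 8(4) that B2 by (simp add: dig_def)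
  have vt': "vtree B b Z (ar sg9 6) x G l" unfolding vtree_def
  proof (intro conjI allI impI)
    fix i assume i: "i < Z" show "ar sg9 6 i < B" using a9[OF i] d13[OF ixE[OF i]] by simp
  next
    fix c assume c: "(c + 1) * 2 ^ l \<le> Z"
    then have "(c + 1) * L \<le> 2 * Q * L" using Z'(4) by (simp add: L_def)
    then have cQ: "c < 2 * Q" using L(2) by (rule block_count)
    have cL: "c * L + L \<le> Z" using c by (simp add: L_def)
    have c2: "c * (2*L) + 2*L \<le> 2 * Z" using cL by simp
    define e where "e = c div 2"
    have e: "e < Q" using cQ by (simp add: e_def)
    then have eZ: "(e + 1) * 2 ^ Suc l \<le> Z" unfolding Z by (intro mult_right_mono) auto
    then have e2: "e * (2*L) + 2*L \<le> Z" using L by simp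
    define D where "D = B ^ L"
    have DD: "B ^ (2 * L) = D * D" unfolding D_def by (simp add: power_add[symmetric] mult_2)
    define V where "V = nval B (ar sg 6) (e * (2*L)) (2*L)"
    have in2: "(c * (2*L) + i) div (2*L) = c" "(c * (2*L) + i) mod (2*L) = i" "(c * (2*L) + i) div (4*L) = e" if "i < 2*L" for i
    proof -
      show 1: "(c * (2*L) + i) div (2*L) = c" "(c * (2*L) + i) mod (2*L) = i" by (rule block_div_mod, use that in simp)+
      have "(c * (2*L) + i) div (4*L) = (c * (2*L) + i) div (2*L) div 2" by (simp add: div_mult2_eq[symmetric])
      then show "(c * (2*L) + i) div (4*L) = e" using 1 by (simp add: e_def)
    qed
    have vfv: "nval B fv (c * (2*L)) n = nval B (ar sg 6) (e * (2*L)) n" if "n \<le> 2*L" for n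
      by (rule nval_cong) (use that in2 in \<open>simp add: fv_def\<close>)
    have vfc: "nval B (fc a) (c * (2*L)) L = nval B (ar sg a) (l * Z + c * 2 ^ l) (2 ^ l)" for a
      unfolding L_def[symmetric] by (rule nval_cong) (use in2 L(2) in \<open>simp add: fc_def add.assoc\<close>)
    define X where "X = pv x l c"
    define N where "N = nval B (ar sg 5) (l * Z + c * 2 ^ l) (2 ^ l)"
    have X: "nval B (fc 4) (c * (2*L)) L = X" unfolding vfc X_def using pt c by (simp add: ptree_def)
    have N: "D dvd X * N + 1" unfolding X_def N_def D_def using nt c by (simp add: ntree_def L_def)
    define q where "q = nval B (ar sg4 13) (c * (2*L)) L"
    have hl: "2 ^ (Suc l - 1) = L" by (simp add: L_def)
    have qc: "[q = V * N] (mod D)"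
    proof -
      have "[nval B (ar sg4 13) (c * (2*L)) (L + L) = nval B fv (c * (2*L)) L * N] (mod B ^ (L + L))"
        using 4(5) cQ unfolding hl unfolding L(1) N_def vfc[symmetric] mult_2[of L] by blast
      then have "[nval B (ar sg4 13) (c * (2*L)) (L + L) = nval B fv (c * (2*L)) L * N] (mod D)"
        unfolding D_def by (rule cong_dvd_modulus_nat) (simp add: le_imp_power_dvd)
      moreover have "[nval B (ar sg4 13) (c * (2*L)) (L + L) = q] (mod D)" unfolding q_def D_def by (rule nval_low)
      moreover have "[V = nval B fv (c * (2*L)) L] (mod D)"
        using nval_low[of B "ar sg 6" "e * (2*L)" L L] vfv[of L] L(2) by (simp add: V_def D_def mult_2)
      then have "[V * N = nval B fv (c * (2*L)) L * N] (mod D)" by (rule cong_scalar_right)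
      ultimately show ?thesis by (metis cong_trans cong_sym)
    qed
    have qD: "q < D" unfolding q_def D_def using 4(4) c2 by (intro nval_less) simp
    have VL: "V \<le> 2 * (b ^ L * b ^ L)"
    proof -
      have "V \<le> 2 * b ^ (2*L)" using vt eZ unfolding vtree_def V_def L(1) by blast
      then show ?thesis by (simp add: power_add[symmetric] mult_2)
    qed
    have XL: "X \<le> b ^ L" unfolding X_def L_def using xb c by (intro pv_le) simp
    note ms = montgomery_step[OF B D_def _ VL XL qD qc N]
    have L1: "1 \<le> L" using L(2) by simp
    define T where "T = nval B (ar sg8 13) (c * (2*L)) (2*L)"
    have "[T = V + q * X] (mod D * D)"
    proof -
      have "T = nval B (dig B (2*L) (ar sg7 8)) (c * (2*L)) (2*L)"
        unfolding T_def by (rule nval_cong) (use 8(4) c2 in simp)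
      also have "[\<dots> = nval B (ar sg7 8) (c * (2*L)) (2*L)] (mod B ^ (2*L))"
        using L(2) B2 by (intro nval_dig) auto
      also have "nval B (ar sg7 8) (c * (2*L)) (2*L) = nval B (\<lambda>i. ar sg5 13 i + fv i) (c * (2*L)) (2*L)"
        by (rule nval_cong) (use a6 7(3) c2 in simp)
      also have "\<dots> = nval B (ar sg5 13) (c * (2*L)) (2*L) + V"
        unfolding nval_add_const using vfv[of "2*L"] by (simp add: V_def)
      also have "[nval B (ar sg5 13) (c * (2*L)) (2*L) + V = q * X + V] (mod B ^ (2*L))"
      proof (rule cong_add[OF _ cong_refl])
        show "[nval B (ar sg5 13) (c * (2*L)) (2*L) = q * X] (mod B ^ (2*L))"
          using 5(5) cQ unfolding hl unfolding L(1) q_def X[symmetric] by blast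
      qed
      finally show ?thesis unfolding DD by (simp add: add.commute)
    qed
    moreover have "T < D * D" unfolding T_def DD[symmetric] using d13 c2 by (intro nval_less) simp
    ultimately have T: "T = V + q * X" using ms(3)[OF L1] by (simp add: cong_def)
    define W where "W = nval B (ar sg9 6) (c * 2 ^ l) (2 ^ l)"
    have in1: "(c * L + i) div L = c" "(c * L + i) mod L = i" if "i < L" for i
      using that by (rule block_div_mod)+
    have W: "W = nval B (ar sg8 13) (c * (2*L) + L) L"
      unfolding W_def L_def[symmetric] by (rule nval_cong) (use a9 cL in1 in \<open>simp add: add.assoc\<close>)
    have Tw: "T = nval B (ar sg8 13) (c * (2*L)) L + D * W"
      unfolding T_def W D_def mult_2[of L] by (rule nval_add)
    have low: "nval B (ar sg8 13) (c * (2*L)) L < D" unfolding D_def using d13 c2 by (intro nval_less) simp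
    \<comment> \<open>The lower half of \<open>T\<close> is divisible by \<open>D\<close> and
      smaller than \<open>D\<close>, hence zero, so the upper half is exactly \<open>T\<close>
      divided by \<open>D\<close>.\<close>
    have "D dvd nval B (ar sg8 13) (c * (2*L)) L"
      using ms(1)[OF L1] unfolding T[symmetric] Tw by (metis dvd_add_left_iff dvd_triv_left)
    then have "nval B (ar sg8 13) (c * (2*L)) L = 0" using low by (metis nat_dvd_not_less neq0_conv)
    then have DW: "D * W = V + q * X" using T Tw by simp
    have "0 < D" unfolding D_def using B2 by simp
    then have "W \<le> 2 * b ^ L" using ms(2)[OF L1] unfolding DW[symmetric] by simp
    then show "nval B (ar sg9 6) (c * 2 ^ l) (2 ^ l) \<le> 2 * b ^ 2 ^ l" by (simp add: W_def L_def)
    show "gcd (nval B (ar sg9 6) (c * 2 ^ l) (2 ^ l)) (x (c * 2 ^ l + j)) = G (c * 2 ^ l + j)" if j: "j < 2 ^ l" for j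
    proof -
      let ?x = "x (c * 2 ^ l + j)"
      have jZ: "c * 2 ^ l + j < Z" using c j by simp
      have "?x dvd X" unfolding X_def pv_def using j by (intro dvd_prodI) auto
      then have xq: "?x dvd q * X" by simp
      have "coprime D ?x" unfolding D_def using cop[OF jZ] by simp
      then have "gcd W ?x = gcd (D * W) ?x" by (rule gcd_mult_coprime[symmetric])
      \<comment> \<open>Every leaf below the child divides \<open>X\<close>, so adding
        \<open>q * X\<close> does not affect the gcd with it.\<close>
      also have "\<dots> = gcd V ?x" 
      proof -
        obtain m where "q * X = ?x * m" using xq by (rule dvdE)
        then show ?thesis unfolding DW using gcd_add_mult[of ?x m V] by (simp add: gcd.commute add.commute mult.commute)
      qed
      also have "\<dots> = G (c * 2 ^ l + j)"
      proof -
        \<comment> \<open>The position of the leaf within the parent's block: a right child, with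
          \<open>c\<close> odd, starts \<open>L\<close> leaves later.\<close>
        define j' where "j' = (c mod 2) * L + j"
        have j': "j' < 2 ^ Suc l" "e * 2 ^ Suc l + j' = c * 2 ^ l + j"
        proof -
          have "c mod 2 * L \<le> 1 * L" by (intro mult_right_mono) auto
          moreover have "j < L" using j by (simp add: L_def)
          ultimately show "j' < 2 ^ Suc l" unfolding j'_def L(1) by linarith
          have "c * L = (e * 2 + c mod 2) * L" by (simp add: e_def)
          then show "e * 2 ^ Suc l + j' = c * 2 ^ l + j" unfolding j'_def L(1) L_def[symmetric] by (simp add: algebra_simps)
        qed
        have "gcd (nval B (ar sg 6) (e * 2 ^ Suc l) (2 ^ Suc l)) (x (e * 2 ^ Suc l + j')) = G (e * 2 ^ Suc l + j')"
          using vt eZ j'(1) unfolding vtree_def by blast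
        then show ?thesis unfolding j'(2) unfolding V_def L(1) .
      qed
      finally show ?thesis by (simp add: W_def)
    qed
  qed
  have t: "tm sg9 \<le> tm sg + 800000 * ((l + 3) ^ 3 * (2 * Z + 2 ^ Suc l + 1))"
  proof -
    define Y where "Y = (l + 3) ^ 3 * (2 * Z + 2 ^ Suc l + 1)"
    have "1 * (2 * Z + 2 ^ Suc l + 1) \<le> Y" unfolding Y_def by (intro mult_right_mono one_le_power) auto
    then have q: "2 * Z + 1 \<le> Y" by simp
    have "Suc l + 2 = l + 3" by simp
    then have "(Suc l + 2) ^ 3 * (2 * Z + 2 ^ Suc l + 1) = Y" unfolding Y_def by metis
    moreover have "t9 \<le> t + 800000 * Y" if "t3 = t + 16" "t4 \<le> t3 + 250000 * Y" "t5 \<le> t4 + 250000 * Y" "t6 \<le> t5 + 500 * (2 * Z + 1)" "t7 = t6 + 4"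
      "t8 \<le> t7 + 50 * (2 * Z + 1)" "t9 \<le> t8 + 500 * (Z + 1)" for t t3 t4 t5 t6 t7 t8 t9 :: nat
      using that q by simp
    ultimately have "tm sg9 \<le> tm sg + 800000 * Y" using 3(4) 4(3) 5(3) 6(2) 7(4) 8(3) 9(2) by metis
    then show ?thesis by (simp only: Y_def)
  qed
  have fr: "frame ({10..29} \<union> {36,37,38}) ({8..13} \<union> {6}) sg sg9"
  proof -
    have "frame ({10..29} \<union> {36,37,38}) ({8..13} \<union> {6}) sg sg3" using 1 2 3 by (auto simp: frame_def)
    moreover have "frame ({10..29} \<union> {36,37,38}) ({8..13} \<union> {6}) sg3 sg4" by (rule frame_mono[OF 4(2)]) auto
    moreover have "frame ({10..29} \<union> {36,37,38}) ({8..13} \<union> {6}) sg4 sg5" by (rule frame_mono[OF 5(2)]) auto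
    moreover have "frame ({10..29} \<union> {36,37,38}) ({8..13} \<union> {6}) sg5 sg7" using 6 7 by (auto simp: frame_def)
    moreover have "frame ({10..29} \<union> {36,37,38}) ({8..13} \<union> {6}) sg7 sg8" by (rule frame_mono[OF 8(2)]) auto
    moreover have "frame ({10..29} \<union> {36,37,38}) ({8..13} \<union> {6}) sg8 sg9" using 9 by (auto simp: frame_def)
    ultimately show ?thesis by (meson frame_trans subset_refl)
  qed
  show ?thesis unfolding down_code_def
    by (rule exI[of _ sg9], intro conjI run_Seq[OF 1(1)] run_Seq[OF 2(1)] run_Seq[OF 3(1)] run_Seq[OF 4(1)] run_Seq[OF 5(1)]
        run_Seq[OF 6(1)] run_Seq[OF 7(1)] run_Seq[OF 8(1)] 9(1) fr t vt')
qed

end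

section \<open>Grouping the inputs\<close>

text \<open>
  Inputs with the same current node are put into common chunks of \<open>L\<close> slots; array \<open>14\<close> holds for each
  node its next free slot, a multiple of \<open>L\<close> meaning that a new chunk must be opened.
\<close>

definition alloc_code :: com where
  "alloc_code = asg 43 (Var 0 [+] Var 4) ;; map_loop 14 24 4 (Cst 0) ;; map_loop 4 24 43 (Cst 1) ;; asg 39 (Cst 0) ;;
     for_loop 24 0 (asg 40 (Arr 17 vI) ;; asg 41 (Arr 14 (Var 40)) ;;
       asg 42 (Ite (Var 41 [mod] Var 34) (Cst 1) (Var 39 [*] Var 34) (Var 41)) ;;
       asg 39 (Ite (Var 41 [mod] Var 34) (Cst 1) (Var 39 [+] Cst 1) (Var 39)) ;;
       sto 15 (Var 42 [div] Var 34) (Var 40) ;; sto 16 vI (Var 42) ;; sto 4 (Var 42) (Arr 0 vI) ;;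
       sto 14 (Var 40) (Var 42 [+] Cst 1)) ;;
     asg 31 (Var 39 [*] Var 34)"

text \<open>The free slots left in a chunk whose next free slot is \<open>f\<close>. The outer
  \<open>mod\<close> gives zero when \<open>f\<close> is a multiple of \<open>L\<close>, that is,
  when no chunk is open.\<close>

definition slack :: "nat \<Rightarrow> nat \<Rightarrow> nat" where
  "slack L f = (L - f mod L) mod L"

text \<open>\<open>tp\<close> counts the chunks; \<open>FR\<close>, \<open>CH\<close>,
  \<open>PS\<close> and \<open>XT\<close> stand for the arrays \<open>14\<close>, \<open>15\<close>,
  \<open>16\<close> and \<open>4\<close>: next free slot of a node, node of a chunk, slot of an
  input, and content of a slot. The clause with the sum balances all slots against filled and free
  ones. Unfilled slots hold the neutral leaf \<open>1\<close>.\<close>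

definition alloc_inv :: "nat \<Rightarrow> nat \<Rightarrow> nat \<Rightarrow> (nat \<Rightarrow> nat) \<Rightarrow> (nat \<Rightarrow> nat) \<Rightarrow> nat \<Rightarrow> nat \<Rightarrow>
    (nat \<Rightarrow> nat) \<Rightarrow> (nat \<Rightarrow> nat) \<Rightarrow> (nat \<Rightarrow> nat) \<Rightarrow> (nat \<Rightarrow> nat) \<Rightarrow> bool" where
  "alloc_inv L Vn U x cv j tp FR CH PS XT \<longleftrightarrow>
     (\<forall>i<j. PS i < tp * L \<and> XT (PS i) = x i \<and> CH (PS i div L) = cv i) \<and>
     (\<forall>v<Vn. FR v mod L \<noteq> 0 \<longrightarrow> FR v < tp * L \<and> CH (FR v div L) = v \<and> (\<forall>i<j. PS i div L = FR v div L \<longrightarrow> PS i < FR v)) \<and>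
     tp * L = j + (\<Sum>v<Vn. slack L (FR v)) \<and>
     (\<forall>i<U. XT i = 1 \<or> i < tp * L \<and> (\<exists>k<j. XT i = x k)) \<and>
     (\<forall>c<tp. CH c < Vn)"

lemma slack_zero: "f mod L = 0 \<Longrightarrow> slack L f = 0"
  by (simp add: slack_def)

lemma slack_pos: "f mod L \<noteq> 0 \<Longrightarrow> slack L f = L - f mod L"
  by (cases "L = 0") (auto simp: slack_def)

lemma slack_new: "0 < L \<Longrightarrow> slack L (t * L + 1) = L - 1"
  by (cases "L = 1") (auto simp: slack_def mod_Suc)

lemma slack_Suc: "f mod L \<noteq> 0 \<Longrightarrow> 0 < L \<Longrightarrow> slack L (f + 1) + 1 = slack L f"
proof -
  assume f: "f mod L \<noteq> 0" and L: "0 < L"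
  have lt: "f mod L < L" using L by simp
  show ?thesis
  proof (cases "Suc (f mod L) = L")
    case True
    then show ?thesis using slack_pos[OF f] slack_zero[of "f + 1" L] by (simp add: mod_Suc)
  next
    case False
    then have m: "(f + 1) mod L = Suc (f mod L)" by (simp add: mod_Suc)
    then show ?thesis using slack_pos[OF f] slack_pos[of "f + 1" L] lt by simp
  qed
qed

text \<open>Each node has at most one open chunk, with fewer than \<open>L\<close> free slots. So
  padding costs at most one chunk per node, however unevenly the inputs are distributed.\<close>

lemma alloc_inv_top:
  assumes "alloc_inv L Vn U x cv j tp FR CH PS XT" "0 < L"
  shows "tp * L \<le> j + Vn * L"
proof -
  have "(\<Sum>v<Vn. slack L (FR v)) \<le> (\<Sum>v<Vn. L)"
    using assms(2) by (intro sum_mono) (simp add: slack_def less_imp_le_nat)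
  also have "\<dots> = Vn * L" by simp
  finally show ?thesis using assms(1) by (simp add: alloc_inv_def)
qed

text \<open>A new chunk starts beyond all slots in use. In an open chunk every occupied slot lies
  before \<open>f\<close>, so nothing is overwritten; and two nodes cannot share an open chunk,
  since \<open>CH\<close> determines its node.\<close>

lemma alloc_inv_step:
  assumes I: "alloc_inv L Vn U x cv j tp FR CH PS XT" and L: "0 < L" and v: "cv j < Vn" and U: "Suc j + Vn * L \<le> U"
  defines "f \<equiv> FR (cv j)"
  defines "f' \<equiv> (if f mod L = 0 then tp * L else f)"
  defines "tp' \<equiv> (if f mod L = 0 then tp + 1 else tp)"
  shows "alloc_inv L Vn U x cv (Suc j) tp' (FR(cv j := f' + 1)) (CH(f' div L := cv j)) (PS(j := f')) (XT(f' := x j)) \<and> f' < tp' * L"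
proof -
  let ?v = "cv j"
  have A: "\<And>i. i < j \<Longrightarrow> PS i < tp * L \<and> XT (PS i) = x i \<and> CH (PS i div L) = cv i"
    and Bq: "\<And>v. v < Vn \<Longrightarrow> FR v mod L \<noteq> 0 \<Longrightarrow> FR v < tp * L \<and> CH (FR v div L) = v \<and> (\<forall>i<j. PS i div L = FR v div L \<longrightarrow> PS i < FR v)"
    and Cq: "tp * L = j + (\<Sum>v<Vn. slack L (FR v))"
    and Dq: "\<And>i. i < U \<Longrightarrow> XT i = 1 \<or> i < tp * L \<and> (\<exists>k<j. XT i = x k)"
    and Eq: "\<And>c. c < tp \<Longrightarrow> CH c < Vn"
    using I unfolding alloc_inv_def by blast+
  have dlt: "i div L < tp" if "i < tp * L" for i using that by (simp add: less_mult_imp_div_less)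
  have sm: "(\<Sum>u<Vn. slack L ((FR(?v := y)) u)) + slack L f = (\<Sum>u<Vn. slack L (FR u)) + slack L y" for y
  proof -
    have "(\<Sum>u<Vn. slack L ((FR(?v := y)) u)) = slack L y + (\<Sum>u\<in>{..<Vn} - {?v}. slack L (FR u))"
      using v by (subst sum.remove[of _ ?v]) (auto intro!: sum.cong)
    moreover have "(\<Sum>u<Vn. slack L (FR u)) = slack L f + (\<Sum>u\<in>{..<Vn} - {?v}. slack L (FR u))"
      unfolding f_def using v by (subst sum.remove[of _ ?v]) auto
    ultimately show ?thesis by simp
  qed
  show ?thesis
  proof (cases "f mod L = 0")
    case True
    then have f': "f' = tp * L" "tp' = tp + 1" by (simp_all add: f'_def tp'_def)
    have fd: "f' div L = tp" using L f' by simp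
    show ?thesis unfolding alloc_inv_def
    proof (intro conjI allI impI)
      fix i assume i: "i < Suc j"
      show "(PS(j := f')) i < tp' * L" using A[of i] i f' L by (cases "i = j") auto
      show "(XT(f' := x j)) ((PS(j := f')) i) = x i" using A[of i] i f' by (cases "i = j") auto
      show "(CH(f' div L := ?v)) ((PS(j := f')) i div L) = cv i" using A[of i] dlt[of "PS i"] i fd by (cases "i = j") auto
    next
      fix u assume u: "u < Vn" and m: "(FR(?v := f' + 1)) u mod L \<noteq> 0"
      show "(FR(?v := f' + 1)) u < tp' * L"
      proof (cases "u = ?v")
        case True
        \<comment> \<open>With \<open>L = 1\<close> a new chunk is full at once and its next free
          slot is again a multiple of \<open>L\<close>.\<close>
        have "L \<noteq> 1" using m by auto
        then show ?thesis using True f' L by simp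
      next
        case False
        then show ?thesis using Bq[of u] u m f' by simp
      qed
      show "(CH(f' div L := ?v)) ((FR(?v := f' + 1)) u div L) = u"
      proof (cases "u = ?v")
        case True
        have "L \<noteq> 1" using m by auto
        then have "(tp * L + 1) div L = tp" using L by (intro block_div_mod) simp
        then show ?thesis using True fd f' by simp
      next
        case False
        then show ?thesis using Bq[of u] dlt[of "FR u"] u m fd by simp
      qed
      fix i assume i: "i < Suc j" and d: "(PS(j := f')) i div L = (FR(?v := f' + 1)) u div L"
      show "(PS(j := f')) i < (FR(?v := f' + 1)) u"
      proof (cases "u = ?v")
        case T: True
        show ?thesis
        proof (cases "i = j")
          case True then show ?thesis using T by simp
        next
          case False
          then have "PS i < tp * L" using A[of i] i by simp
          then show ?thesis using False T f' by simp
        qed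
      next
        case F: False
        show ?thesis
        proof (cases "i = j")
          case True
          then have "tp = FR u div L" using d F fd by simp
          moreover have "FR u div L < tp" using Bq[of u] u m F dlt by simp
          ultimately show ?thesis by simp
        next
          case False then show ?thesis using Bq[of u] u m F d i by simp
        qed
      qed
    next
      have "tp' * L = Suc j + ((\<Sum>u<Vn. slack L (FR u)) + (L - 1))" using Cq f' L by simp
      also have "(\<Sum>u<Vn. slack L (FR u)) + (L - 1) = (\<Sum>u<Vn. slack L ((FR(?v := f' + 1)) u))"
        using sm[of "f' + 1"] slack_zero[OF True] slack_new[OF L, of tp] f' by simp
      finally show "tp' * L = Suc j + (\<Sum>u<Vn. slack L ((FR(?v := f' + 1)) u))" .
    next
      fix i assume i: "i < U"
      show "(XT(f' := x j)) i = 1 \<or> i < tp' * L \<and> (\<exists>k<Suc j. (XT(f' := x j)) i = x k)"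
      proof (cases "i = f'")
        case True then show ?thesis using f' L by auto
      next
        case False then show ?thesis using Dq[OF i] f' by (auto simp: less_Suc_eq)
      qed
    next
      fix c assume "c < tp'"
      then show "(CH(f' div L := ?v)) c < Vn" using Eq[of c] v fd f' by auto
    next
      show "f' < tp' * L" using f' L by simp
    qed
  next
    case False
    then have f': "f' = f" "tp' = tp" by (simp_all add: f'_def tp'_def)
    have Bf: "f < tp * L" "CH (f div L) = ?v" "\<And>i. i < j \<Longrightarrow> PS i div L = f div L \<Longrightarrow> PS i < f"
      using Bq[OF v] False unfolding f_def by blast+
    have CHe: "CH(f div L := ?v) = CH" using Bf(2) by auto
    show ?thesis unfolding alloc_inv_def f' CHe
    proof (intro conjI allI impI)
      fix i assume i: "i < Suc j"
      show "(PS(j := f)) i < tp * L" using A[of i] i Bf by (cases "i = j") auto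
      show "(XT(f := x j)) ((PS(j := f)) i) = x i" using A[of i] Bf(3)[of i] i by (cases "i = j") auto
      show "CH ((PS(j := f)) i div L) = cv i" using A[of i] Bf i by (cases "i = j") auto
    next
      fix u assume u: "u < Vn" and m: "(FR(?v := f + 1)) u mod L \<noteq> 0"
      have dv: "(f + 1) div L = f div L \<and> f + 1 < tp * L" if "(f + 1) mod L \<noteq> 0"
      proof -
        have "(f + 1) div L = f div L" using that by (simp add: div_Suc mod_Suc split: if_splits)
        moreover have "f + 1 \<noteq> tp * L" using that by auto
        ultimately show ?thesis using Bf(1) by simp
      qed
      show "(FR(?v := f + 1)) u < tp * L" using Bq[of u] u m dv by (cases "u = ?v") auto
      show "CH ((FR(?v := f + 1)) u div L) = u" using Bq[of u] u m dv Bf(2) by (cases "u = ?v") auto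
      fix i assume i: "i < Suc j" and d: "(PS(j := f)) i div L = (FR(?v := f + 1)) u div L"
      show "(PS(j := f)) i < (FR(?v := f + 1)) u"
      proof (cases "u = ?v")
        case T: True
        then show ?thesis using Bf(3)[of i] i d m dv by (cases "i = j") auto
      next
        case F: False
        show ?thesis
        proof (cases "i = j")
          case True
          then have "CH (f div L) = u" using Bq[of u] u m F d by simp
          then show ?thesis using Bf(2) F by simp
        next
          case False then show ?thesis using Bq[of u] u m F d i by simp
        qed
      qed
    next
      show "tp * L = Suc j + (\<Sum>u<Vn. slack L ((FR(?v := f + 1)) u))"
        using sm[of "f + 1"] slack_Suc[OF False L] Cq by simp
    next
      fix i assume i: "i < U"
      show "(XT(f := x j)) i = 1 \<or> i < tp * L \<and> (\<exists>k<Suc j. (XT(f := x j)) i = x k)"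
      proof (cases "i = f")
        case True then show ?thesis using Bf(1) by auto
      next
        case False then show ?thesis using Dq[OF i] by (auto simp: less_Suc_eq)
      qed
    next
      fix c assume "c < tp" then show "CH c < Vn" by (rule Eq)
    next
      show "f < tp * L" by (rule Bf(1))
    qed
  qed
qed

context ram
begin

text \<open>The hypothesis \<open>Vn * L \<le> m\<close> bounds the padding by \<open>m\<close>;
  hence \<open>n + m\<close> cells preset to \<open>1\<close> are enough for all chunks.\<close>

lemma alloc_run:
  assumes v: "vr sg 0 = n" "vr sg 4 = m" "vr sg 34 = L" "0 < L" and Vn: "Vn * L \<le> m" and S: "2 * (n + m) < S"
    and cv: "\<And>j. j < n \<Longrightarrow> ar sg 17 j < Vn"
  shows "\<exists>sg' tp. run alloc_code sg sg' \<and> frame {24,31,39,40,41,42,43} {4,14,15,16} sg sg' \<and> tm sg' \<le> tm sg + 2000 * (n + m + 1) \<and>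
     vr sg' 31 = tp * L \<and> tp * L \<le> n + m \<and>
     (\<forall>i<n. ar sg' 16 i < tp * L \<and> ar sg' 4 (ar sg' 16 i) = ar sg 0 i \<and> ar sg' 15 (ar sg' 16 i div L) = ar sg 17 i) \<and>
     (\<forall>i<tp * L. ar sg' 4 i = 1 \<or> (\<exists>k<n. ar sg' 4 i = ar sg 0 k)) \<and> (\<forall>c<tp. ar sg' 15 c < Vn)"
proof -
  have Vm: "Vn \<le> m"
  proof -
    have "Vn * 1 \<le> Vn * L" using v(4) by (intro mult_left_mono) auto
    then show ?thesis using Vn by linarith
  qed
  obtain sg1 where 1: "run (asg 43 (Var 0 [+] Var 4)) sg sg1" "vr sg1 = (vr sg)(43 := n + m)" "ar sg1 = ar sg" "tm sg1 = tm sg + 4"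
    using asg_ex[of sg "Var 0 [+] Var 4" 43 "n + m"] v S by auto
  have "\<exists>sg'. run (map_loop 14 24 4 (Cst 0)) sg1 sg' \<and> tm sg' \<le> tm sg1 + 500 * (m + 1) \<and> vr sg' = (vr sg1)(24 := m) \<and>
     ar sg' = (ar sg1)(14 := (\<lambda>i. if i < m then ev (upv 24 i sg1) (Cst 0) else ar sg1 14 i))"
    by (rule run_map) (use 1 v S in auto)
  then obtain sg2 where 2: "run (map_loop 14 24 4 (Cst 0)) sg1 sg2" "tm sg2 \<le> tm sg1 + 500 * (m + 1)" "vr sg2 = (vr sg1)(24 := m)"
     "ar sg2 = (ar sg1)(14 := (\<lambda>i. if i < m then ev (upv 24 i sg1) (Cst 0) else ar sg1 14 i))" by blast
  have "\<exists>sg'. run (map_loop 4 24 43 (Cst 1)) sg2 sg' \<and> tm sg' \<le> tm sg2 + 500 * (n + m + 1) \<and> vr sg' = (vr sg2)(24 := n + m) \<and>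
     ar sg' = (ar sg2)(4 := (\<lambda>i. if i < n + m then ev (upv 24 i sg2) (Cst 1) else ar sg2 4 i))"
    by (rule run_map) (use 1 2 v S in auto)
  then obtain sg3 where 3: "run (map_loop 4 24 43 (Cst 1)) sg2 sg3" "tm sg3 \<le> tm sg2 + 500 * (n + m + 1)" "vr sg3 = (vr sg2)(24 := n + m)"
     "ar sg3 = (ar sg2)(4 := (\<lambda>i. if i < n + m then ev (upv 24 i sg2) (Cst 1) else ar sg2 4 i))" by blast
  obtain sg4 where 4: "run (asg 39 (Cst 0)) sg3 sg4" "vr sg4 = (vr sg3)(39 := 0)" "ar sg4 = ar sg3" "tm sg4 = tm sg3 + 2"
    using asg_ex[of sg3 "Cst 0" 39 0] by auto
  let ?x = "ar sg 0" and ?cv = "ar sg 17"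
  let ?b = "asg 40 (Arr 17 vI) ;; asg 41 (Arr 14 (Var 40)) ;;
       asg 42 (Ite (Var 41 [mod] Var 34) (Cst 1) (Var 39 [*] Var 34) (Var 41)) ;;
       asg 39 (Ite (Var 41 [mod] Var 34) (Cst 1) (Var 39 [+] Cst 1) (Var 39)) ;;
       sto 15 (Var 42 [div] Var 34) (Var 40) ;; sto 16 vI (Var 42) ;; sto 4 (Var 42) (Arr 0 vI) ;;
       sto 14 (Var 40) (Var 42 [+] Cst 1)"
  let ?I = "\<lambda>j sg'. frame {24,39,40,41,42} {4,14,15,16} sg4 sg' \<and> (\<forall>u<Vn. ar sg' 14 u \<le> n + m) \<and>
     alloc_inv L Vn (n + m) ?x ?cv j (vr sg' 39) (ar sg' 14) (ar sg' 15) (ar sg' 16) (ar sg' 4)"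
  have "\<exists>sg'. run (for_loop 24 0 ?b) sg4 sg' \<and> tm sg' \<le> tm sg4 + n * (100 + 5) + 3 \<and> ?I n sg' \<and> vr sg' 24 = n \<and> vr sg' 0 = n"
  proof (rule run_for[where I = ?I])
    fix j sg' assume j: "j < n" and I: "?I j sg'" and w: "vr sg' 24 = j" "vr sg' 0 = n"
    note fI = frame_vr[OF conjunct1[OF I]] frame_ar[OF conjunct1[OF I]]
    have v': "vr sg' 34 = L" "ar sg' 17 = ?cv" "ar sg' 0 = ?x" using fI 1 2 3 4 v by auto
    define u where "u = ?cv j"
    define f where "f = ar sg' 14 u"
    define tp where "tp = vr sg' 39"
    define f' where "f' = (if f mod L = 0 then tp * L else f)"
    define tp' where "tp' = (if f mod L = 0 then tp + 1 else tp)"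
    have u: "u < Vn" using cv[OF j] by (simp add: u_def)
    have ai: "alloc_inv L Vn (n + m) ?x ?cv j tp (ar sg' 14) (ar sg' 15) (ar sg' 16) (ar sg' 4)" using I by (simp add: tp_def)
    have U: "Suc j + Vn * L \<le> n + m" using j Vn by simp
    have as: "alloc_inv L Vn (n + m) ?x ?cv (Suc j) tp' ((ar sg' 14)(u := f' + 1)) ((ar sg' 15)(f' div L := u)) ((ar sg' 16)(j := f')) ((ar sg' 4)(f' := ?x j))"
      "f' < tp' * L"
      using alloc_inv_step[OF ai v(4) _ U] u unfolding u_def f_def f'_def tp'_def by auto
    have tL: "tp' * L \<le> n + m" using alloc_inv_top[OF as(1) v(4)] U by linarith
    have tt: "tp' \<le> n + m"
    proof -
      have "tp' * 1 \<le> tp' * L" using v(4) by (intro mult_left_mono) auto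
      then show ?thesis using tL by linarith
    qed
    have f'n: "f' < n + m" "f' div L < S" using as(2) tL S by (auto intro: le_less_trans[OF div_le_dividend])
    have fn: "f \<le> n + m" using I u by (simp add: f_def)
    have uS: "u < S" using u Vm S by simp
    obtain sga where a: "run (asg 40 (Arr 17 vI)) sg' sga" "vr sga = (vr sg')(40 := u)" "ar sga = ar sg'" "tm sga = tm sg' + 5"
      using asg_ex[of sg' "Arr 17 vI" 40 u] w v' j S uS by (auto simp: u_def)
    obtain sgb where b: "run (asg 41 (Arr 14 (Var 40))) sga sgb" "vr sgb = (vr sga)(41 := f)" "ar sgb = ar sg'" "tm sgb = tm sg' + 10"
      using asg_ex[of sga "Arr 14 (Var 40)" 41 f] a uS fn S by (auto simp: f_def)
    obtain sgc where c: "run (asg 42 (Ite (Var 41 [mod] Var 34) (Cst 1) (Var 39 [*] Var 34) (Var 41))) sgb sgc" "vr sgc = (vr sgb)(42 := f')" "ar sgc = ar sg'" "tm sgc = tm sg' + 20"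
    proof -
      have e: "ev sgb (Ite (Var 41 [mod] Var 34) (Cst 1) (Var 39 [*] Var 34) (Var 41)) = f'"
        and o: "ok sgb (Ite (Var 41 [mod] Var 34) (Cst 1) (Var 39 [*] Var 34) (Var 41))"
        using a b v' by (auto simp: f'_def tp_def)
      show ?thesis using that asg_ex[OF o _ e, of 42] b f'n S by (auto simp del: ok.simps ev.simps)
    qed
    obtain sgd where d: "run (asg 39 (Ite (Var 41 [mod] Var 34) (Cst 1) (Var 39 [+] Cst 1) (Var 39))) sgc sgd" "vr sgd = (vr sgc)(39 := tp')" "ar sgd = ar sg'" "tm sgd = tm sg' + 30"
    proof -
      have e: "ev sgc (Ite (Var 41 [mod] Var 34) (Cst 1) (Var 39 [+] Cst 1) (Var 39)) = tp'"
        and o: "ok sgc (Ite (Var 41 [mod] Var 34) (Cst 1) (Var 39 [+] Cst 1) (Var 39))"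
        using a b c v' by (auto simp: tp'_def tp_def)
      show ?thesis using that asg_ex[OF o _ e, of 39] c tt S by (auto simp del: ok.simps ev.simps)
    qed
    have vd: "vr sgd = (vr sg')(40 := u, 41 := f, 42 := f', 39 := tp')" using a b c d by simp
    obtain sge where e: "run (sto 15 (Var 42 [div] Var 34) (Var 40)) sgd sge" "vr sge = vr sgd" "ar sge = (ar sg')(15 := (ar sg' 15)(f' div L := u))" "tm sge = tm sg' + 37"
      using sto_ex[of sgd "Var 42 [div] Var 34" "Var 40" 15 "f' div L" u] vd d v' f'n by auto
    obtain sgf where f: "run (sto 16 vI (Var 42)) sge sgf" "vr sgf = vr sgd" "ar sgf = (ar sge)(16 := (ar sg' 16)(j := f'))" "tm sgf = tm sg' + 42"
      using sto_ex[of sge vI "Var 42" 16 j f'] vd e w j S by auto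
    obtain sgg where g: "run (sto 4 (Var 42) (Arr 0 vI)) sgf sgg" "vr sgg = vr sgd" "ar sgg = (ar sgf)(4 := (ar sg' 4)(f' := ?x j))" "tm sgg = tm sg' + 50"
      using sto_ex[of sgf "Var 42" "Arr 0 vI" 4 f' "?x j"] vd e f w j S f'n v' by auto
    obtain sgh where h: "run (sto 14 (Var 40) (Var 42 [+] Cst 1)) sgg sgh" "vr sgh = vr sgd" "ar sgh = (ar sgg)(14 := (ar sg' 14)(u := f' + 1))" "tm sgh = tm sg' + 57"
      using sto_ex[of sgg "Var 40" "Var 42 [+] Cst 1" 14 u "f' + 1"] vd e f g w j S uS by auto
    have fr: "frame {24,39,40,41,42} {4,14,15,16} sg4 (upv 24 (Suc j) sgh)"
      using fI vd e f g h by (auto simp: frame_def)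
    have arh: "ar sgh 14 = (ar sg' 14)(u := f' + 1)" "ar sgh 15 = (ar sg' 15)(f' div L := u)" "ar sgh 16 = (ar sg' 16)(j := f')" "ar sgh 4 = (ar sg' 4)(f' := ?x j)"
      using e f g h by simp_all
    have I': "?I (Suc j) (upv 24 (Suc j) sgh)"
      using fr as(1) I f'n h(2) vd by (auto simp: arh)
    show "\<exists>sg''. run ?b sg' sg'' \<and> tm sg'' \<le> tm sg' + 100 \<and> vr sg'' 24 = j \<and> vr sg'' 0 = n \<and> ?I (Suc j) (upv 24 (Suc j) sg'')"
      by (rule exI[of _ sgh], intro conjI[OF run_Seq[OF a(1) run_Seq[OF b(1) run_Seq[OF c(1) run_Seq[OF d(1) run_Seq[OF e(1) run_Seq[OF f(1) run_Seq[OF g(1) h(1)]]]]]]]])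
         (use h vd w I' in auto)
  next
    show "?I 0 (upv 24 0 sg4)" using 1 2 3 4 Vm by (auto simp: alloc_inv_def slack_def)
  qed (use 1 2 3 4 v S in auto)
  then obtain sg5 where 5: "run (for_loop 24 0 ?b) sg4 sg5" "tm sg5 \<le> tm sg4 + n * (100 + 5) + 3" "?I n sg5" by blast
  define tp where "tp = vr sg5 39"
  have ai: "alloc_inv L Vn (n + m) ?x ?cv n tp (ar sg5 14) (ar sg5 15) (ar sg5 16) (ar sg5 4)" using 5(3) by (simp add: tp_def)
  have tL: "tp * L \<le> n + m" using alloc_inv_top[OF ai v(4)] Vn by linarith
  note f5 = frame_vr[OF conjunct1[OF 5(3)]] frame_ar[OF conjunct1[OF 5(3)]]
  obtain sg6 where 6: "run (asg 31 (Var 39 [*] Var 34)) sg5 sg6" "vr sg6 = (vr sg5)(31 := tp * L)" "ar sg6 = ar sg5" "tm sg6 = tm sg5 + 4"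
    using asg_ex[of sg5 "Var 39 [*] Var 34" 31 "tp * L"] f5 1 2 3 4 v tL S by (auto simp: tp_def)
  have fr: "frame {24,31,39,40,41,42,43} {4,14,15,16} sg sg6"
    using f5 1 2 3 4 6 by (auto simp: frame_def)
  have t: "tm sg6 \<le> tm sg + 2000 * (n + m + 1)" using 1(4) 2(2) 3(2) 4(4) 5(2) 6(4) by simp
  have post: "(\<forall>i<n. ar sg5 16 i < tp * L \<and> ar sg5 4 (ar sg5 16 i) = ?x i \<and> ar sg5 15 (ar sg5 16 i div L) = ?cv i)"
    "(\<forall>i<tp * L. ar sg5 4 i = 1 \<or> (\<exists>k<n. ar sg5 4 i = ?x k))" "(\<forall>c<tp. ar sg5 15 c < Vn)"
  proof -
    show "\<forall>i<n. ar sg5 16 i < tp * L \<and> ar sg5 4 (ar sg5 16 i) = ?x i \<and> ar sg5 15 (ar sg5 16 i div L) = ?cv i"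
      "\<forall>c<tp. ar sg5 15 c < Vn"
      using ai unfolding alloc_inv_def by blast+
    have "\<forall>i<n + m. ar sg5 4 i = 1 \<or> i < tp * L \<and> (\<exists>k<n. ar sg5 4 i = ?x k)" using ai unfolding alloc_inv_def by blast
    then show "\<forall>i<tp * L. ar sg5 4 i = 1 \<or> (\<exists>k<n. ar sg5 4 i = ?x k)" using tL by (meson less_le_trans)
  qed
  show ?thesis unfolding alloc_code_def
    by (rule exI[of _ sg6], rule exI[of _ tp], intro conjI[OF run_Seq[OF 1(1) run_Seq[OF 2(1) run_Seq[OF 3(1) run_Seq[OF 4(1) run_Seq[OF 5(1) 6(1)]]]]]] conjI fr t tL)
       (use 6 post in auto)
qed

end

section \<open>One step of the simultaneous binary search\<close>

definition inv_expr :: expr where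
  "inv_expr = (Arr 5 vI [*] (Cst 2 [+] Arr 4 vI [*] Arr 5 vI)) [mod] Var 5"

definition inv_code :: com where
  "inv_code = asg 46 (Var 2 [+] Cst 1) ;; map_loop 5 24 31 (Var 5 [-] Cst 1) ;; for_loop 45 46 (upd_loop 10 5 24 31 inv_expr)"

definition up_code :: com where
  "up_code = asg 32 (Cst 1) ;; for_loop 30 33 (upx_code 4 ;; upn_code ;; asg 32 (Cst 2 [*] Var 32))"

definition down_loop :: com where
  "down_loop = for_loop 47 33 (asg 30 (Var 33 [-] (Var 47 [+] Cst 1)) ;; asg 32 (Pow2 (Var 30)) ;; down_code)"

definition gcd_code :: com where
  "gcd_code = asg 46 (Cst 2 [*] Var 2 [+] Cst 2) ;; for_loop 45 46
     (map_loop 20 24 0 (Ite (Arr 19 vI) (Cst 1) (Arr 18 vI) (Arr 19 vI)) ;;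
      upd_loop 10 19 24 0 (Ite (Arr 19 vI) (Cst 1) (Cst 0) (Arr 18 vI [mod] Arr 19 vI)) ;;
      map_loop 18 24 0 (Arr 20 vI))"

text \<open>The identity x y (2 + x y) + 1 = (x y + 1)^2 doubles the precision of a negated inverse
  \<open>y\<close>. Claiming a single new bit per step is enough here, at the price of a factor of
  order R in the time of \<open>inv_code\<close>.\<close>

lemma hensel_step:
  fixes x y :: nat
  assumes "2 ^ i dvd x * y + 1" "1 \<le> i" "i + 1 \<le> lam"
  shows "2 ^ (i + 1) dvd x * (y * (2 + x * y) mod 2 ^ lam) + 1"
proof -
  have "[x * (y * (2 + x * y) mod 2 ^ lam) + 1 = x * (y * (2 + x * y)) + 1] (mod 2 ^ lam)"
    by (intro cong_add cong_mult cong_refl) (simp add: cong_def)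
  then have c: "[x * (y * (2 + x * y) mod 2 ^ lam) + 1 = x * (y * (2 + x * y)) + 1] (mod 2 ^ (i + 1))"
    by (rule cong_dvd_modulus_nat) (rule le_imp_power_dvd, rule assms(3))
  have "(2::nat) ^ (i + 1) dvd 2 ^ (i + i)" using assms(2) by (intro le_imp_power_dvd) auto
  also have "(2::nat) ^ (i + i) = 2 ^ i * 2 ^ i" by (simp add: power_add)
  also have "\<dots> dvd (x * y + 1) * (x * y + 1)" using assms(1) mult_dvd_mono by blast
  also have "(x * y + 1) * (x * y + 1) = x * (y * (2 + x * y)) + 1" by (simp add: algebra_simps)
  finally show ?thesis using cong_dvd_iff[OF c] by blast
qed

text \<open>Euclid's algorithm that stands still once the remainder is zero, so that one fixed
  number of steps serves all inputs at once.\<close>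

fun eucl :: "nat \<Rightarrow> nat \<Rightarrow> nat \<Rightarrow> nat \<times> nat" where
  "eucl u v 0 = (u, v)"
| "eucl u v (Suc i) = (if snd (eucl u v i) = 0 then eucl u v i
     else (snd (eucl u v i), fst (eucl u v i) mod snd (eucl u v i)))"

text \<open>The product of the two numbers is the potential. It is at most \<open>v * v\<close>
  after the first step, whatever the size of \<open>u\<close>, and then at least halved by each
  step, since \<open>2 * (a mod b) \<le> a\<close> for \<open>b < a\<close>.\<close>

lemma eucl_inv:
  assumes "1 \<le> v"
  shows "gcd (fst (eucl u v i)) (snd (eucl u v i)) = gcd u v \<and> fst (eucl u v i) \<le> max u v \<and> snd (eucl u v i) \<le> max u v \<and>
     (1 \<le> i \<longrightarrow> (snd (eucl u v i) < fst (eucl u v i) \<or> snd (eucl u v i) = 0) \<and>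
        fst (eucl u v i) * snd (eucl u v i) * 2 ^ (i - 1) \<le> v * v)"
proof (induction i)
  case (Suc i)
  define a where "a = fst (eucl u v i)"
  define b where "b = snd (eucl u v i)"
  show ?case
  proof (cases "b = 0")
    case True
    then show ?thesis using Suc assms by (cases "i = 0") (auto simp: b_def)
  next
    case False
    have e: "eucl u v (Suc i) = (b, a mod b)" using False by (simp add: a_def b_def)
    have g: "gcd b (a mod b) = gcd a b" by (metis gcd.commute gcd_red_nat)
    have m: "a mod b < b" using False by simp
    have "b * (a mod b) * 2 ^ i \<le> v * v"
    proof (cases "i = 0")
      case True
      then have "b = v" by (simp add: b_def)
      then show ?thesis using m True by (simp add: mult_le_mono less_imp_le_nat)
    next
      case F: False
      then have ab: "b < a" "a * b * 2 ^ (i - 1) \<le> v * v" using Suc False by (auto simp: a_def b_def)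
      have "2 * (a mod b) \<le> a"
      proof -
        have "1 * b \<le> a div b * b" using ab(1) False by (intro mult_right_mono) (auto simp: Suc_le_eq div_greater_zero_iff)
        moreover have "a = a div b * b + a mod b" by simp
        ultimately show ?thesis using m by linarith
      qed
      then have "b * (2 * (a mod b)) \<le> b * a" by (rule mult_le_mono2)
      then have "b * (2 * (a mod b)) * 2 ^ (i - 1) \<le> a * b * 2 ^ (i - 1)" by (simp add: mult.commute)
      moreover have "b * (a mod b) * 2 ^ i = b * (2 * (a mod b)) * 2 ^ (i - 1)" using F by (cases i) simp_all
      ultimately show ?thesis using ab(2) by linarith
    qed
    then show ?thesis using Suc g m unfolding e by (auto simp: a_def b_def intro: order_trans[OF mod_le_divisor] less_imp_le_nat order_trans)
  qed
qed (use assms in auto)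

text \<open>After \<open>2 * R + 2\<close> steps the potential is at most 2^(2R) / 2^(2R+1) and
  hence zero, which means that the remainder has become zero.\<close>

lemma eucl_gcd:
  assumes "1 \<le> v" "v \<le> 2 ^ R"
  shows "fst (eucl u v (2 * R + 2)) = gcd u v"
proof -
  let ?a = "fst (eucl u v (2 * R + 2))" and ?b = "snd (eucl u v (2 * R + 2))"
  have I: "gcd ?a ?b = gcd u v" "?b < ?a \<or> ?b = 0" "?a * ?b * 2 ^ (2 * R + 2 - 1) \<le> v * v"
    using eucl_inv[OF assms(1), of u "2 * R + 2"] by auto
  have "v * v \<le> 2 ^ R * 2 ^ R" using assms(2) by (intro mult_le_mono)
  also have "(2::nat) ^ R * 2 ^ R = 2 ^ (2 * R)" by (simp add: power_add[symmetric] mult_2)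
  also have "\<dots> < 2 ^ (2 * R + 2 - 1)" by simp
  finally have "?a * ?b * 2 ^ (2 * R + 2 - 1) < 1 * 2 ^ (2 * R + 2 - 1)" using I(3) by linarith
  then have "?a * ?b = 0" by (metis less_one mult_less_cancel2)
  then have "?b = 0" using I(2) by auto
  then show ?thesis using I(1) by simp
qed

lemma ptree_cong: "(\<And>i. i < Z \<Longrightarrow> X (l * Z + i) = X' (l * Z + i)) \<Longrightarrow> ptree B Z X x l \<Longrightarrow> ptree B Z X' x l"
  and ntree_cong: "(\<And>i. i < Z \<Longrightarrow> X (l * Z + i) = X' (l * Z + i)) \<Longrightarrow> ntree B Z X x l \<Longrightarrow> ntree B Z X' x l"
proof -
  assume e: "\<And>i. i < Z \<Longrightarrow> X (l * Z + i) = X' (l * Z + i)"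
  have n: "nval B X (l * Z + c * 2 ^ l) (2 ^ l) = nval B X' (l * Z + c * 2 ^ l) (2 ^ l)" if "(c + 1) * 2 ^ l \<le> Z" for c
  proof (rule nval_cong)
    fix i assume "i < (2::nat) ^ l"
    then have "c * 2 ^ l + i < Z" using that by simp
    from e[OF this] show "X (l * Z + c * 2 ^ l + i) = X' (l * Z + c * 2 ^ l + i)" by (simp add: add.assoc)
  qed
  show "ptree B Z X x l \<Longrightarrow> ptree B Z X' x l" using e n unfolding ptree_def by simp
  show "ntree B Z X x l \<Longrightarrow> ntree B Z X' x l" using e n unfolding ntree_def by simp
qed

context ram
begin

lemma room_mono: "room g Z B \<Longrightarrow> g' \<le> g \<Longrightarrow> Z' \<le> Z \<Longrightarrow> room g' Z' B"
proof -
  assume r: "room g Z B" and g: "g' \<le> g" and Z: "Z' \<le> Z"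
  have "8 * 2 ^ (g' + 2) * (B * B) \<le> 8 * 2 ^ (g + 2) * (B * B)"
    using g by (intro mult_right_mono mult_left_mono power_increasing) auto
  moreover have "4 * (g' + 2) * Z' \<le> 4 * (g + 2) * Z" using g Z by (intro mult_le_mono) auto
  moreover have "4 * (g' + 2) \<le> 4 * (g + 2)" using g by simp
  ultimately show ?thesis using r unfolding room_def by (meson le_less_trans order_trans)
qed

lemma inv_run:
  assumes v: "vr sg 2 = R" "vr sg 31 = Z" "vr sg 5 = B" "B = 2 ^ (R + 2)" and S: "Z < S" "B \<le> S" "R + 1 \<le> S"
    and x: "\<And>i. i < Z \<Longrightarrow> odd (ar sg 4 i) \<and> ar sg 4 i \<le> S"
  shows "\<exists>sg'. run inv_code sg sg' \<and> frame {24,45,46} {5,10} sg sg' \<and> tm sg' \<le> tm sg + 3000 * ((R + 2) * (Z + 1)) \<and>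
     ntree B Z (ar sg' 5) (ar sg 4) 0"
proof -
  have B1: "1 \<le> B" using v(4) by simp
  obtain sg1 where 1: "run (asg 46 (Var 2 [+] Cst 1)) sg sg1" "vr sg1 = (vr sg)(46 := R + 1)" "ar sg1 = ar sg" "tm sg1 = tm sg + 4"
    using asg_ex[of sg "Var 2 [+] Cst 1" 46 "R + 1"] v S by auto
  have "\<exists>sg'. run (map_loop 5 24 31 (Var 5 [-] Cst 1)) sg1 sg' \<and> tm sg' \<le> tm sg1 + 500 * (Z + 1) \<and> vr sg' = (vr sg1)(24 := Z) \<and>
     ar sg' = (ar sg1)(5 := (\<lambda>i. if i < Z then ev (upv 24 i sg1) (Var 5 [-] Cst 1) else ar sg1 5 i))"
    by (rule run_map) (use 1 v(1-3) B1 S in auto)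
  then obtain sg2 where 2: "run (map_loop 5 24 31 (Var 5 [-] Cst 1)) sg1 sg2" "tm sg2 \<le> tm sg1 + 500 * (Z + 1)" "vr sg2 = (vr sg1)(24 := Z)"
     "ar sg2 = (ar sg1)(5 := (\<lambda>i. if i < Z then ev (upv 24 i sg1) (Var 5 [-] Cst 1) else ar sg1 5 i))" by blast
  let ?I = "\<lambda>k sg'. frame {24,45} {5,10} sg2 sg' \<and> (\<forall>i<Z. ar sg' 5 i < B \<and> 2 ^ (k + 1) dvd ar sg 4 i * ar sg' 5 i + 1)"
  have "\<exists>sg'. run (for_loop 45 46 (upd_loop 10 5 24 31 inv_expr)) sg2 sg' \<and> tm sg' \<le> tm sg2 + (R + 1) * (1000 * (Z + 1) + 5) + 3 \<and>
     ?I (R + 1) sg' \<and> vr sg' 45 = R + 1 \<and> vr sg' 46 = R + 1"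
  proof (rule run_for[where I = ?I])
    fix k sg' assume k: "k < R + 1" and I: "?I k sg'" and w: "vr sg' 45 = k" "vr sg' 46 = R + 1"
    note fI = frame_vr[OF conjunct1[OF I]] frame_ar[OF conjunct1[OF I]]
    have v': "vr sg' 31 = Z" "vr sg' 5 = B" "ar sg' 4 = ar sg 4" using fI 1 2 v by auto
    have ok: "ok (upv 24 i sg') inv_expr" "ev (upv 24 i sg') inv_expr = (ar sg' 5 i * (2 + ar sg 4 i * ar sg' 5 i)) mod B" if "i < Z" for i
    proof -
      have "ar sg' 5 i < B" using I that by blast
      then have "ar sg' 5 i \<le> S" using S(2) by linarith
      then show "ok (upv 24 i sg') inv_expr" using x[OF that] v' S(1) that by (auto simp: inv_expr_def)
      show "ev (upv 24 i sg') inv_expr = (ar sg' 5 i * (2 + ar sg 4 i * ar sg' 5 i)) mod B" using v' by (simp add: inv_expr_def)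
    qed
    have "\<exists>sg1. run (upd_loop 10 5 24 31 inv_expr) sg' sg1 \<and> tm sg1 \<le> tm sg' + 1000 * (Z + 1) \<and>
       vr sg1 = (vr sg')(24 := Z) \<and> (\<forall>b. b \<noteq> 5 \<longrightarrow> b \<noteq> 10 \<longrightarrow> ar sg1 b = ar sg' b) \<and>
       (\<forall>i. ar sg1 5 i = (if i < Z then ev (upv 24 i sg') inv_expr else ar sg' 5 i))"
    proof (rule run_upd)
      show "ok (upv 24 i sg') inv_expr" if "i < Z" for i by (rule ok(1)[OF that])
    qed (use v' S in \<open>auto simp: inv_expr_def\<close>)
    then obtain sga where a: "run (upd_loop 10 5 24 31 inv_expr) sg' sga" "tm sga \<le> tm sg' + 1000 * (Z + 1)"
       "vr sga = (vr sg')(24 := Z)" "\<forall>b. b \<noteq> 5 \<longrightarrow> b \<noteq> 10 \<longrightarrow> ar sga b = ar sg' b"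
       "\<forall>i. ar sga 5 i = (if i < Z then ev (upv 24 i sg') inv_expr else ar sg' 5 i)" by blast
    have new: "ar sga 5 i < B \<and> 2 ^ (Suc k + 1) dvd ar sg 4 i * ar sga 5 i + 1" if "i < Z" for i
    proof -
      have e: "ar sga 5 i = (ar sg' 5 i * (2 + ar sg 4 i * ar sg' 5 i)) mod B" using a(5) ok(2)[OF that] that by simp
      have "2 ^ (k + 1) dvd ar sg 4 i * ar sg' 5 i + 1" using I that by blast
      then have "2 ^ (k + 1 + 1) dvd ar sg 4 i * (ar sg' 5 i * (2 + ar sg 4 i * ar sg' 5 i) mod 2 ^ (R + 2)) + 1"
        by (rule hensel_step) (use k in auto)
      then show ?thesis unfolding e v(4) by simp
    qed
    show "\<exists>sg''. run (upd_loop 10 5 24 31 inv_expr) sg' sg'' \<and> tm sg'' \<le> tm sg' + 1000 * (Z + 1) \<and> vr sg'' 45 = k \<and> vr sg'' 46 = R + 1 \<and> ?I (Suc k) (upv 45 (Suc k) sg'')"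
      by (rule exI[of _ sga], intro conjI[OF a(1)] conjI[OF a(2)]) (use a w fI new in \<open>auto simp: frame_def\<close>)
  next
    \<comment> \<open>The iteration starts with -1, that is \<open>B - 1\<close>, a negated inverse
      modulo \<open>2\<close> of every odd number. From one correct bit, \<open>R + 1\<close> steps
      reach the \<open>R + 2\<close> bits of the base.\<close>
    have "2 ^ (0 + 1) dvd ar sg 4 i * (B - 1) + 1" if "i < Z" for i
    proof -
      have "odd (B - 1)" using v(4) B1 by simp
      then show ?thesis using x[OF that] by simp
    qed
    moreover have "ar sg2 5 i = B - 1" if "i < Z" for i using 2(4) 1 v(3) that by simp
    ultimately show "?I 0 (upv 45 0 sg2)" using B1 by simp
  qed (use 1 2 S in auto)
  then obtain sg3 where 3: "run (for_loop 45 46 (upd_loop 10 5 24 31 inv_expr)) sg2 sg3"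
     "tm sg3 \<le> tm sg2 + (R + 1) * (1000 * (Z + 1) + 5) + 3" "?I (R + 1) sg3" by blast
  have "ntree B Z (ar sg3 5) (ar sg 4) 0"
    using 3(3) unfolding ntree_def by (simp add: pv_0 nval_def v(4))
  moreover have "tm sg3 \<le> tm sg + 3000 * ((R + 2) * (Z + 1))"
  proof -
    have "(R + 1) * (1000 * (Z + 1) + 5) \<le> (R + 2) * (1005 * (Z + 1))" by (intro mult_le_mono) auto
    also have "\<dots> = 1005 * ((R + 2) * (Z + 1))" by (simp only: mult.left_commute)
    finally have a: "(R + 1) * (1000 * (Z + 1) + 5) \<le> 1005 * ((R + 2) * (Z + 1))" .
    have b: "1 * (Z + 1) \<le> (R + 2) * (Z + 1)" by (intro mult_right_mono) auto
    have "t3 \<le> t + 3000 * q" if "t1 = t + 4" "t2 \<le> t1 + 500 * z" "t3 \<le> t2 + p + 3" "p \<le> 1005 * q" "1 * z \<le> q" "1 \<le> z" for t t1 t2 t3 p q z :: nat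
      using that by simp
    from this[OF 1(4) 2(2) 3(2) a b] show ?thesis by simp
  qed
  moreover have "frame {24,45,46} {5,10} sg sg3"
    using frame_vr[OF conjunct1[OF 3(3)]] frame_ar[OF conjunct1[OF 3(3)]] 1 2 by (auto simp: frame_def)
  ultimately show ?thesis unfolding inv_code_def
    by (intro exI[of _ sg3] conjI[OF run_Seq[OF 1(1) run_Seq[OF 2(1) 3(1)]]]) auto
qed

lemma up_run:
  assumes v: "vr sg 33 = g" "vr sg 31 = Z" "vr sg 5 = B" and Z: "Z = Q * 2 ^ g"
    and B: "B = 4 * b" "1 \<le> b" and xb: "\<And>i. i < Z \<Longrightarrow> x i \<le> b"
    and rm: "room g Z B" and pt: "ptree B Z (ar sg 4) x 0" and nt: "ntree B Z (ar sg 5) x 0"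
  shows "\<exists>sg'. run up_code sg sg' \<and> frame ({10..29} \<union> {30,32,36,37,38}) ({8..13} \<union> {4,5,7}) sg sg' \<and>
     tm sg' \<le> tm sg + 1300000 * ((g + 1) * ((g + 4) ^ 3 * (2 * Z + 2 ^ (g + 2) + 1))) \<and>
     (\<forall>l\<le>g. ptree B Z (ar sg' 4) x l \<and> ntree B Z (ar sg' 5) x l)"
proof -
  have B4: "4 \<le> B" using B by simp
  have gS: "8 * 2 ^ g \<le> S" "g \<le> S"
  proof -
    have "8 * 2 ^ g * 1 \<le> 8 * 2 ^ g * (B * B)" using B4 by (intro mult_left_mono) auto
    also have "\<dots> \<le> S" by (rule roomD(1)[OF rm]) simp
    finally show "8 * 2 ^ g \<le> S" by simp
    show "g \<le> S" using roomD(2)[OF rm, of g] by simp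
  qed
  obtain sg1 where 1: "run (asg 32 (Cst 1)) sg sg1" "vr sg1 = (vr sg)(32 := 1)" "ar sg1 = ar sg" "tm sg1 = tm sg + 2"
    using asg_ex[of sg "Cst 1" 32 1] S_ge by auto
  define W where "W = (g + 4) ^ 3 * (2 * Z + 2 ^ (g + 2) + 1)"
  have "1 * 1 \<le> W" unfolding W_def by (intro mult_le_mono one_le_power) auto
  then have W1: "1 \<le> W" by simp
  let ?c = "upx_code 4 ;; upn_code ;; asg 32 (Cst 2 [*] Var 32)"
  let ?I = "\<lambda>l sg'. frame ({10..29} \<union> {30,32,36,37,38}) ({8..13} \<union> {4,5,7}) sg1 sg' \<and> vr sg' 32 = 2 ^ l \<and>
     (\<forall>k\<le>l. ptree B Z (ar sg' 4) x k \<and> ntree B Z (ar sg' 5) x k)"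
  have "\<exists>sg'. run (for_loop 30 33 ?c) sg1 sg' \<and> tm sg' \<le> tm sg1 + g * (1200000 * W + 5) + 3 \<and> ?I g sg' \<and> vr sg' 30 = g \<and> vr sg' 33 = g"
  proof (rule run_for[where I = ?I])
    fix l sg' assume l: "l < g" and I: "?I l sg'" and w: "vr sg' 30 = l" "vr sg' 33 = g"
    note fI = frame_vr[OF conjunct1[OF I]] frame_ar[OF conjunct1[OF I]]
    have v': "vr sg' 31 = Z" "vr sg' 5 = B" "vr sg' 32 = 2 ^ l" using fI 1 v I by auto
    have "g = (g - Suc l) + Suc l" using l by simp
    then have Zl: "Z = Q * 2 ^ (g - Suc l) * 2 ^ Suc l" unfolding Z by (metis mult.assoc power_add)
    obtain sga where a: "run (upx_code 4) sg' sga" "frame ({10..29} \<union> {36,37,38}) ({8..13} \<union> {4}) sg' sga"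
      "tm sga \<le> tm sg' + 300000 * ((l + 3) ^ 3 * (Z + 2 ^ Suc l + 1))"
      "\<forall>i. \<not> (Suc l * Z \<le> i \<and> i < Suc l * Z + Z) \<longrightarrow> ar sga 4 i = ar sg' 4 i" "ptree B Z (ar sga 4) x (Suc l)"
      using upx_run[where a = 4 and x = x, OF w(1) v'(1,3,2) Zl B xb _ rm l] I by auto
    note fa = frame_vr[OF a(2)] frame_ar[OF a(2)]
    have nta: "ntree B Z (ar sga 5) x l" using fa I by simp
    have va: "vr sga 30 = l" "vr sga 31 = Z" "vr sga 32 = 2 ^ l" "vr sga 5 = B" using fa w v' by auto
    obtain sgb where b: "run upn_code sga sgb" "frame ({10..29} \<union> {36,37,38}) ({8..13} \<union> {5,7}) sga sgb"
      "tm sgb \<le> tm sga + 800000 * ((l + 4) ^ 3 * (2 * Z + 2 ^ (l + 2) + 1))"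
      "\<forall>i. \<not> (Suc l * Z \<le> i \<and> i < Suc l * Z + Z) \<longrightarrow> ar sgb 5 i = ar sga 5 i" "ntree B Z (ar sgb 5) x (Suc l)"
      using upn_run[OF va Zl B4 rm l a(5) nta] by auto
    note fb = frame_vr[OF b(2)] frame_ar[OF b(2)]
    have lS: "2 * 2 ^ l \<le> S"
    proof -
      have "(2::nat) ^ l \<le> 2 ^ g" using l by (intro power_increasing) auto
      then show ?thesis using gS(1) by linarith
    qed
    obtain sgc where c: "run (asg 32 (Cst 2 [*] Var 32)) sgb sgc" "vr sgc = (vr sgb)(32 := 2 ^ Suc l)" "ar sgc = ar sgb" "tm sgc = tm sgb + 4"
      using asg_ex[of sgb "Cst 2 [*] Var 32" 32 "2 ^ Suc l"] fb va lS by auto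
    have old: "k * Z + i < Suc l * Z" if "k \<le> l" "i < Z" for k i
    proof -
      have "k * Z \<le> l * Z" using that(1) by (rule mult_le_mono1)
      then show ?thesis using that(2) unfolding mult_Suc by linarith
    qed
    have "ptree B Z (ar sgc 4) x k \<and> ntree B Z (ar sgc 5) x k" if "k \<le> Suc l" for k
    proof (cases "k = Suc l")
      case True then show ?thesis using a(5) b(5) c(3) fb by simp
    next
      case False
      then have k: "k \<le> l" using that by simp
      have "ptree B Z (ar sgc 4) x k"
      proof (rule ptree_cong)
        show "ptree B Z (ar sg' 4) x k" using I k by blast
        show "ar sg' 4 (k * Z + i) = ar sgc 4 (k * Z + i)" if "i < Z" for i
          using old[OF k that] a(4) c(3) fb(2)[of 4] by simp
      qed
      moreover have "ntree B Z (ar sgc 5) x k"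
      proof (rule ntree_cong)
        show "ntree B Z (ar sg' 5) x k" using I k by blast
        show "ar sg' 5 (k * Z + i) = ar sgc 5 (k * Z + i)" if "i < Z" for i
          using old[OF k that] b(4) c(3) fa(2)[of 5] by simp
      qed
      ultimately show ?thesis ..
    qed
    moreover have "tm sgc \<le> tm sg' + 1200000 * W"
    proof -
      have p: "(2::nat) ^ Suc l \<le> 2 ^ (g + 2)" "(2::nat) ^ (l + 2) \<le> 2 ^ (g + 2)" using l by (intro power_increasing; simp)+
      have "(l + 3) ^ 3 * (Z + 2 ^ Suc l + 1) \<le> W" unfolding W_def using l p by (intro mult_le_mono power_mono) auto
      moreover have "(l + 4) ^ 3 * (2 * Z + 2 ^ (l + 2) + 1) \<le> W" unfolding W_def using l p by (intro mult_le_mono power_mono) auto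
      moreover have "tc \<le> t + 1200000 * W" if "p \<le> W" "q \<le> W" "ta \<le> t + 300000 * p" "tb \<le> ta + 800000 * q" "tc = tb + 4" for t ta tb tc p q :: nat
        using that W1 by simp
      ultimately show ?thesis using a(3) b(3) c(4) by blast
    qed
    moreover have "frame ({10..29} \<union> {30,32,36,37,38}) ({8..13} \<union> {4,5,7}) sg1 (upv 30 (Suc l) sgc)"
    proof -
      have "frame ({10..29} \<union> {30,32,36,37,38}) ({8..13} \<union> {4,5,7}) sg' sga" by (rule frame_mono[OF a(2)]) auto
      moreover have "frame ({10..29} \<union> {30,32,36,37,38}) ({8..13} \<union> {4,5,7}) sga sgb" by (rule frame_mono[OF b(2)]) auto
      moreover have "frame ({10..29} \<union> {30,32,36,37,38}) ({8..13} \<union> {4,5,7}) sgb (upv 30 (Suc l) sgc)" using c by (auto simp: frame_def)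
      ultimately show ?thesis using I by (meson frame_trans subset_refl)
    qed
    moreover have "vr sgc 30 = l" "vr sgc 33 = g" using c fb fa w by auto
    ultimately show "\<exists>sg''. run ?c sg' sg'' \<and> tm sg'' \<le> tm sg' + 1200000 * W \<and> vr sg'' 30 = l \<and> vr sg'' 33 = g \<and> ?I (Suc l) (upv 30 (Suc l) sg'')"
      by (intro exI[of _ sgc] conjI[OF run_Seq[OF a(1) run_Seq[OF b(1) c(1)]]]) (simp add: c(2))
  qed (use 1 v gS pt nt in auto)
  then obtain sg2 where 2: "run (for_loop 30 33 ?c) sg1 sg2" "tm sg2 \<le> tm sg1 + g * (1200000 * W + 5) + 3" "?I g sg2" by blast
  have "tm sg2 \<le> tm sg + 1300000 * ((g + 1) * W)"
  proof -
    have "g * (1200000 * W + 5) \<le> g * (1200005 * W)" using W1 by (intro mult_le_mono) auto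
    then have "g * (1200000 * W + 5) \<le> 1200005 * (g * W)" by simp
    moreover have "(g + 1) * W = g * W + W" by simp
    moreover have "t2 \<le> t + 1300000 * (gw + W)" if "t1 = t + 2" "t2 \<le> t1 + p + 3" "p \<le> 1200005 * gw" for t t1 t2 p gw :: nat
      using that W1 by simp
    ultimately show ?thesis using 1(4) 2(2) by metis
  qed
  moreover have "frame ({10..29} \<union> {30,32,36,37,38}) ({8..13} \<union> {4,5,7}) sg sg2"
  proof -
    have "frame ({10..29} \<union> {30,32,36,37,38}) ({8..13} \<union> {4,5,7}) sg sg1" using 1 by (auto simp: frame_def)
    then show ?thesis using conjunct1[OF 2(3)] by (meson frame_trans subset_refl)
  qed
  ultimately show ?thesis unfolding up_code_def W_def[symmetric]
    by (intro exI[of _ sg2] conjI[OF run_Seq[OF 1(1) 2(1)]]) (use 2(3) in auto)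
qed

lemma down_loop_run:
  assumes v: "vr sg 33 = g" "vr sg 31 = Z" "vr sg 5 = B" and Z: "Z = Q * 2 ^ g"
    and B: "B = 4 * b" "1 \<le> b" and xb: "\<And>i. i < Z \<Longrightarrow> x i \<le> b" and cop: "\<And>i. i < Z \<Longrightarrow> coprime B (x i)"
    and rm: "room g Z B" and pn: "\<forall>l\<le>g. ptree B Z (ar sg 4) x l \<and> ntree B Z (ar sg 5) x l"
    and vt: "vtree B b Z (ar sg 6) x G g"
  shows "\<exists>sg'. run down_loop sg sg' \<and> frame ({10..29} \<union> {30,32,36,37,38,47}) ({8..13} \<union> {6}) sg sg' \<and>
     tm sg' \<le> tm sg + 900000 * ((g + 1) * ((g + 4) ^ 3 * (2 * Z + 2 ^ (g + 2) + 1))) \<and> vtree B b Z (ar sg' 6) x G 0"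
proof -
  have B4: "4 \<le> B" using B by simp
  have gS: "8 * 2 ^ g \<le> S" "g \<le> S"
  proof -
    have "8 * 2 ^ g * 1 \<le> 8 * 2 ^ g * (B * B)" using B4 by (intro mult_left_mono) auto
    also have "\<dots> \<le> S" by (rule roomD(1)[OF rm]) simp
    finally show "8 * 2 ^ g \<le> S" by simp
    show "g \<le> S" using roomD(2)[OF rm, of g] by simp
  qed
  define W where "W = (g + 4) ^ 3 * (2 * Z + 2 ^ (g + 2) + 1)"
  have "1 * 1 \<le> W" unfolding W_def by (intro mult_le_mono one_le_power) auto
  then have W1: "1 \<le> W" by simp
  let ?X = "{10..29} \<union> {30,32,36,37,38,47} :: nat set" and ?Y = "{8..13} \<union> {6} :: nat set"
  let ?c = "asg 30 (Var 33 [-] (Var 47 [+] Cst 1)) ;; asg 32 (Pow2 (Var 30)) ;; down_code"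
  let ?I = "\<lambda>j sg'. frame ?X ?Y sg sg' \<and> vtree B b Z (ar sg' 6) x G (g - j)"
  have "\<exists>sg'. run (for_loop 47 33 ?c) sg sg' \<and> tm sg' \<le> tm sg + g * (800020 * W + 5) + 3 \<and> ?I g sg' \<and> vr sg' 47 = g \<and> vr sg' 33 = g"
  proof (rule run_for[where I = ?I])
    fix j sg' assume j: "j < g" and I: "?I j sg'" and w: "vr sg' 47 = j" "vr sg' 33 = g"
    note fI = frame_vr[OF conjunct1[OF I]] frame_ar[OF conjunct1[OF I]]
    define l where "l = g - Suc j"
    have l: "l < g" "g - j = Suc l" using j by (auto simp: l_def)
    have lS: "(2::nat) ^ l \<le> S"
    proof -
      have "(2::nat) ^ l \<le> 2 ^ g" using l by (intro power_increasing) auto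
      then show ?thesis using gS(1) by linarith
    qed
    obtain sga where a: "run (asg 30 (Var 33 [-] (Var 47 [+] Cst 1))) sg' sga" "vr sga = (vr sg')(30 := l)" "ar sga = ar sg'" "tm sga = tm sg' + 6"
    proof -
      have "l \<le> S" using l(1) gS(2) by linarith
      then show ?thesis using that asg_ex[of sg' "Var 33 [-] (Var 47 [+] Cst 1)" 30 l] w j by (auto simp: l_def)
    qed
    obtain sgb where b: "run (asg 32 (Pow2 (Var 30))) sga sgb" "vr sgb = (vr sga)(32 := 2 ^ l)" "ar sgb = ar sg'" "tm sgb = tm sg' + 9"
      using asg_ex[of sga "Pow2 (Var 30)" 32 "2 ^ l"] a lS by auto
    have vb: "vr sgb 30 = l" "vr sgb 31 = Z" "vr sgb 32 = 2 ^ l" "vr sgb 5 = B" using a b fI v by auto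
    have "g = (g - Suc l) + Suc l" using l by simp
    then have Zl: "Z = Q * 2 ^ (g - Suc l) * 2 ^ Suc l" unfolding Z by (metis mult.assoc power_add)
    have ptb: "ptree B Z (ar sgb 4) x l" "ntree B Z (ar sgb 5) x l" using pn l(1) b(3) fI by auto
    have vtb: "vtree B b Z (ar sgb 6) x G (Suc l)" using I b(3) l(2) by simp
    obtain sgc where c: "run down_code sgb sgc" "frame ({10..29} \<union> {36,37,38}) ({8..13} \<union> {6}) sgb sgc"
      "tm sgc \<le> tm sgb + 800000 * ((l + 3) ^ 3 * (2 * Z + 2 ^ Suc l + 1))" "vtree B b Z (ar sgc 6) x G l"
      using down_run[OF vb Zl B xb cop rm l(1) ptb vtb] by auto
    note fc = frame_vr[OF c(2)] frame_ar[OF c(2)]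
    have t: "tm sgc \<le> tm sg' + 800020 * W"
    proof -
      have "(2::nat) ^ Suc l \<le> 2 ^ (g + 2)" using l by (intro power_increasing) auto
      then have "(l + 3) ^ 3 * (2 * Z + 2 ^ Suc l + 1) \<le> W" unfolding W_def using l by (intro mult_le_mono power_mono) auto
      moreover have "tc \<le> t + 800020 * W" if "p \<le> W" "tb = t + 9" "tc \<le> tb + 800000 * p" for t tb tc p :: nat using that W1 by simp
      ultimately show ?thesis using b(4) c(3) by blast
    qed
    have fr: "frame ?X ?Y sg (upv 47 (Suc j) sgc)"
    proof -
      have "frame ?X ?Y sg' sgb" using a b by (auto simp: frame_def)
      moreover have "frame ?X ?Y sgb (upv 47 (Suc j) sgc)" using frame_mono[OF c(2), of ?X ?Y] by simp blast
      ultimately show ?thesis using I by (meson frame_trans subset_refl)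
    qed
    show "\<exists>sg''. run ?c sg' sg'' \<and> tm sg'' \<le> tm sg' + 800020 * W \<and> vr sg'' 47 = j \<and> vr sg'' 33 = g \<and> ?I (Suc j) (upv 47 (Suc j) sg'')"
      by (intro exI[of _ sgc] conjI[OF run_Seq[OF a(1) run_Seq[OF b(1) c(1)]]] conjI[OF t]) (use fr c(4) fc a b w in \<open>auto simp: l_def\<close>)
  qed (use v gS vt in auto)
  then obtain sg2 where 2: "run (for_loop 47 33 ?c) sg sg2" "tm sg2 \<le> tm sg + g * (800020 * W + 5) + 3" "?I g sg2" by blast
  have "tm sg2 \<le> tm sg + 900000 * ((g + 1) * W)"
  proof -
    have "g * (800020 * W + 5) \<le> g * (800025 * W)" using W1 by (intro mult_le_mono) auto
    then have "g * (800020 * W + 5) \<le> 800025 * (g * W)" by simp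
    moreover have "(g + 1) * W = g * W + W" by simp
    moreover have "t2 \<le> t + 900000 * (gw + W)" if "t2 \<le> t + p + 3" "p \<le> 800025 * gw" for t t2 p gw :: nat
      using that W1 by simp
    ultimately show ?thesis using 2(2) by metis
  qed
  then show ?thesis unfolding down_loop_def W_def[symmetric] using 2 by auto
qed

lemma gcd_run:
  assumes v: "vr sg 0 = n" "vr sg 2 = R" and S: "n < S" "2 * R + 2 \<le> S"
    and x: "\<And>j. j < n \<Longrightarrow> 1 \<le> ar sg 19 j \<and> ar sg 19 j \<le> 2 ^ R \<and> ar sg 19 j \<le> S \<and> ar sg 18 j \<le> S"
  shows "\<exists>sg'. run gcd_code sg sg' \<and> frame {24,45,46} {10,18,19,20} sg sg' \<and> tm sg' \<le> tm sg + 3000 * ((2 * R + 3) * (n + 1)) \<and>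
     (\<forall>j<n. ar sg' 18 j = gcd (ar sg 18 j) (ar sg 19 j))"
proof -
  obtain sg1 where 1: "run (asg 46 (Cst 2 [*] Var 2 [+] Cst 2)) sg sg1" "vr sg1 = (vr sg)(46 := 2 * R + 2)" "ar sg1 = ar sg" "tm sg1 = tm sg + 6"
    using asg_ex[of sg "Cst 2 [*] Var 2 [+] Cst 2" 46 "2 * R + 2"] v S by auto
  let ?e1 = "Ite (Arr 19 vI) (Cst 1) (Arr 18 vI) (Arr 19 vI)"
  let ?e2 = "Ite (Arr 19 vI) (Cst 1) (Cst 0) (Arr 18 vI [mod] Arr 19 vI)"
  let ?c = "map_loop 20 24 0 ?e1 ;; upd_loop 10 19 24 0 ?e2 ;; map_loop 18 24 0 (Arr 20 vI)"
  let ?u = "ar sg 18" and ?v = "ar sg 19"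
  let ?I = "\<lambda>k sg'. frame {24,45} {10,18,19,20} sg1 sg' \<and> (\<forall>j<n. ar sg' 18 j = fst (eucl (?u j) (?v j) k) \<and> ar sg' 19 j = snd (eucl (?u j) (?v j) k))"
  have "\<exists>sg'. run (for_loop 45 46 ?c) sg1 sg' \<and> tm sg' \<le> tm sg1 + (2 * R + 2) * (2000 * (n + 1) + 5) + 3 \<and> ?I (2 * R + 2) sg' \<and>
     vr sg' 45 = 2 * R + 2 \<and> vr sg' 46 = 2 * R + 2"
  proof (rule run_for[where I = ?I])
    fix k sg' assume k: "k < 2 * R + 2" and I: "?I k sg'" and w: "vr sg' 45 = k" "vr sg' 46 = 2 * R + 2"
    note fI = frame_vr[OF conjunct1[OF I]] frame_ar[OF conjunct1[OF I]]
    have v': "vr sg' 0 = n" using fI 1 v by auto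
    have bd: "ar sg' 18 j \<le> S" "ar sg' 19 j \<le> S" if "j < n" for j
      using eucl_inv[of "?v j" "?u j" k] x[OF that] I that by auto
    have ok1: "ok (upv 24 j sg') ?e1" if "j < n" for j using that S by simp
    have "\<exists>sg1. run (map_loop 20 24 0 ?e1) sg' sg1 \<and> tm sg1 \<le> tm sg' + 500 * (n + 1) \<and> vr sg1 = (vr sg')(24 := n) \<and>
       ar sg1 = (ar sg')(20 := (\<lambda>i. if i < n then ev (upv 24 i sg') ?e1 else ar sg' 20 i))"
    proof (rule run_map)
      show "ok (upv 24 i sg') ?e1" if "i < n" for i by (rule ok1[OF that])
    qed (use v' S in auto)
    then obtain sga where a: "run (map_loop 20 24 0 ?e1) sg' sga" "tm sga \<le> tm sg' + 500 * (n + 1)" "vr sga = (vr sg')(24 := n)"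
       "ar sga = (ar sg')(20 := (\<lambda>i. if i < n then ev (upv 24 i sg') ?e1 else ar sg' 20 i))" by blast
    have ok2: "ok (upv 24 j sga) ?e2" if "j < n" for j using that S a bd[OF that] by simp
    have "\<exists>sg1. run (upd_loop 10 19 24 0 ?e2) sga sg1 \<and> tm sg1 \<le> tm sga + 1000 * (n + 1) \<and>
       vr sg1 = (vr sga)(24 := n) \<and> (\<forall>b. b \<noteq> 19 \<longrightarrow> b \<noteq> 10 \<longrightarrow> ar sg1 b = ar sga b) \<and>
       (\<forall>i. ar sg1 19 i = (if i < n then ev (upv 24 i sga) ?e2 else ar sga 19 i))"
    proof (rule run_upd)
      show "ok (upv 24 i sga) ?e2" if "i < n" for i by (rule ok2[OF that])
    qed (use a v' S in auto)
    then obtain sgb where b: "run (upd_loop 10 19 24 0 ?e2) sga sgb" "tm sgb \<le> tm sga + 1000 * (n + 1)"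
       "vr sgb = (vr sga)(24 := n)" "\<forall>b. b \<noteq> 19 \<longrightarrow> b \<noteq> 10 \<longrightarrow> ar sgb b = ar sga b"
       "\<forall>i. ar sgb 19 i = (if i < n then ev (upv 24 i sga) ?e2 else ar sga 19 i)" by blast
    have "\<exists>sg1. run (map_loop 18 24 0 (Arr 20 vI)) sgb sg1 \<and> tm sg1 \<le> tm sgb + 500 * (n + 1) \<and> vr sg1 = (vr sgb)(24 := n) \<and>
       ar sg1 = (ar sgb)(18 := (\<lambda>i. if i < n then ev (upv 24 i sgb) (Arr 20 vI) else ar sgb 18 i))"
      by (rule run_map) (use a b v' S in auto)
    then obtain sgc where c: "run (map_loop 18 24 0 (Arr 20 vI)) sgb sgc" "tm sgc \<le> tm sgb + 500 * (n + 1)" "vr sgc = (vr sgb)(24 := n)"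
       "ar sgc = (ar sgb)(18 := (\<lambda>i. if i < n then ev (upv 24 i sgb) (Arr 20 vI) else ar sgb 18 i))" by blast
    have new: "ar sgc 18 j = fst (eucl (?u j) (?v j) (Suc k)) \<and> ar sgc 19 j = snd (eucl (?u j) (?v j) (Suc k))" if "j < n" for j
    proof -
      have I': "ar sg' 18 j = fst (eucl (?u j) (?v j) k)" "ar sg' 19 j = snd (eucl (?u j) (?v j) k)" using I that by blast+
      have "ar sgc 18 j = (if ar sg' 19 j = 0 then ar sg' 18 j else ar sg' 19 j)" using a b c that by simp
      moreover have "ar sgc 19 j = (if ar sg' 19 j = 0 then 0 else ar sg' 18 j mod ar sg' 19 j)" using a b c that by simp
      ultimately show ?thesis using I' by simp
    qed
    show "\<exists>sg''. run ?c sg' sg'' \<and> tm sg'' \<le> tm sg' + 2000 * (n + 1) \<and> vr sg'' 45 = k \<and> vr sg'' 46 = 2 * R + 2 \<and> ?I (Suc k) (upv 45 (Suc k) sg'')"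
    proof (intro exI[of _ sgc] conjI[OF run_Seq[OF a(1) run_Seq[OF b(1) c(1)]]] conjI)
      show "tm sgc \<le> tm sg' + 2000 * (n + 1)" using a(2) b(2) c(2) by simp
      show "frame {24,45} {10,18,19,20} sg1 (upv 45 (Suc k) sgc)" using fI a b c by (auto simp: frame_def)
      show "\<forall>j<n. ar (upv 45 (Suc k) sgc) 18 j = fst (eucl (?u j) (?v j) (Suc k)) \<and> ar (upv 45 (Suc k) sgc) 19 j = snd (eucl (?u j) (?v j) (Suc k))"
        using new by simp
    qed (use a b c w in auto)
  qed (use 1 S in auto)
  then obtain sg2 where 2: "run (for_loop 45 46 ?c) sg1 sg2" "tm sg2 \<le> tm sg1 + (2 * R + 2) * (2000 * (n + 1) + 5) + 3" "?I (2 * R + 2) sg2" by blast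
  have "tm sg2 \<le> tm sg + 3000 * ((2 * R + 3) * (n + 1))"
  proof -
    have "(2 * R + 2) * (2000 * (n + 1) + 5) \<le> (2 * R + 3) * (2005 * (n + 1))" by (intro mult_le_mono) auto
    then have a: "(2 * R + 2) * (2000 * (n + 1) + 5) \<le> 2005 * ((2 * R + 3) * (n + 1))" by (simp only: mult.left_commute)
    have "1 * 1 \<le> (2 * R + 3) * (n + 1)" by (intro mult_le_mono) auto
    moreover have "t2 \<le> t + 3000 * q" if "t1 = t + 6" "t2 \<le> t1 + p + 3" "p \<le> 2005 * q" "1 * 1 \<le> q" for t t1 t2 p q :: nat using that by simp
    ultimately show ?thesis using 1(4) 2(2) a by blast
  qed
  moreover have "frame {24,45,46} {10,18,19,20} sg sg2"
    using frame_vr[OF conjunct1[OF 2(3)]] frame_ar[OF conjunct1[OF 2(3)]] 1 by (auto simp: frame_def)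
  moreover have "\<forall>j<n. ar sg2 18 j = gcd (?u j) (?v j)" using 2(3) eucl_gcd x by auto
  ultimately show ?thesis unfolding gcd_code_def by (intro exI[of _ sg2] conjI[OF run_Seq[OF 1(1) 2(1)]]) auto
qed

end

section \<open>One level of the search for all inputs\<close>

definition vin_expr :: expr where
  "vin_expr = Arr 3 (Var 33 [*] Var 4 [+] Cst 2 [*] Arr 15 (vI [div] Var 34) [*] Var 34 [+] vI [mod] Var 34)"

text \<open>The search moves to the left child if the gcd with its product exceeds \<open>1\<close>,
  and to the right child otherwise.\<close>

definition cv_expr :: expr where
  "cv_expr = Cst 2 [*] Arr 17 vI [+] Ite (Cst 1) (Arr 18 vI) (Cst 0) (Cst 1)"

definition level_code :: com where
  "level_code = asg 34 (Pow2 (Var 33)) ;; alloc_code ;; inv_code ;; up_code ;; map_loop 6 24 31 vin_expr ;; down_loop ;;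
     map_loop 18 24 0 (Arr 6 (Arr 16 vI)) ;; map_loop 19 24 0 (Arr 0 vI) ;; gcd_code ;; upd_loop 10 17 24 0 cv_expr"

text \<open>The tree over 1, ..., 2^K depends on the size bound only; it is built once and serves
  every level of every round.\<close>

definition dtree_code :: com where
  "dtree_code = asg 31 (Var 4) ;; asg 32 (Cst 1) ;; map_loop 3 24 4 (vI [+] Cst 1) ;;
     for_loop 30 3 (upx_code 3 ;; asg 32 (Cst 2 [*] Var 32))"

lemma frame_trans_same [trans]: "frame X Y sg sg' \<Longrightarrow> frame X Y sg' sg'' \<Longrightarrow> frame X Y sg sg''"
  by (rule frame_trans) auto

context ram
begin

lemma dtree_run:
  assumes v: "vr sg 3 = K" "vr sg 4 = 2 ^ K" "vr sg 5 = B" and B: "B = 4 * b" "2 ^ K \<le> b" and rm: "room K (2 ^ K) B"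
  shows "\<exists>sg'. run dtree_code sg sg' \<and> frame ({10..32} \<union> {36,37,38}) ({8..13} \<union> {3}) sg sg' \<and>
     tm sg' \<le> tm sg + 400000 * ((K + 1) * ((K + 4) ^ 3 * (2 ^ K + 2 ^ K + 1))) \<and>
     (\<forall>l\<le>K. ptree B (2 ^ K) (ar sg' 3) Suc l)"
proof -
  let ?Z = "2 ^ K :: nat"
  have b1: "1 \<le> b" using B(2) one_le_power[of "2::nat" K] by linarith
  have B4: "4 \<le> B" using B b1 by simp
  have gS: "8 * ?Z \<le> S" "K \<le> S"
  proof -
    have "8 * 2 ^ K * 1 \<le> 8 * 2 ^ K * (B * B)" using B4 by (intro mult_left_mono) auto
    also have "\<dots> \<le> S" by (rule roomD(1)[OF rm]) simp
    finally show "8 * 2 ^ K \<le> S" by simp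
    show "K \<le> S" using roomD(2)[OF rm, of K] by simp
  qed
  obtain sg1 where 1: "run (asg 31 (Var 4)) sg sg1" "vr sg1 = (vr sg)(31 := ?Z)" "ar sg1 = ar sg" "tm sg1 = tm sg + 2"
    using asg_ex[of sg "Var 4" 31 ?Z] v gS by auto
  obtain sg2 where 2: "run (asg 32 (Cst 1)) sg1 sg2" "vr sg2 = (vr sg1)(32 := 1)" "ar sg2 = ar sg" "tm sg2 = tm sg + 4"
    using asg_ex[of sg1 "Cst 1" 32 1] 1 S_ge by auto
  have "\<exists>sg'. run (map_loop 3 24 4 (vI [+] Cst 1)) sg2 sg' \<and> tm sg' \<le> tm sg2 + 500 * (?Z + 1) \<and> vr sg' = (vr sg2)(24 := ?Z) \<and>
     ar sg' = (ar sg2)(3 := (\<lambda>i. if i < ?Z then ev (upv 24 i sg2) (vI [+] Cst 1) else ar sg2 3 i))"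
    by (rule run_map) (use 1 2 v gS in auto)
  then obtain sg3 where 3: "run (map_loop 3 24 4 (vI [+] Cst 1)) sg2 sg3" "tm sg3 \<le> tm sg2 + 500 * (?Z + 1)" "vr sg3 = (vr sg2)(24 := ?Z)"
     "ar sg3 = (ar sg2)(3 := (\<lambda>i. if i < ?Z then ev (upv 24 i sg2) (vI [+] Cst 1) else ar sg2 3 i))" by blast
  have p0: "ptree B ?Z (ar sg3 3) Suc 0"
  proof -
    have "ar sg3 3 i = Suc i" if "i < ?Z" for i using 3(4) that by simp
    moreover have "Suc i < B" if "i < ?Z" for i using that B b1 by linarith
    ultimately show ?thesis unfolding ptree_def by (simp add: pv_0 nval_def)
  qed
  define W where "W = (K + 4) ^ 3 * (?Z + ?Z + 1)"
  have W0: "1 * (?Z + ?Z + 1) \<le> W" unfolding W_def by (intro mult_le_mono one_le_power) auto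
  have W1: "1 \<le> W" using W0 by simp
  let ?X = "{10..32} \<union> {36,37,38} :: nat set" and ?Y = "{8..13} \<union> {3} :: nat set"
  let ?c = "upx_code 3 ;; asg 32 (Cst 2 [*] Var 32)"
  let ?I = "\<lambda>l sg'. frame ({10..29} \<union> {30,32,36,37,38}) ?Y sg3 sg' \<and> vr sg' 32 = 2 ^ l \<and> (\<forall>k\<le>l. ptree B ?Z (ar sg' 3) Suc k)"
  have "\<exists>sg'. run (for_loop 30 3 ?c) sg3 sg' \<and> tm sg' \<le> tm sg3 + K * (300004 * W + 5) + 3 \<and> ?I K sg' \<and> vr sg' 30 = K \<and> vr sg' 3 = K"
  proof (rule run_for[where I = ?I])
    fix l sg' assume l: "l < K" and I: "?I l sg'" and w: "vr sg' 30 = l" "vr sg' 3 = K"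
    note fI = frame_vr[OF conjunct1[OF I]] frame_ar[OF conjunct1[OF I]]
    have v': "vr sg' 31 = ?Z" "vr sg' 5 = B" "vr sg' 32 = 2 ^ l" using fI 1 2 3 v I by auto
    have "K = (K - Suc l) + Suc l" using l by simp
    then have Zl: "?Z = 2 ^ (K - Suc l) * 2 ^ Suc l" by (metis power_add)
    have xb: "Suc i \<le> b" if "i < ?Z" for i using that B(2) by linarith
    obtain sga where a: "run (upx_code 3) sg' sga" "frame ({10..29} \<union> {36,37,38}) ({8..13} \<union> {3}) sg' sga"
      "tm sga \<le> tm sg' + 300000 * ((l + 3) ^ 3 * (?Z + 2 ^ Suc l + 1))"
      "\<forall>i. \<not> (Suc l * ?Z \<le> i \<and> i < Suc l * ?Z + ?Z) \<longrightarrow> ar sga 3 i = ar sg' 3 i" "ptree B ?Z (ar sga 3) Suc (Suc l)"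
      using upx_run[where a = 3 and x = Suc, OF w(1) v'(1,3,2) Zl B(1) b1 xb _ rm l] I by auto
    note fa = frame_vr[OF a(2)] frame_ar[OF a(2)]
    have lS: "2 * 2 ^ l \<le> S"
    proof -
      have "(2::nat) ^ l \<le> 2 ^ K" using l by (intro power_increasing) auto
      then show ?thesis using gS(1) by linarith
    qed
    obtain sgc where c: "run (asg 32 (Cst 2 [*] Var 32)) sga sgc" "vr sgc = (vr sga)(32 := 2 ^ Suc l)" "ar sgc = ar sga" "tm sgc = tm sga + 4"
      using asg_ex[of sga "Cst 2 [*] Var 32" 32 "2 ^ Suc l"] fa v' lS by auto
    have old: "k * ?Z + i < Suc l * ?Z" if "k \<le> l" "i < ?Z" for k i
    proof -
      have "k * ?Z \<le> l * ?Z" using that(1) by (rule mult_le_mono1)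
      then show ?thesis using that(2) unfolding mult_Suc by linarith
    qed
    have "ptree B ?Z (ar sgc 3) Suc k" if "k \<le> Suc l" for k
    proof (cases "k = Suc l")
      case True then show ?thesis using a(5) c(3) by simp
    next
      case False
      then have k: "k \<le> l" using that by simp
      show ?thesis
      proof (rule ptree_cong)
        show "ptree B ?Z (ar sg' 3) Suc k" using I k by blast
        show "ar sg' 3 (k * ?Z + i) = ar sgc 3 (k * ?Z + i)" if "i < ?Z" for i
          using old[OF k that] a(4) c(3) by simp
      qed
    qed
    moreover have "tm sgc \<le> tm sg' + 300004 * W"
    proof -
      have p: "(2::nat) ^ Suc l \<le> 2 ^ K" using l by (intro power_increasing) auto
      have "(l + 3) ^ 3 * (?Z + 2 ^ Suc l + 1) \<le> W" unfolding W_def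
      proof (intro mult_le_mono power_mono)
        show "?Z + 2 ^ Suc l + 1 \<le> ?Z + ?Z + 1" using p by linarith
      qed (use l in auto)
      moreover have "tc \<le> t + 300004 * W" if "p \<le> W" "ta \<le> t + 300000 * p" "tc = ta + 4" for t ta tc p :: nat
        using that W1 by simp
      ultimately show ?thesis using a(3) c(4) by blast
    qed
    moreover have "frame ({10..29} \<union> {30,32,36,37,38}) ?Y sg3 (upv 30 (Suc l) sgc)"
    proof -
      have "frame ({10..29} \<union> {30,32,36,37,38}) ?Y sg' sga" by (rule frame_mono[OF a(2)]) auto
      moreover have "frame ({10..29} \<union> {30,32,36,37,38}) ?Y sga (upv 30 (Suc l) sgc)" using c by (auto simp: frame_def)
      ultimately show ?thesis using I by (meson frame_trans subset_refl)
    qed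
    moreover have "vr sgc 30 = l" "vr sgc 3 = K" using c fa w by auto
    ultimately show "\<exists>sg''. run ?c sg' sg'' \<and> tm sg'' \<le> tm sg' + 300004 * W \<and> vr sg'' 30 = l \<and> vr sg'' 3 = K \<and> ?I (Suc l) (upv 30 (Suc l) sg'')"
      by (intro exI[of _ sgc] conjI[OF run_Seq[OF a(1) c(1)]]) (simp add: c(2))
  qed (use 1 2 3 v gS p0 in auto)
  then obtain sg4 where 4: "run (for_loop 30 3 ?c) sg3 sg4" "tm sg4 \<le> tm sg3 + K * (300004 * W + 5) + 3" "?I K sg4" by blast
  have "tm sg4 \<le> tm sg + 400000 * ((K + 1) * W)"
  proof -
    have "K * (300004 * W + 5) \<le> K * (300009 * W)" using W1 by (intro mult_le_mono) auto
    then have a: "K * (300004 * W + 5) \<le> 300009 * (K * W)" by (simp only: mult.left_commute)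
    have b: "(K + 1) * W = K * W + W" by simp
    have "t4 \<le> t + 400000 * (kw + W)" if "t2 = t + 4" "t3 \<le> t2 + 500 * (z + 1)" "t4 \<le> t3 + p + 3" "p \<le> 300009 * kw" "1 * (z + z + 1) \<le> W" for t t2 t3 t4 p kw z :: nat
      using that by simp
    from this[OF 2(4) 3(2) 4(2) a W0] show ?thesis unfolding b .
  qed
  moreover have "frame ?X ?Y sg sg4"
  proof -
    have "frame ?X ?Y sg sg3" using 1 2 3 by (auto simp: frame_def)
    moreover have "frame ?X ?Y sg3 sg4" by (rule frame_mono[OF conjunct1[OF 4(3)]]) auto
    ultimately show ?thesis by (meson frame_trans subset_refl)
  qed
  ultimately show ?thesis unfolding dtree_code_def W_def[symmetric]
    by (intro exI[of _ sg4] conjI[OF run_Seq[OF 1(1) run_Seq[OF 2(1) run_Seq[OF 3(1) 4(1)]]]]) (use 4(3) in auto)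
qed

text \<open>The searches stand at nodes of height \<open>g + 1\<close> and \<open>g\<close> is the
  height of their children. The chunk length 2^g is the digit length of a child's product, so this
  product is a legal starting value at the root of the remainder tree over a chunk.\<close>

lemma level_run:
  assumes v: "vr sg 0 = n" "vr sg 2 = R" "vr sg 4 = 2 ^ K" "vr sg 5 = 2 ^ (R + 2)" "vr sg 33 = g" and g: "g < K" and KR: "K \<le> R"
    and rm: "room K (n + 2 ^ K) (2 ^ (R + 2))" and pd: "ptree (2 ^ (R + 2)) (2 ^ K) (ar sg 3) Suc g"
    and x: "\<And>j. j < n \<Longrightarrow> odd (ar sg 0 j) \<and> ar sg 0 j \<le> 2 ^ R" and cv: "\<And>j. j < n \<Longrightarrow> ar sg 17 j < 2 ^ (K - Suc g)"
  shows "\<exists>sg'. run level_code sg sg' \<and> frame ({10..32} \<union> {34..47}) {4..20} sg sg' \<and>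
     tm sg' \<le> tm sg + 12000000 * ((R + 4) ^ 4 * (n + 2 ^ K + 1)) \<and>
     (\<forall>j<n. ar sg' 17 j = 2 * ar sg 17 j + (if 1 < gcd (pv Suc g (2 * ar sg 17 j)) (ar sg 0 j) then 0 else 1))"
proof -
  define B where "B = (2::nat) ^ (R + 2)"
  define b where "b = (2::nat) ^ R"
  define L where "L = (2::nat) ^ g"
  define m where "m = (2::nat) ^ K"
  define Vn where "Vn = (2::nat) ^ (K - Suc g)"
  have B: "B = 4 * b" "1 \<le> b" by (simp_all add: B_def b_def)
  have L0: "0 < L" by (simp add: L_def)
  have mb: "m \<le> b" unfolding m_def b_def using KR by (intro power_increasing) auto
  \<comment> \<open>The \<open>Vn\<close> nodes the searches can be at have length
    \<open>2 * L\<close> and partition the numbers up to \<open>2 ^ K\<close>; so the padding in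
    \<open>alloc_run\<close> is bounded by \<open>m\<close>.\<close>
  have VL: "Vn * (2 * L) = m" unfolding Vn_def L_def m_def using g
    by (metis Suc_diff_Suc less_eq_Suc_le le_add_diff_inverse2 power_Suc power_add)
  note rm' = rm[folded B_def m_def]
  note rD = roomD[OF rm']
  have BS: "8 * (B * B) \<le> S" using rD(1)[of 0] by simp
  have B4: "4 \<le> B" using B by simp
  have B1: "4 * B \<le> S"
  proof -
    have "4 * B \<le> 8 * (B * B)" using B4 by simp
    then show ?thesis using BS by linarith
  qed
  have nmS: "4 * (n + m) < S"
  proof -
    have "4 * 1 * (n + m) \<le> 4 * (K + 2) * (n + m)" by (intro mult_le_mono) auto
    also have "\<dots> < S" using rm' by (simp add: room_def)
    finally show ?thesis by simp
  qed
  have RS: "2 * R + 2 \<le> S"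
  proof -
    have "R < b" unfolding b_def by (rule less_exp)
    then have "2 * R + 2 \<le> 4 * B" using B(1) by linarith
    then show ?thesis using B1 by linarith
  qed
  have LS: "L \<le> S" "g \<le> S"
  proof -
    have "L \<le> m" unfolding L_def m_def using g by (intro power_increasing) auto
    then show "L \<le> S" using nmS by simp
    have "g < L" unfolding L_def by (rule less_exp)
    then show "g \<le> S" using \<open>L \<le> m\<close> nmS by simp
  qed
  obtain sg1 where 1: "run (asg 34 (Pow2 (Var 33))) sg sg1" "vr sg1 = (vr sg)(34 := L)" "ar sg1 = ar sg" "tm sg1 = tm sg + 3"
    using asg_ex[of sg "Pow2 (Var 33)" 34 L] v LS by (auto simp: L_def)
  have "\<exists>sg' tp. run alloc_code sg1 sg' \<and> frame {24,31,39,40,41,42,43} {4,14,15,16} sg1 sg' \<and> tm sg' \<le> tm sg1 + 2000 * (n + m + 1) \<and>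
     vr sg' 31 = tp * L \<and> tp * L \<le> n + m \<and>
     (\<forall>i<n. ar sg' 16 i < tp * L \<and> ar sg' 4 (ar sg' 16 i) = ar sg1 0 i \<and> ar sg' 15 (ar sg' 16 i div L) = ar sg1 17 i) \<and>
     (\<forall>i<tp * L. ar sg' 4 i = 1 \<or> (\<exists>k<n. ar sg' 4 i = ar sg1 0 k)) \<and> (\<forall>c<tp. ar sg' 15 c < Vn)"
    by (rule alloc_run) (use 1 v L0 VL nmS cv in \<open>auto simp: m_def Vn_def\<close>)
  then obtain sg2 tp where 2: "run alloc_code sg1 sg2" "frame {24,31,39,40,41,42,43} {4,14,15,16} sg1 sg2" "tm sg2 \<le> tm sg1 + 2000 * (n + m + 1)"
     "vr sg2 31 = tp * L" "tp * L \<le> n + m"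
     "\<forall>i<n. ar sg2 16 i < tp * L \<and> ar sg2 4 (ar sg2 16 i) = ar sg 0 i \<and> ar sg2 15 (ar sg2 16 i div L) = ar sg 17 i"
     "\<forall>i<tp * L. ar sg2 4 i = 1 \<or> (\<exists>k<n. ar sg2 4 i = ar sg 0 k)" "\<forall>c<tp. ar sg2 15 c < Vn" using 1(3) by auto
  note f2 = frame_vr[OF 2(2)] frame_ar[OF 2(2)]
  define Z where "Z = tp * L"
  define xx where "xx = ar sg2 4"
  have xx: "odd (xx i) \<and> xx i \<le> b" if "i < Z" for i
    using 2(7) that x B(2) unfolding Z_def xx_def b_def[symmetric] by (metis odd_one)
  have ZS: "Z < S" "Z \<le> n + m" using 2(5) nmS by (auto simp: Z_def)
  have v2: "vr sg2 0 = n" "vr sg2 2 = R" "vr sg2 4 = m" "vr sg2 5 = B" "vr sg2 33 = g" "vr sg2 34 = L" "vr sg2 31 = Z"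
    "ar sg2 0 = ar sg 0" "ar sg2 3 = ar sg 3" "ar sg2 17 = ar sg 17"
    using f2 1 v 2(4) by (auto simp: m_def B_def Z_def)
  have bS: "b \<le> S" using B B1 by linarith
  obtain sg3 where 3: "run inv_code sg2 sg3" "frame {24,45,46} {5,10} sg2 sg3" "tm sg3 \<le> tm sg2 + 3000 * ((R + 2) * (Z + 1))" "ntree B Z (ar sg3 5) xx 0"
  proof -
    have "B \<le> S" "R + 1 \<le> S" using B1 RS by linarith+
    moreover have "odd (ar sg2 4 i) \<and> ar sg2 4 i \<le> S" if "i < Z" for i using xx[OF that] bS unfolding xx_def by linarith
    ultimately show ?thesis using that inv_run[OF v2(2,7,4) B_def ZS(1)] unfolding xx_def by blast
  qed
  note f3 = frame_vr[OF 3(2)] frame_ar[OF 3(2)]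
  have p3: "ptree B Z (ar sg3 4) xx 0"
  proof -
    have "ar sg3 4 = xx" using f3 by (simp add: xx_def)
    moreover have "xx i < B" if "i < Z" for i using xx[OF that] B by linarith
    ultimately show ?thesis unfolding ptree_def by (simp add: pv_0 nval_def)
  qed
  have rmg: "room g Z B" by (rule room_mono[OF rm']) (use g ZS in auto)
  have v3: "vr sg3 33 = g" "vr sg3 31 = Z" "vr sg3 5 = B" using f3 v2 by auto
  have ZL: "Z = tp * 2 ^ g" by (simp add: Z_def L_def)
  have xb: "\<And>i. i < Z \<Longrightarrow> xx i \<le> b" using xx by blast
  obtain sg4 where 4: "run up_code sg3 sg4" "frame ({10..29} \<union> {30,32,36,37,38}) ({8..13} \<union> {4,5,7}) sg3 sg4"
     "tm sg4 \<le> tm sg3 + 1300000 * ((g + 1) * ((g + 4) ^ 3 * (2 * Z + 2 ^ (g + 2) + 1)))"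
     "\<forall>l\<le>g. ptree B Z (ar sg4 4) xx l \<and> ntree B Z (ar sg4 5) xx l"
    using up_run[OF v3 ZL B xb rmg p3 3(4)] by blast
  note f4 = frame_vr[OF 4(2)] frame_ar[OF 4(2)]
  have v4: "vr sg4 0 = n" "vr sg4 2 = R" "vr sg4 4 = m" "vr sg4 5 = B" "vr sg4 33 = g" "vr sg4 34 = L" "vr sg4 31 = Z"
    "ar sg4 0 = ar sg 0" "ar sg4 3 = ar sg 3" "ar sg4 17 = ar sg 17" "ar sg4 15 = ar sg2 15" "ar sg4 16 = ar sg2 16"
    using f4 f3 v2 by auto
  have chx: "2 * ar sg2 15 c * L + L \<le> m" if "c < tp" for c
  proof -
    have "ar sg2 15 c < Vn" using 2(8) that by blast
    then have "(ar sg2 15 c + 1) * (2 * L) \<le> Vn * (2 * L)" by (intro mult_right_mono) auto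
    then show ?thesis unfolding VL by simp
  qed
  have cdiv: "i div L < tp" if "i < Z" for i using that by (simp add: Z_def less_mult_imp_div_less)
  have gmS: "g * m + m < S"
  proof -
    have "(g + 1) * m \<le> (K + 2) * (n + m)" using g by (intro mult_le_mono) auto
    also have "\<dots> < S" by (rule rD(5)[of 0]) simp
    finally show ?thesis by simp
  qed
  \<comment> \<open>Slot \<open>i\<close> receives digit \<open>i mod L\<close> of the product at
    the left child of its chunk's node, read from the slice of height \<open>g\<close> of the tree
    over 1, ..., 2^K.\<close>
  have vin: "ok (upv 24 i sg4) vin_expr" "ev (upv 24 i sg4) vin_expr = ar sg 3 (g * m + 2 * ar sg2 15 (i div L) * L + i mod L)"
    "2 * ar sg2 15 (i div L) * L + i mod L < m" if "i < Z" for i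
  proof -
    note c = chx[OF cdiv[OF that]]
    have iL: "i mod L < L" using L0 by simp
    show k: "2 * ar sg2 15 (i div L) * L + i mod L < m" using c iL by linarith
    have "i div L \<le> i" by simp
    then have "i div L < S" using that ZS by linarith
    moreover have "ar sg2 15 (i div L) \<le> S"
    proof -
      have "ar sg2 15 (i div L) * 1 \<le> ar sg2 15 (i div L) * L" using L0 by (intro mult_left_mono) auto
      moreover have "a \<le> S" if "a * 1 \<le> p" "2 * p + L \<le> m" for a p using that nmS by simp
      ultimately show ?thesis using c[unfolded mult.assoc] by blast
    qed
    ultimately show "ok (upv 24 i sg4) vin_expr" "ev (upv 24 i sg4) vin_expr = ar sg 3 (g * m + 2 * ar sg2 15 (i div L) * L + i mod L)"
      using v4 k gmS by (auto simp: vin_expr_def)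
  qed
  have "\<exists>sg'. run (map_loop 6 24 31 vin_expr) sg4 sg' \<and> tm sg' \<le> tm sg4 + 500 * (Z + 1) \<and> vr sg' = (vr sg4)(24 := Z) \<and>
     ar sg' = (ar sg4)(6 := (\<lambda>i. if i < Z then ev (upv 24 i sg4) vin_expr else ar sg4 6 i))"
  proof (rule run_map)
    show "ok (upv 24 i sg4) vin_expr" if "i < Z" for i by (rule vin(1)[OF that])
  qed (use v4 ZS in \<open>auto simp: vin_expr_def\<close>)
  then obtain sg5 where 5: "run (map_loop 6 24 31 vin_expr) sg4 sg5" "tm sg5 \<le> tm sg4 + 500 * (Z + 1)" "vr sg5 = (vr sg4)(24 := Z)"
     "ar sg5 = (ar sg4)(6 := (\<lambda>i. if i < Z then ev (upv 24 i sg4) vin_expr else ar sg4 6 i))" by blast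
  have a5: "ar sg5 6 i = ar sg 3 (g * m + 2 * ar sg2 15 (i div L) * L + i mod L)" if "i < Z" for i
    using 5(4) vin(2)[OF that] that by (simp del: ev.simps)
  \<comment> \<open>The gcds that the remainder tree has to deliver at its leaves; on padding slots,
    whose leaf is \<open>1\<close>, they are trivial.\<close>
  define G where "G i = gcd (pv Suc g (2 * ar sg2 15 (i div L))) (xx i)" for i
  have vt5: "vtree B b Z (ar sg5 6) xx G g" unfolding vtree_def
  proof (intro conjI allI impI)
    fix i assume i: "i < Z"
    show "ar sg5 6 i < B" using a5[OF i] vin(3)[OF i] pd unfolding ptree_def B_def[symmetric] m_def[symmetric] by (simp add: add.assoc)
  next
    fix c assume c: "(c + 1) * 2 ^ g \<le> Z"
    have ct: "c < tp" using c unfolding ZL by (rule block_count) simp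
    have in1: "(c * L + i) div L = c" "(c * L + i) mod L = i" if "i < L" for i using that by (rule block_div_mod)+
    have "nval B (ar sg5 6) (c * L) L = nval B (ar sg 3) (g * m + 2 * ar sg2 15 c * L) L"
    proof (rule nval_cong)
      fix i assume i: "i < L"
      have "c * L + i < Z" using c i by (simp add: L_def)
      from a5[OF this] show "ar sg5 6 (c * L + i) = ar sg 3 (g * m + 2 * ar sg2 15 c * L + i)" unfolding in1[OF i] .
    qed
    also have "\<dots> = pv Suc g (2 * ar sg2 15 c)"
    proof -
      have "(2 * ar sg2 15 c + 1) * 2 ^ g \<le> 2 ^ K" using chx[OF ct] by (simp add: L_def m_def)
      then show ?thesis using pd unfolding ptree_def L_def m_def B_def by blast
    qed
    finally have nv: "nval B (ar sg5 6) (c * 2 ^ g) (2 ^ g) = pv Suc g (2 * ar sg2 15 c)" by (simp only: L_def)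
    \<comment> \<open>The factors are at most 2^K \<le> 2^R = \<open>b\<close>, so the starting
      value obeys the size bound even without the factor \<open>2\<close>.\<close>
    have "pv Suc g (2 * ar sg2 15 c) \<le> b ^ 2 ^ g"
    proof (rule pv_le)
      fix j assume "j < (2::nat) ^ g"
      then have "Suc (2 * ar sg2 15 c * 2 ^ g + j) \<le> m" using chx[OF ct] by (simp add: L_def)
      then show "Suc (2 * ar sg2 15 c * 2 ^ g + j) \<le> b" using mb by linarith
    qed
    then show "nval B (ar sg5 6) (c * 2 ^ g) (2 ^ g) \<le> 2 * b ^ 2 ^ g" unfolding nv by linarith
    fix j assume "j < (2::nat) ^ g"
    then show "gcd (nval B (ar sg5 6) (c * 2 ^ g) (2 ^ g)) (xx (c * 2 ^ g + j)) = G (c * 2 ^ g + j)"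
      unfolding nv G_def using in1[of j] by (simp add: L_def)
  qed
  \<comment> \<open>The base is a power of two, so coprimality with all leaves is where the removal
    of the even parts is used.\<close>
  have cop: "coprime B (xx i)" if "i < Z" for i
    unfolding B_def using xx[OF that] by (simp only: coprime_power_left_iff coprime_left_2_iff_odd) auto
  have v5: "vr sg5 33 = g" "vr sg5 31 = Z" "vr sg5 5 = B" using 5 v4 by auto
  have pn5: "\<forall>l\<le>g. ptree B Z (ar sg5 4) xx l \<and> ntree B Z (ar sg5 5) xx l" using 4(4) 5(4) by simp
  obtain sg6 where 6: "run down_loop sg5 sg6" "frame ({10..29} \<union> {30,32,36,37,38,47}) ({8..13} \<union> {6}) sg5 sg6"
     "tm sg6 \<le> tm sg5 + 900000 * ((g + 1) * ((g + 4) ^ 3 * (2 * Z + 2 ^ (g + 2) + 1)))" "vtree B b Z (ar sg6 6) xx G 0"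
    using down_loop_run[OF v5 ZL B xb cop rmg pn5 vt5] by blast
  note f6 = frame_vr[OF 6(2)] frame_ar[OF 6(2)]
  have v6: "vr sg6 0 = n" "vr sg6 2 = R" "ar sg6 0 = ar sg 0" "ar sg6 17 = ar sg 17" "ar sg6 16 = ar sg2 16"
    using f6 5 v4 by auto
  have g6: "gcd (ar sg6 6 i) (xx i) = G i" "ar sg6 6 i < B" if "i < Z" for i
  proof -
    have "(i + 1) * 2 ^ 0 \<le> Z" using that by simp
    moreover have "(0::nat) < 2 ^ 0" by simp
    ultimately have "gcd (nval B (ar sg6 6) (i * 2 ^ 0) (2 ^ 0)) (xx (i * 2 ^ 0 + 0)) = G (i * 2 ^ 0 + 0)"
      using 6(4) unfolding vtree_def by blast
    then show "gcd (ar sg6 6 i) (xx i) = G i" by (simp add: nval_def)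
    show "ar sg6 6 i < B" using 6(4) that unfolding vtree_def by blast
  qed
  have ps: "ar sg2 16 j < Z" "xx (ar sg2 16 j) = ar sg 0 j" "ar sg2 15 (ar sg2 16 j div L) = ar sg 17 j" if "j < n" for j
    using 2(6) that by (auto simp: Z_def xx_def)
  have nS: "n < S" using nmS by simp
  have "\<exists>sg'. run (map_loop 18 24 0 (Arr 6 (Arr 16 vI))) sg6 sg' \<and> tm sg' \<le> tm sg6 + 500 * (n + 1) \<and> vr sg' = (vr sg6)(24 := n) \<and>
     ar sg' = (ar sg6)(18 := (\<lambda>i. if i < n then ev (upv 24 i sg6) (Arr 6 (Arr 16 vI)) else ar sg6 18 i))"
  proof (rule run_map)
    show "ok (upv 24 i sg6) (Arr 6 (Arr 16 vI))" if "i < n" for i using ps(1)[OF that] ZS nS that v6 by simp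
  qed (use v6 nS in auto)
  then obtain sg7 where 7: "run (map_loop 18 24 0 (Arr 6 (Arr 16 vI))) sg6 sg7" "tm sg7 \<le> tm sg6 + 500 * (n + 1)" "vr sg7 = (vr sg6)(24 := n)"
     "ar sg7 = (ar sg6)(18 := (\<lambda>i. if i < n then ev (upv 24 i sg6) (Arr 6 (Arr 16 vI)) else ar sg6 18 i))" by blast
  have "\<exists>sg'. run (map_loop 19 24 0 (Arr 0 vI)) sg7 sg' \<and> tm sg' \<le> tm sg7 + 500 * (n + 1) \<and> vr sg' = (vr sg7)(24 := n) \<and>
     ar sg' = (ar sg7)(19 := (\<lambda>i. if i < n then ev (upv 24 i sg7) (Arr 0 vI) else ar sg7 19 i))"
    by (rule run_map) (use v6 7 nS in auto)
  then obtain sg8 where 8: "run (map_loop 19 24 0 (Arr 0 vI)) sg7 sg8" "tm sg8 \<le> tm sg7 + 500 * (n + 1)" "vr sg8 = (vr sg7)(24 := n)"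
     "ar sg8 = (ar sg7)(19 := (\<lambda>i. if i < n then ev (upv 24 i sg7) (Arr 0 vI) else ar sg7 19 i))" by blast
  have a8: "ar sg8 18 j = ar sg6 6 (ar sg2 16 j)" "ar sg8 19 j = ar sg 0 j" if "j < n" for j
    using 7(4) 8(4) v6 that by simp_all
  have "\<exists>sg'. run gcd_code sg8 sg' \<and> frame {24,45,46} {10,18,19,20} sg8 sg' \<and> tm sg' \<le> tm sg8 + 3000 * ((2 * R + 3) * (n + 1)) \<and>
     (\<forall>j<n. ar sg' 18 j = gcd (ar sg8 18 j) (ar sg8 19 j))"
  proof (rule gcd_run)
    fix j assume j: "j < n"
    have "odd (ar sg 0 j)" "ar sg 0 j \<le> b" using x[OF j] by (auto simp: b_def)
    then have "1 \<le> ar sg 0 j" "ar sg 0 j \<le> b" "ar sg 0 j \<le> S" using bS by (auto elim: oddE)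
    moreover have "ar sg6 6 (ar sg2 16 j) \<le> S" using g6(2)[OF ps(1)[OF j]] B1 by linarith
    ultimately show "1 \<le> ar sg8 19 j \<and> ar sg8 19 j \<le> 2 ^ R \<and> ar sg8 19 j \<le> S \<and> ar sg8 18 j \<le> S"
      using a8[OF j] by (simp add: b_def)
  qed (use v6 7 8 nS RS in auto)
  then obtain sg9 where 9: "run gcd_code sg8 sg9" "frame {24,45,46} {10,18,19,20} sg8 sg9" "tm sg9 \<le> tm sg8 + 3000 * ((2 * R + 3) * (n + 1))"
     "\<forall>j<n. ar sg9 18 j = gcd (ar sg8 18 j) (ar sg8 19 j)" by blast
  note f9 = frame_vr[OF 9(2)] frame_ar[OF 9(2)]
  have a9: "ar sg9 18 j = gcd (pv Suc g (2 * ar sg 17 j)) (ar sg 0 j)" if "j < n" for j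
    using 9(4) a8[OF that] that g6(1)[OF ps(1)[OF that]] ps[OF that] by (simp add: G_def)
  have v9: "vr sg9 0 = n" "ar sg9 17 = ar sg 17" using f9 8 7 v6 by auto
  have ok9: "ok (upv 24 j sg9) cv_expr" if "j < n" for j
  proof -
    have "ar sg 17 j < Vn" using cv[OF that] by (simp add: Vn_def)
    moreover have "Vn * 1 \<le> Vn * (2 * L)" using L0 by (intro mult_left_mono) auto
    ultimately have "ar sg 17 j \<le> S" using nmS unfolding VL by simp
    then show ?thesis using that nS v9 by (simp add: cv_expr_def)
  qed
  have "\<exists>sg'. run (upd_loop 10 17 24 0 cv_expr) sg9 sg' \<and> tm sg' \<le> tm sg9 + 1000 * (n + 1) \<and>
       vr sg' = (vr sg9)(24 := n) \<and> (\<forall>b. b \<noteq> 17 \<longrightarrow> b \<noteq> 10 \<longrightarrow> ar sg' b = ar sg9 b) \<and>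
       (\<forall>i. ar sg' 17 i = (if i < n then ev (upv 24 i sg9) cv_expr else ar sg9 17 i))"
  proof (rule run_upd)
    show "ok (upv 24 i sg9) cv_expr" if "i < n" for i by (rule ok9[OF that])
  qed (use v9 nS in \<open>auto simp: cv_expr_def\<close>)
  then obtain sg10 where 10: "run (upd_loop 10 17 24 0 cv_expr) sg9 sg10" "tm sg10 \<le> tm sg9 + 1000 * (n + 1)"
       "vr sg10 = (vr sg9)(24 := n)" "\<forall>b. b \<noteq> 17 \<longrightarrow> b \<noteq> 10 \<longrightarrow> ar sg10 b = ar sg9 b"
       "\<forall>i. ar sg10 17 i = (if i < n then ev (upv 24 i sg9) cv_expr else ar sg9 17 i)" by blast
  have post: "\<forall>j<n. ar sg10 17 j = 2 * ar sg 17 j + (if 1 < gcd (pv Suc g (2 * ar sg 17 j)) (ar sg 0 j) then 0 else 1)"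
    using 10(5) a9 v9 by (simp add: cv_expr_def)
  define Y where "Y = (R + 4) ^ 4 * (n + m + 1)"
  have t: "tm sg10 \<le> tm sg + 12000000 * Y"
  proof -
    have y1: "c * (n + m + 1) \<le> Y" if "c \<le> (R + 4) ^ 4" for c
      unfolding Y_def using that by (rule mult_le_mono1)
    have R4: "R + 4 \<le> (R + 4) ^ 4"
      using power_increasing[of 1 4 "R + 4"] by simp
    have "1 * (n + m + 1) \<le> Y" by (rule y1) (rule one_le_power, simp)
    then have h1: "n + m + 1 \<le> Y" by simp
    have "(R + 2) * (n + m + 1) \<le> Y" using R4 by (intro y1) linarith
    moreover have "(R + 2) * (Z + 1) \<le> (R + 2) * (n + m + 1)" using ZS(2) by (intro mult_le_mono) auto
    ultimately have h2: "(R + 2) * (Z + 1) \<le> Y" by linarith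
    have h3: "(2 * R + 3) * (n + 1) \<le> 2 * Y"
    proof -
      have "(2 * R + 3) * (n + 1) \<le> (2 * (R + 4)) * (n + m + 1)" by (intro mult_le_mono) auto
      also have "\<dots> = 2 * ((R + 4) * (n + m + 1))" by (simp only: mult.assoc)
      also have "\<dots> \<le> 2 * Y" using y1[OF R4] by simp
      finally show ?thesis .
    qed
    have h4: "(g + 1) * ((g + 4) ^ 3 * (2 * Z + 2 ^ (g + 2) + 1)) \<le> 5 * Y"
    proof -
      have "(2::nat) ^ (g + 2) \<le> 2 * m"
      proof -
        have "(2::nat) ^ (g + 2) \<le> 2 ^ (K + 1)" using g by (intro power_increasing) auto
        then show ?thesis by (simp add: m_def)
      qed
      then have "2 * Z + 2 ^ (g + 2) + 1 \<le> 5 * (n + m + 1)" using ZS(2) by simp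
      moreover have "g + 1 \<le> R + 4" "(g + 4) ^ 3 \<le> (R + 4) ^ 3" using g KR by (auto intro!: power_mono)
      ultimately have "(g + 1) * ((g + 4) ^ 3 * (2 * Z + 2 ^ (g + 2) + 1)) \<le> (R + 4) * ((R + 4) ^ 3 * (5 * (n + m + 1)))"
        by (intro mult_le_mono)
      also have "\<dots> = 5 * ((R + 4) * (R + 4) ^ 3 * (n + m + 1))" by (simp only: mult.left_commute mult.assoc)
      also have "(R + 4) * (R + 4) ^ 3 = (R + 4) ^ 4" by (simp add: numeral_eq_Suc)
      finally show ?thesis by (simp only: Y_def)
    qed
    have "t10 \<le> t + 12000000 * Y" if "t1 = t + 3" "t2 \<le> t1 + 2000 * (n + m + 1)" "t3 \<le> t2 + 3000 * p" "p \<le> Y" "t4 \<le> t3 + 1300000 * q" "q \<le> 5 * Y"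
      "t5 \<le> t4 + 500 * (z + 1)" "z \<le> n + m" "t6 \<le> t5 + 900000 * q" "t7 \<le> t6 + 500 * (n + 1)" "t8 \<le> t7 + 500 * (n + 1)" "t9 \<le> t8 + 3000 * r" "r \<le> 2 * Y"
      "t10 \<le> t9 + 1000 * (n + 1)" for t t1 t2 t3 t4 t5 t6 t7 t8 t9 t10 p q r z :: nat
      using that h1 by simp
    from this[OF 1(4) 2(3) 3(3) h2 4(3) h4 5(2) ZS(2) 6(3) 7(2) 8(2) 9(3) h3 10(2)] show ?thesis .
  qed
  have fr: "frame ({10..32} \<union> {34..47}) {4..20} sg sg10"
  proof -
    let ?F = "frame ({10..32} \<union> {34..47}) {4..20}"
    have "?F sg sg1" using 1 by (auto simp: frame_def)
    also have "?F sg1 sg2" by (rule frame_mono[OF 2(2)]) auto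
    also have "?F sg2 sg3" by (rule frame_mono[OF 3(2)]) auto
    also have "?F sg3 sg4" by (rule frame_mono[OF 4(2)]) auto
    also have "?F sg4 sg5" using 5 by (auto simp: frame_def)
    also have "?F sg5 sg6" by (rule frame_mono[OF 6(2)]) auto
    also have "?F sg6 sg8" using 7 8 by (auto simp: frame_def)
    also have "?F sg8 sg9" by (rule frame_mono[OF 9(2)]) auto
    also have "?F sg9 sg10" using 10 by (auto simp: frame_def)
    finally show ?thesis .
  qed
  show ?thesis unfolding level_code_def m_def[symmetric] Y_def[symmetric]
    by (intro exI[of _ sg10] conjI[OF run_Seq[OF 1(1) run_Seq[OF 2(1) run_Seq[OF 3(1) run_Seq[OF 4(1) run_Seq[OF 5(1) run_Seq[OF 6(1)
         run_Seq[OF 7(1) run_Seq[OF 8(1) run_Seq[OF 9(1) 10(1)]]]]]]]]]] conjI[OF fr] conjI[OF t] post)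
qed

end

section \<open>Splitting off prime factors in rounds\<close>

text \<open>
  Array \<open>0\<close> holds the unfactored parts of the inputs, array \<open>2\<close> the factors found (row \<open>r\<close> starts at
  \<open>r * n\<close>, with entry \<open>1\<close> for no factor), array \<open>3\<close> the product tree of \<open>1, \<dots>, 2 ^ K\<close>, array \<open>17\<close> the
  node each search has reached and array \<open>18\<close> the factors of the current round.
\<close>

definition emit_code :: com where
  "emit_code = smap_loop 2 49 0 (Arr 18 vI) ;; upd_loop 10 0 24 0 (Arr 0 vI [div] Arr 18 vI)"

definition two_code :: com where
  "two_code = map_loop 18 24 0 (Ite (Arr 0 vI [mod] Cst 2) (Cst 1) (Cst 2) (Cst 1)) ;; emit_code"

definition fac_expr :: expr where
  "fac_expr = Ite (Cst 0) (Arr 17 vI)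
     (Ite (Arr 0 vI [mod] (Arr 17 vI [+] Cst 1)) (Cst 1) (Arr 17 vI [+] Cst 1) (Arr 0 vI)) (Arr 0 vI)"

definition search_code :: com where
  "search_code = map_loop 17 24 0 (Cst 0) ;;
     for_loop 57 3 (asg 33 (Var 3 [-] (Var 57 [+] Cst 1)) ;; level_code)"

definition round_code :: com where
  "round_code = search_code ;; map_loop 18 24 0 fac_expr ;; emit_code"

definition strip_code :: com where
  "strip_code = for_loop 48 2 (asg 49 (Var 48 [*] Var 0) ;; two_code)"

definition rounds_code :: com where
  "rounds_code = for_loop 48 2 (asg 49 ((Var 2 [+] Var 48) [*] Var 0) ;; round_code)"

text \<open>
  After all blocks of size above \<open>2 ^ h\<close> have been searched, \<open>v\<close> is the block of size \<open>2 ^ h\<close> that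
  contains the smallest \<open>d\<close> with a common factor with \<open>x\<close>, if \<open>{1..2 ^ K}\<close> contains such a \<open>d\<close>.
\<close>

definition search_inv :: "nat \<Rightarrow> nat \<Rightarrow> nat \<Rightarrow> nat \<Rightarrow> bool" where
  "search_inv K x h v \<longleftrightarrow> v < 2 ^ (K - h) \<and> (\<forall>d. 1 \<le> d \<longrightarrow> d \<le> v * 2 ^ h \<longrightarrow> coprime d x) \<and>
     ((\<exists>d. 1 \<le> d \<and> d \<le> 2 ^ K \<and> \<not> coprime d x) \<longrightarrow> (\<exists>d. v * 2 ^ h < d \<and> d \<le> (v + 1) * 2 ^ h \<and> \<not> coprime d x))"

lemma search_inv_start: "search_inv K x K 0"
  unfolding search_inv_def by (auto intro: Suc_le_lessD)

text \<open>A product is coprime to \<open>x\<close> exactly if all its factors are. So the gcd with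
  the left child's product decides whether the left half contains some \<open>d\<close> not coprime
  to \<open>x\<close>, and if not, the search may discard that half.\<close>

lemma search_inv_step:
  assumes I: "search_inv K x (Suc g) v" and g: "g < K" and x: "0 < x"
  shows "search_inv K x g (2 * v + (if 1 < gcd (pv Suc g (2 * v)) x then 0 else 1))"
proof -
  have vK: "v < 2 ^ (K - Suc g)" and low: "\<And>d. 1 \<le> d \<Longrightarrow> d \<le> 2 * v * 2 ^ g \<Longrightarrow> coprime d x"
    and ex: "\<exists>d. 1 \<le> d \<and> d \<le> 2 ^ K \<and> \<not> coprime d x \<Longrightarrow> \<exists>d. 2 * v * 2 ^ g < d \<and> d \<le> (2 * v + 2) * 2 ^ g \<and> \<not> coprime d x"
    using I unfolding search_inv_def by (simp_all add: algebra_simps)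
  have K: "2 ^ (K - g) = 2 * (2 ^ (K - Suc g) :: nat)" using g by (metis Suc_diff_Suc power_Suc)
  show ?thesis
  proof (cases "\<exists>j<2 ^ g. \<not> coprime (Suc (2 * v * 2 ^ g + j)) x")
    case True
    then obtain j where j: "j < 2 ^ g" "\<not> coprime (Suc (2 * v * 2 ^ g + j)) x" by blast
    have "Suc (2 * v * 2 ^ g + j) dvd pv Suc g (2 * v)" unfolding pv_def using j by (intro dvd_prodI) auto
    then have "\<not> coprime (pv Suc g (2 * v)) x" using j(2) coprime_divisors[OF _ dvd_refl] by blast
    then have "gcd (pv Suc g (2 * v)) x \<noteq> 1" by (simp add: coprime_iff_gcd_eq_1)
    moreover have "gcd (pv Suc g (2 * v)) x \<noteq> 0" using x by simp
    ultimately have "1 < gcd (pv Suc g (2 * v)) x" by linarith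
    moreover have "search_inv K x g (2 * v)" unfolding search_inv_def
    proof (intro conjI)
      show "2 * v < 2 ^ (K - g)" unfolding K using vK by simp
      show "\<forall>d. 1 \<le> d \<longrightarrow> d \<le> 2 * v * 2 ^ g \<longrightarrow> coprime d x" using low by blast
      have "Suc (2 * v * 2 ^ g + j) \<le> (2 * v + 1) * 2 ^ g" using j(1) by simp
      then show "(\<exists>d. 1 \<le> d \<and> d \<le> 2 ^ K \<and> \<not> coprime d x) \<longrightarrow> (\<exists>d. 2 * v * 2 ^ g < d \<and> d \<le> (2 * v + 1) * 2 ^ g \<and> \<not> coprime d x)"
        using j(2) by (intro impI exI[of _ "Suc (2 * v * 2 ^ g + j)"]) simp
    qed
    ultimately show ?thesis by simp
  next
    case False
    then have "coprime (pv Suc g (2 * v)) x" unfolding pv_def by (intro prod_coprime_left) auto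
    then have g1: "gcd (pv Suc g (2 * v)) x = 1" by simp
    have low': "coprime d x" if "1 \<le> d" "d \<le> (2 * v + 1) * 2 ^ g" for d
    proof (cases "d \<le> 2 * v * 2 ^ g")
      case True then show ?thesis using low that by blast
    next
      case f: False
      then have "Suc (2 * v * 2 ^ g + (d - 1 - 2 * v * 2 ^ g)) = d" by simp
      moreover have "d - 1 - 2 * v * 2 ^ g < 2 ^ g" using that f by (simp add: algebra_simps)
      ultimately show ?thesis using False by metis
    qed
    have "search_inv K x g (2 * v + 1)" unfolding search_inv_def
    proof (intro conjI impI)
      show "2 * v + 1 < 2 ^ (K - g)" unfolding K using vK by simp
      show "\<forall>d. 1 \<le> d \<longrightarrow> d \<le> (2 * v + 1) * 2 ^ g \<longrightarrow> coprime d x" using low' by blast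
      assume "\<exists>d. 1 \<le> d \<and> d \<le> 2 ^ K \<and> \<not> coprime d x"
      from ex[OF this] obtain d where d: "2 * v * 2 ^ g < d" "d \<le> (2 * v + 2) * 2 ^ g" "\<not> coprime d x" by blast
      then have "\<not> d \<le> (2 * v + 1) * 2 ^ g" using low'[of d] by auto
      then show "\<exists>d. (2 * v + 1) * 2 ^ g < d \<and> d \<le> (2 * v + 1 + 1) * 2 ^ g \<and> \<not> coprime d x"
        using d by (intro exI[of _ d]) simp
    qed
    then show ?thesis using g1 by simp
  qed
qed

text \<open>The search ends at the single candidate \<open>v + 1\<close>, which is accepted if it is
  a divisor above \<open>1\<close>. Otherwise \<open>x\<close> has no prime factor up to 2^K; being
  below 2^(2K), it is then \<open>1\<close> or prime and is taken as a whole.\<close>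

definition fac :: "nat \<Rightarrow> nat \<Rightarrow> nat" where
  "fac x v = (if 0 < v then if x mod (v + 1) < 1 then v + 1 else x else x)"

text \<open>A common prime factor of \<open>v + 1\<close> and \<open>x\<close> cannot be at most
  \<open>v\<close>, where all numbers are coprime to \<open>x\<close>, so it is
  \<open>v + 1\<close>: an accepted candidate is prime. A composite \<open>x\<close> has a least
  prime factor p with p * p \<le> x < 2^(2K), hence p \<le> 2^K, so the search does find a
  candidate.\<close>

lemma fac_prime:
  assumes I: "search_inv K x 0 v" and x: "0 < x" "x < 2 ^ (2 * K)"
  shows "fac x v dvd x" "fac x v = 1 \<or> prime (fac x v)" "fac x v = 1 \<longleftrightarrow> x = 1" "fac x v \<le> x"
proof -
  have low: "\<And>d. 1 \<le> d \<Longrightarrow> d \<le> v \<Longrightarrow> coprime d x"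
    and ex: "\<exists>d. 1 \<le> d \<and> d \<le> 2 ^ K \<and> \<not> coprime d x \<Longrightarrow> \<not> coprime (v + 1) x"
    using I unfolding search_inv_def by (auto dest!: le_antisym[OF _ Suc_leI])
  have big: "p = v + 1" if "prime p" "p dvd v + 1" "p dvd x" for p
  proof -
    have "p \<le> v + 1" using that(2) by (rule dvd_imp_le) simp
    moreover have "\<not> coprime p x" using that by (metis coprime_common_divisor_nat dvd_refl not_prime_1)
    moreover have "1 \<le> p" using that(1) prime_ge_1_nat by blast
    ultimately show ?thesis using low[of p] by linarith
  qed
  show d: "fac x v dvd x" unfolding fac_def by (auto simp: mod_eq_0_iff_dvd)
  have "x = 1 \<or> prime x \<or> fac x v = v + 1 \<and> 0 < v \<and> v + 1 dvd x"
  proof (rule ccontr)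
    assume c: "\<not> ?thesis"
    define p where "p = (LEAST p. prime p \<and> p dvd x)"
    have "\<exists>p. prime p \<and> p dvd x" using c prime_factor_nat by blast
    then have p: "prime p" "p dvd x" unfolding p_def by (metis (mono_tags, lifting) LeastI_ex)+
    obtain y where y: "x = p * y" using p(2) by blast
    have "y \<noteq> 1" using c y p(1) by auto
    then obtain q where q: "prime q" "q dvd y" using prime_factor_nat by blast
    have "p \<le> q" unfolding p_def using q y by (intro Least_le) auto
    moreover have "q \<le> y" using q(2) y x(1) by (intro dvd_imp_le) auto
    ultimately have "p * p \<le> x" unfolding y by simp
    then have "p * p < 2 ^ K * 2 ^ K" using x(2) by (simp add: mult_2 power_add)
    then have "p \<le> 2 ^ K" using mult_le_mono[of "2 ^ K" p "2 ^ K" p] by linarith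
    moreover have "\<not> coprime p x" using p by (metis coprime_common_divisor_nat dvd_refl not_prime_1)
    ultimately have nc: "\<not> coprime (v + 1) x" using ex p(1) prime_ge_1_nat by blast
    then have "gcd (v + 1) x \<noteq> 1" by (simp add: coprime_iff_gcd_eq_1)
    then obtain r where r: "prime r" "r dvd gcd (v + 1) x" using prime_factor_nat by blast
    then have "r = v + 1" using big by simp
    then have "v + 1 dvd x" "0 < v" using r by (auto simp: prime_nat_iff)
    then show False using c by (simp add: fac_def)
  qed
  then have *: "x = 1 \<or> prime x \<or> fac x v = v + 1 \<and> 0 < v \<and> v + 1 dvd x \<and> prime (v + 1)"
  proof (elim disjE)
    assume a: "fac x v = v + 1 \<and> 0 < v \<and> v + 1 dvd x"
    then obtain p where p: "prime p" "p dvd v + 1" using prime_factor_nat[of "v + 1"] by auto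
    then have "p = v + 1" using a big dvd_trans by blast
    then show ?thesis using a p by blast
  qed auto
  have 1: "fac x v = x \<or> fac x v = v + 1 \<and> 0 < v" unfolding fac_def by auto
  show "fac x v = 1 \<or> prime (fac x v)"
  proof (cases "x = 1 \<or> prime x")
    case True
    then show ?thesis using d by (metis nat_dvd_1_iff_1 prime_nat_iff)
  qed (use * in auto)
  show "fac x v \<le> x" using d x(1) by (rule dvd_imp_le)
  then show "fac x v = 1 \<longleftrightarrow> x = 1" using 1 by auto
qed

section \<open>Bookkeeping of the factors found\<close>

definition rows :: "nat \<Rightarrow> nat \<Rightarrow> (nat \<Rightarrow> nat) \<Rightarrow> (nat \<Rightarrow> nat) \<Rightarrow> (nat \<Rightarrow> nat) \<Rightarrow> bool" where
  "rows n r C X x \<longleftrightarrow> (\<forall>j<n. (\<forall>i<r. C (i * n + j) = 1 \<or> prime (C (i * n + j))) \<and> (\<Prod>i<r. C (i * n + j)) * X j = x j)"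

lemma rows_step:
  assumes r: "rows n r C X x" and F: "\<And>j. j < n \<Longrightarrow> (F j = 1 \<or> prime (F j)) \<and> F j dvd X j"
    and C': "\<And>i. C' i = (if r * n \<le> i \<and> i < r * n + n then F (i - r * n) else C i)"
    and X': "\<And>j. j < n \<Longrightarrow> X' j = X j div F j"
  shows "rows n (Suc r) C' X' x"
  unfolding rows_def
proof (intro allI impI)
  fix j assume j: "j < n"
  have new: "C' (r * n + j) = F j" using C' j by simp
  have old: "C' (i * n + j) = C (i * n + j)" if "i < r" for i
  proof -
    have "Suc i * n \<le> r * n" using that by (intro mult_le_mono1) simp
    then show ?thesis using C' j by simp
  qed
  have "(\<Prod>i<Suc r. C' (i * n + j)) * X' j = (\<Prod>i<r. C (i * n + j)) * (F j * (X j div F j))"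
    using new old X'[OF j] by (simp add: mult.assoc)
  also have "\<dots> = x j" using r F[OF j] j by (simp add: rows_def)
  finally show "(\<forall>i<Suc r. C' (i * n + j) = 1 \<or> prime (C' (i * n + j))) \<and> (\<Prod>i<Suc r. C' (i * n + j)) * X' j = x j"
    using new old F[OF j] r j by (auto simp: less_Suc_eq rows_def)
qed

context ram
begin

lemma emit_run:
  assumes v: "vr sg 0 = n" "vr sg 49 = f" and S: "f + n \<le> S" "n < S"
    and x: "\<And>j. j < n \<Longrightarrow> ar sg 0 j \<le> S \<and> ar sg 18 j \<le> S"
  shows "\<exists>sg'. run emit_code sg sg' \<and> frame {24} {0,2,10} sg sg' \<and> tm sg' \<le> tm sg + 1500 * (n + 1) \<and>
     (\<forall>i. ar sg' 2 i = (if f \<le> i \<and> i < f + n then ar sg 18 (i - f) else ar sg 2 i)) \<and>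
     (\<forall>j<n. ar sg' 0 j = ar sg 0 j div ar sg 18 j)"
proof -
  have "\<exists>sg'. run (smap_loop 2 49 0 (Arr 18 vI)) sg sg' \<and> tm sg' \<le> tm sg + 500 * (n + 1) \<and> vr sg' = (vr sg)(24 := n) \<and>
     ar sg' = (ar sg)(2 := (\<lambda>x. if f \<le> x \<and> x < f + n then ev (upv 24 (x - f) sg) (Arr 18 vI) else ar sg 2 x))"
    by (rule run_smap) (use v S in auto)
  then obtain sg1 where 1: "run (smap_loop 2 49 0 (Arr 18 vI)) sg sg1" "tm sg1 \<le> tm sg + 500 * (n + 1)" "vr sg1 = (vr sg)(24 := n)"
     "ar sg1 = (ar sg)(2 := (\<lambda>x. if f \<le> x \<and> x < f + n then ev (upv 24 (x - f) sg) (Arr 18 vI) else ar sg 2 x))" by blast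
  have "\<exists>sg'. run (upd_loop 10 0 24 0 (Arr 0 vI [div] Arr 18 vI)) sg1 sg' \<and> tm sg' \<le> tm sg1 + 1000 * (n + 1) \<and>
       vr sg' = (vr sg1)(24 := n) \<and> (\<forall>b. b \<noteq> 0 \<longrightarrow> b \<noteq> 10 \<longrightarrow> ar sg' b = ar sg1 b) \<and>
       (\<forall>i. ar sg' 0 i = (if i < n then ev (upv 24 i sg1) (Arr 0 vI [div] Arr 18 vI) else ar sg1 0 i))"
    by (rule run_upd) (use v S x 1 in auto)
  then obtain sg2 where 2: "run (upd_loop 10 0 24 0 (Arr 0 vI [div] Arr 18 vI)) sg1 sg2" "tm sg2 \<le> tm sg1 + 1000 * (n + 1)"
       "vr sg2 = (vr sg1)(24 := n)" "\<forall>b. b \<noteq> 0 \<longrightarrow> b \<noteq> 10 \<longrightarrow> ar sg2 b = ar sg1 b"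
       "\<forall>i. ar sg2 0 i = (if i < n then ev (upv 24 i sg1) (Arr 0 vI [div] Arr 18 vI) else ar sg1 0 i)" by blast
  show ?thesis unfolding emit_code_def
    by (intro exI[of _ sg2] conjI[OF run_Seq[OF 1(1) 2(1)]] conjI) (use 1 2 in \<open>auto simp: frame_def\<close>)
qed

lemma two_run:
  assumes v: "vr sg 0 = n" "vr sg 49 = r * n" and S: "r * n + n \<le> S" "n < S"
    and x: "\<And>j. j < n \<Longrightarrow> ar sg 0 j \<le> S" and rw: "rows n r (ar sg 2) (ar sg 0) y"
  shows "\<exists>sg'. run two_code sg sg' \<and> frame {24} {0,2,10,18} sg sg' \<and> tm sg' \<le> tm sg + 2000 * (n + 1) \<and>
     rows n (Suc r) (ar sg' 2) (ar sg' 0) y \<and> (\<forall>j<n. ar sg' 0 j = (if even (ar sg 0 j) then ar sg 0 j div 2 else ar sg 0 j))"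
proof -
  let ?e = "Ite (Arr 0 vI [mod] Cst 2) (Cst 1) (Cst 2) (Cst 1)"
  have "\<exists>sg'. run (map_loop 18 24 0 ?e) sg sg' \<and> tm sg' \<le> tm sg + 500 * (n + 1) \<and> vr sg' = (vr sg)(24 := n) \<and>
     ar sg' = (ar sg)(18 := (\<lambda>i. if i < n then ev (upv 24 i sg) ?e else ar sg 18 i))"
    by (rule run_map) (use v S x in auto)
  then obtain sg1 where 1: "run (map_loop 18 24 0 ?e) sg sg1" "tm sg1 \<le> tm sg + 500 * (n + 1)" "vr sg1 = (vr sg)(24 := n)"
     "ar sg1 = (ar sg)(18 := (\<lambda>i. if i < n then ev (upv 24 i sg) ?e else ar sg 18 i))" by blast
  define F where "F j = (if even (ar sg 0 j) then 2 else 1 :: nat)" for j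
  have a1: "ar sg1 18 j = F j" "ar sg1 0 j = ar sg 0 j" if "j < n" for j
    using 1(4) that by (simp_all add: F_def even_iff_mod_2_eq_zero)
  have v1: "vr sg1 0 = n" "vr sg1 49 = r * n" using 1 v by auto
  have x1: "ar sg1 0 j \<le> S \<and> ar sg1 18 j \<le> S" if "j < n" for j using a1[OF that] x[OF that] S_ge by (simp add: F_def)
  obtain sg2 where 2: "run emit_code sg1 sg2" "frame {24} {0,2,10} sg1 sg2" "tm sg2 \<le> tm sg1 + 1500 * (n + 1)"
     "\<forall>i. ar sg2 2 i = (if r * n \<le> i \<and> i < r * n + n then ar sg1 18 (i - r * n) else ar sg1 2 i)"
     "\<forall>j<n. ar sg2 0 j = ar sg1 0 j div ar sg1 18 j" using emit_run[OF v1 S x1] by blast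
  have d: "ar sg2 0 j = ar sg 0 j div F j" if "j < n" for j using 2(5) a1[OF that] that by simp
  have "rows n (Suc r) (ar sg2 2) (ar sg2 0) y"
  proof (rule rows_step[OF rw])
    show "(F j = 1 \<or> prime (F j)) \<and> F j dvd ar sg 0 j" for j by (simp add: F_def)
    show "ar sg2 2 i = (if r * n \<le> i \<and> i < r * n + n then F (i - r * n) else ar sg 2 i)" for i
      using 2(4) a1[of "i - r * n"] 1(4) by auto
  qed (rule d)
  moreover have "\<forall>j<n. ar sg2 0 j = (if even (ar sg 0 j) then ar sg 0 j div 2 else ar sg 0 j)" using d by (simp add: F_def)
  moreover have "frame {24} {0,2,10,18} sg sg2"
  proof -
    have "frame {24} {0,2,10,18} sg sg1" using 1 by (auto simp: frame_def)
    also have "frame {24} {0,2,10,18} sg1 sg2" by (rule frame_mono[OF 2(2)]) auto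
    finally show ?thesis .
  qed
  ultimately show ?thesis unfolding two_code_def
    by (intro exI[of _ sg2] conjI[OF run_Seq[OF 1(1) 2(1)]] conjI) (use 1(2) 2(3) in auto)
qed

lemma search_run:
  assumes v: "vr sg 0 = n" "vr sg 2 = R" "vr sg 3 = K" "vr sg 4 = 2 ^ K" "vr sg 5 = 2 ^ (R + 2)" and KR: "K \<le> R"
    and rm: "room K (n + 2 ^ K) (2 ^ (R + 2))" and pt: "\<And>l. l \<le> K \<Longrightarrow> ptree (2 ^ (R + 2)) (2 ^ K) (ar sg 3) Suc l"
    and x: "\<And>j. j < n \<Longrightarrow> odd (ar sg 0 j) \<and> ar sg 0 j \<le> 2 ^ R" and S: "n < S" "K < S"
  shows "\<exists>sg'. run search_code sg sg' \<and> frame ({10..47} \<union> {57}) {4..20} sg sg' \<and>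
     tm sg' \<le> tm sg + 12001000 * ((R + 4) ^ 5 * (n + 2 ^ K + 1)) \<and> (\<forall>j<n. search_inv K (ar sg 0 j) 0 (ar sg' 17 j))"
proof -
  have "\<exists>sg'. run (map_loop 17 24 0 (Cst 0)) sg sg' \<and> tm sg' \<le> tm sg + 500 * (n + 1) \<and> vr sg' = (vr sg)(24 := n) \<and>
     ar sg' = (ar sg)(17 := (\<lambda>i. if i < n then ev (upv 24 i sg) (Cst 0) else ar sg 17 i))"
    by (rule run_map) (use v S in auto)
  then obtain sg1 where 1: "run (map_loop 17 24 0 (Cst 0)) sg sg1" "tm sg1 \<le> tm sg + 500 * (n + 1)" "vr sg1 = (vr sg)(24 := n)"
     "ar sg1 = (ar sg)(17 := (\<lambda>i. if i < n then ev (upv 24 i sg) (Cst 0) else ar sg 17 i))" by blast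
  define Y where "Y = (R + 4) ^ 4 * (n + 2 ^ K + 1)"
  let ?F = "frame ({10..47} \<union> {57}) {4..20}"
  have F1: "?F sg sg1" using 1 by (auto simp: frame_def)
  let ?c = "asg 33 (Var 3 [-] (Var 57 [+] Cst 1)) ;; level_code"
  let ?I = "\<lambda>i sg'. ?F sg sg' \<and> (\<forall>j<n. search_inv K (ar sg 0 j) (K - i) (ar sg' 17 j))"
  have "\<exists>sg'. run (for_loop 57 3 ?c) sg1 sg' \<and> tm sg' \<le> tm sg1 + K * ((12000000 * Y + 6) + 5) + 3 \<and> ?I K sg' \<and> vr sg' 57 = K \<and> vr sg' 3 = K"
  proof (rule run_for[where I = ?I])
    fix i sg' assume i: "i < K" and I: "?I i sg'" and w: "vr sg' 57 = i" "vr sg' 3 = K"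
    define g where "g = K - Suc i"
    have g: "g < K" "K - i = Suc g" "K - Suc i = g" "K - Suc g = i" using i by (auto simp: g_def)
    note fI = frame_vr[OF conjunct1[OF I]] frame_ar[OF conjunct1[OF I]]
    obtain sga where a: "run (asg 33 (Var 3 [-] (Var 57 [+] Cst 1))) sg' sga" "vr sga = (vr sg')(33 := g)" "ar sga = ar sg'" "tm sga = tm sg' + 6"
    proof -
      have "ev sg' (Var 3 [-] (Var 57 [+] Cst 1)) = g" "g \<le> S" "ok sg' (Var 3 [-] (Var 57 [+] Cst 1))"
        using w i g(1) S by (simp_all add: g_def)
      from asg_ex[OF this(3) _ this(1,2), of 33] that show ?thesis by auto
    qed
    have va: "vr sga 0 = n" "vr sga 2 = R" "vr sga 4 = 2 ^ K" "vr sga 5 = 2 ^ (R + 2)" "vr sga 33 = g"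
      "ar sga 3 = ar sg 3" "ar sga 0 = ar sg 0" using a fI v by auto
    have pa: "ptree (2 ^ (R + 2)) (2 ^ K) (ar sga 3) Suc g" unfolding va(6) using pt g by simp
    have xa: "odd (ar sga 0 j) \<and> ar sga 0 j \<le> 2 ^ R" if "j < n" for j using x[OF that] va by simp
    have si: "search_inv K (ar sg 0 j) (Suc g) (ar sga 17 j)" if "j < n" for j using I that a(3) g by simp
    have ca: "ar sga 17 j < 2 ^ (K - Suc g)" if "j < n" for j using si[OF that] unfolding search_inv_def by blast
    obtain sgb where b: "run level_code sga sgb" "frame ({10..32} \<union> {34..47}) {4..20} sga sgb" "tm sgb \<le> tm sga + 12000000 * Y"
      "\<forall>j<n. ar sgb 17 j = 2 * ar sga 17 j + (if 1 < gcd (pv Suc g (2 * ar sga 17 j)) (ar sga 0 j) then 0 else 1)"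
      unfolding Y_def using level_run[OF va(1-5) g(1) KR rm pa xa ca] by blast
    have "?F sg sgb"
    proof -
      have "?F sg sg'" using I by blast
      also have "?F sg' sga" using a by (auto simp: frame_def)
      also have "?F sga sgb" by (rule frame_mono[OF b(2)]) auto
      finally show ?thesis .
    qed
    moreover have "search_inv K (ar sg 0 j) g (ar sgb 17 j)" if "j < n" for j
    proof -
      have "0 < ar sg 0 j" using x[OF that] by (auto intro: Nat.gr0I)
      from search_inv_step[OF si[OF that] g(1) this] show ?thesis using b(4) that va by simp
    qed
    moreover have "vr sgb 57 = i" "vr sgb 3 = K" using frame_vr[OF b(2)] a w by auto
    ultimately show "\<exists>sg''. run ?c sg' sg'' \<and> tm sg'' \<le> tm sg' + (12000000 * Y + 6) \<and> vr sg'' 57 = i \<and> vr sg'' 3 = K \<and> ?I (Suc i) (upv 57 (Suc i) sg'')"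
      by (intro exI[of _ sgb] conjI[OF run_Seq[OF a(1) b(1)]] conjI) (use a(4) b(3) g in auto)
  qed (use 1 v S F1 in \<open>auto simp: search_inv_start\<close>)
  then obtain sg2 where 2: "run (for_loop 57 3 ?c) sg1 sg2" "tm sg2 \<le> tm sg1 + K * ((12000000 * Y + 6) + 5) + 3" "?I K sg2" by blast
  have "tm sg2 \<le> tm sg + 12001000 * ((R + 4) * Y)"
  proof -
    have "1 * (n + 2 ^ K + 1) \<le> Y" unfolding Y_def by (intro mult_le_mono1 one_le_power) simp
    then have Y: "n + 1 \<le> Y" "1 \<le> Y" by simp_all
    have "K * ((12000000 * Y + 6) + 5) \<le> R * (12000011 * Y)" using Y KR by (intro mult_le_mono) auto
    then have k: "K * ((12000000 * Y + 6) + 5) \<le> 12000011 * (R * Y)" by (simp only: mult.left_commute)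
    have e: "(R + 4) * Y = R * Y + 4 * Y" by (simp only: distrib_right)
    have "t2 \<le> t + 12001000 * (q + 4 * Y)" if "t1 \<le> t + 500 * (n + 1)" "t2 \<le> t1 + p + 3" "p \<le> 12000011 * q" for t t1 t2 p q :: nat
      using that Y by simp
    from this[OF 1(2) 2(2) k] show ?thesis unfolding e .
  qed
  moreover have "(R + 4) * Y = (R + 4) ^ 5 * (n + 2 ^ K + 1)" unfolding Y_def by (simp only: mult.assoc[symmetric] power_Suc[symmetric]) simp
  ultimately have "tm sg2 \<le> tm sg + 12001000 * ((R + 4) ^ 5 * (n + 2 ^ K + 1))" by simp
  then show ?thesis unfolding search_code_def
    by (intro exI[of _ sg2] conjI[OF run_Seq[OF 1(1) 2(1)]]) (use 2(3) in auto)
qed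

text \<open>Progress is measured by size: unless the round leaves \<open>1\<close>, it divides out a
  prime and so at least halves the unfactored part.\<close>

lemma round_run:
  assumes v: "vr sg 0 = n" "vr sg 2 = R" "vr sg 3 = K" "vr sg 4 = 2 ^ K" "vr sg 5 = 2 ^ (R + 2)" "vr sg 49 = r * n" and KR: "K \<le> R" "R \<le> 2 * K"
    and rm: "room K (n + 2 ^ K) (2 ^ (R + 2))" and pt: "\<And>l. l \<le> K \<Longrightarrow> ptree (2 ^ (R + 2)) (2 ^ K) (ar sg 3) Suc l"
    and x: "\<And>j. j < n \<Longrightarrow> odd (ar sg 0 j) \<and> ar sg 0 j < 2 ^ R" and S: "n < S" "K < S" "2 ^ R \<le> S" "2 ^ K \<le> S" "r * n + n \<le> S"
    and rw: "rows n r (ar sg 2) (ar sg 0) y"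
  shows "\<exists>sg'. run round_code sg sg' \<and> frame ({10..47} \<union> {57}) ({4..20} \<union> {0,2}) sg sg' \<and>
     tm sg' \<le> tm sg + 12003000 * ((R + 4) ^ 5 * (n + 2 ^ K + 1)) \<and> rows n (Suc r) (ar sg' 2) (ar sg' 0) y \<and>
     (\<forall>j<n. odd (ar sg' 0 j) \<and> (ar sg' 0 j = 1 \<or> 2 * ar sg' 0 j \<le> ar sg 0 j))"
proof -
  have x': "odd (ar sg 0 j) \<and> ar sg 0 j \<le> 2 ^ R" if "j < n" for j using x[OF that] by simp
  obtain sg1 where 1: "run search_code sg sg1" "frame ({10..47} \<union> {57}) {4..20} sg sg1"
     "tm sg1 \<le> tm sg + 12001000 * ((R + 4) ^ 5 * (n + 2 ^ K + 1))" "\<forall>j<n. search_inv K (ar sg 0 j) 0 (ar sg1 17 j)"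
    using search_run[OF v(1-5) KR(1) rm pt x' S(1,2)] by blast
  note f1 = frame_vr[OF 1(2)] frame_ar[OF 1(2)]
  have v1: "vr sg1 0 = n" "vr sg1 49 = r * n" "ar sg1 0 = ar sg 0" "ar sg1 2 = ar sg 2" using f1 v by auto
  define F where "F j = fac (ar sg 0 j) (ar sg1 17 j)" for j
  have F: "F j dvd ar sg 0 j" "F j = 1 \<or> prime (F j)" "F j = 1 \<longleftrightarrow> ar sg 0 j = 1" "F j \<le> ar sg 0 j" if "j < n" for j
  proof -
    have "0 < ar sg 0 j" using x[OF that] by (auto intro: Nat.gr0I)
    moreover have "(2::nat) ^ R \<le> 2 ^ (2 * K)" using KR(2) by (intro power_increasing) auto
    then have "ar sg 0 j < 2 ^ (2 * K)" using x[OF that] by linarith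
    ultimately show "F j dvd ar sg 0 j" "F j = 1 \<or> prime (F j)" "F j = 1 \<longleftrightarrow> ar sg 0 j = 1" "F j \<le> ar sg 0 j"
      unfolding F_def using 1(4) that fac_prime by blast+
  qed
  have xS: "ar sg 0 j \<le> S" if "j < n" for j using x[OF that] S(3) by linarith
  have "\<exists>sg'. run (map_loop 18 24 0 fac_expr) sg1 sg' \<and> tm sg' \<le> tm sg1 + 500 * (n + 1) \<and> vr sg' = (vr sg1)(24 := n) \<and>
     ar sg' = (ar sg1)(18 := (\<lambda>i. if i < n then ev (upv 24 i sg1) fac_expr else ar sg1 18 i))"
  proof (rule run_map)
    fix j assume j: "j < n"
    have "search_inv K (ar sg 0 j) 0 (ar sg1 17 j)" using 1(4) j by blast
    then have "ar sg1 17 j < 2 ^ K" unfolding search_inv_def by simp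
    then have "ar sg1 17 j < S" using S(4) by linarith
    then show "ok (upv 24 j sg1) fac_expr" using v1 xS[OF j] j S(1) by (simp add: fac_expr_def)
  qed (use v1 S(1) in \<open>auto simp: fac_expr_def\<close>)
  then obtain sg2 where 2: "run (map_loop 18 24 0 fac_expr) sg1 sg2" "tm sg2 \<le> tm sg1 + 500 * (n + 1)" "vr sg2 = (vr sg1)(24 := n)"
     "ar sg2 = (ar sg1)(18 := (\<lambda>i. if i < n then ev (upv 24 i sg1) fac_expr else ar sg1 18 i))" by blast
  have a2: "ar sg2 18 j = F j" "ar sg2 0 j = ar sg 0 j" if "j < n" for j
    using 2(4) that v1 by (simp_all add: F_def fac_def fac_expr_def)
  have v2: "vr sg2 0 = n" "vr sg2 49 = r * n" using 2 v1 by auto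
  have x2: "ar sg2 0 j \<le> S \<and> ar sg2 18 j \<le> S" if "j < n" for j using a2[OF that] xS[OF that] F(4)[OF that] by simp
  obtain sg3 where 3: "run emit_code sg2 sg3" "frame {24} {0,2,10} sg2 sg3" "tm sg3 \<le> tm sg2 + 1500 * (n + 1)"
     "\<forall>i. ar sg3 2 i = (if r * n \<le> i \<and> i < r * n + n then ar sg2 18 (i - r * n) else ar sg2 2 i)"
     "\<forall>j<n. ar sg3 0 j = ar sg2 0 j div ar sg2 18 j" using emit_run[OF v2 S(5,1) x2] by blast
  have d: "ar sg3 0 j = ar sg 0 j div F j" if "j < n" for j using 3(5) a2[OF that] that by simp
  have rw': "rows n (Suc r) (ar sg3 2) (ar sg3 0) y"
  proof (rule rows_step[OF rw])
    show "(F j = 1 \<or> prime (F j)) \<and> F j dvd ar sg 0 j" if "j < n" for j using F[OF that] by blast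
    show "ar sg3 2 i = (if r * n \<le> i \<and> i < r * n + n then F (i - r * n) else ar sg 2 i)" for i
      using 3(4) a2[of "i - r * n"] 2(4) v1 by auto
  qed (rule d)
  have odd': "odd (ar sg3 0 j) \<and> (ar sg3 0 j = 1 \<or> 2 * ar sg3 0 j \<le> ar sg 0 j)" if jn: "j < n" for j
  proof -
    obtain z where z: "ar sg 0 j = F j * z" using F(1)[OF jn] by blast
    have "odd (F j)" "odd z" using x[OF jn] z by auto
    have F0: "0 < F j" using \<open>odd (F j)\<close> by (auto intro: Nat.gr0I)
    have dz: "ar sg3 0 j = z" unfolding d[OF jn] z using F0 by simp
    have "z = 1 \<or> 2 * z \<le> F j * z"
    proof (cases "F j = 1")
      case True then show ?thesis using F(3)[OF jn] z by simp
    next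
      case False
      then have "2 \<le> F j" using F0 by linarith
      then show ?thesis by simp
    qed
    then show ?thesis unfolding dz using \<open>odd z\<close> z by simp
  qed
  have t: "tm sg3 \<le> tm sg + 12003000 * ((R + 4) ^ 5 * (n + 2 ^ K + 1))"
  proof -
    define Y where "Y = (R + 4) ^ 5 * (n + 2 ^ K + 1)"
    have "1 * (n + 1) \<le> Y" unfolding Y_def by (intro mult_le_mono one_le_power) auto
    then have "t3 \<le> t + 12003000 * Y" if "t1 \<le> t + 12001000 * Y" "t2 \<le> t1 + 500 * (n + 1)" "t3 \<le> t2 + 1500 * (n + 1)" for t t1 t2 t3
      using that by simp
    from this[OF 1(3)[folded Y_def] 2(2) 3(3)] show ?thesis unfolding Y_def .
  qed
  have fr: "frame ({10..47} \<union> {57}) ({4..20} \<union> {0,2}) sg sg3" (is "?F sg sg3")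
  proof -
    have "?F sg sg1" by (rule frame_mono[OF 1(2)]) auto
    also have "?F sg1 sg2" using 2 by (auto simp: frame_def)
    also have "?F sg2 sg3" by (rule frame_mono[OF 3(2)]) auto
    finally show ?thesis .
  qed
  show ?thesis unfolding round_code_def
    by (intro exI[of _ sg3] conjI[OF run_Seq[OF 1(1) run_Seq[OF 2(1) 3(1)]]] conjI[OF fr] conjI[OF t] conjI[OF rw']) (use odd' in blast)
qed

text \<open>A part that is still even after \<open>r\<close> rounds has been halved in all of them.
  As the inputs are positive and below \<open>2 ^ R\<close>, no part can be even after
  \<open>R\<close> rounds; parts that become odd earlier just receive entries
  \<open>1\<close>.\<close>

lemma strip_run:
  assumes v: "vr sg 0 = n" "vr sg 2 = R" and S: "R * n \<le> S" "R < S" "n < S" "2 ^ R \<le> S"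
    and x: "\<And>j. j < n \<Longrightarrow> 0 < ar sg 0 j \<and> ar sg 0 j < 2 ^ R"
  shows "\<exists>sg'. run strip_code sg sg' \<and> frame {24,48,49} {0,2,10,18} sg sg' \<and> tm sg' \<le> tm sg + 2010 * ((R + 4) * (n + 1)) \<and>
     rows n R (ar sg' 2) (ar sg' 0) (ar sg 0) \<and> (\<forall>j<n. odd (ar sg' 0 j) \<and> ar sg' 0 j \<le> ar sg 0 j)"
proof -
  let ?F = "frame {24,48,49} {0,2,10,18}"
  let ?c = "asg 49 (Var 48 [*] Var 0) ;; two_code"
  let ?I = "\<lambda>r sg'. ?F sg sg' \<and> rows n r (ar sg' 2) (ar sg' 0) (ar sg 0) \<and>
     (\<forall>j<n. ar sg' 0 j \<le> ar sg 0 j \<and> 0 < ar sg' 0 j \<and> (odd (ar sg' 0 j) \<or> ar sg' 0 j * 2 ^ r \<le> ar sg 0 j))"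
  have "\<exists>sg'. run (for_loop 48 2 ?c) sg sg' \<and> tm sg' \<le> tm sg + R * ((2000 * (n + 1) + 4) + 5) + 3 \<and> ?I R sg' \<and> vr sg' 48 = R \<and> vr sg' 2 = R"
  proof (rule run_for[where I = ?I])
    fix r sg' assume r: "r < R" and I: "?I r sg'" and w: "vr sg' 48 = r" "vr sg' 2 = R"
    note fI = frame_vr[OF conjunct1[OF I]] frame_ar[OF conjunct1[OF I]]
    have "Suc r * n \<le> R * n" using r by (intro mult_le_mono1) simp
    then have rn: "r * n + n \<le> S" using S(1) by simp
    have v': "vr sg' 0 = n" using fI v by simp
    obtain sga where a: "run (asg 49 (Var 48 [*] Var 0)) sg' sga" "vr sga = (vr sg')(49 := r * n)" "ar sga = ar sg'" "tm sga = tm sg' + 4"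
      using asg_ex[of sg' "Var 48 [*] Var 0" 49 "r * n"] w v' rn by auto
    have va: "vr sga 0 = n" "vr sga 49 = r * n" using a v' by auto
    have xa: "ar sga 0 j \<le> S" if "j < n" for j
    proof -
      have "ar sg' 0 j \<le> ar sg 0 j" using I that by blast
      then show ?thesis using x[OF that] S(4) a(3) by simp
    qed
    have rwa: "rows n r (ar sga 2) (ar sga 0) (ar sg 0)" using I a(3) by simp
    obtain sgb where b: "run two_code sga sgb" "frame {24} {0,2,10,18} sga sgb" "tm sgb \<le> tm sga + 2000 * (n + 1)"
      "rows n (Suc r) (ar sgb 2) (ar sgb 0) (ar sg 0)" "\<forall>j<n. ar sgb 0 j = (if even (ar sga 0 j) then ar sga 0 j div 2 else ar sga 0 j)"
      using two_run[OF va rn S(3) xa rwa] by blast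
    have "?F sg sgb"
    proof -
      have "?F sg sg'" using I by blast
      also have "?F sg' sga" using a by (auto simp: frame_def)
      also have "?F sga sgb" by (rule frame_mono[OF b(2)]) auto
      finally show ?thesis .
    qed
    moreover have "ar sgb 0 j \<le> ar sg 0 j \<and> 0 < ar sgb 0 j \<and> (odd (ar sgb 0 j) \<or> ar sgb 0 j * 2 ^ Suc r \<le> ar sg 0 j)" if "j < n" for j
    proof -
      define z where "z = ar sg' 0 j"
      have I': "z \<le> ar sg 0 j" "0 < z" "odd z \<or> z * 2 ^ r \<le> ar sg 0 j" unfolding z_def using I that by blast+
      have b': "ar sgb 0 j = (if even z then z div 2 else z)" unfolding z_def using b(5) that a(3) by simp
      show ?thesis
      proof (cases "even z")
        case True
        then obtain u where "z = 2 * u" by blast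
        then show ?thesis using I' b' True by simp
      qed (use I' b' in simp)
    qed
    moreover have "vr sgb 48 = r" "vr sgb 2 = R" using frame_vr[OF b(2)] a w by auto
    ultimately show "\<exists>sg''. run ?c sg' sg'' \<and> tm sg'' \<le> tm sg' + (2000 * (n + 1) + 4) \<and> vr sg'' 48 = r \<and> vr sg'' 2 = R \<and> ?I (Suc r) (upv 48 (Suc r) sg'')"
      by (intro exI[of _ sgb] conjI[OF run_Seq[OF a(1) b(1)]] conjI) (use a(4) b(3,4) in auto)
  qed (use v S x in \<open>auto simp: rows_def\<close>)
  then obtain sg1 where 1: "run (for_loop 48 2 ?c) sg sg1" "tm sg1 \<le> tm sg + R * ((2000 * (n + 1) + 4) + 5) + 3" "?I R sg1" by blast
  have "tm sg1 \<le> tm sg + 2010 * ((R + 4) * (n + 1))"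
  proof -
    have "R * ((2000 * (n + 1) + 4) + 5) \<le> R * (2010 * (n + 1))" by (intro mult_le_mono) auto
    then have k: "R * ((2000 * (n + 1) + 4) + 5) \<le> 2010 * (R * (n + 1))" by (simp only: mult.left_commute)
    have e: "(R + 4) * (n + 1) = R * (n + 1) + 4 * (n + 1)" by (simp only: distrib_right)
    have "t2 \<le> t + 2010 * (q + 4 * (n + 1))" if "t2 \<le> t + p + 3" "p \<le> 2010 * q" for t t2 p q :: nat using that by simp
    from this[OF 1(2) k] show ?thesis unfolding e .
  qed
  moreover have "odd (ar sg1 0 j) \<and> ar sg1 0 j \<le> ar sg 0 j" if "j < n" for j
  proof -
    have I: "ar sg1 0 j \<le> ar sg 0 j" "0 < ar sg1 0 j" "odd (ar sg1 0 j) \<or> ar sg1 0 j * 2 ^ R \<le> ar sg 0 j" using 1(3) that by blast+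
    moreover have "1 * 2 ^ R \<le> ar sg1 0 j * 2 ^ R" using I(2) by (intro mult_le_mono1) simp
    ultimately show ?thesis using x[OF that] by linarith
  qed
  ultimately show ?thesis unfolding strip_code_def
    by (intro exI[of _ sg1] conjI[OF 1(1)]) (use 1(3) in auto)
qed

text \<open>The same counting with \<open>round_run\<close>: a part other than \<open>1\<close>
  after \<open>r\<close> rounds has been halved \<open>r\<close> times, which is impossible for
  \<open>r = R\<close>. The rows continue at \<open>R\<close>, behind those of the factors
  \<open>2\<close>, so there are \<open>2 * R\<close> in all.\<close>

lemma rounds_run:
  assumes v: "vr sg 0 = n" "vr sg 2 = R" "vr sg 3 = K" "vr sg 4 = 2 ^ K" "vr sg 5 = 2 ^ (R + 2)" and KR: "K \<le> R" "R \<le> 2 * K"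
    and rm: "room K (n + 2 ^ K) (2 ^ (R + 2))" and pt: "\<And>l. l \<le> K \<Longrightarrow> ptree (2 ^ (R + 2)) (2 ^ K) (ar sg 3) Suc l"
    and x: "\<And>j. j < n \<Longrightarrow> odd (ar sg 0 j) \<and> ar sg 0 j < 2 ^ R" and S: "n < S" "K < S" "2 ^ R \<le> S" "2 ^ K \<le> S" "2 * R * n \<le> S" "R < S"
    and rw: "rows n R (ar sg 2) (ar sg 0) y"
  shows "\<exists>sg'. run rounds_code sg sg' \<and> frame ({10..49} \<union> {57}) ({4..20} \<union> {0,2}) sg sg' \<and>
     tm sg' \<le> tm sg + 12004000 * ((R + 4) ^ 6 * (n + 2 ^ K + 1)) \<and> rows n (2 * R) (ar sg' 2) (\<lambda>_. 1) y"
proof -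
  let ?F = "frame ({10..49} \<union> {57}) ({4..20} \<union> {0,2})"
  let ?c = "asg 49 ((Var 2 [+] Var 48) [*] Var 0) ;; round_code"
  let ?I = "\<lambda>r sg'. ?F sg sg' \<and> rows n (R + r) (ar sg' 2) (ar sg' 0) y \<and>
     (\<forall>j<n. odd (ar sg' 0 j) \<and> ar sg' 0 j < 2 ^ R \<and> (ar sg' 0 j = 1 \<or> ar sg' 0 j * 2 ^ r \<le> ar sg 0 j))"
  define Y where "Y = (R + 4) ^ 5 * (n + 2 ^ K + 1)"
  have "\<exists>sg'. run (for_loop 48 2 ?c) sg sg' \<and> tm sg' \<le> tm sg + R * ((12003000 * Y + 6) + 5) + 3 \<and> ?I R sg' \<and> vr sg' 48 = R \<and> vr sg' 2 = R"
  proof (rule run_for[where I = ?I])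
    fix r sg' assume r: "r < R" and I: "?I r sg'" and w: "vr sg' 48 = r" "vr sg' 2 = R"
    note fI = frame_vr[OF conjunct1[OF I]] frame_ar[OF conjunct1[OF I]]
    have "Suc (R + r) * n \<le> 2 * R * n" using r by (intro mult_le_mono1) simp
    then have rn: "(R + r) * n + n \<le> S" using S(5) unfolding mult_Suc by linarith
    have v': "vr sg' 0 = n" using fI v by simp
    obtain sga where a: "run (asg 49 ((Var 2 [+] Var 48) [*] Var 0)) sg' sga" "vr sga = (vr sg')(49 := (R + r) * n)" "ar sga = ar sg'" "tm sga = tm sg' + 6"
    proof -
      have "ev sg' ((Var 2 [+] Var 48) [*] Var 0) = (R + r) * n" "(R + r) * n \<le> S" "ok sg' ((Var 2 [+] Var 48) [*] Var 0)"
        using w v' rn by simp_all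
      from asg_ex[OF this(3) _ this(1,2), of 49] that show ?thesis by auto
    qed
    have va: "vr sga 0 = n" "vr sga 2 = R" "vr sga 3 = K" "vr sga 4 = 2 ^ K" "vr sga 5 = 2 ^ (R + 2)" "vr sga 49 = (R + r) * n"
      "ar sga 3 = ar sg 3" using a fI v by auto
    have pa: "ptree (2 ^ (R + 2)) (2 ^ K) (ar sga 3) Suc l" if "l \<le> K" for l unfolding va(7) using pt[OF that] .
    have xa: "odd (ar sga 0 j) \<and> ar sga 0 j < 2 ^ R" if "j < n" for j using I that a(3) by simp
    have rwa: "rows n (R + r) (ar sga 2) (ar sga 0) y" using I a(3) by simp
    obtain sgb where b: "run round_code sga sgb" "frame ({10..47} \<union> {57}) ({4..20} \<union> {0,2}) sga sgb" "tm sgb \<le> tm sga + 12003000 * Y"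
      "rows n (Suc (R + r)) (ar sgb 2) (ar sgb 0) y" "\<forall>j<n. odd (ar sgb 0 j) \<and> (ar sgb 0 j = 1 \<or> 2 * ar sgb 0 j \<le> ar sga 0 j)"
      unfolding Y_def using round_run[OF va(1-6) KR rm pa xa S(1-4) rn rwa] by blast
    have "?F sg sgb"
    proof -
      have "?F sg sg'" using I by blast
      also have "?F sg' sga" using a by (auto simp: frame_def)
      also have "?F sga sgb" by (rule frame_mono[OF b(2)]) auto
      finally show ?thesis .
    qed
    moreover have "odd (ar sgb 0 j) \<and> ar sgb 0 j < 2 ^ R \<and> (ar sgb 0 j = 1 \<or> ar sgb 0 j * 2 ^ Suc r \<le> ar sg 0 j)" if "j < n" for j
    proof -
      define z u where "z = ar sg' 0 j" and "u = ar sgb 0 j"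
      have I': "z < 2 ^ R" "odd z" "z = 1 \<or> z * 2 ^ r \<le> ar sg 0 j" unfolding z_def using I that by blast+
      have b': "odd u" "u = 1 \<or> 2 * u \<le> z" unfolding z_def u_def using b(5) that a(3) by auto
      have "1 \<le> z" using I'(2) by (cases z) auto
      have "u < 2 ^ R" using b'(2) I'(1) \<open>1 \<le> z\<close> by linarith
      moreover have "u * 2 ^ Suc r \<le> ar sg 0 j" if "u \<noteq> 1"
      proof -
        have u: "2 * u \<le> z" using b'(2) that by blast
        have "1 \<le> u" using b'(1) by (cases u) auto
        then have "z \<noteq> 1" using u by linarith
        then have "z * 2 ^ r \<le> ar sg 0 j" using I'(3) by blast
        moreover have "2 * u * 2 ^ r \<le> z * 2 ^ r" using u by (rule mult_le_mono1)
        moreover have "u * 2 ^ Suc r = 2 * u * 2 ^ r" by simp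
        ultimately show ?thesis by linarith
      qed
      ultimately show ?thesis unfolding u_def[symmetric] using b'(1) by blast
    qed
    moreover have "vr sgb 48 = r" "vr sgb 2 = R" using frame_vr[OF b(2)] a w by auto
    ultimately show "\<exists>sg''. run ?c sg' sg'' \<and> tm sg'' \<le> tm sg' + (12003000 * Y + 6) \<and> vr sg'' 48 = r \<and> vr sg'' 2 = R \<and> ?I (Suc r) (upv 48 (Suc r) sg'')"
      by (intro exI[of _ sgb] conjI[OF run_Seq[OF a(1) b(1)]] conjI) (use a(4) b(3,4) in auto)
  qed (use v S x rw in auto)
  then obtain sg1 where 1: "run (for_loop 48 2 ?c) sg sg1" "tm sg1 \<le> tm sg + R * ((12003000 * Y + 6) + 5) + 3" "?I R sg1" by blast
  have "tm sg1 \<le> tm sg + 12004000 * ((R + 4) * Y)"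
  proof -
    have "1 * 1 \<le> Y" unfolding Y_def by (intro mult_le_mono one_le_power) auto
    then have Y: "1 \<le> Y" by simp
    have "R * ((12003000 * Y + 6) + 5) \<le> R * (12003011 * Y)" using Y by (intro mult_le_mono) auto
    then have k: "R * ((12003000 * Y + 6) + 5) \<le> 12003011 * (R * Y)" by (simp only: mult.left_commute)
    have e: "(R + 4) * Y = R * Y + 4 * Y" by (simp only: distrib_right)
    have "t2 \<le> t + 12004000 * (q + 4 * Y)" if "t2 \<le> t + p + 3" "p \<le> 12003011 * q" for t t2 p q :: nat using that Y by simp
    from this[OF 1(2) k] show ?thesis unfolding e .
  qed
  moreover have "(R + 4) * Y = (R + 4) ^ 6 * (n + 2 ^ K + 1)" unfolding Y_def by (simp only: mult.assoc[symmetric] power_Suc[symmetric]) simp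
  ultimately have t: "tm sg1 \<le> tm sg + 12004000 * ((R + 4) ^ 6 * (n + 2 ^ K + 1))" by simp
  have one: "ar sg1 0 j = 1" if "j < n" for j
  proof (rule ccontr)
    assume "ar sg1 0 j \<noteq> 1"
    then have I: "odd (ar sg1 0 j)" "ar sg1 0 j * 2 ^ R \<le> ar sg 0 j" using 1(3) that by blast+
    have "1 \<le> ar sg1 0 j" using I(1) by (cases "ar sg1 0 j") auto
    then have "1 * 2 ^ R \<le> ar sg1 0 j * 2 ^ R" by (rule mult_le_mono1)
    then show False using I(2) x[OF that] by linarith
  qed
  have "rows n (R + R) (ar sg1 2) (ar sg1 0) y" using 1(3) by blast
  then have "rows n (2 * R) (ar sg1 2) (\<lambda>_. 1) y" unfolding rows_def mult_2 using one by simp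
  then show ?thesis unfolding rounds_code_def
    by (intro exI[of _ sg1] conjI[OF 1(1)] conjI[OF _ conjI[OF t]]) (use 1(3) in auto)
qed

end

section \<open>Writing the output\<close>

definition out_code :: com where
  "out_code = asg 50 (Var 2 [+] Var 2) ;; asg 53 (Cst 0) ;;
     for_loop 51 0 (asg 54 (Var 53) ;; asg 53 (Var 53 [+] Cst 1) ;;
       for_loop 52 50 (asg 56 (Arr 2 (Var 52 [*] Var 0 [+] Var 51)) ;; sto 1 (Var 53) (Var 56) ;;
         asg 53 (Var 53 [+] Ite (Cst 1) (Var 56) (Cst 1) (Cst 0))) ;;
       sto 1 (Var 54) (Var 53 [-] (Var 54 [+] Cst 1)))"

definition holds :: "(nat \<Rightarrow> nat) \<Rightarrow> nat \<Rightarrow> nat list \<Rightarrow> bool" where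
  "holds A a ys \<longleftrightarrow> (\<forall>j<length ys. A (a + j) = ys ! j)"

lemma holds_Nil [simp]: "holds A a []"
  by (simp add: holds_def)

lemma holds_append: "holds A a (xs @ ys) \<longleftrightarrow> holds A a xs \<and> holds A (a + length xs) ys"
proof
  assume h: "holds A a (xs @ ys)"
  have "A (a + length xs + j) = ys ! j" if "j < length ys" for j
    using h[unfolded holds_def, rule_format, of "length xs + j"] that by (simp add: add.assoc)
  moreover have "A (a + j) = xs ! j" if "j < length xs" for j
    using h[unfolded holds_def, rule_format, of j] that by (simp add: nth_append)
  ultimately show "holds A a xs \<and> holds A (a + length xs) ys" unfolding holds_def by blast
next
  assume h: "holds A a xs \<and> holds A (a + length xs) ys"
  have "A (a + j) = (xs @ ys) ! j" if "j < length xs + length ys" for j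
  proof (cases "j < length xs")
    case True then show ?thesis using h by (simp add: holds_def nth_append)
  next
    case False
    then have "j - length xs < length ys" using that by simp
    then have "A (a + length xs + (j - length xs)) = ys ! (j - length xs)" using h unfolding holds_def by blast
    then show ?thesis using False by (simp add: nth_append)
  qed
  then show "holds A a (xs @ ys)" unfolding holds_def by simp
qed

lemma holds_Cons: "holds A a (y # ys) \<longleftrightarrow> A a = y \<and> holds A (a + 1) ys"
  using holds_append[of A a "[y]" ys] by (simp add: holds_def)

lemma holds_cong: "holds A a ys \<Longrightarrow> (\<And>i. a \<le> i \<Longrightarrow> i < a + length ys \<Longrightarrow> A' i = A i) \<Longrightarrow> holds A' a ys"
  by (simp add: holds_def)

definition column :: "nat \<Rightarrow> (nat \<Rightarrow> nat) \<Rightarrow> nat \<Rightarrow> nat \<Rightarrow> nat list" where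
  "column n C r j = filter (\<lambda>f. 1 < f) (map (\<lambda>i. C (i * n + j)) [0..<r])"

lemma column_0 [simp]: "column n C 0 j = []"
  by (simp add: column_def)

lemma column_Suc: "column n C (Suc r) j = column n C r j @ (if 1 < C (r * n + j) then [C (r * n + j)] else [])"
  by (simp add: column_def)

lemma length_column: "length (column n C r j) \<le> r"
  unfolding column_def using length_filter_le[of _ "map (\<lambda>i. C (i * n + j)) [0..<r]"] by simp

definition columns :: "nat \<Rightarrow> (nat \<Rightarrow> nat) \<Rightarrow> nat \<Rightarrow> nat \<Rightarrow> nat list" where
  "columns n C r k = concat (map (\<lambda>ps. length ps # ps) (map (column n C r) [0..<k]))"

lemma columns_Suc: "columns n C r (Suc k) = columns n C r k @ length (column n C r k) # column n C r k"
  by (simp add: columns_def)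

lemma length_columns: "length (columns n C r k) \<le> k * (r + 1)"
proof (induction k)
  case 0 then show ?case by (simp add: columns_def)
next
  case (Suc k) then show ?case using length_column[of n C r k] by (simp add: columns_Suc)
qed

text \<open>Leaving out the entries \<open>1\<close> does not change the product of a column; what
  remains is a multiset of primes with product \<open>x j\<close>, so unique factorization
  applies.\<close>

lemma mset_column:
  assumes "rows n r C (\<lambda>_. 1) x" "j < n"
  shows "mset (column n C r j) = prime_factorization (x j)"
proof -
  have p: "prod_list (column n C k j) = (\<Prod>i<k. C (i * n + j))" if "k \<le> r" for k
    using that
  proof (induction k)
    case (Suc k)
    have "C (k * n + j) = 1 \<or> prime (C (k * n + j))" using assms Suc.prems by (auto simp: rows_def)
    then show ?case using Suc by (auto simp: column_Suc dest: prime_gt_1_nat)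
  qed simp
  have "x j = prod_mset (mset (column n C r j))"
    using p[of r] assms by (simp add: rows_def prod_mset_prod_list)
  moreover have "prime q" if q: "q \<in># mset (column n C r j)" for q
  proof -
    obtain i where "i < r" "q = C (i * n + j)" "1 < q" using q by (auto simp: column_def)
    then show ?thesis using assms unfolding rows_def by (metis less_irrefl)
  qed
  ultimately show ?thesis using prime_factorization_prod_mset_primes[of "mset (column n C r j)"] by simp
qed

context ram
begin

text \<open>Every entry of a column is written at the current output position, but the position only
  advances past entries above \<open>1\<close>; an entry \<open>1\<close> is overwritten or ends up
  behind the list. The cell for the count is reserved first and filled when the column is
  complete.\<close>

lemma out_run:
  assumes v: "vr sg 0 = n" "vr sg 2 = R" and S: "n * (2 * R + 1) < S" "2 * R < S" "n < S"
    and C: "\<And>i. i < 2 * R * n \<Longrightarrow> ar sg 2 i \<le> S"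
  shows "\<exists>sg'. run out_code sg sg' \<and> tm sg' \<le> tm sg + 100 * ((R + 4) * (n + 1)) \<and>
     holds (ar sg' 1) 0 (columns n (ar sg 2) (2 * R) n)"
proof -
  obtain sg1 where 1: "run (asg 50 (Var 2 [+] Var 2)) sg sg1" "vr sg1 = (vr sg)(50 := 2 * R)" "ar sg1 = ar sg" "tm sg1 = tm sg + 4"
    using asg_ex[of sg "Var 2 [+] Var 2" 50 "2 * R"] v S by auto
  obtain sg2 where 2: "run (asg 53 (Cst 0)) sg1 sg2" "vr sg2 = (vr sg1)(53 := 0)" "ar sg2 = ar sg1" "tm sg2 = tm sg1 + 2"
    using asg_ex[of sg1 "Cst 0" 53 0] by auto
  let ?C = "ar sg 2"
  let ?d = "asg 56 (Arr 2 (Var 52 [*] Var 0 [+] Var 51)) ;; sto 1 (Var 53) (Var 56) ;;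
         asg 53 (Var 53 [+] Ite (Cst 1) (Var 56) (Cst 1) (Cst 0))"
  let ?c = "asg 54 (Var 53) ;; asg 53 (Var 53 [+] Cst 1) ;; for_loop 52 50 ?d ;; sto 1 (Var 54) (Var 53 [-] (Var 54 [+] Cst 1))"
  let ?L = "\<lambda>k. columns n ?C (2 * R) k"
  let ?I = "\<lambda>k sg'. vr sg' 0 = n \<and> vr sg' 50 = 2 * R \<and> ar sg' 2 = ?C \<and> vr sg' 53 = length (?L k) \<and> holds (ar sg' 1) 0 (?L k)"
  have "\<exists>sg'. run (for_loop 51 0 ?c) sg2 sg' \<and> tm sg' \<le> tm sg2 + n * ((2 * R * (22 + 5) + 20) + 5) + 3 \<and> ?I n sg' \<and> vr sg' 51 = n \<and> vr sg' 0 = n"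
  proof (rule run_for[where I = ?I])
    fix k sg' assume k: "k < n" and I: "?I k sg'" and w: "vr sg' 51 = k" "vr sg' 0 = n"
    define h where "h = length (?L k)"
    have hS: "h + (2 * R + 1) < S"
    proof -
      have "h \<le> k * (2 * R + 1)" unfolding h_def by (rule length_columns)
      moreover have "Suc k * (2 * R + 1) \<le> n * (2 * R + 1)" using k by (intro mult_le_mono1) simp
      ultimately show ?thesis using S(1) unfolding mult_Suc by linarith
    qed
    obtain sga where a: "run (asg 54 (Var 53)) sg' sga" "vr sga = (vr sg')(54 := h)" "ar sga = ar sg'" "tm sga = tm sg' + 2"
      using asg_ex[of sg' "Var 53" 54 h] I hS by (auto simp: h_def)
    obtain sgb where b: "run (asg 53 (Var 53 [+] Cst 1)) sga sgb" "vr sgb = (vr sga)(53 := h + 1)" "ar sgb = ar sga" "tm sgb = tm sga + 4"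
      using asg_ex[of sga "Var 53 [+] Cst 1" 53 "h + 1"] I hS a by (auto simp: h_def)
    let ?q = "\<lambda>r. column n ?C r k"
    let ?J = "\<lambda>r sg''. vr sg'' 0 = n \<and> vr sg'' 51 = k \<and> vr sg'' 54 = h \<and> ar sg'' 2 = ?C \<and>
       vr sg'' 53 = h + 1 + length (?q r) \<and> holds (ar sg'' 1) 0 (?L k) \<and> holds (ar sg'' 1) (h + 1) (?q r)"
    have "\<exists>sg''. run (for_loop 52 50 ?d) sgb sg'' \<and> tm sg'' \<le> tm sgb + 2 * R * (22 + 5) + 3 \<and> ?J (2 * R) sg'' \<and> vr sg'' 52 = 2 * R \<and> vr sg'' 50 = 2 * R"
    proof (rule run_for[where I = ?J])
      fix r sg'' assume r: "r < 2 * R" and J: "?J r sg''" and u: "vr sg'' 52 = r" "vr sg'' 50 = 2 * R"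
      have rk: "r * n + k < 2 * R * n"
      proof -
        have "Suc r * n \<le> 2 * R * n" using r by (intro mult_le_mono1) simp
        then show ?thesis using k unfolding mult_Suc by linarith
      qed
      have "2 * R * n \<le> n * (2 * R + 1)" by simp
      then have rkS: "r * n + k < S" using rk S(1) by linarith
      define f where "f = ?C (r * n + k)"
      have fS: "f \<le> S" unfolding f_def by (rule C[OF rk])
      define o' where "o' = h + 1 + length (?q r)"
      \<comment> \<open>Entries \<open>1\<close> are written as well, so there must be a cell beyond
        the factors counted so far.\<close>
      have oS: "o' + 1 < S" using length_column[of n ?C r k] r hS unfolding o'_def by linarith
      obtain sgc where c: "run (asg 56 (Arr 2 (Var 52 [*] Var 0 [+] Var 51))) sg'' sgc" "vr sgc = (vr sg'')(56 := f)" "ar sgc = ar sg''" "tm sgc = tm sg'' + 9"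
      proof -
        have "ok sg'' (Arr 2 (Var 52 [*] Var 0 [+] Var 51))" "ev sg'' (Arr 2 (Var 52 [*] Var 0 [+] Var 51)) = f"
          using J u rkS by (simp_all add: f_def)
        from asg_ex[OF this(1) _ this(2) fS, of 56] that show ?thesis by auto
      qed
      obtain sgd where d: "run (sto 1 (Var 53) (Var 56)) sgc sgd" "vr sgd = vr sgc" "ar sgd = (ar sgc)(1 := (ar sgc 1)(o' := f))" "tm sgd = tm sgc + 5"
        using sto_ex[of sgc "Var 53" "Var 56" 1 o' f] c J oS by (auto simp: o'_def)
      let ?o = "o' + (if 1 < f then 1 else 0)"
      obtain sge where e: "run (asg 53 (Var 53 [+] Ite (Cst 1) (Var 56) (Cst 1) (Cst 0))) sgd sge" "vr sge = (vr sgd)(53 := ?o)" "ar sge = ar sgd" "tm sge = tm sgd + 8"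
      proof -
        have "ok sgd (Var 53 [+] Ite (Cst 1) (Var 56) (Cst 1) (Cst 0))" "ev sgd (Var 53 [+] Ite (Cst 1) (Var 56) (Cst 1) (Cst 0)) = ?o" "?o \<le> S"
          using J c d oS by (simp_all add: o'_def)
        from asg_ex[OF this(1) _ this(2,3), of 53] that show ?thesis by auto
      qed
      have ae: "ar sge 1 = (ar sg'' 1)(o' := f)" "ar sge 2 = ?C" using c d e J by simp_all
      have al: "ar sge 1 i = ar sg'' 1 i" if "i < o'" for i using ae(1) that by simp
      have JL: "holds (ar sg'' 1) 0 (?L k)" "holds (ar sg'' 1) (h + 1) (?q r)" using J by blast+
      have "holds (ar sge 1) 0 (?L k)"
        by (rule holds_cong[OF JL(1)], rule al) (simp add: o'_def h_def)
      moreover have q: "holds (ar sge 1) (h + 1) (?q r)"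
        by (rule holds_cong[OF JL(2)], rule al) (simp add: o'_def)
      moreover have "holds (ar sge 1) (h + 1) (?q (Suc r))"
        unfolding column_Suc holds_append f_def[symmetric] using q ae(1) by (simp add: holds_Cons o'_def)
      moreover have "?o = h + 1 + length (?q (Suc r))" unfolding column_Suc f_def[symmetric] by (simp add: o'_def)
      ultimately show "\<exists>sg3. run ?d sg'' sg3 \<and> tm sg3 \<le> tm sg'' + 22 \<and> vr sg3 52 = r \<and> vr sg3 50 = 2 * R \<and> ?J (Suc r) (upv 52 (Suc r) sg3)"
        by (intro exI[of _ sge] conjI[OF run_Seq[OF c(1) run_Seq[OF d(1) e(1)]]] conjI) (use c d e J u ae in auto)
    qed (use a b I w S(2) in \<open>auto simp: h_def\<close>)
    then obtain sgc where c: "run (for_loop 52 50 ?d) sgb sgc" "tm sgc \<le> tm sgb + 2 * R * (22 + 5) + 3" "?J (2 * R) sgc" "vr sgc 50 = 2 * R" by blast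
    let ?ct = "length (?q (2 * R))"
    obtain sgd where d: "run (sto 1 (Var 54) (Var 53 [-] (Var 54 [+] Cst 1))) sgc sgd" "vr sgd = vr sgc"
      "ar sgd = (ar sgc)(1 := (ar sgc 1)(h := ?ct))" "tm sgd = tm sgc + 9"
    proof -
      have "ok sgc (Var 53 [-] (Var 54 [+] Cst 1))" "ev sgc (Var 53 [-] (Var 54 [+] Cst 1)) = ?ct" using c(3) by simp_all
      from sto_ex[of sgc "Var 54", OF _ this(1) _ _ _ this(2), of 1 h] c(3) hS that show ?thesis by auto
    qed
    have al: "ar sgd 1 i = ar sgc 1 i" if "i \<noteq> h" for i using d(3) that by simp
    have JL: "holds (ar sgc 1) 0 (?L k)" "holds (ar sgc 1) (h + 1) (?q (2 * R))" using c(3) by blast+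
    have "holds (ar sgd 1) 0 (?L k)"
      by (rule holds_cong[OF JL(1)], rule al) (simp add: h_def)
    moreover have "holds (ar sgd 1) (h + 1) (?q (2 * R))"
      by (rule holds_cong[OF JL(2)], rule al) simp
    ultimately have L: "holds (ar sgd 1) 0 (?L (Suc k))"
      unfolding columns_Suc holds_append holds_Cons by (simp add: h_def[symmetric] d(3))
    have "length (?L (Suc k)) = h + 1 + ?ct" unfolding columns_Suc by (simp add: h_def)
    then show "\<exists>sg3. run ?c sg' sg3 \<and> tm sg3 \<le> tm sg' + (2 * R * (22 + 5) + 20) \<and> vr sg3 51 = k \<and> vr sg3 0 = n \<and> ?I (Suc k) (upv 51 (Suc k) sg3)"
      by (intro exI[of _ sgd] conjI[OF run_Seq[OF a(1) run_Seq[OF b(1) run_Seq[OF c(1) d(1)]]]] conjI) (use a b c d L in auto)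
  qed (use 1 2 v S in \<open>auto simp: columns_def\<close>)
  then obtain sg3 where 3: "run (for_loop 51 0 ?c) sg2 sg3" "tm sg3 \<le> tm sg2 + n * ((2 * R * (22 + 5) + 20) + 5) + 3" "?I n sg3" by blast
  have "tm sg3 \<le> tm sg + 100 * ((R + 4) * (n + 1))"
  proof -
    have "n * ((2 * R * (22 + 5) + 20) + 5) \<le> n * (100 * (R + 4))" by (intro mult_le_mono) auto
    also have "\<dots> = 100 * ((R + 4) * n)" by (simp only: mult.left_commute mult.commute)
    finally have k: "n * ((2 * R * (22 + 5) + 20) + 5) \<le> 100 * ((R + 4) * n)" .
    have e: "(R + 4) * (n + 1) = (R + 4) * n + (R + 4)" by simp
    have "t3 \<le> t + 100 * (q + (R + 4))" if "t1 = t + 4" "t2 = t1 + 2" "t3 \<le> t2 + p + 3" "p \<le> 100 * q" for t t1 t2 t3 p q :: nat using that by simp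
    from this[OF 1(4) 2(4) 3(2) k] show ?thesis unfolding e .
  qed
  then show ?thesis unfolding out_code_def
    by (intro exI[of _ sg3] conjI[OF run_Seq[OF 1(1) run_Seq[OF 2(1) 3(1)]]]) (use 3(3) in auto)
qed

end

section \<open>The complete program\<close>

definition setup_code :: com where
  "setup_code = asg 2 (Cst 0) ;; asg 7 (Cst 1) ;; asg 9 (Var 1 [+] Cst 1) ;;
     Loop (Lt (Reg 7) (Reg 9)) (asg 7 (Cst 2 [*] Var 7) ;; asg 2 (Var 2 [+] Cst 1)) ;;
     asg 3 ((Var 2 [+] Cst 1) [div] Cst 2) ;; asg 4 (Pow2 (Var 3)) ;; asg 5 (Pow2 (Var 2 [+] Cst 2))"

definition factor_code :: com where
  "factor_code = setup_code ;; dtree_code ;; strip_code ;; rounds_code ;; out_code"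

text \<open>Four squarings turn \<open>n + s + 2\<close> into its 16th power, the stride in register
  \<open>60\<close>, whose eighth power the word size condition bounds. The output is array
  \<open>1\<close>, which begins at address S, so the last instruction copies the stride to register
  \<open>0\<close>.\<close>

definition factor_program :: com where
  "factor_program = Op 61 Add (Reg 0) (Reg 1) ;; Op 61 Add (Reg 61) (Const 2) ;; Op 61 Mul (Reg 61) (Reg 61) ;;
     Op 61 Mul (Reg 61) (Reg 61) ;; Op 61 Mul (Reg 61) (Reg 61) ;; Op 60 Mul (Reg 61) (Reg 61) ;;
     factor_code ;; Op 0 BitOr (Reg 60) (Const 0)"

section \<open>Bit lengths and the number of steps\<close>

definition bitlen :: "nat \<Rightarrow> nat" where
  "bitlen s = (LEAST r. s < 2 ^ r)"

lemma less_bitlen: "s < 2 ^ bitlen s"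
  unfolding bitlen_def by (rule LeastI[of _ s]) (rule less_exp)

lemma bitlen_less: "i < bitlen s \<Longrightarrow> 2 ^ i \<le> s"
  unfolding bitlen_def using not_less_Least not_less by blast

lemma power_bitlen_le: "2 ^ bitlen s \<le> 2 * s + 1"
proof (cases "bitlen s")
  case (Suc i)
  then show ?thesis using bitlen_less[of i s] by simp
qed simp

definition halflen :: "nat \<Rightarrow> nat" where
  "halflen s = (bitlen s + 1) div 2"

lemma halflen_bounds: "halflen s \<le> bitlen s" "bitlen s \<le> 2 * halflen s" "2 * halflen s \<le> bitlen s + 1"
  unfolding halflen_def by (cases "bitlen s", auto)

text \<open>Stated with a square to stay within the natural numbers: the size 2^K of the search
  range is O(\<surd>s).\<close>

lemma power_halflen_le: "2 ^ halflen s * 2 ^ halflen s \<le> 4 * s + 2"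
proof -
  have "(2::nat) ^ halflen s * 2 ^ halflen s = 2 ^ (2 * halflen s)" by (simp add: power_add mult_2)
  also have "\<dots> \<le> 2 ^ (bitlen s + 1)" using halflen_bounds by (intro power_increasing) auto
  finally show ?thesis using power_bitlen_le[of s] by simp
qed

text \<open>The exponent \<open>6\<close> is made up of one factor each for the rounds, the levels
  of the search and the levels of the trees, and three for the multiplication of long
  numbers.\<close>

definition steps :: "nat \<Rightarrow> nat \<Rightarrow> nat" where
  "steps n s = (bitlen s + 4) ^ 6 * (n + 2 ^ halflen s + 1)"

context ram
begin

lemma setup_run:
  assumes v: "vr sg 1 = s" and S: "8 * (s + 2) \<le> S"
  shows "\<exists>sg'. run setup_code sg sg' \<and> frame {2,3,4,5,7,9} {} sg sg' \<and> tm sg' \<le> tm sg + 10 * (bitlen s + 4) \<and>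
     vr sg' 2 = bitlen s \<and> vr sg' 3 = halflen s \<and> vr sg' 4 = 2 ^ halflen s \<and> vr sg' 5 = 2 ^ (bitlen s + 2)"
proof -
  define R where "R = bitlen s"
  have p2: "2 ^ R \<le> 2 * s + 1" unfolding R_def by (rule power_bitlen_le)
  have "R < 2 * s + 1" using less_exp p2 by (rule less_le_trans)
  then have RS: "R + 2 \<le> S" "2 ^ R \<le> S" "2 ^ (R + 2) \<le> S" using p2 S by simp_all
  obtain sg1 where 1: "run (asg 2 (Cst 0)) sg sg1" "vr sg1 = (vr sg)(2 := 0)" "ar sg1 = ar sg" "tm sg1 = tm sg + 2"
    using asg_ex[of sg "Cst 0" 2 0] by auto
  obtain sg2 where 2: "run (asg 7 (Cst 1)) sg1 sg2" "vr sg2 = (vr sg1)(7 := 1)" "ar sg2 = ar sg1" "tm sg2 = tm sg1 + 2"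
    using asg_ex[of sg1 "Cst 1" 7 1] S_ge by auto
  obtain sg3 where 3: "run (asg 9 (Var 1 [+] Cst 1)) sg2 sg3" "vr sg3 = (vr sg2)(9 := s + 1)" "ar sg3 = ar sg2" "tm sg3 = tm sg2 + 4"
    using asg_ex[of sg2 "Var 1 [+] Cst 1" 9 "s + 1"] 1 2 v S by auto
  let ?I = "\<lambda>i sg'. frame {2,7} {} sg3 sg' \<and> vr sg' 7 = 2 ^ i \<and> vr sg' 2 = i"
  let ?c = "asg 7 (Cst 2 [*] Var 7) ;; asg 2 (Var 2 [+] Cst 1)"
  have "\<exists>sg'. run (Loop (Lt (Reg 7) (Reg 9)) ?c) sg3 sg' \<and> tm sg' \<le> tm sg3 + R * (8 + 1) + 1 \<and> ?I R sg'"
  proof (rule run_Loop_inv[where I = ?I])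
    fix i sg' assume i: "i \<le> R" and I: "?I i sg'"
    have "vr sg' 9 = s + 1" using frame_vr[OF conjunct1[OF I]] 3 by simp
    moreover have "2 ^ i < s + 1 \<longleftrightarrow> i < R"
    proof
      assume "2 ^ i < s + 1"
      then show "i < R" using less_bitlen[of s] i by (cases "i = R") (auto simp: R_def)
    next
      assume "i < R"
      then show "2 ^ i < s + 1" using bitlen_less unfolding R_def by (simp add: less_Suc_eq_le)
    qed
    ultimately show "vr sg' 7 < vr sg' 9 \<longleftrightarrow> i < R" using I by simp
  next
    fix i sg' assume i: "i < R" and I: "?I i sg'"
    have "2 ^ i \<le> s" using bitlen_less i unfolding R_def by blast
    then have i2: "2 ^ Suc i \<le> S" using S by simp
    have iS: "i + 1 \<le> S" using i RS(1) by simp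
    obtain sga where a: "run (asg 7 (Cst 2 [*] Var 7)) sg' sga" "vr sga = (vr sg')(7 := 2 ^ Suc i)" "ar sga = ar sg'" "tm sga = tm sg' + 4"
    proof -
      have "ok sg' (Cst 2 [*] Var 7)" "ev sg' (Cst 2 [*] Var 7) = 2 ^ Suc i" using I by simp_all
      from asg_ex[OF this(1) _ this(2) i2, of 7] that show ?thesis by auto
    qed
    obtain sgb where b: "run (asg 2 (Var 2 [+] Cst 1)) sga sgb" "vr sgb = (vr sga)(2 := i + 1)" "ar sgb = ar sga" "tm sgb = tm sga + 4"
    proof -
      have "ok sga (Var 2 [+] Cst 1)" "ev sga (Var 2 [+] Cst 1) = i + 1" using I a by simp_all
      from asg_ex[OF this(1) _ this(2) iS, of 2] that show ?thesis by auto
    qed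
    have "frame {2,7} {} sg3 sgb"
    proof -
      have "frame {2,7} {} sg3 sg'" using I by blast
      also have "frame {2,7} {} sg' sgb" using a b by (auto simp: frame_def)
      finally show ?thesis .
    qed
    then show "\<exists>sg''. run ?c sg' sg'' \<and> tm sg'' \<le> tm sg' + 8 \<and> ?I (Suc i) sg''"
      by (intro exI[of _ sgb] conjI[OF run_Seq[OF a(1) b(1)]] conjI) (use a b in auto)
  qed (use 1 2 3 in auto)
  then obtain sg4 where 4: "run (Loop (Lt (Reg 7) (Reg 9)) ?c) sg3 sg4" "tm sg4 \<le> tm sg3 + R * (8 + 1) + 1" "?I R sg4" by blast
  define K where "K = halflen s"
  have KR: "K \<le> R" unfolding K_def R_def by (rule halflen_bounds)
  have "(2::nat) ^ K \<le> 2 ^ R" using KR by (intro power_increasing) auto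
  then have KS: "2 ^ K \<le> S" "K \<le> S" using KR RS by linarith+
  obtain sg5 where 5: "run (asg 3 ((Var 2 [+] Cst 1) [div] Cst 2)) sg4 sg5" "vr sg5 = (vr sg4)(3 := K)" "ar sg5 = ar sg4" "tm sg5 = tm sg4 + 6"
  proof -
    have "ok sg4 ((Var 2 [+] Cst 1) [div] Cst 2)" "ev sg4 ((Var 2 [+] Cst 1) [div] Cst 2) = K" using 4(3) by (simp_all add: K_def halflen_def R_def)
    from asg_ex[OF this(1) _ this(2) KS(2), of 3] that show ?thesis by auto
  qed
  obtain sg6 where 6: "run (asg 4 (Pow2 (Var 3))) sg5 sg6" "vr sg6 = (vr sg5)(4 := 2 ^ K)" "ar sg6 = ar sg5" "tm sg6 = tm sg5 + 3"
    using asg_ex[of sg5 "Pow2 (Var 3)" 4 "2 ^ K"] 5 KS by auto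
  obtain sg7 where 7: "run (asg 5 (Pow2 (Var 2 [+] Cst 2))) sg6 sg7" "vr sg7 = (vr sg6)(5 := 2 ^ (R + 2))" "ar sg7 = ar sg6" "tm sg7 = tm sg6 + 5"
  proof -
    have "vr sg6 2 = R" using 4(3) 5 6 by simp
    then have "ok sg6 (Pow2 (Var 2 [+] Cst 2))" "ev sg6 (Pow2 (Var 2 [+] Cst 2)) = 2 ^ (R + 2)" using RS(3) by simp_all
    from asg_ex[OF this(1) _ this(2) RS(3), of 5] that show ?thesis by auto
  qed
  have "frame {2,3,4,5,7,9} {} sg sg7" (is "?F sg sg7")
  proof -
    have "?F sg sg3" using 1 2 3 by (auto simp: frame_def)
    also have "?F sg3 sg4" by (rule frame_mono[OF conjunct1[OF 4(3)]]) auto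
    also have "?F sg4 sg7" using 5 6 7 by (auto simp: frame_def)
    finally show ?thesis .
  qed
  moreover have "tm sg7 \<le> tm sg + 10 * (R + 4)" using 1(4) 2(4) 3(4) 4(2) 5(4) 6(4) 7(4) by simp
  ultimately show ?thesis unfolding setup_code_def R_def[symmetric] K_def[symmetric]
    by (intro exI[of _ sg7] conjI[OF run_Seq[OF 1(1) run_Seq[OF 2(1) run_Seq[OF 3(1) run_Seq[OF 4(1) run_Seq[OF 5(1) run_Seq[OF 6(1) 7(1)]]]]]]] conjI)
      (use 4(3) 5 6 7 in auto)
qed

lemma factor_run:
  assumes v: "vr sg 0 = n" "vr sg 1 = s" and S: "(n + s + 2) ^ 16 \<le> S"
    and x: "\<And>j. j < n \<Longrightarrow> 1 \<le> ar sg 0 j \<and> ar sg 0 j \<le> s"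
  shows "\<exists>sg' C. run factor_code sg sg' \<and> tm sg' \<le> tm sg + 13000000 * steps n s \<and> n * (2 * bitlen s + 1) < S \<and>
     rows n (2 * bitlen s) C (\<lambda>_. 1) (ar sg 0) \<and> holds (ar sg' 1) 0 (columns n C (2 * bitlen s) n)"
proof -
  define Z where "Z = n + s + 2"
  define R where "R = bitlen s"
  define K where "K = halflen s"
  have KR: "K \<le> R" "R \<le> 2 * K" unfolding K_def R_def by (rule halflen_bounds)+
  have Z2: "2 \<le> Z" by (simp add: Z_def)
  have p2: "2 ^ R \<le> 2 * Z" using power_bitlen_le[of s] unfolding R_def Z_def by simp
  have "(2::nat) ^ K \<le> 2 ^ R" using KR by (intro power_increasing) auto
  then have pK: "2 ^ K \<le> 2 * Z" using p2 by linarith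
  \<comment> \<open>As \<open>Z\<close> is at least \<open>2\<close>, powers of two can be traded
    for powers of \<open>Z\<close>. This reduces every size condition below to counting exponents up
    to \<open>16\<close>.\<close>
  have pw: "2 ^ a * Z ^ b \<le> S" if "a + b \<le> 16" for a b
  proof -
    have "2 ^ a * Z ^ b \<le> Z ^ a * Z ^ b" using Z2 by (intro mult_le_mono power_mono) auto
    also have "\<dots> = Z ^ (a + b)" by (simp add: power_add)
    also have "\<dots> \<le> Z ^ 16" using Z2 that by (intro power_increasing) auto
    finally show ?thesis using S unfolding Z_def by linarith
  qed
  have Z8: "256 * Z \<le> S" using pw[of 8 1] by simp
  have RZ: "R < 2 * Z" using less_exp p2 by (rule less_le_trans)
  have rm: "room K (n + 2 ^ K) (2 ^ (R + 2))" unfolding room_def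
  proof (intro conjI)
    have "8 * 2 ^ (K + 2) * (2 ^ (R + 2) * 2 ^ (R + 2)) = 512 * (2 ^ K * (2 ^ R * (2 ^ R :: nat)))" by (simp add: power_add)
    also have "\<dots> \<le> 512 * (2 * Z * (2 * Z * (2 * Z)))" using pK p2 by (intro mult_le_mono) auto
    also have "\<dots> = 2 ^ 12 * Z ^ 3" by (simp add: power3_eq_cube)
    also have "\<dots> \<le> S" by (rule pw) simp
    finally show "8 * 2 ^ (K + 2) * (2 ^ (R + 2) * 2 ^ (R + 2)) \<le> S" .
    show "4 * (K + 2) \<le> S" using KR(1) RZ Z2 Z8 by simp
    have "K + 2 \<le> 4 * Z" "n + 2 ^ K \<le> 4 * Z" using KR(1) RZ pK Z2 by (auto simp: Z_def)
    then have "4 * (K + 2) * (n + 2 ^ K) \<le> 4 * (4 * Z) * (4 * Z)" by (intro mult_le_mono) auto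
    also have "\<dots> = 64 * Z ^ 2" by (simp add: power2_eq_square)
    also have "\<dots> < 2 ^ 14 * Z ^ 2" using Z2 by simp
    also have "\<dots> \<le> S" by (rule pw) simp
    finally show "4 * (K + 2) * (n + 2 ^ K) < S" .
  qed
  have rm0: "room K (2 ^ K) (2 ^ (R + 2))" using rm by (rule room_mono) auto
  have nR: "n * (2 * R + 1) < S"
  proof -
    have "n * (2 * R + 1) \<le> (n + 2 ^ K) * (4 * (K + 2))" using KR(2) by (intro mult_le_mono) auto
    then show ?thesis using rm by (simp add: room_def mult.commute)
  qed
  have sm: "n < S" "R < S" "2 * R < S" "K < S" "2 ^ R \<le> S" "2 ^ K \<le> S"
    using Z8 Z2 p2 pK KR(1) RZ by (auto simp: Z_def)
  have RnS: "2 * R * n \<le> S" "R * n \<le> S" using nR by (simp_all add: algebra_simps)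
  have "8 * (s + 2) \<le> S" using Z8 unfolding Z_def by simp
  then obtain sg1 where 1: "run setup_code sg sg1" "frame {2,3,4,5,7,9} {} sg sg1" "tm sg1 \<le> tm sg + 10 * (R + 4)"
     "vr sg1 2 = R" "vr sg1 3 = K" "vr sg1 4 = 2 ^ K" "vr sg1 5 = 2 ^ (R + 2)"
    unfolding R_def K_def using setup_run[OF v(2)] by blast
  have v1: "vr sg1 0 = n" "ar sg1 0 = ar sg 0" using frame_vr[OF 1(2)] frame_ar[OF 1(2)] v by auto
  have B: "(2::nat) ^ (R + 2) = 4 * 2 ^ R" "(2::nat) ^ K \<le> 2 ^ R" using KR by (simp_all add: power_increasing)
  obtain sg2 where 2: "run dtree_code sg1 sg2" "frame ({10..32} \<union> {36,37,38}) ({8..13} \<union> {3}) sg1 sg2"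
     "tm sg2 \<le> tm sg1 + 400000 * ((K + 1) * ((K + 4) ^ 3 * (2 ^ K + 2 ^ K + 1)))" "\<forall>l\<le>K. ptree (2 ^ (R + 2)) (2 ^ K) (ar sg2 3) Suc l"
    using dtree_run[OF 1(5-7) B rm0] by blast
  note f2 = frame_vr[OF 2(2)] frame_ar[OF 2(2)]
  have v2: "vr sg2 0 = n" "vr sg2 2 = R" "vr sg2 3 = K" "vr sg2 4 = 2 ^ K" "vr sg2 5 = 2 ^ (R + 2)" "ar sg2 0 = ar sg 0"
    using f2 1 v1 by auto
  have xs: "0 < ar sg 0 j \<and> ar sg 0 j < 2 ^ R" if "j < n" for j
    using x[OF that] less_bitlen[of s] unfolding R_def by linarith
  have x2: "0 < ar sg2 0 j \<and> ar sg2 0 j < 2 ^ R" if "j < n" for j using xs[OF that] v2(6) by simp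
  obtain sg3 where 3: "run strip_code sg2 sg3" "frame {24,48,49} {0,2,10,18} sg2 sg3" "tm sg3 \<le> tm sg2 + 2010 * ((R + 4) * (n + 1))"
     "rows n R (ar sg3 2) (ar sg3 0) (ar sg2 0)" "\<forall>j<n. odd (ar sg3 0 j) \<and> ar sg3 0 j \<le> ar sg2 0 j"
    using strip_run[OF v2(1,2) RnS(2) sm(2,1,5) x2] by blast
  note f3 = frame_vr[OF 3(2)] frame_ar[OF 3(2)]
  have v3: "vr sg3 0 = n" "vr sg3 2 = R" "vr sg3 3 = K" "vr sg3 4 = 2 ^ K" "vr sg3 5 = 2 ^ (R + 2)" "ar sg3 3 = ar sg2 3"
    using f3 v2 by auto
  have x3: "odd (ar sg3 0 j) \<and> ar sg3 0 j < 2 ^ R" if "j < n" for j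
    using 3(5) x2[OF that] that le_less_trans by blast
  have p3: "ptree (2 ^ (R + 2)) (2 ^ K) (ar sg3 3) Suc l" if "l \<le> K" for l unfolding v3(6) using 2(4) that by blast
  obtain sg4 where 4: "run rounds_code sg3 sg4" "frame ({10..49} \<union> {57}) ({4..20} \<union> {0,2}) sg3 sg4"
     "tm sg4 \<le> tm sg3 + 12004000 * ((R + 4) ^ 6 * (n + 2 ^ K + 1))" "rows n (2 * R) (ar sg4 2) (\<lambda>_. 1) (ar sg2 0)"
    using rounds_run[OF v3(1-5) KR rm p3 x3 sm(1,4,5,6) RnS(1) sm(2) 3(4)] by blast
  note f4 = frame_vr[OF 4(2)] frame_ar[OF 4(2)]
  have v4: "vr sg4 0 = n" "vr sg4 2 = R" using f4 v3 by auto
  \<comment> \<open>Each entry divides the input of its column, so it is small enough to be loaded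
    into a variable.\<close>
  have C: "ar sg4 2 i \<le> S" if "i < 2 * R * n" for i
  proof -
    have n0: "0 < n" using that by (cases n) auto
    have "i div n < 2 * R" "i mod n < n" using that n0 by (simp_all add: less_mult_imp_div_less)
    then have "(\<Prod>k<2 * R. ar sg4 2 (k * n + i mod n)) = ar sg2 0 (i mod n)" "0 < ar sg2 0 (i mod n)" "ar sg2 0 (i mod n) < 2 ^ R"
      using 4(4) x2 by (auto simp: rows_def)
    moreover have "ar sg4 2 (i div n * n + i mod n) dvd (\<Prod>k<2 * R. ar sg4 2 (k * n + i mod n))"
      using \<open>i div n < 2 * R\<close> by (intro dvd_prodI[of _ "i div n"]) auto
    ultimately have "ar sg4 2 i \<le> ar sg2 0 (i mod n)" by (simp add: dvd_imp_le)
    then show ?thesis using \<open>ar sg2 0 (i mod n) < 2 ^ R\<close> sm(5) by linarith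
  qed
  obtain sg5 where 5: "run out_code sg4 sg5" "tm sg5 \<le> tm sg4 + 100 * ((R + 4) * (n + 1))" "holds (ar sg5 1) 0 (columns n (ar sg4 2) (2 * R) n)"
    using out_run[OF v4 nR sm(3,1) C] by blast
  have t: "tm sg5 \<le> tm sg + 13000000 * steps n s"
  proof -
    define Y where "Y = (R + 4) ^ 6 * (n + 2 ^ K + 1)"
    have R6: "R + 4 \<le> (R + 4) ^ 6" "(R + 4) ^ 4 \<le> (R + 4) ^ 6"
      using power_increasing[of 1 6 "R + 4"] power_increasing[of 4 6 "R + 4"] by simp_all
    have h1: "(R + 4) * (n + 1) \<le> Y" unfolding Y_def using R6 by (intro mult_le_mono) auto
    moreover have "(R + 4) * 1 \<le> (R + 4) * (n + 1)" by (intro mult_le_mono) auto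
    ultimately have h2: "R + 4 \<le> Y" by simp
    have "(K + 1) * ((K + 4) ^ 3 * (2 ^ K + 2 ^ K + 1)) \<le> (R + 4) * ((R + 4) ^ 3 * (2 * (n + 2 ^ K + 1)))"
      using KR(1) by (intro mult_le_mono power_mono) auto
    also have "\<dots> = 2 * ((R + 4) * (R + 4) ^ 3 * (n + 2 ^ K + 1))" by (simp only: mult.left_commute mult.assoc)
    also have "(R + 4) * (R + 4) ^ 3 = (R + 4) ^ 4" by (simp add: numeral_eq_Suc)
    also have "2 * ((R + 4) ^ 4 * (n + 2 ^ K + 1)) \<le> 2 * Y" unfolding Y_def using R6(2) by (intro mult_le_mono) auto
    finally have h3: "(K + 1) * ((K + 4) ^ 3 * (2 ^ K + 2 ^ K + 1)) \<le> 2 * Y" .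
    have "t5 \<le> t + 13000000 * Y" if "t1 \<le> t + 10 * p" "p \<le> Y" "t2 \<le> t1 + 400000 * q" "q \<le> 2 * Y" "t3 \<le> t2 + 2010 * u" "t4 \<le> t3 + 12004000 * Y"
      "t5 \<le> t4 + 100 * u" "u \<le> Y" for t t1 t2 t3 t4 t5 p q u :: nat using that by linarith
    from this[OF 1(3) h2 2(3) h3 3(3) 4(3)[folded Y_def] 5(2) h1] show ?thesis unfolding steps_def Y_def R_def K_def .
  qed
  have rw: "rows n (2 * R) (ar sg4 2) (\<lambda>_. 1) (ar sg 0)" using 4(4) v2(6) by simp
  show ?thesis unfolding factor_code_def R_def[symmetric]
    by (intro exI[of _ sg5] exI[of _ "ar sg4 2"] conjI[OF run_Seq[OF 1(1) run_Seq[OF 2(1) run_Seq[OF 3(1) run_Seq[OF 4(1) 5(1)]]]]]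
       conjI[OF t] conjI[OF nR] conjI[OF rw] 5(3))
qed

end

section \<open>The soft-O bound and the complete statement\<close>

lemma steps_soft_bigo: "(\<lambda>(n, s). 14000000 * real (steps n s)) \<in> soft_bigo (\<lambda>(n, s). real n + sqrt (real s))"
proof -
  define T :: "nat \<times> nat \<Rightarrow> real" where "T = (\<lambda>(n, s). real n + sqrt (real s))"
  \<comment> \<open>The threshold \<open>3\<close> lies above e, so the logarithm is at least
    \<open>1\<close> and absorbs additive constants. The constant is 10^6 * 3, from bitlen + 4 \<le>
    10 ln T and n + 2^halflen + 1 \<le> 3 T.\<close>
  have bd: "real (steps n s) \<le> 3000000 * (T (n, s) * ln (T (n, s)) ^ 6)" if T: "3 \<le> T (n, s)" for n s
  proof -
    define t where "t = T (n, s)"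
    have t: "t = real n + sqrt (real s)" "3 \<le> t" using T by (simp_all add: t_def T_def)
    have "exp (1::real) \<le> t" using exp_le t(2) by linarith
    then have ln1: "1 \<le> ln t" using t(2) by (subst ln_ge_iff) auto
    have "sqrt (real s) \<le> t" using t by simp
    then have "sqrt (real s) * sqrt (real s) \<le> t * t" by (intro mult_mono) (use t in auto)
    then have s: "real s \<le> t ^ 2" by (simp add: power2_eq_square)
    have t9: "9 \<le> t ^ 2" using power_mono[OF t(2), of 2] by simp
    have "2 ^ bitlen s \<le> 2 * real s + 1"
      using of_nat_mono[OF power_bitlen_le[of s], where 'a = real] by simp
    also have "\<dots> \<le> 3 * t ^ 2" using s t9 by linarith
    also have "\<dots> \<le> t * t ^ 2" using t(2) by (intro mult_right_mono) auto
    finally have p: "2 ^ bitlen s \<le> t ^ 3" by (simp add: power3_eq_cube power2_eq_square)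
    \<comment> \<open>Replacing e by \<open>4 = 2 * 2\<close> squares the bound t^3 for the power of
      two; this passes to the natural logarithm without the logarithm of \<open>2\<close>.\<close>
    have "exp (real (bitlen s)) = exp 1 ^ bitlen s" by (simp flip: exp_of_nat_mult)
    also have "\<dots> \<le> (2 * 2) ^ bitlen s" using exp_le by (intro power_mono) auto
    also have "\<dots> = 2 ^ bitlen s * 2 ^ bitlen s" by (rule power_mult_distrib)
    also have "\<dots> \<le> t ^ 3 * t ^ 3" using p t(2) by (intro mult_mono) auto
    also have "\<dots> = t ^ 6" by (simp flip: power_add)
    finally have "real (bitlen s) \<le> ln (t ^ 6)" using t(2) by (subst ln_ge_iff) auto
    then have "real (bitlen s + 4) \<le> 10 * ln t" using ln1 t(2) by (simp add: ln_realpow)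
    then have "real (bitlen s + 4) ^ 6 \<le> (10 * ln t) ^ 6" by (intro power_mono) auto
    then have R: "real ((bitlen s + 4) ^ 6) \<le> 1000000 * ln t ^ 6" by (simp add: power_mult_distrib)
    have "(2 ^ halflen s) ^ 2 \<le> 4 * real s + 2"
      using of_nat_mono[OF power_halflen_le[of s], where 'a = real] by (simp add: power2_eq_square)
    also have "\<dots> \<le> (2 * sqrt (real s) + 2) ^ 2" by (simp add: power2_sum)
    finally have "2 ^ halflen s \<le> 2 * sqrt (real s) + 2" by (rule power2_le_imp_le) simp
    moreover have "0 \<le> sqrt (real s)" by simp
    ultimately have K: "real (n + 2 ^ halflen s + 1) \<le> 3 * t" using t by simp
    have "real (steps n s) \<le> (1000000 * ln t ^ 6) * (3 * t)"
      unfolding steps_def of_nat_mult using R K by (intro mult_mono) auto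
    then show ?thesis unfolding t_def[symmetric] by (simp add: mult.commute)
  qed
  have "\<forall>\<^sub>F y in at_top. (3::real) \<le> y" by (rule eventually_ge_at_top)
  then have "\<forall>\<^sub>F p in filtercomap T at_top. 3 \<le> T p" unfolding eventually_filtercomap by blast
  then have "\<forall>\<^sub>F p in filtercomap T at_top.
      norm ((\<lambda>(n, s). 14000000 * real (steps n s)) p) \<le> 42000000000000 * norm (T p * ln (T p) ^ 6)"
  proof (rule eventually_mono)
    fix p assume p: "3 \<le> T p"
    obtain n s where [simp]: "p = (n, s)" by (cases p)
    have "0 \<le> T p * ln (T p) ^ 6" using p by simp
    then show "norm ((\<lambda>(n, s). 14000000 * real (steps n s)) p) \<le> 42000000000000 * norm (T p * ln (T p) ^ 6)"
      using bd[of n s] p by simp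
  qed
  then have "(\<lambda>(n, s). 14000000 * real (steps n s)) \<in> O[filtercomap T at_top](\<lambda>p. T p * ln (T p) ^ 6)"
    by (rule bigoI)
  then show ?thesis unfolding soft_bigo_def T_def[symmetric] by blast
qed

lemma factor_program_correct:
  assumes n: "length xs = n" and xs: "set xs \<subseteq> {1..s}" and w: "(n + s + 2) ^ 128 \<le> 2 ^ w"
  shows "\<exists>\<tau> sg. exec w factor_program (input_state s xs) \<tau> sg \<and> \<tau> \<le> 14000000 * steps n s \<and> outputs_factorizations w sg xs"
proof -
  define Z where "Z = n + s + 2"
  define S where "S = Z ^ 16"
  have Z2: "2 \<le> Z" by (simp add: Z_def)
  have zw: "Z ^ k < 2 ^ w" if "k < 128" for k
  proof -
    have "Z ^ k < Z ^ 128" using Z2 that by (intro power_strict_increasing) auto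
    then show ?thesis using w unfolding Z_def by linarith
  qed
  interpret ram w S
  proof
    have "2 ^ 16 \<le> S" unfolding S_def using Z2 by (rule power_mono) simp
    then show "256 \<le> S" by simp
    show "S ^ 8 \<le> 2 ^ w" using w unfolding S_def Z_def by (simp flip: power_mult)
  qed
  have ZS: "Z \<le> S" unfolding S_def using Z2 power_increasing[of 1 16 Z] by simp
  define \<rho>0 where "\<rho>0 z a = \<lparr>regs = (\<lambda>_. 0)(0 := n, 1 := s, 61 := z, 60 := a), mem = (\<lambda>a. if a < n then xs ! a else 0)\<rparr>" for z a :: nat
  have r0: "exec w (Op 61 Add (Reg 0) (Reg 1)) (input_state s xs) 1 (\<rho>0 (n + s) 0)"
  proof -
    have "n + s < 2 ^ w" using zw[of 1] by (simp add: Z_def)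
    then show ?thesis using exec_Op[of w 61 Add "Reg 0" "Reg 1" "input_state s xs"]
      by (simp add: \<rho>0_def input_state_def n fun_upd_twist fun_upd_idem)
  qed
  have r1: "exec w (Op 61 Add (Reg 61) (Const 2)) (\<rho>0 (n + s) 0) 1 (\<rho>0 Z 0)"
  proof -
    have "2 < (2::nat) ^ w" using zw[of 2] Z2 power_mono[OF Z2, of 2] by simp
    then show ?thesis using exec_Op[of w 61 Add "Reg 61" "Const 2" "\<rho>0 (n + s) 0"] zw[of 1]
      by (simp add: \<rho>0_def Z_def fun_upd_twist)
  qed
  have r2: "exec w (Op 61 Mul (Reg 61) (Reg 61)) (\<rho>0 (Z ^ k) 0) 1 (\<rho>0 (Z ^ (k + k)) 0)" if "k + k < 128" for k
    using exec_Op[of w 61 Mul "Reg 61" "Reg 61" "\<rho>0 (Z ^ k) 0"] zw[OF that]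
    by (simp add: \<rho>0_def fun_upd_twist power_add)
  have r3: "exec w (Op 60 Mul (Reg 61) (Reg 61)) (\<rho>0 (Z ^ 8) 0) 1 (\<rho>0 (Z ^ 8) S)"
    using exec_Op[of w 60 Mul "Reg 61" "Reg 61" "\<rho>0 (Z ^ 8) 0"] zw[of 16]
    by (simp add: \<rho>0_def S_def flip: power_add)
  \<comment> \<open>Array \<open>0\<close> starts at address \<open>0\<close>, so it already is the
    input; the other arrays inherit whatever the memory holds.\<close>
  define sg where "sg = Ast ((\<lambda>_. 0)(0 := n, 1 := s)) (\<lambda>a i. mem (\<rho>0 (Z ^ 8) S) (a * S + i)) 0"
  have sim: "sim sg (\<rho>0 (Z ^ 8) S)"
    using ZS unfolding sim_def bounded_def by (auto simp: sg_def \<rho>0_def Z_def)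
  have a0: "ar sg 0 j = xs ! j" if "j < n" for j using that by (simp add: sg_def \<rho>0_def)
  have "1 \<le> ar sg 0 j \<and> ar sg 0 j \<le> s" if "j < n" for j
  proof -
    have "xs ! j \<in> {1..s}" by (rule subsetD[OF xs], rule nth_mem) (simp add: n that)
    then show ?thesis using a0[OF that] by simp
  qed
  moreover have "vr sg 0 = n" "vr sg 1 = s" by (simp_all add: sg_def)
  ultimately obtain sg' C where c: "run factor_code sg sg'" "tm sg' \<le> tm sg + 13000000 * steps n s" "n * (2 * bitlen s + 1) < S"
     "rows n (2 * bitlen s) C (\<lambda>_. 1) (ar sg 0)" "holds (ar sg' 1) 0 (columns n C (2 * bitlen s) n)"
    using factor_run[of sg n s] by (auto simp: S_def Z_def)
  obtain \<tau> \<rho> where e: "exec w factor_code (\<rho>0 (Z ^ 8) S) \<tau> \<rho>" "sim sg' \<rho>" "tm sg + \<tau> \<le> tm sg'"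
    using c(1) sim unfolding run_def by blast
  define \<rho>' where "\<rho>' = \<rho>\<lparr>regs := (regs \<rho>)(0 := S)\<rparr>"
  have r4: "exec w (Op 0 BitOr (Reg 60) (Const 0)) \<rho> 1 \<rho>'"
    using exec_Op[of w 0 BitOr "Reg 60" "Const 0" \<rho>] e(2) by (simp add: sim_def \<rho>'_def)
  have m: "exec w (Op 61 Mul (Reg 61) (Reg 61)) (\<rho>0 Z 0) 1 (\<rho>0 (Z ^ 2) 0)" "exec w (Op 61 Mul (Reg 61) (Reg 61)) (\<rho>0 (Z ^ 2) 0) 1 (\<rho>0 (Z ^ 4) 0)"
    "exec w (Op 61 Mul (Reg 61) (Reg 61)) (\<rho>0 (Z ^ 4) 0) 1 (\<rho>0 (Z ^ 8) 0)"
    using r2[of 1] r2[of 2] r2[of 4] by (simp_all add: numeral_2_eq_2[symmetric])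
  have ex: "exec w factor_program (input_state s xs) (1 + (1 + (1 + (1 + (1 + (1 + (\<tau> + 1))))))) \<rho>'"
    unfolding factor_program_def
    by (rule exec_Seq[OF r0 exec_Seq[OF r1 exec_Seq[OF m(1) exec_Seq[OF m(2) exec_Seq[OF m(3) exec_Seq[OF r3 exec_Seq[OF e(1) r4]]]]]]])
  \<comment> \<open>The seven instructions around \<open>factor_code\<close> are paid for by raising
    the constant from 13000000 to 14000000.\<close>
  have "1 * 1 \<le> steps n s" unfolding steps_def by (intro mult_le_mono one_le_power) auto
  then have t: "1 + (1 + (1 + (1 + (1 + (1 + (\<tau> + 1)))))) \<le> 14000000 * steps n s"
    using e(3) c(2) by (simp add: sg_def)
  let ?L = "columns n C (2 * bitlen s) n"
  let ?pss = "map (column n C (2 * bitlen s)) [0..<n]"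
  have "map mset ?pss = map prime_factorization xs"
    by (rule nth_equalityI) (use n a0 mset_column[OF c(4)] in auto)
  moreover have "mem_holds w \<rho>' (regs \<rho>' 0) (concat (map (\<lambda>ps. length ps # ps) ?pss))"
    unfolding columns_def[symmetric] mem_holds_def
  proof (intro conjI allI impI)
    have L: "length ?L < S" using length_columns[of n C "2 * bitlen s" n] c(3) by linarith
    have "S + length ?L \<le> 2 * S" using L by simp
    also have "\<dots> \<le> S * S" using S_ge by simp
    finally show "regs \<rho>' 0 + length ?L \<le> 2 ^ w" using S_less by (simp add: \<rho>'_def)
    fix j assume j: "j < length ?L"
    then have "(1::nat) < 30" "j < S" using L by simp_all
    then have "mem \<rho> (1 * S + j) = ar sg' 1 j" using e(2) unfolding sim_def by blast
    then show "mem \<rho>' (regs \<rho>' 0 + j) = ?L ! j" using c(5) j by (simp add: \<rho>'_def holds_def)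
  qed
  ultimately have "outputs_factorizations w \<rho>' xs" unfolding outputs_factorizations_def by blast
  then show ?thesis using ex t by blast
qed

theorem theorem3p8:
  "\<exists>(P :: com) (k :: nat) (t :: nat \<times> nat \<Rightarrow> real).
     t \<in> soft_bigo (\<lambda>(n, s). real n + sqrt (real s)) \<and>
     (\<forall>(w :: nat) (n :: nat) (s :: nat) (xs :: nat list).
        length xs = n \<longrightarrow> set xs \<subseteq> {1..s} \<longrightarrow> (n + s + 2) ^ k \<le> 2 ^ w \<longrightarrow>
        (\<exists>\<tau> \<sigma>. exec w P (input_state s xs) \<tau> \<sigma> \<and> real \<tau> \<le> t (n, s) \<and>
               outputs_factorizations w \<sigma> xs))"
proof (rule exI[of _ factor_program], rule exI[of _ 128], rule exI[of _ "\<lambda>(n, s). 14000000 * real (steps n s)"], intro conjI allI impI)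
  show "(\<lambda>(n, s). 14000000 * real (steps n s)) \<in> soft_bigo (\<lambda>(n, s). real n + sqrt (real s))"
    by (rule steps_soft_bigo)
  fix w n s :: nat and xs :: "nat list"
  assume "length xs = n" "set xs \<subseteq> {1..s}" "(n + s + 2) ^ 128 \<le> 2 ^ w"
  from factor_program_correct[OF this] obtain \<tau> sg where "exec w factor_program (input_state s xs) \<tau> sg"
    "\<tau> \<le> 14000000 * steps n s" "outputs_factorizations w sg xs" by blast
  moreover from this(2) have "real \<tau> \<le> 14000000 * real (steps n s)"
    using of_nat_mono[of \<tau> "14000000 * steps n s", where 'a = real] by simp
  ultimately show "\<exists>\<tau> sg. exec w factor_program (input_state s xs) \<tau> sg \<and> real \<tau> \<le> (\<lambda>(n, s). 14000000 * real (steps n s)) (n, s) \<and>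
      outputs_factorizations w sg xs" by auto
qed

end
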